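(* Let $\lambda>0$, $\ell>0$ and let $\gamma\in A_\ell$ be a penalized pinned elastica. If $0<\lambda\ell^2<\hat\lambda$, then $\gamma$ is stable if and only if $\gamma$ is either the line segment or, up to reflection across the $x$-axis and reparametrization, $\gamma_{\rm larc}^{\lambda,\ell,1}$. If $\lambda\ell^2\ge\hat\lambda$, then $\gamma$ is stable if and only if $\gamma$ is the line segment. As a consequence, if $0<\lambda\ell^2<\hat\lambda$, then up to reflection across the $x$-axis and reparametrization there are exactly two local minimizers of $\mathcal{E}_\lambda$ in $A_\ell$; otherwise the local minimizer is unique (up to reparametrization).
   Context: Elliptic functions: for $q\in[0,1)$, $x\in\mathbb{R}$, $\mathrm{F}(x,q)=\int_0^x(1-q^2\sin^2\theta)^{-1/2}\,d\theta$, $\mathrm{E}(x,q)=\int_0^x(1-q^2\sin^2\theta)^{1/2}\,d\theta$, $\mathrm{K}(q)=\mathrm{F}(\pi/2,q)$, $\mathrm{E}(q)=\mathrm{E}(\pi/2,q)$; $\mathrm{am}(\cdot,q)$ is the inverse of $x\mapsto\mathrm{F}(x,q)$, $\mathrm{cn}(x,q)=\cos\mathrm{am}(x,q)$. The function $q\mapsto2\mathrm{E}(q)-\mathrm{K}(q)$ is strictly decreasing on $[0,1)$ with unique zero $q_*\in(0,1)$. On $[1/\sqrt2,1)$ let $f(q)=(4q^4-5q^2+1)\mathrm{K}(q)+(-8q^4+8q^2-1)\mathrm{E}(q)$ and $g(q)=8(2\mathrm{E}(q)-\mathrm{K}(q))^2(2q^2-1)$. $f$ has a unique zero $\hat q\in[1/\sqrt2,1)$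 (in $(1/\sqrt2,q_* )$); $\hat\lambda:=g(\hat q)\approx0.70107$. $g(1/\sqrt2)=0$, $g$ is strictly increasing on $[1/\sqrt2,\hat q]$, strictly decreasing on $[\hat q,q_*]$ with $g(q_* )=0$, strictly increasing on $[q_*,1)$ with $g\to\infty$ at $1$. For $c\in(0,\hat\lambda]$ let $q_2(c)$ be the solution of $g(q)=c$ in $[\hat q,q_* )$. Setting: $A_\ell=\{\gamma\in W^{2,2}(0,1;\mathbb{R}^2): |\gamma'|\neq0$ on $[0,1]$, $\gamma(0)=(0,0),\ \gamma(1)=(\ell,0)\}$; $\mathcal{E}_\lambda[\gamma]=\int_\gamma k^2\,ds+\lambda L[\gamma]$ with $k$ signed curvature, $s$ arclength, $L$ length. A penalized pinned elastica is $\gamma\in A_\ell$ with $\frac{d}{d\varepsilon}\mathcal{E}_\lambda[\gamma+\varepsilon\eta]|_{\varepsilon=0}=0$ for all $\eta\in W^{2,2}(0,1;\mathbb{R}^2)\cap W^{1,2}_0(0,1;\mathbb{R}^2)$. It is called stable if it is a local minimizer of $\mathcal{E}_\lambda$ in $A_\ell$, i.e. there is $\delta>0$ with $\mathcal{E}_\lambda[\gamma]\le\mathcal{E}_\lambda[\Gamma]$ for all $\Gamma\in A_\ell$ with $\|\Gamma-\gamma\|_{W^{2,2}}<\delta$. The line segment is the segment from $(0,0)$ to $(\ell,0)$. For $0<\lambda\ell^2\le\hat\lambda$, $\gamma_{\rm larc}^{\lambda,\ell,1}:[0,2\mathrm{K}(q)/\alpha]\to\mathbb{R}^2$ is the arclength-parametrized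 curve $\gamma(s)=\frac1\alpha\big(2\mathrm{E}(\mathrm{am}(\alpha s-\mathrm{K}(q),q),q)+2\mathrm{E}(q)-\alpha s,\ 2q\,\mathrm{cn}(\alpha s-\mathrm{K}(q),q)\big)$ with $q=q_2(\lambda\ell^2)$, $\alpha=\frac{2}{\ell}(2\mathrm{E}(q)-\mathrm{K}(q))$. *)

theory Defs
  imports "HOL-Analysis.Analysis"
begin

definition sint0 :: "(real \<Rightarrow> real) \<Rightarrow> real \<Rightarrow> real" where
  "sint0 h x = (if 0 \<le> x then integral {0..x} h else - integral {x..0} h)"

definition EllF :: "real \<Rightarrow> real \<Rightarrow> real" where
  "EllF x q = sint0 (\<lambda>\<theta>. 1 / sqrt (1 - q\<^sup>2 * (sin \<theta>)\<^sup>2)) x"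

definition EllEx :: "real \<Rightarrow> real \<Rightarrow> real" where
  "EllEx x q = sint0 (\<lambda>\<theta>. sqrt (1 - q\<^sup>2 * (sin \<theta>)\<^sup>2)) x"

definition EllK :: "real \<Rightarrow> real" where
  "EllK q = EllF (pi / 2) q"

definition EllE :: "real \<Rightarrow> real" where
  "EllE q = EllEx (pi / 2) q"

definition am :: "real \<Rightarrow> real \<Rightarrow> real" where
  "am u q = (THE x. EllF x q = u)"

definition cn :: "real \<Rightarrow> real \<Rightarrow> real" where
  "cn u q = cos (am u q)"

definition qstar :: real where
  "qstar = (THE q. 0 < q \<and> q < 1 \<and> 2 * EllE q - EllK q = 0)"

definition fcrit :: "real \<Rightarrow> real" where
  "fcrit q = (4 * q^4 - 5 * q^2 + 1) * EllK q + (- 8 * q^4 + 8 * q^2 - 1) * EllE q"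

definition gcrit :: "real \<Rightarrow> real" where
  "gcrit q = 8 * (2 * EllE q - EllK q)\<^sup>2 * (2 * q\<^sup>2 - 1)"

definition qhat :: real where
  "qhat = (THE q. 1 / sqrt 2 \<le> q \<and> q < 1 \<and> fcrit q = 0)"

definition lamhat :: real where
  "lamhat = gcrit qhat"

definition q2 :: "real \<Rightarrow> real" where
  "q2 c = (THE q. qhat \<le> q \<and> q < qstar \<and> gcrit q = c)"

type_synonym curve = "real \<Rightarrow> real \<times> real"

text \<open>W22 g g1 g2: g is in W^{2,2}(0,1) with (classical) derivative g1 on [0,1],
  g1 absolutely continuous with weak derivative g2, and g2 square integrable.\<close>
definition W22 :: "curve \<Rightarrow> curve \<Rightarrow> curve \<Rightarrow> bool" where
  "W22 g g1 g2 \<longleftrightarrow>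
     (\<forall>t\<in>{0..1}. (g has_vector_derivative g1 t) (at t within {0..1})) \<and>
     g2 absolutely_integrable_on {0..1} \<and>
     (\<lambda>t. (norm (g2 t))\<^sup>2) integrable_on {0..1} \<and>
     (\<forall>t\<in>{0..1}. g1 t = g1 0 + integral {0..t} g2)"

definition d1 :: "curve \<Rightarrow> curve" where
  "d1 g = fst (SOME p. W22 g (fst p) (snd p))"

definition d2 :: "curve \<Rightarrow> curve" where
  "d2 g = snd (SOME p. W22 g (fst p) (snd p))"

definition Aset :: "real \<Rightarrow> curve set" where
  "Aset l = {g. (\<exists>g1 g2. W22 g g1 g2 \<and> (\<forall>t\<in>{0..1}. g1 t \<noteq> 0)) \<and>
                 g 0 = (0, 0) \<and> g 1 = (l, 0)}"

definition cross :: "real \<times> real \<Rightarrow> real \<times> real \<Rightarrow> real" where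
  "cross a b = fst a * snd b - snd a * fst b"

text \<open>\<int>_\<gamma> k^2 ds = \<int>_0^1 (\<gamma>' \<times> \<gamma>'')^2 / |\<gamma>'|^5 dt and L = \<int>_0^1 |\<gamma>'| dt.\<close>
definition bending :: "curve \<Rightarrow> real" where
  "bending g = integral {0..1} (\<lambda>t. (cross (d1 g t) (d2 g t))\<^sup>2 / (norm (d1 g t)) ^ 5)"

definition curve_length :: "curve \<Rightarrow> real" where
  "curve_length g = integral {0..1} (\<lambda>t. norm (d1 g t))"

definition energy :: "real \<Rightarrow> curve \<Rightarrow> real" where
  "energy lam g = bending g + lam * curve_length g"

definition w22_dist :: "curve \<Rightarrow> curve \<Rightarrow> real" where
  "w22_dist G g = sqrt (integral {0..1} (\<lambda>t. (norm (G t - g t))\<^sup>2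
        + (norm (d1 G t - d1 g t))\<^sup>2 + (norm (d2 G t - d2 g t))\<^sup>2))"

definition pinned_elastica :: "real \<Rightarrow> real \<Rightarrow> curve \<Rightarrow> bool" where
  "pinned_elastica lam l g \<longleftrightarrow> g \<in> Aset l \<and>
     (\<forall>\<eta>. (\<exists>\<eta>1 \<eta>2. W22 \<eta> \<eta>1 \<eta>2) \<and> \<eta> 0 = 0 \<and> \<eta> 1 = 0 \<longrightarrow>
        ((\<lambda>\<epsilon>. energy lam (\<lambda>t. g t + \<epsilon> *\<^sub>R \<eta> t)) has_real_derivative 0) (at 0))"

definition stable :: "real \<Rightarrow> real \<Rightarrow> curve \<Rightarrow> bool" where
  "stable lam l g \<longleftrightarrow> g \<in> Aset l \<and>
     (\<exists>\<delta>>0. \<forall>G\<in>Aset l. w22_dist G g < \<delta> \<longrightarrow> energy lam g \<le> energy lam G)"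

definition reparam :: "curve \<Rightarrow> curve \<Rightarrow> real \<Rightarrow> real \<Rightarrow> bool" where
  "reparam g b a c \<longleftrightarrow> (\<exists>\<phi>. \<phi> ` {0..1} = {a..c} \<and> strict_mono_on {0..1} \<phi> \<and>
      continuous_on {0..1} \<phi> \<and> (\<forall>t\<in>{0..1}. g t = b (\<phi> t)))"

definition reflx :: "real \<times> real \<Rightarrow> real \<times> real" where
  "reflx p = (fst p, - snd p)"

definition is_segment :: "real \<Rightarrow> curve \<Rightarrow> bool" where
  "is_segment l g \<longleftrightarrow> reparam g (\<lambda>s. (s, 0)) 0 l"

definition larc_q :: "real \<Rightarrow> real \<Rightarrow> real" where
  "larc_q lam l = q2 (lam * l\<^sup>2)"

definition larc_alpha :: "real \<Rightarrow> real \<Rightarrow> real" where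
  "larc_alpha lam l = 2 / l * (2 * EllE (larc_q lam l) - EllK (larc_q lam l))"

text \<open>\<gamma>_larc^{\<lambda>,\<ell>,1}, arclength parametrized on [0, 2K(q)/\<alpha>].\<close>
definition larc :: "real \<Rightarrow> real \<Rightarrow> curve" where
  "larc lam l s = (let q = larc_q lam l; \<alpha> = larc_alpha lam l in
     (1 / \<alpha> * (2 * EllEx (am (\<alpha> * s - EllK q) q) q + 2 * EllE q - \<alpha> * s),
      1 / \<alpha> * (2 * q * cn (\<alpha> * s - EllK q) q)))"

definition larc_end :: "real \<Rightarrow> real \<Rightarrow> real" where
  "larc_end lam l = 2 * EllK (larc_q lam l) / larc_alpha lam l"

definition is_larc :: "real \<Rightarrow> real \<Rightarrow> curve \<Rightarrow> bool" where
  "is_larc lam l g \<longleftrightarrow> reparam g (larc lam l) 0 (larc_end lam l) \<or>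
                       reparam (reflx \<circ> g) (larc lam l) 0 (larc_end lam l)"

definition equiv_rr :: "curve \<Rightarrow> curve \<Rightarrow> bool" where
  "equiv_rr g h \<longleftrightarrow> reparam g h 0 1 \<or> reparam (reflx \<circ> g) h 0 1"

end

theory Submission imports Defs begin

text \<open>Write the derivative of a curve as \<open>v (cos \<psi>, sin \<psi>)\<close>. With the multiplier \<open>p\<close> of the pinning condition the
  Euler-Lagrange equation integrates to \<open>\<psi>' = p y v / 2\<close> and \<open>lam - p\<^sup>2 y\<^sup>2 / 4 = p cos \<psi>\<close>. The height \<open>y\<close> is itself
  a Jacobi field; modifying it at a zero shows that a stable critical curve which is not the segment is a single arc
  with \<open>p < 0\<close>, that is, a larc with a modulus \<open>q\<close> such that \<open>gcrit q = lam l\<^sup>2\<close>. If \<open>q \<le> qhat\<close>, the larcs of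
  smaller modulus, scaled to the same end points, have less energy. If \<open>qhat < q < qstar\<close>, the energy of every curve whose
  tangent angle oscillates over an interval of length \<open>2 A\<close> is at least a function of \<open>r = sin (A / 2)\<close> which on
  \<open>[qhat, qstar]\<close> is minimal at \<open>r = q\<close>, where it is the energy of the larc; so the larc is stable.\<close>

section \<open>Sobolev functions and curves on the unit interval\<close>

text \<open>Two features shape the argument. A competitor must keep both end points, so variations
  are made in the speed and the tangent angle, and the resulting curve is rotated and scaled back
  onto the chord; this correction is the source of the terms in \<open>p\<close> of the second
  variation. On the stability side the energy is invariant under reparametrization, so the second
  variation is degenerate and gives no coercivity in W^{2,2}. The larc is instead compared with all
  nearby curves at once: the calibration sees only the oscillation of the tangent angle, which
  W^{2,2}-closeness controls uniformly. Its multiplier is chosen so that the weight vanishes at the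
  two extreme angles. The threshold enters both halves in the same way: where \<open>EllU\<close> is
  positive, the derivatives of \<open>arc_energy\<close> and of \<open>low_energy\<close> at
  \<open>r\<close> have the sign of \<open>lam * l\<^sup>2 - gcrit r\<close>. Below
  \<open>qhat\<close> the function \<open>gcrit\<close> increases, so smaller moduli lower the
  energy; between \<open>qhat\<close> and \<open>qstar\<close> it decreases, so \<open>q\<close> is
  a minimum. At \<open>q = qhat\<close> the moduli to the left already suffice, which makes the
  limiting larc unstable.\<close>

definition L2 :: "(real \<Rightarrow> real) \<Rightarrow> bool" where
  "L2 f \<longleftrightarrow> f \<in> borel_measurable (lebesgue_on {0..1}) \<and> (\<lambda>t. (f t)\<^sup>2) integrable_on {0..1}"

text \<open>One representative \<open>f'\<close> of the weak derivative is carried along with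
  \<open>f\<close>. The sum, product and chain rules then build such pairs syntactically, and weak
  derivatives are computed by applying rules.\<close>

definition H1 :: "(real \<Rightarrow> real) \<Rightarrow> (real \<Rightarrow> real) \<Rightarrow> bool" where
  "H1 f f' \<longleftrightarrow> L2 f' \<and> (\<forall>t\<in>{0..1}. f t = f 0 + integral {0..t} f')"

lemma mult_le_squares: "\<bar>a * b\<bar> \<le> a\<^sup>2 + (b::real)\<^sup>2"
proof -
  have "0 \<le> (\<bar>a\<bar> - \<bar>b\<bar>)\<^sup>2" "0 \<le> a\<^sup>2" "0 \<le> b\<^sup>2" by auto
  moreover have "0 \<le> \<bar>a\<bar> * \<bar>b\<bar>" by simp
  moreover have "0 \<le> a\<^sup>2 + b\<^sup>2 - 2 * (\<bar>a\<bar> * \<bar>b\<bar>)" using calculation(1) by (simp add: power2_diff)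
  ultimately show ?thesis unfolding abs_mult by linarith
qed

lemma L2_mult_absolutely_integrable:
  assumes "L2 f" "L2 g" shows "(\<lambda>t. f t * g t) absolutely_integrable_on {0..1}"
proof (rule measurable_bounded_by_integrable_imp_absolutely_integrable)
  show "(\<lambda>t. f t * g t) \<in> borel_measurable (lebesgue_on {0..1})"
    using assms by (auto simp: L2_def)
  show "(\<lambda>t. (f t)\<^sup>2 + (g t)\<^sup>2) integrable_on {0..1}"
    using assms by (auto simp: L2_def intro: integrable_add)
qed (use mult_le_squares in \<open>auto simp del: abs_mult\<close>)

lemma continuous_on_imp_L2:
  assumes "continuous_on {0..1} f" shows "L2 f"
  unfolding L2_def
  by (auto intro!: continuous_imp_measurable_on_sets_lebesgue integrable_continuous_interval continuous_intros assms)

lemma L2_imp_absolutely_integrable: "L2 f \<Longrightarrow> f absolutely_integrable_on {0..1}"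
  using L2_mult_absolutely_integrable[of f "\<lambda>_. 1"] continuous_on_imp_L2[of "\<lambda>_. 1"] by simp

lemma L2_square_bound:
  assumes "f \<in> borel_measurable (lebesgue_on {0..1})" "h integrable_on {0..1}"
    "\<And>t. t \<in> {0..1} \<Longrightarrow> (f t)\<^sup>2 \<le> h t"
  shows "L2 f"
proof -
  have "(\<lambda>t. (f t)\<^sup>2) absolutely_integrable_on {0..1}"
    by (rule measurable_bounded_by_integrable_imp_absolutely_integrable[OF _ _ assms(2)])
       (use assms in auto)
  then show ?thesis using assms(1) by (auto simp: L2_def absolutely_integrable_on_def)
qed

lemma L2_add: assumes "L2 f" "L2 g" shows "L2 (\<lambda>t. f t + g t)"
proof -
  have "(f t + g t)\<^sup>2 \<le> 2 * (f t)\<^sup>2 + 2 * (g t)\<^sup>2" for t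
    using sum_squares_ge_zero[of "f t - g t" 0] by (auto simp: power2_eq_square algebra_simps)
  moreover have "(\<lambda>t. 2 * (f t)\<^sup>2 + 2 * (g t)\<^sup>2) integrable_on {0..1}"
    using assms by (auto simp: L2_def intro!: integrable_add)
  ultimately show ?thesis
    using assms by (intro L2_square_bound) (auto simp: L2_def)
qed

lemma L2_bounded_mult:
  assumes "h \<in> borel_measurable (lebesgue_on {0..1})" "bounded (h ` {0..1})" "L2 f"
  shows "L2 (\<lambda>t. h t * f t)"
proof -
  obtain B where B: "B > 0" "\<And>t. t \<in> {0..1} \<Longrightarrow> \<bar>h t\<bar> \<le> B"
    using assms(2) unfolding bounded_pos by auto
  show ?thesis
  proof (rule L2_square_bound)
    show "(\<lambda>t. h t * f t) \<in> borel_measurable (lebesgue_on {0..1})"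
      using assms by (auto simp: L2_def)
    show "(\<lambda>t. B\<^sup>2 * (f t)\<^sup>2) integrable_on {0..1}"
      using assms by (intro integrable_on_mult_right) (auto simp: L2_def)
    fix t :: real assume "t \<in> {0..1}"
    then have "(h t)\<^sup>2 \<le> B\<^sup>2" using B(2)[of t] abs_le_square_iff[of "h t" B] B(1) by auto
    then show "(h t * f t)\<^sup>2 \<le> B\<^sup>2 * (f t)\<^sup>2" by (simp add: power_mult_distrib mult_right_mono)
  qed
qed

lemma L2_cont_mult:
  assumes "continuous_on {0..1} h" "L2 f" shows "L2 (\<lambda>t. h t * f t)"
  using assms by (intro L2_bounded_mult continuous_imp_measurable_on_sets_lebesgue
      compact_imp_bounded compact_continuous_image) auto

lemma L2_cmult: "L2 f \<Longrightarrow> L2 (\<lambda>t. c * f t)"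
  by (rule L2_cont_mult) auto

lemma L2_diff: "L2 f \<Longrightarrow> L2 g \<Longrightarrow> L2 (\<lambda>t. f t - g t)"
  using L2_add[of f "\<lambda>t. -1 * g t"] L2_cmult[of g "-1"] by simp

lemma L2_cong: assumes "L2 f" "\<And>t. t \<in> {0..1} \<Longrightarrow> f t = g t" shows "L2 g"
proof -
  have "g \<in> borel_measurable (lebesgue_on {0..1}) \<longleftrightarrow> f \<in> borel_measurable (lebesgue_on {0..1})"
    using assms(2) by (intro measurable_cong) auto
  moreover have "(\<lambda>t. (g t)\<^sup>2) integrable_on {0..1} \<longleftrightarrow> (\<lambda>t. (f t)\<^sup>2) integrable_on {0..1}"
    using assms(2) by (intro integrable_cong) auto
  ultimately show ?thesis using assms(1) by (simp add: L2_def)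
qed

lemma absolutely_integrable_mult_bounded:
  fixes h f :: "real \<Rightarrow> real"
  assumes "continuous_on {0..1} h" "f absolutely_integrable_on {0..1}"
  shows "(\<lambda>t. h t * f t) absolutely_integrable_on {0..(1::real)}"
  by (rule absolutely_integrable_bounded_measurable_product_real)
     (use assms in \<open>auto intro!: continuous_imp_measurable_on_sets_lebesgue
      compact_imp_bounded compact_continuous_image\<close>)

section \<open>Calculus of absolutely continuous functions with square integrable derivative\<close>

lemma H1_L2: "H1 f f' \<Longrightarrow> L2 f'" unfolding H1_def by blast

lemma L2_integrable_sub: "L2 f \<Longrightarrow> 0 \<le> a \<Longrightarrow> b \<le> 1 \<Longrightarrow> f integrable_on {a..b}"
  by (rule integrable_on_subinterval[of _ "{0..1}"])
    (auto dest: L2_imp_absolutely_integrable simp: absolutely_integrable_on_def)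

lemma L2_integrable: "L2 f \<Longrightarrow> f integrable_on {0..1}"
  by (rule L2_integrable_sub) auto

lemma H1_eq: "H1 f f' \<Longrightarrow> t \<in> {0..1} \<Longrightarrow> f t = f 0 + integral {0..t} f'"
  unfolding H1_def by blast

lemma H1_diff_eq:
  assumes "H1 f f'" "0 \<le> s" "s \<le> t" "t \<le> 1" shows "f t - f s = integral {s..t} f'"
  using H1_eq[OF assms(1), of s] H1_eq[OF assms(1), of t] assms
    Henstock_Kurzweil_Integration.integral_combine[of 0 s t f'] L2_integrable_sub[OF H1_L2[OF assms(1)], of 0 t]
  by auto

lemma H1_continuous: assumes "H1 f f'" shows "continuous_on {0..1} f"
proof -
  have "continuous_on {0..1} (\<lambda>t. f 0 + integral {0..t} f')"
    by (intro continuous_intros indefinite_integral_continuous_1 L2_integrable H1_L2[OF assms])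
  then show ?thesis
    by (rule continuous_on_eq) (rule H1_eq[OF assms, symmetric])
qed

lemma H1_const: "H1 (\<lambda>_. c) (\<lambda>_. 0)"
  by (simp add: H1_def continuous_on_imp_L2)

lemma H1_add: assumes "H1 f f'" "H1 g g'" shows "H1 (\<lambda>t. f t + g t) (\<lambda>t. f' t + g' t)"
  unfolding H1_def
proof (intro conjI ballI)
  show "L2 (\<lambda>t. f' t + g' t)" by (rule L2_add[OF assms[THEN H1_L2]])
  fix t :: real assume t: "t \<in> {0..1}"
  show "f t + g t = f 0 + g 0 + integral {0..t} (\<lambda>t. f' t + g' t)"
    using H1_eq[OF assms(1) t] H1_eq[OF assms(2) t] L2_integrable_sub[OF H1_L2[OF assms(1)], of 0 t]
      L2_integrable_sub[OF H1_L2[OF assms(2)], of 0 t] t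
    by (simp add: Henstock_Kurzweil_Integration.integral_add)
qed

lemma H1_cmult: assumes "H1 f f'" shows "H1 (\<lambda>t. c * f t) (\<lambda>t. c * f' t)"
  unfolding H1_def
proof (intro conjI ballI)
  show "L2 (\<lambda>t. c * f' t)" by (rule L2_cmult[OF H1_L2[OF assms]])
  fix t :: real assume t: "t \<in> {0..1}"
  show "c * f t = c * f 0 + integral {0..t} (\<lambda>t. c * f' t)"
    using H1_eq[OF assms t] by (simp add: algebra_simps)
qed

lemma H1_diff: "H1 f f' \<Longrightarrow> H1 g g' \<Longrightarrow> H1 (\<lambda>t. f t - g t) (\<lambda>t. f' t - g' t)"
  using H1_add[of f f' "\<lambda>t. -1 * g t" "\<lambda>t. -1 * g' t"] H1_cmult[of g g' "-1"] by simp

lemma H1_cong: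
  assumes "H1 f f'" "\<And>t. t \<in> {0..1} \<Longrightarrow> f t = g t" "\<And>t. t \<in> {0..1} \<Longrightarrow> f' t = g' t"
  shows "H1 g g'"
  unfolding H1_def
proof (intro conjI ballI)
  show "L2 g'" using L2_cong[OF H1_L2[OF assms(1)], of g'] assms(3) by auto
  fix t :: real assume t: "t \<in> {0..1}"
  have "integral {0..t} f' = integral {0..t} g'"
    using t assms(3) by (intro integral_cong) auto
  then show "g t = g 0 + integral {0..t} g'"
    using H1_eq[OF assms(1) t] assms(2)[of t] assms(2)[of 0] t by auto
qed

lemma H1_C1:
  assumes "\<And>t. t \<in> {0..1} \<Longrightarrow> (f has_real_derivative f' t) (at t within {0..1})" "continuous_on {0..1} f'"
  shows "H1 f f'"
  unfolding H1_def
proof (intro conjI ballI)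
  show "L2 f'" by (rule continuous_on_imp_L2[OF assms(2)])
  fix t :: real assume t: "t \<in> {0..1}"
  have "(f' has_integral f t - f 0) {0..t}"
    using t by (intro fundamental_theorem_of_calculus)
      (auto intro: has_field_derivative_subset[OF assms(1)]
        simp flip: has_real_derivative_iff_has_vector_derivative)
  then show "f t = f 0 + integral {0..t} f'" by (simp add: integral_unique)
qed

text \<open>On a short interval the mean value theorem and the uniform continuity of
  \<open>h'\<close> make the error at most \<open>e\<close> times the variation of \<open>f\<close>
  there. Over a partition these errors add up to at most \<open>e * V\<close> with \<open>V\<close>
  the total variation, and \<open>e\<close> is arbitrary. Differentiability almost everywhere of
  \<open>f\<close> never enters.\<close>

lemma H1_chain:
  assumes f: "H1 f f'" and h: "\<And>x. x \<in> f ` {0..1} \<Longrightarrow> (h has_real_derivative h' x) (at x)"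
    and h': "continuous_on (f ` {0..1}) h'"
  shows "H1 (\<lambda>t. h (f t)) (\<lambda>t. h' (f t) * f' t)"
proof -
  note cf = H1_continuous[OF f]
  have chf: "continuous_on {0..1} (\<lambda>t. h' (f t))"
    using continuous_on_compose[OF cf h'] by (simp add: o_def)
  have G: "L2 (\<lambda>t. h' (f t) * f' t)"
    by (rule L2_cont_mult[OF chf H1_L2[OF f]])
  have absf: "L2 (\<lambda>t. \<bar>f' t\<bar>)" using H1_L2[OF f] by (auto simp: L2_def)
  define V where "V = integral {0..1} (\<lambda>t. \<bar>f' t\<bar>)"
  have V0: "V \<ge> 0" unfolding V_def by (rule Henstock_Kurzweil_Integration.integral_nonneg[OF L2_integrable[OF absf]]) auto
  have loc: "\<exists>d>0. \<forall>s t. 0 \<le> s \<and> s \<le> t \<and> t \<le> 1 \<and> t - s < d \<longrightarrow>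
     \<bar>h (f t) - h (f s) - integral {s..t} (\<lambda>t. h' (f t) * f' t)\<bar> \<le> e * integral {s..t} (\<lambda>t. \<bar>f' t\<bar>)"
    if e: "e > 0" for e
  proof -
    have "uniformly_continuous_on (f ` {0..1}) h'"
      by (intro compact_uniformly_continuous h' compact_continuous_image cf) auto
    then obtain d0 where d0: "d0 > 0" "\<And>x y. x \<in> f ` {0..1} \<Longrightarrow> y \<in> f ` {0..1} \<Longrightarrow> dist y x < d0 \<Longrightarrow> dist (h' y) (h' x) < e"
      unfolding uniformly_continuous_on_def using e by metis
    have "uniformly_continuous_on {0..1} f"
      by (intro compact_uniformly_continuous cf) auto
    then obtain d where d: "d > 0" "\<And>x y. x \<in> {0..1} \<Longrightarrow> y \<in> {0..1} \<Longrightarrow> dist y x < d \<Longrightarrow> dist (f y) (f x) < d0"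
      unfolding uniformly_continuous_on_def using d0(1) by metis
    show ?thesis
    proof (intro exI[of _ d] conjI allI impI d(1))
      fix s t :: real assume st: "0 \<le> s \<and> s \<le> t \<and> t \<le> 1 \<and> t - s < d"
      have sub: "closed_segment (f s) (f t) \<subseteq> f ` {s..t}"
      proof -
        have "connected (f ` {s..t})"
          using st by (intro connected_continuous_image continuous_on_subset[OF cf]) auto
        then have "convex (f ` {s..t})" by (metis is_interval_convex_1 is_interval_connected_1)
        then show ?thesis using st by (intro closed_segment_subset) auto
      qed
      \<comment> \<open>The intermediate value is found inside the image of \<open>{s..t}\<close>,
        so it has the form \<open>f u\<close> with \<open>u\<close> in that interval; this allows
        comparing \<open>h' (f u)\<close> with \<open>h' (f r)\<close> for every \<open>r\<close> of
        the same interval.\<close>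
      have "\<exists>\<xi>\<in>f ` {s..t}. h (f t) - h (f s) = h' \<xi> * (f t - f s)"
      proof (cases "f s = f t")
        case True then show ?thesis using st by (auto intro!: bexI[of _ s])
      next
        case False
        have seg: "x \<in> f ` {0..1}" if "x \<in> {min (f s) (f t)..max (f s) (f t)}" for x
        proof -
          have "x \<in> closed_segment (f s) (f t)" using that by (auto simp: closed_segment_eq_real_ivl split: if_splits)
          then show ?thesis using sub st by fastforce
        qed
        have "\<exists>z>min (f s) (f t). z < max (f s) (f t) \<and> h (max (f s) (f t)) - h (min (f s) (f t)) =
            (max (f s) (f t) - min (f s) (f t)) * h' z"
          using False by (intro MVT2 h seg) auto
        then obtain z where z: "z > min (f s) (f t)" "z < max (f s) (f t)"
          "h (max (f s) (f t)) - h (min (f s) (f t)) = (max (f s) (f t) - min (f s) (f t)) * h' z" by blast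
        have "z \<in> closed_segment (f s) (f t)" using z by (auto simp: closed_segment_eq_real_ivl split: if_splits)
        moreover have "h (f t) - h (f s) = h' z * (f t - f s)"
          using z(3) by (cases "f s \<le> f t") (auto simp: max_def min_def algebra_simps)
        ultimately show ?thesis using sub by blast
      qed
      then obtain u where u: "u \<in> {s..t}" "h (f t) - h (f s) = h' (f u) * (f t - f s)" by auto
      have i1: "f' integrable_on {s..t}" using st L2_integrable_sub[OF H1_L2[OF f]] by auto
      have i2: "(\<lambda>t. h' (f t) * f' t) integrable_on {s..t}" using st L2_integrable_sub[OF G] by auto
      have i3: "(\<lambda>t. \<bar>f' t\<bar>) integrable_on {s..t}" using st L2_integrable_sub[OF absf] by auto
      have "h (f t) - h (f s) - integral {s..t} (\<lambda>t. h' (f t) * f' t)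
          = integral {s..t} (\<lambda>r. (h' (f u) - h' (f r)) * f' r)"
        using u(2) H1_diff_eq[OF f, of s t] st i1 i2
        by (simp add: left_diff_distrib Henstock_Kurzweil_Integration.integral_diff integrable_on_mult_right)
      also have "\<bar>\<dots>\<bar> \<le> integral {s..t} (\<lambda>r. e * \<bar>f' r\<bar>)"
      proof -
        have "norm (integral {s..t} (\<lambda>r. (h' (f u) - h' (f r)) * f' r)) \<le> integral {s..t} (\<lambda>r. e * \<bar>f' r\<bar>)"
        proof (rule integral_norm_bound_integral)
          show "(\<lambda>r. (h' (f u) - h' (f r)) * f' r) integrable_on {s..t}"
            using i1 i2 by (simp add: left_diff_distrib Henstock_Kurzweil_Integration.integrable_diff integrable_on_mult_right)
          show "(\<lambda>r. e * \<bar>f' r\<bar>) integrable_on {s..t}" using i3 by (rule integrable_on_mult_right)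
          fix r assume r: "r \<in> {s..t}"
          have "dist (f u) (f r) < d0" using u(1) r st by (intro d(2)) (auto simp: dist_real_def)
          then have "dist (h' (f u)) (h' (f r)) < e" using u(1) r st by (intro d0(2)) auto
          then show "norm ((h' (f u) - h' (f r)) * f' r) \<le> e * \<bar>f' r\<bar>"
            by (simp add: dist_real_def abs_mult mult_right_mono)
        qed
        then show ?thesis by simp
      qed
      finally show "\<bar>h (f t) - h (f s) - integral {s..t} (\<lambda>t. h' (f t) * f' t)\<bar> \<le> e * integral {s..t} (\<lambda>t. \<bar>f' t\<bar>)"
        by simp
    qed
  qed
  have glob: "\<bar>h (f T) - h (f 0) - integral {0..T} (\<lambda>t. h' (f t) * f' t)\<bar> \<le> e * V"
    if e: "e > 0" and T: "T \<in> {0..1}" for e T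
  proof -
    obtain d where d: "d > 0" "\<And>s t. 0 \<le> s \<and> s \<le> t \<and> t \<le> 1 \<and> t - s < d \<Longrightarrow>
     \<bar>h (f t) - h (f s) - integral {s..t} (\<lambda>t. h' (f t) * f' t)\<bar> \<le> e * integral {s..t} (\<lambda>t. \<bar>f' t\<bar>)"
      using loc[OF e] by metis
    obtain N where N: "inverse (real (Suc N)) < d"
      using reals_Archimedean[OF d(1)] by auto
    define M where "M = Suc N"
    have M: "real M > 0" "1 / real M < d" using N unfolding M_def by (auto simp: inverse_eq_divide)
    have step: "T * real (Suc k) / M - T * real k / M = T / M" for k by (simp add: add_divide_distrib distrib_left)
    have "\<bar>h (f (T * real k / M)) - h (f 0) - integral {0..T * real k / M} (\<lambda>t. h' (f t) * f' t)\<bar>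
       \<le> e * integral {0..T * real k / M} (\<lambda>t. \<bar>f' t\<bar>)" if "k \<le> M" for k
      using that
    proof (induction k)
      case 0 then show ?case by simp
    next
      case (Suc k)
      define a where "a = T * real k / M"
      define b where "b = T * real (Suc k) / M"
      have "T / M \<le> 1 / M" using T M by (auto simp: field_simps)
      then have ab: "0 \<le> a" "a \<le> b" "b - a < d"
        using T M step[of k] unfolding a_def b_def by (auto simp: field_simps)
      have "T * real (Suc k) \<le> 1 * real M" using T Suc(2) by (intro mult_mono) auto
      then have b1: "b \<le> 1" using M by (simp add: b_def field_simps)
      have c1: "integral {0..b} (\<lambda>t. h' (f t) * f' t) = integral {0..a} (\<lambda>t. h' (f t) * f' t) + integral {a..b} (\<lambda>t. h' (f t) * f' t)"
        using ab b1 L2_integrable_sub[OF G, of 0 b] by (simp add: Henstock_Kurzweil_Integration.integral_combine)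
      have c2: "integral {0..b} (\<lambda>t. \<bar>f' t\<bar>) = integral {0..a} (\<lambda>t. \<bar>f' t\<bar>) + integral {a..b} (\<lambda>t. \<bar>f' t\<bar>)"
        using ab b1 L2_integrable_sub[OF absf, of 0 b] by (simp add: Henstock_Kurzweil_Integration.integral_combine)
      have "\<bar>h (f a) - h (f 0) - integral {0..a} (\<lambda>t. h' (f t) * f' t)\<bar> \<le> e * integral {0..a} (\<lambda>t. \<bar>f' t\<bar>)"
        using Suc unfolding a_def by auto
      moreover have "\<bar>h (f b) - h (f a) - integral {a..b} (\<lambda>t. h' (f t) * f' t)\<bar> \<le> e * integral {a..b} (\<lambda>t. \<bar>f' t\<bar>)"
        using ab b1 by (intro d(2)) auto
      ultimately show ?case unfolding b_def[symmetric] c1 c2 distrib_left by linarith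
    qed
    from this[of M] M have "\<bar>h (f T) - h (f 0) - integral {0..T} (\<lambda>t. h' (f t) * f' t)\<bar>
       \<le> e * integral {0..T} (\<lambda>t. \<bar>f' t\<bar>)" by simp
    also have "\<dots> \<le> e * V" unfolding V_def using e T
      by (intro mult_left_mono integral_subset_le L2_integrable_sub[OF absf]) auto
    finally show ?thesis .
  qed
  show ?thesis unfolding H1_def
  proof (intro conjI ballI G)
    fix T :: real assume T: "T \<in> {0..1}"
    have "\<bar>h (f T) - h (f 0) - integral {0..T} (\<lambda>t. h' (f t) * f' t)\<bar> \<le> 0 + e" if "e > 0" for e
    proof -
      have "\<bar>h (f T) - h (f 0) - integral {0..T} (\<lambda>t. h' (f t) * f' t)\<bar> \<le> e / (V + 1) * V"
        using V0 that by (intro glob T) auto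
      also have "\<dots> \<le> e" using V0 that by (simp add: field_simps)
      finally show ?thesis by simp
    qed
    then have "\<bar>h (f T) - h (f 0) - integral {0..T} (\<lambda>t. h' (f t) * f' t)\<bar> \<le> 0"
      by (rule field_le_epsilon)
    then show "h (f T) = h (f 0) + integral {0..T} (\<lambda>t. h' (f t) * f' t)" by linarith
  qed
qed

text \<open>Polarization: a product is half of the square of the sum minus the two squares, so the
  chain rule for the square function suffices.\<close>

lemma H1_mult: assumes "H1 f f'" "H1 g g'" shows "H1 (\<lambda>t. f t * g t) (\<lambda>t. f' t * g t + f t * g' t)"
proof -
  have sq: "H1 (\<lambda>t. (u t)\<^sup>2) (\<lambda>t. 2 * u t * u' t)" if "H1 u u'" for u u'
    using that by (rule H1_chain[where h="\<lambda>x. x\<^sup>2" and h'="\<lambda>x. 2 * x"]) (auto intro!: derivative_eq_intros continuous_intros)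
  have e1: "1/2 * ((a + b)\<^sup>2 - a\<^sup>2 - b\<^sup>2) = a * b" for a b :: real
    by (simp add: power2_sum)
  have e2: "1/2 * (2 * (a + b) * (a' + b') - 2 * a * a' - 2 * b * b') = a' * b + a * b'" for a b a' b' :: real
    by (simp add: algebra_simps add_divide_distrib)
  have "H1 (\<lambda>t. 1/2 * ((f t + g t)\<^sup>2 - (f t)\<^sup>2 - (g t)\<^sup>2))
     (\<lambda>t. 1/2 * (2 * (f t + g t) * (f' t + g' t) - 2 * f t * f' t - 2 * g t * g' t))"
    by (intro H1_cmult H1_diff sq H1_add assms)
  then show ?thesis unfolding e1 e2 .
qed

lemma H1_by_parts:
  assumes "H1 f f'" "H1 g g'"
  shows "integral {0..1} (\<lambda>t. f' t * g t + f t * g' t) = f 1 * g 1 - f 0 * g 0"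
  using H1_eq[OF H1_mult[OF assms], of 1] by simp

lemma H1_inverse:
  assumes "H1 f f'" "\<And>t. t \<in> {0..1} \<Longrightarrow> f t \<noteq> 0"
  shows "H1 (\<lambda>t. 1 / f t) (\<lambda>t. - f' t / (f t)\<^sup>2)"
proof -
  have "H1 (\<lambda>t. 1 / f t) (\<lambda>t. - 1 / (f t)\<^sup>2 * f' t)"
    using assms by (intro H1_chain[where h="\<lambda>x. 1 / x" and h'="\<lambda>x. - 1 / x\<^sup>2"])
      (auto intro!: derivative_eq_intros continuous_intros simp: power2_eq_square)
  then show ?thesis by simp
qed

lemma H1_sqrt:
  assumes "H1 f f'" "\<And>t. t \<in> {0..1} \<Longrightarrow> f t > 0"
  shows "H1 (\<lambda>t. sqrt (f t)) (\<lambda>t. f' t / (2 * sqrt (f t)))"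
proof -
  have "H1 (\<lambda>t. sqrt (f t)) (\<lambda>t. 1 / (2 * sqrt (f t)) * f' t)"
  proof (rule H1_chain[where h=sqrt and h'="\<lambda>x. 1 / (2 * sqrt x)"])
    show "continuous_on (f ` {0..1}) (\<lambda>x. 1 / (2 * sqrt x))"
      using assms(2) by (intro continuous_intros) (force simp: less_le)+
    fix x assume "x \<in> f ` {0..1}"
    then have "x > 0" using assms(2) by auto
    then show "(sqrt has_real_derivative 1 / (2 * sqrt x)) (at x)"
      by (auto intro!: derivative_eq_intros simp: field_simps)
  qed (rule assms(1))
  then show ?thesis by simp
qed

lemma H1_sin: "H1 f f' \<Longrightarrow> H1 (\<lambda>t. sin (f t)) (\<lambda>t. cos (f t) * f' t)"
  by (rule H1_chain[where h=sin and h'=cos]) (auto intro!: derivative_eq_intros continuous_intros)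

lemma H1_cos: "H1 f f' \<Longrightarrow> H1 (\<lambda>t. cos (f t)) (\<lambda>t. - sin (f t) * f' t)"
  by (rule H1_chain[where h=cos and h'="\<lambda>x. - sin x"]) (auto intro!: derivative_eq_intros continuous_intros)

lemma H1_integral: "L2 f \<Longrightarrow> H1 (\<lambda>t. c + integral {0..t} f) f"
  unfolding H1_def by simp

text \<open>Lebesgue differentiation: at almost every point \<open>f t\<close> is the limit of
  averages over intervals to the right of \<open>t\<close>, and all these averages vanish. The point
  1 is put into the exceptional set because no interval fits to its right.\<close>

lemma integral_zero_imp_negligible:
  fixes f :: "real \<Rightarrow> real"
  assumes "L2 f" "\<And>t. t \<in> {0..1} \<Longrightarrow> integral {0..t} f = 0"
  shows "\<exists>N. negligible N \<and> (\<forall>t\<in>{0..1} - N. f t = 0)"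
proof -
  have "H1 (\<lambda>_. 0) f" using assms by (simp add: H1_def)
  then have z: "integral {s..t} f = 0" if "0 \<le> s" "s \<le> t" "t \<le> 1" for s t
    using H1_diff_eq[of "\<lambda>_. 0" f s t] that by auto
  define F where "F = (\<lambda>t. if t \<in> {0..1} then f t else 0)"
  obtain N where N: "negligible N" "\<And>x e. \<lbrakk>x \<notin> N; 0 < e\<rbrakk> \<Longrightarrow>
     \<exists>d>0. \<forall>h. 0 < h \<and> h < d \<longrightarrow>
        norm (integral (cbox x (x + h *\<^sub>R One)) F /\<^sub>R h ^ DIM(real) - F x) < e"
  proof (rule integrable_ccontinuous_explicit[of F])
    fix a b :: real
    have "F integrable_on UNIV" unfolding F_def
      using L2_integrable[OF assms(1)] by (simp only: integrable_restrict_UNIV)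
    then show "F integrable_on cbox a b" by (rule integrable_on_subcbox) auto
  qed blast
  have "f t = 0" if t: "t \<in> {0..1} - (N \<union> {1})" for t
  proof (rule ccontr)
    assume ne: "f t \<noteq> 0"
    then obtain d where d: "d > 0" "\<And>h. 0 < h \<Longrightarrow> h < d \<Longrightarrow> norm (integral (cbox t (t + h *\<^sub>R One)) F /\<^sub>R h ^ DIM(real) - F t) < \<bar>f t\<bar>"
      using N(2)[of t "\<bar>f t\<bar>"] t by auto
    define h where "h = min (d/2) (1 - t)"
    have h: "0 < h" "h < d" "t + h \<le> 1" using d t by (auto simp: h_def)
    have "integral {t..t+h} F = integral {t..t+h} f"
      using t h by (intro integral_cong) (auto simp: F_def)
    also have "\<dots> = 0" using t h by (intro z) auto
    finally show False using d(2)[OF h(1,2)] t by (simp add: F_def)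
  qed
  then show ?thesis using N(1) by (intro exI[of _ "N \<union> {1}"]) (auto intro: negligible_Un)
qed

lemma H1_unique:
  assumes "H1 f f'" "H1 g g'" "\<And>t. t \<in> {0..1} \<Longrightarrow> f t = g t"
  shows "\<exists>N. negligible N \<and> (\<forall>t\<in>{0..1} - N. f' t = g' t)"
proof -
  have d: "H1 (\<lambda>t. f t - g t) (\<lambda>t. f' t - g' t)" by (rule H1_diff[OF assms(1,2)])
  have "integral {0..t} (\<lambda>t. f' t - g' t) = 0" if "t \<in> {0..1}" for t
    using H1_eq[OF d that] assms(3)[OF that] assms(3)[of 0] by simp
  from integral_zero_imp_negligible[OF H1_L2[OF d] this] show ?thesis by simp
qed

lemma integral_cong_ae:
  assumes "negligible N" "\<And>t. t \<in> S - N \<Longrightarrow> f t = g t"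
  shows "integral S f = integral S g"
  by (rule integral_spike[OF assms(1)]) (use assms(2) in auto)

lemma L2_abs: "L2 f \<Longrightarrow> L2 (\<lambda>t. \<bar>f t\<bar>)"
  by (auto simp: L2_def)

lemma L2_square_integrable: "L2 f \<Longrightarrow> (\<lambda>t. (f t)\<^sup>2) integrable_on {0..1}"
  by (simp add: L2_def)

text \<open>Integrate the square of \<bar>\<open>f\<close>\<bar> minus its mean \<open>m\<close>,
  which is nonnegative.\<close>

lemma L2_Cauchy_Schwarz:
  assumes "L2 f" shows "(integral {0..1} (\<lambda>t. \<bar>f t\<bar>))\<^sup>2 \<le> integral {0..1} (\<lambda>t. (f t)\<^sup>2)"
proof -
  define m where "m = integral {0..1} (\<lambda>t. \<bar>f t\<bar>)"
  note i = L2_square_integrable[OF assms] L2_integrable[OF L2_abs[OF assms]]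
  have "((\<lambda>t. (f t)\<^sup>2 - 2 * m * \<bar>f t\<bar> + m\<^sup>2) has_integral
      (integral {0..1} (\<lambda>t. (f t)\<^sup>2) - 2 * m * m + m\<^sup>2 * (1 - 0))) {0..1}"
    unfolding m_def using has_integral_const_real[of "m\<^sup>2" 0 1]
    by (intro has_integral_add has_integral_diff has_integral_mult_right integrable_integral i)
       (simp add: m_def)
  moreover have "0 \<le> (f t)\<^sup>2 - 2 * m * \<bar>f t\<bar> + m\<^sup>2" for t
    using zero_le_power2[of "\<bar>f t\<bar> - m"] by (simp add: power2_eq_square algebra_simps)
  ultimately have "0 \<le> integral {0..1} (\<lambda>t. (f t)\<^sup>2) - 2 * m * m + m\<^sup>2 * (1 - 0)"
    by (rule has_integral_nonneg)
  then show ?thesis unfolding m_def by (simp add: power2_eq_square)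
qed

lemma integral_square_zero_imp:
  assumes "L2 f" "integral {0..1} (\<lambda>t. (f t)\<^sup>2) = 0" "t \<in> {0..1}"
  shows "integral {0..t} f = 0"
proof -
  have "integral {0..1} (\<lambda>t. \<bar>f t\<bar>) = 0" using L2_Cauchy_Schwarz[OF assms(1)] assms(2) by simp
  moreover have "\<bar>integral {0..t} f\<bar> \<le> integral {0..t} (\<lambda>t. \<bar>f t\<bar>)"
    using integral_norm_bound_integral[of f "{0..t}" "\<lambda>t. \<bar>f t\<bar>"] assms(3)
      L2_integrable_sub[OF assms(1)] L2_integrable_sub[OF L2_abs[OF assms(1)]] by auto
  moreover have "integral {0..t} (\<lambda>t. \<bar>f t\<bar>) \<le> integral {0..1} (\<lambda>t. \<bar>f t\<bar>)"
    using assms(3) by (intro integral_subset_le L2_integrable_sub[OF L2_abs[OF assms(1)]]) auto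
  ultimately show ?thesis by linarith
qed

section \<open>Sobolev curves: components, uniqueness of the derivatives, energy and
  distance\<close>

lemma W22_has_vector_derivative:
  "W22 g g1 g2 \<Longrightarrow> t \<in> {0..1} \<Longrightarrow> (g has_vector_derivative g1 t) (at t within {0..1})"
  unfolding W22_def by blast

lemma W22_H1:
  assumes "W22 g g1 g2"
  shows "H1 (\<lambda>t. fst (g1 t)) (\<lambda>t. fst (g2 t))" "H1 (\<lambda>t. snd (g1 t)) (\<lambda>t. snd (g2 t))"
proof -
  have ai: "g2 absolutely_integrable_on {0..1}" and sq: "(\<lambda>t. (norm (g2 t))\<^sup>2) integrable_on {0..1}"
    and eq: "\<And>t. t \<in> {0..1} \<Longrightarrow> g1 t = g1 0 + integral {0..t} g2"
    using assms unfolding W22_def by blast+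
  have *: "H1 (\<lambda>t. P (g1 t)) (\<lambda>t. P (g2 t))"
    if P: "bounded_linear P" "\<And>x. (P x)\<^sup>2 \<le> (norm x)\<^sup>2" for P :: "real \<times> real \<Rightarrow> real"
    unfolding H1_def
  proof (intro conjI ballI)
    have m: "(\<lambda>t. P (g2 t)) absolutely_integrable_on {0..1}"
      using absolutely_integrable_linear[OF ai P(1)] by (simp add: o_def)
    show "L2 (\<lambda>t. P (g2 t))"
      by (rule L2_square_bound[OF _ sq]) (use absolutely_integrable_imp_borel_measurable[OF m] P(2) in auto)
    fix t :: real assume t: "t \<in> {0..1}"
    have "g2 integrable_on {0..1}" using ai by (auto simp: absolutely_integrable_on_def)
    then have "g2 integrable_on {0..t}" by (rule integrable_on_subinterval) (use t in auto)
    then have "integral {0..t} (\<lambda>t. P (g2 t)) = P (integral {0..t} g2)"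
      using integral_linear[OF _ P(1), of g2 "{0..t}"] by (simp add: o_def)
    then show "P (g1 t) = P (g1 0) + integral {0..t} (\<lambda>t. P (g2 t))"
      using eq[OF t] by (metis P(1) linear_simps(1))
  qed
  show "H1 (\<lambda>t. fst (g1 t)) (\<lambda>t. fst (g2 t))"
    by (rule *[OF bounded_linear_fst]) (auto simp: norm_Pair norm_prod_def)
  show "H1 (\<lambda>t. snd (g1 t)) (\<lambda>t. snd (g2 t))"
    by (rule *[OF bounded_linear_snd]) (auto simp: norm_Pair norm_prod_def)
qed

lemma absolutely_integrable_Pair:
  fixes a b :: "real \<Rightarrow> real"
  assumes "a absolutely_integrable_on S" "b absolutely_integrable_on S"
  shows "(\<lambda>t. (a t, b t)) absolutely_integrable_on S"
proof -
  have bl: "bounded_linear (\<lambda>x::real. (x, 0::real))" "bounded_linear (\<lambda>x::real. (0::real, x))"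
    by (auto intro!: bounded_linear_Pair bounded_linear_ident bounded_linear_zero)
  have "(\<lambda>t. (a t, 0) + (0, b t)) absolutely_integrable_on S"
    using absolutely_integrable_linear[OF assms(1) bl(1)] absolutely_integrable_linear[OF assms(2) bl(2)]
    by (intro set_integral_add(1)) (auto simp: o_def)
  then show ?thesis by simp
qed

lemma integral_Pair:
  fixes a b :: "real \<Rightarrow> real"
  assumes "(\<lambda>t. (a t, b t)) integrable_on S"
  shows "integral S (\<lambda>t. (a t, b t)) = (integral S a, integral S b)"
  using integral_linear[OF assms bounded_linear_fst] integral_linear[OF assms bounded_linear_snd]
  by (simp add: o_def prod_eq_iff)

lemma W22_I:
  assumes a: "H1 a a'" and b: "H1 b b'"
    and d: "\<And>t. t \<in> {0..1} \<Longrightarrow> (g has_vector_derivative (a t, b t)) (at t within {0..1})"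
  shows "W22 g (\<lambda>t. (a t, b t)) (\<lambda>t. (a' t, b' t))"
proof -
  have ai: "(\<lambda>t. (a' t, b' t)) absolutely_integrable_on {0..1}"
    by (intro absolutely_integrable_Pair L2_imp_absolutely_integrable H1_L2[OF a] H1_L2[OF b])
  have sq: "(\<lambda>t. (norm (a' t, b' t))\<^sup>2) integrable_on {0..1}"
    using L2_square_integrable[OF H1_L2[OF a]] L2_square_integrable[OF H1_L2[OF b]]
    by (auto simp: norm_Pair intro: integrable_add)
  have "(a t, b t) = (a 0, b 0) + integral {0..t} (\<lambda>t. (a' t, b' t))" if t: "t \<in> {0..1}" for t
  proof -
    have "(\<lambda>t. (a' t, b' t)) integrable_on {0..1}" using ai by (auto simp: absolutely_integrable_on_def)
    then have "(\<lambda>t. (a' t, b' t)) integrable_on {0..t}" by (rule integrable_on_subinterval) (use t in auto)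
    then show ?thesis using H1_eq[OF a t] H1_eq[OF b t] by (simp add: integral_Pair)
  qed
  then show ?thesis unfolding W22_def using d ai sq by blast
qed

lemma W22_primitive:
  assumes a: "H1 a a'" and b: "H1 b b'"
  shows "W22 (\<lambda>t. (p + integral {0..t} a, q + integral {0..t} b)) (\<lambda>t. (a t, b t)) (\<lambda>t. (a' t, b' t))"
proof (rule W22_I[OF a b])
  fix t :: real assume t: "t \<in> {0..1}"
  show "((\<lambda>t. (p + integral {0..t} a, q + integral {0..t} b)) has_vector_derivative (a t, b t)) (at t within {0..1})"
    using has_vector_derivative_Pair[OF
        has_vector_derivative_add[OF has_vector_derivative_const integral_has_vector_derivative[OF H1_continuous[OF a] t]]
        has_vector_derivative_add[OF has_vector_derivative_const integral_has_vector_derivative[OF H1_continuous[OF b] t]]]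
    by simp
qed

text \<open>This makes the choice operator in \<open>d1\<close> and \<open>d2\<close> harmless.
  First derivatives agree pointwise, by uniqueness of derivatives within a closed interval, and
  second ones up to a null set; energy and distance are integrals, so any admissible pair computes
  them.\<close>

lemma W22_unique:
  assumes "W22 g g1 g2" "W22 g h1 h2"
  shows "\<And>t. t \<in> {0..1} \<Longrightarrow> g1 t = h1 t"
    and "\<exists>N. negligible N \<and> (\<forall>t\<in>{0..1} - N. g2 t = h2 t)"
proof -
  show e: "g1 t = h1 t" if t: "t \<in> {0..1}" for t
  proof -
    have "(g has_vector_derivative g1 t) (at t within cbox 0 1)" "(g has_vector_derivative h1 t) (at t within cbox 0 1)"
      using assms t W22_has_vector_derivative by (simp_all add: cbox_interval)
    then show ?thesis
      using vector_derivative_unique_within_closed_interval[of 0 1 t g] t by auto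
  qed
  obtain N M where "negligible N" "\<forall>t\<in>{0..1} - N. fst (g2 t) = fst (h2 t)"
     "negligible M" "\<forall>t\<in>{0..1} - M. snd (g2 t) = snd (h2 t)"
    using H1_unique[OF W22_H1(1)[OF assms(1)] W22_H1(1)[OF assms(2)]]
      H1_unique[OF W22_H1(2)[OF assms(1)] W22_H1(2)[OF assms(2)]] e by auto
  then show "\<exists>N. negligible N \<and> (\<forall>t\<in>{0..1} - N. g2 t = h2 t)"
    by (intro exI[of _ "N \<union> M"]) (auto simp: prod_eq_iff intro: negligible_Un)
qed

lemma W22_d1_d2: "W22 g g1 g2 \<Longrightarrow> W22 g (d1 g) (d2 g)"
  unfolding d1_def d2_def using someI[of "\<lambda>p. W22 g (fst p) (snd p)" "(g1, g2)"] by simp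

lemma energy_W22:
  assumes "W22 g g1 g2"
  shows "energy lam g = integral {0..1} (\<lambda>t. (cross (g1 t) (g2 t))\<^sup>2 / (norm (g1 t)) ^ 5)
     + lam * integral {0..1} (\<lambda>t. norm (g1 t))"
proof -
  note W = W22_d1_d2[OF assms]
  note U = W22_unique[OF assms W]
  obtain N where N: "negligible N" "\<forall>t\<in>{0..1} - N. g2 t = d2 g t" using U(2) by blast
  show ?thesis unfolding energy_def bending_def curve_length_def
    using U(1) N(2) by (intro arg_cong2[where f="(+)"] arg_cong2[where f="(*)"] integral_cong_ae[OF N(1)]) auto
qed

lemma w22_dist_W22:
  assumes "W22 G G1 G2" "W22 g g1 g2"
  shows "w22_dist G g = sqrt (integral {0..1} (\<lambda>t. (norm (G t - g t))\<^sup>2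
        + (norm (G1 t - g1 t))\<^sup>2 + (norm (G2 t - g2 t))\<^sup>2))"
proof -
  note U = W22_unique[OF assms(1) W22_d1_d2[OF assms(1)]]
  note V = W22_unique[OF assms(2) W22_d1_d2[OF assms(2)]]
  obtain N M where N: "negligible N" "\<forall>t\<in>{0..1} - N. G2 t = d2 G t"
     "negligible M" "\<forall>t\<in>{0..1} - M. g2 t = d2 g t" using U(2) V(2) by blast
  show ?thesis unfolding w22_dist_def
    using U(1) V(1) N by (intro arg_cong[where f=sqrt] integral_cong_ae[OF negligible_Un[OF N(1,3)]]) auto
qed

lemma W22_add_scaled:
  assumes "W22 g g1 g2" "W22 h h1 h2"
  shows "W22 (\<lambda>t. g t + e *\<^sub>R h t) (\<lambda>t. g1 t + e *\<^sub>R h1 t) (\<lambda>t. g2 t + e *\<^sub>R h2 t)"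
proof -
  have pr: "(fst p + e * fst q, snd p + e * snd q) = p + e *\<^sub>R q" for p q :: "real \<times> real"
    by (simp add: prod_eq_iff)
  have "W22 (\<lambda>t. g t + e *\<^sub>R h t) (\<lambda>t. (fst (g1 t) + e * fst (h1 t), snd (g1 t) + e * snd (h1 t)))
    (\<lambda>t. (fst (g2 t) + e * fst (h2 t), snd (g2 t) + e * snd (h2 t)))"
  proof (intro W22_I H1_add H1_cmult W22_H1[OF assms(1)] W22_H1[OF assms(2)])
    fix t :: real assume "t \<in> {0..1}"
    then have "((\<lambda>t. g t + e *\<^sub>R h t) has_vector_derivative g1 t + e *\<^sub>R h1 t) (at t within {0..1})"
      by (intro has_vector_derivative_add bounded_linear.has_vector_derivative[OF bounded_linear_scaleR_right]
          W22_has_vector_derivative[OF assms(1)] W22_has_vector_derivative[OF assms(2)])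
    then show "((\<lambda>t. g t + e *\<^sub>R h t) has_vector_derivative (fst (g1 t) + e * fst (h1 t), snd (g1 t) + e * snd (h1 t))) (at t within {0..1})"
        by (simp only: pr)
  qed
  then show ?thesis by (simp only: pr)
qed

section \<open>Complete elliptic integrals\<close>

lemma modulus_bound: fixes q x :: real assumes "\<bar>q\<bar> < 1" shows "1 - q\<^sup>2 \<le> 1 - q\<^sup>2 * (sin x)\<^sup>2" "0 < 1 - q\<^sup>2 * (sin x)\<^sup>2"
proof -
  have "(sin x)\<^sup>2 \<le> 1" using sin_cos_squared_add[of x] zero_le_power2[of "cos x"] by linarith
  then have "q\<^sup>2 * (sin x)\<^sup>2 \<le> q\<^sup>2" by (simp add: mult_left_le)
  moreover have "q\<^sup>2 < 1" using assms by (simp add: abs_square_less_1)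
  ultimately show "1 - q\<^sup>2 \<le> 1 - q\<^sup>2 * (sin x)\<^sup>2" "0 < 1 - q\<^sup>2 * (sin x)\<^sup>2" by auto
qed

text \<open>Near \<open>x\<close> the signed integral differs by a constant from an ordinary
  integral starting at \<open>-R\<close>. This removes the case distinction at 0.\<close>

lemma sint0_deriv:
  assumes "continuous_on UNIV h" shows "(sint0 h has_real_derivative h x) (at x)"
proof -
  define R where "R = \<bar>x\<bar> + 1"
  have ci: "h integrable_on {a..b}" for a b
    by (intro integrable_continuous_interval continuous_on_subset[OF assms]) auto
  have eq: "sint0 h y = integral {-R..y} h - integral {-R..0} h" if "y \<in> {-R..R}" for y
    using that Henstock_Kurzweil_Integration.integral_combine[of "-R" 0 y h, OF _ _ ci]
      Henstock_Kurzweil_Integration.integral_combine[of "-R" y 0 h, OF _ _ ci]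
    by (auto simp: sint0_def R_def)
  have "((\<lambda>y. integral {-R..y} h) has_real_derivative h x) (at x within {-R..R})"
    by (intro integral_has_real_derivative continuous_on_subset[OF assms]) (auto simp: R_def)
  moreover have "at x within {-R..R} = at x" by (rule at_within_Icc_at) (auto simp: R_def)
  ultimately have "((\<lambda>y. integral {-R..y} h - integral {-R..0} h) has_real_derivative h x) (at x)"
    by (auto intro!: derivative_eq_intros)
  then show ?thesis
    by (rule has_field_derivative_transform_within_open[where S="{-R<..<R}"]) (auto simp: eq R_def)
qed

lemma sint0_odd:
  assumes "continuous_on UNIV h" "\<And>x. h (- x) = h x" shows "sint0 h (- x) = - sint0 h x"
proof -
  have "((\<lambda>x. sint0 h x + sint0 h (- x)) has_real_derivative 0) (at y)" for y
    by (auto intro!: derivative_eq_intros sint0_deriv[OF assms(1)] DERIV_chain2[OF sint0_deriv[OF assms(1)]] simp: assms(2))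
  then have "sint0 h x + sint0 h (- x) = sint0 h 0 + sint0 h (- 0)"
    using DERIV_isconst_all by blast
  also have "\<dots> = 0" by (simp add: sint0_def)
  finally show ?thesis by simp
qed

context fixes q :: real assumes q: "\<bar>q\<bar> < 1" begin

lemma EllF_integrand_continuous: "continuous_on S (\<lambda>x. 1 / sqrt (1 - q\<^sup>2 * (sin x)\<^sup>2))"
  using modulus_bound(2)[OF q] by (intro continuous_intros) (auto simp: less_le)

lemma EllE_integrand_continuous: "continuous_on S (\<lambda>x. sqrt (1 - q\<^sup>2 * (sin x)\<^sup>2))"
  by (intro continuous_intros)

lemma EllF_deriv: "((\<lambda>x. EllF x q) has_real_derivative 1 / sqrt (1 - q\<^sup>2 * (sin x)\<^sup>2)) (at x)"
  unfolding EllF_def by (rule sint0_deriv[OF EllF_integrand_continuous])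

lemma EllEx_deriv: "((\<lambda>x. EllEx x q) has_real_derivative sqrt (1 - q\<^sup>2 * (sin x)\<^sup>2)) (at x)"
  unfolding EllEx_def by (rule sint0_deriv[OF EllE_integrand_continuous])

lemma EllF_minus: "EllF (- x) q = - EllF x q"
  unfolding EllF_def by (rule sint0_odd[OF EllF_integrand_continuous]) simp

lemma EllEx_minus: "EllEx (- x) q = - EllEx x q"
  unfolding EllEx_def by (rule sint0_odd[OF EllE_integrand_continuous]) simp

lemma EllF_strict_mono: "x < y \<Longrightarrow> EllF x q < EllF y q"
  by (rule DERIV_pos_imp_increasing) (use EllF_deriv modulus_bound(2)[OF q] in \<open>force intro!: exI\<close>)+

lemma am_EllF: "am (EllF x q) q = x"
  unfolding am_def
proof (rule the_equality)
  fix y assume "EllF y q = EllF x q"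
  then show "y = x" using EllF_strict_mono[of x y] EllF_strict_mono[of y x] by (cases x y rule: linorder_cases) auto
qed simp

lemma EllK_has_integral: "((\<lambda>x. 1 / sqrt (1 - q\<^sup>2 * (sin x)\<^sup>2)) has_integral EllK q) {0..pi/2}"
  unfolding EllK_def EllF_def sint0_def
  using integrable_integral[OF integrable_continuous_interval[OF EllF_integrand_continuous]] by simp

lemma EllE_has_integral: "((\<lambda>x. sqrt (1 - q\<^sup>2 * (sin x)\<^sup>2)) has_integral EllE q) {0..pi/2}"
  unfolding EllE_def EllEx_def sint0_def
  using integrable_integral[OF integrable_continuous_interval[OF EllE_integrand_continuous]] by simp

lemma EllE_pos: "0 < EllE q"
proof -
  have "((\<lambda>x. sqrt (1 - q\<^sup>2)) has_integral (pi/2 - 0) *\<^sub>R sqrt (1 - q\<^sup>2)) {0..pi/2}"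
    using has_integral_const_real[of "sqrt (1 - q\<^sup>2)" 0 "pi/2"] by simp
  then have "(pi/2 - 0) *\<^sub>R sqrt (1 - q\<^sup>2) \<le> EllE q"
    by (rule has_integral_le[OF _ EllE_has_integral]) (use modulus_bound(1)[OF q] in auto)
  moreover have "q\<^sup>2 < 1" using q by (simp add: abs_square_less_1)
  ultimately show ?thesis using pi_gt_zero by (smt (verit) mult_pos_pos real_scaleR_def real_sqrt_gt_zero divide_pos_pos)
qed

lemma EllE_le: "EllE q \<le> pi/2"
proof -
  have "EllE q \<le> (pi/2 - 0) *\<^sub>R 1"
  proof (rule has_integral_le[OF EllE_has_integral, where g="\<lambda>_. 1"])
    show "((\<lambda>_. 1::real) has_integral (pi/2 - 0) *\<^sub>R 1) {0..pi/2}"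
      using has_integral_const_real[of "1::real" 0 "pi/2"] by simp
  qed simp
  then show ?thesis by simp
qed

lemma EllE_le_EllK: "EllE q \<le> EllK q"
proof (rule has_integral_le[OF EllE_has_integral EllK_has_integral])
  fix x :: real
  have "1 - q\<^sup>2 * (sin x)\<^sup>2 \<le> 1" by simp
  then show "sqrt (1 - q\<^sup>2 * (sin x)\<^sup>2) \<le> 1 / sqrt (1 - q\<^sup>2 * (sin x)\<^sup>2)"
    using modulus_bound(2)[OF q, of x] by (simp add: field_simps)
qed

lemma EllK_pos: "0 < EllK q" using EllE_pos EllE_le_EllK by linarith

text \<open>With D the square root in the integrands, the difference of the two sides is the
  integral of q^2 cos^2 / D. Since D is at most 1, it is at least the integral of q^2 cos^2, which
  is q^2 pi / 4.\<close>

lemma EllE_gt: assumes "q \<noteq> 0" shows "(1 - q\<^sup>2) * EllK q < EllE q"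
proof -
  have "((\<lambda>x. (x + sin x * cos x) / 2) has_real_derivative (cos x)\<^sup>2) (at x)" for x
  proof -
    have "((\<lambda>x. (x + sin x * cos x) / 2) has_real_derivative (1 + (cos x * cos x + - sin x * sin x)) / 2) (at x)"
      by (auto intro!: derivative_eq_intros)
    moreover have "(1 + (cos x * cos x + - sin x * sin x)) / 2 = (cos x)\<^sup>2"
      using sin_cos_squared_add[of x] by (simp add: power2_eq_square field_simps)
    ultimately show ?thesis by simp
  qed
  then have "((\<lambda>x. (cos x)\<^sup>2) has_integral (pi/2 + sin (pi/2) * cos (pi/2)) / 2 - (0 + sin 0 * cos 0) / 2) {0..pi/2}"
    by (intro fundamental_theorem_of_calculus)
       (auto simp: has_real_derivative_iff_has_vector_derivative[symmetric] has_field_derivative_at_within)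
  then have "((\<lambda>x. q\<^sup>2 * (cos x)\<^sup>2) has_integral q\<^sup>2 * (pi/4)) {0..pi/2}"
    by (intro has_integral_mult_right) simp
  then have "q\<^sup>2 * (pi/4) \<le> EllE q - (1 - q\<^sup>2) * EllK q"
  proof (rule has_integral_le[OF _ has_integral_diff[OF EllE_has_integral has_integral_mult_right[OF EllK_has_integral]]])
    fix x :: real
    define D where "D = sqrt (1 - q\<^sup>2 * (sin x)\<^sup>2)"
    have D: "D > 0" "D\<^sup>2 = 1 - q\<^sup>2 * (sin x)\<^sup>2" "D \<le> 1"
      using modulus_bound(2)[OF q, of x] by (auto simp: D_def)
    have e: "D - (1 - q\<^sup>2) * (1 / D) = q\<^sup>2 * (cos x)\<^sup>2 / D"
    proof -
      have "D - (1 - q\<^sup>2) * (1 / D) = (D\<^sup>2 - (1 - q\<^sup>2)) / D" using D by (simp add: field_simps power2_eq_square)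
      also have "D\<^sup>2 - (1 - q\<^sup>2) = q\<^sup>2 * (cos x)\<^sup>2" using D(2) by (simp add: cos_squared_eq algebra_simps)
      finally show ?thesis .
    qed
    show "q\<^sup>2 * (cos x)\<^sup>2 \<le> sqrt (1 - q\<^sup>2 * (sin x)\<^sup>2) - (1 - q\<^sup>2) * (1 / sqrt (1 - q\<^sup>2 * (sin x)\<^sup>2))"
      unfolding D_def[symmetric] e using D mult_right_le_one_le[of "q\<^sup>2 * (cos x)\<^sup>2" D]
      by (simp add: pos_le_divide_eq)
  qed
  moreover have "0 < q\<^sup>2 * (pi/4)" using assms pi_gt_zero by simp
  ultimately show ?thesis by linarith
qed

text \<open>With D the square root, D - (1 - q^2) / D^3 is the derivative of q^2 sin cos / D, which
  vanishes at 0 and at pi/2. So the integral of 1 / D^3 reduces to that of D.\<close>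

lemma integral_inverse_cube:
  "((\<lambda>x. 1 / sqrt (1 - q\<^sup>2 * (sin x)\<^sup>2) ^ 3) has_integral EllE q / (1 - q\<^sup>2)) {0..pi/2}"
proof -
  let ?D = "\<lambda>x. sqrt (1 - q\<^sup>2 * (sin x)\<^sup>2)"
  have m: "1 - q\<^sup>2 > 0" using q by (simp add: abs_square_less_1)
  have "((\<lambda>x. q\<^sup>2 * (sin x * cos x / ?D x)) has_real_derivative ?D x - (1 - q\<^sup>2) * (1 / ?D x ^ 3)) (at x)" for x
  proof -
    define D where "D = ?D x"
    have D: "D > 0" "D\<^sup>2 = 1 - q\<^sup>2 * (sin x)\<^sup>2"
      using modulus_bound(2)[OF q, of x] by (auto simp: D_def)
    have c2: "(cos x)\<^sup>2 = 1 - (sin x)\<^sup>2" by (rule cos_squared_eq)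
    have d1: "((\<lambda>x. ?D x) has_real_derivative - (q\<^sup>2 * sin x * cos x) / D) (at x)"
      using modulus_bound(2)[OF q, of x]
      by (auto intro!: derivative_eq_intros simp: D_def field_simps)
    have d2: "((\<lambda>x. q\<^sup>2 * (sin x * cos x / ?D x)) has_real_derivative
       q\<^sup>2 * (((cos x * cos x - sin x * sin x) * D - sin x * cos x * (- (q\<^sup>2 * sin x * cos x) / D)) / (D * D))) (at x)"
      using DERIV_cmult[OF DERIV_divide[OF DERIV_mult[OF DERIV_sin DERIV_cos] d1], of "q\<^sup>2"] D(1)
      unfolding D_def by (simp add: algebra_simps)
    have e: "q\<^sup>2 * (((cos x * cos x - sin x * sin x) * D - sin x * cos x * (- (q\<^sup>2 * sin x * cos x) / D)) / (D * D))
       = q\<^sup>2 * (((cos x)\<^sup>2 - (sin x)\<^sup>2) * D\<^sup>2 + q\<^sup>2 * (sin x)\<^sup>2 * (cos x)\<^sup>2) / D ^ 3"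
      using D(1) by (simp add: field_simps power2_eq_square power3_eq_cube)
    also have "q\<^sup>2 * (((cos x)\<^sup>2 - (sin x)\<^sup>2) * D\<^sup>2 + q\<^sup>2 * (sin x)\<^sup>2 * (cos x)\<^sup>2) = D\<^sup>2 * D\<^sup>2 - (1 - q\<^sup>2)"
      unfolding D(2) c2 by (simp add: algebra_simps power2_eq_square)
    also have "(D\<^sup>2 * D\<^sup>2 - (1 - q\<^sup>2)) / D ^ 3 = D - (1 - q\<^sup>2) * (1 / D ^ 3)"
      using D(1) by (simp add: field_simps power2_eq_square power3_eq_cube)
    finally show ?thesis using d2 unfolding D_def[symmetric] by simp
  qed
  then have "((\<lambda>x. ?D x - (1 - q\<^sup>2) * (1 / ?D x ^ 3)) has_integral
     q\<^sup>2 * (sin (pi/2) * cos (pi/2) / ?D (pi/2)) - q\<^sup>2 * (sin 0 * cos 0 / ?D 0)) {0..pi/2}"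
    by (intro fundamental_theorem_of_calculus)
       (auto simp: has_real_derivative_iff_has_vector_derivative[symmetric] has_field_derivative_at_within)
  then have "((\<lambda>x. ?D x - (?D x - (1 - q\<^sup>2) * (1 / ?D x ^ 3))) has_integral EllE q - 0) {0..pi/2}"
    by (intro has_integral_diff EllE_has_integral) simp
  then have "((\<lambda>x. (1 / (1 - q\<^sup>2)) * ((1 - q\<^sup>2) * (1 / ?D x ^ 3))) has_integral (1 / (1 - q\<^sup>2)) * EllE q) {0..pi/2}"
    by (intro has_integral_mult_right) simp
  then show ?thesis using m by simp
qed

end

section \<open>Derivatives of the complete integrals with respect to the modulus, and the zero of 2
  E - K\<close>

lemma EllE_deriv:
  assumes "0 < q" "q < 1"
  shows "(EllE has_real_derivative (EllE q - EllK q) / q) (at q)"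
proof -
  have b: "1 - y\<^sup>2 * (sin t)\<^sup>2 > 0" if "0 < y" "y < 1" for y t :: real using modulus_bound(2)[of y t] that by auto
  have h1: "((\<lambda>q. integral (cbox 0 (pi/2)) (\<lambda>x. sqrt (1 - q\<^sup>2 * (sin x)\<^sup>2))) has_field_derivative
     integral (cbox 0 (pi/2)) (\<lambda>x. - (q * (sin x)\<^sup>2) / sqrt (1 - q\<^sup>2 * (sin x)\<^sup>2))) (at q within {0<..<1})"
  proof (rule leibniz_rule_field_derivative)
    fix y t :: real assume "y \<in> {0<..<1}" "t \<in> cbox 0 (pi/2)"
    then show "((\<lambda>q. sqrt (1 - q\<^sup>2 * (sin t)\<^sup>2)) has_real_derivative - (y * (sin t)\<^sup>2) / sqrt (1 - y\<^sup>2 * (sin t)\<^sup>2)) (at y within {0<..<1})"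
      using b[of y t] by (auto intro!: derivative_eq_intros simp: field_simps)
  next
    fix y :: real
    show "(\<lambda>x. sqrt (1 - y\<^sup>2 * (sin x)\<^sup>2)) integrable_on cbox 0 (pi/2)"
      unfolding cbox_interval by (intro integrable_continuous_interval continuous_intros)
  next
    have "continuous_on ({0<..<1} \<times> UNIV) (\<lambda>p. - (fst p * (sin (snd p))\<^sup>2) / sqrt (1 - (fst p)\<^sup>2 * (sin (snd p))\<^sup>2))"
      using b by (intro continuous_intros) (force simp: less_le)
    then show "continuous_on ({0<..<1} \<times> cbox 0 (pi/2)) (\<lambda>(y, t). - (y * (sin t)\<^sup>2) / sqrt (1 - y\<^sup>2 * (sin t)\<^sup>2))"
      by (simp add: case_prod_beta') (erule continuous_on_subset, auto)
  qed (use assms in auto)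
  have h2: "at q within {0<..<1} = at q" by (rule at_within_open) (use assms in auto)
  have h3: "((\<lambda>x. (1 / q) * (sqrt (1 - q\<^sup>2 * (sin x)\<^sup>2) - 1 / sqrt (1 - q\<^sup>2 * (sin x)\<^sup>2))) has_integral (1/q) * (EllE q - EllK q)) {0..pi/2}"
    using assms by (intro has_integral_mult_right has_integral_diff EllE_has_integral EllK_has_integral) auto
  \<comment> \<open>The derivative of the integrand, rewritten as a combination of the integrands of
    E and K; this is where the closed form of the derivative comes from.\<close>
  have h4: "(1 / q) * (sqrt (1 - q\<^sup>2 * (sin x)\<^sup>2) - 1 / sqrt (1 - q\<^sup>2 * (sin x)\<^sup>2)) = - (q * (sin x)\<^sup>2) / sqrt (1 - q\<^sup>2 * (sin x)\<^sup>2)" for x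
  proof -
    define D where "D = sqrt (1 - q\<^sup>2 * (sin x)\<^sup>2)"
    have D: "D > 0" "D\<^sup>2 = 1 - q\<^sup>2 * (sin x)\<^sup>2" using b[OF assms, of x] by (auto simp: D_def)
    have "D - 1 / D = (D\<^sup>2 - 1) / D" using D(1) by (simp add: diff_divide_distrib power2_eq_square)
    then show ?thesis unfolding D_def[symmetric] D(2) using assms by (simp add: power2_eq_square)
  qed
  have h5: "integral (cbox 0 (pi/2)) (\<lambda>x. - (q * (sin x)\<^sup>2) / sqrt (1 - q\<^sup>2 * (sin x)\<^sup>2)) = (EllE q - EllK q) / q"
    using integral_unique[OF h3[unfolded h4]] by (simp add: cbox_interval)
  have d: "((\<lambda>q. integral (cbox 0 (pi/2)) (\<lambda>x. sqrt (1 - q\<^sup>2 * (sin x)\<^sup>2))) has_real_derivative (EllE q - EllK q) / q) (at q)"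
    using h1 unfolding h2 h5 .
  show ?thesis
    by (rule has_field_derivative_transform_within_open[OF d, of "{0<..<1}"])
       (use assms EllE_has_integral in \<open>auto simp: integral_unique\<close>)
qed

text \<open>Differentiation under the integral gives q sin^2 / D^3, which is (1 / D^3 - 1 / D) / q.
  The integral of the inverse cube is known, so the derivative closes up in E and K.\<close>

lemma EllK_deriv:
  assumes "0 < q" "q < 1"
  shows "(EllK has_real_derivative (EllE q - (1 - q\<^sup>2) * EllK q) / (q * (1 - q\<^sup>2))) (at q)"
proof -
  have b: "1 - y\<^sup>2 * (sin t)\<^sup>2 > 0" if "0 < y" "y < 1" for y t :: real using modulus_bound(2)[of y t] that by auto
  have m: "1 - q\<^sup>2 > 0" using assms by (simp add: abs_square_less_1)
  have "((\<lambda>q. integral (cbox 0 (pi/2)) (\<lambda>x. 1 / sqrt (1 - q\<^sup>2 * (sin x)\<^sup>2))) has_field_derivative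
     integral (cbox 0 (pi/2)) (\<lambda>x. (q * (sin x)\<^sup>2) / sqrt (1 - q\<^sup>2 * (sin x)\<^sup>2) ^ 3)) (at q within {0<..<1})"
  proof (rule leibniz_rule_field_derivative)
    fix y t :: real assume y: "y \<in> {0<..<1}" "t \<in> cbox 0 (pi/2)"
    define D where "D = sqrt (1 - y\<^sup>2 * (sin t)\<^sup>2)"
    have D: "D > 0" using b[of y t] y by (auto simp: D_def)
    have d: "((\<lambda>q. sqrt (1 - q\<^sup>2 * (sin t)\<^sup>2)) has_real_derivative - (y * (sin t)\<^sup>2) / D) (at y within {0<..<1})"
      using y b[of y t] by (auto intro!: derivative_eq_intros simp: field_simps D_def)
    have "((\<lambda>q. 1 / sqrt (1 - q\<^sup>2 * (sin t)\<^sup>2)) has_real_derivative - (- (y * (sin t)\<^sup>2) / D) / (D * D)) (at y within {0<..<1})"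
      using DERIV_divide[OF DERIV_const[of 1] d] D unfolding D_def by simp
    then show "((\<lambda>q. 1 / sqrt (1 - q\<^sup>2 * (sin t)\<^sup>2)) has_real_derivative (y * (sin t)\<^sup>2) / sqrt (1 - y\<^sup>2 * (sin t)\<^sup>2) ^ 3) (at y within {0<..<1})"
      unfolding D_def[symmetric] by (simp add: power3_eq_cube mult.assoc)
  next
    fix y :: real assume y: "y \<in> {0<..<1}"
    show "(\<lambda>x. 1 / sqrt (1 - y\<^sup>2 * (sin x)\<^sup>2)) integrable_on cbox 0 (pi/2)"
      unfolding cbox_interval using y by (intro integrable_continuous_interval EllF_integrand_continuous) auto
  next
    have "continuous_on ({0<..<1} \<times> UNIV) (\<lambda>p. (fst p * (sin (snd p))\<^sup>2) / sqrt (1 - (fst p)\<^sup>2 * (sin (snd p))\<^sup>2) ^ 3)"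
      using b by (intro continuous_intros) (force simp: less_le)
    then show "continuous_on ({0<..<1} \<times> cbox 0 (pi/2)) (\<lambda>(y, t). (y * (sin t)\<^sup>2) / sqrt (1 - y\<^sup>2 * (sin t)\<^sup>2) ^ 3)"
      by (simp add: case_prod_beta') (erule continuous_on_subset, auto)
  qed (use assms in auto)
  moreover have "at q within {0<..<1} = at q" by (rule at_within_open) (use assms in auto)
  moreover have "((\<lambda>x. (1 / q) * (1 / sqrt (1 - q\<^sup>2 * (sin x)\<^sup>2) ^ 3 - 1 / sqrt (1 - q\<^sup>2 * (sin x)\<^sup>2))) has_integral (1/q) * (EllE q / (1 - q\<^sup>2) - EllK q)) {0..pi/2}"
    using assms by (intro has_integral_mult_right has_integral_diff integral_inverse_cube EllK_has_integral) auto
  moreover have "(1 / q) * (1 / sqrt (1 - q\<^sup>2 * (sin x)\<^sup>2) ^ 3 - 1 / sqrt (1 - q\<^sup>2 * (sin x)\<^sup>2)) = (q * (sin x)\<^sup>2) / sqrt (1 - q\<^sup>2 * (sin x)\<^sup>2) ^ 3" for x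
  proof -
    define D where "D = sqrt (1 - q\<^sup>2 * (sin x)\<^sup>2)"
    have D: "D > 0" "D\<^sup>2 = 1 - q\<^sup>2 * (sin x)\<^sup>2" using b[OF assms, of x] by (auto simp: D_def)
    have "1 / D ^ 3 - 1 / D = (1 - D\<^sup>2) / D ^ 3" using D by (simp add: field_simps power3_eq_cube power2_eq_square)
    then show ?thesis unfolding D_def[symmetric] D(2) using assms by (simp add: power2_eq_square)
  qed
  moreover have "(1/q) * (EllE q / (1 - q\<^sup>2) - EllK q) = (EllE q - (1 - q\<^sup>2) * EllK q) / (q * (1 - q\<^sup>2))"
    using assms m by (simp add: field_simps)
  ultimately have d: "((\<lambda>q. integral (cbox 0 (pi/2)) (\<lambda>x. 1 / sqrt (1 - q\<^sup>2 * (sin x)\<^sup>2))) has_real_derivative (EllE q - (1 - q\<^sup>2) * EllK q) / (q * (1 - q\<^sup>2))) (at q)"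
    by (simp add: integral_unique)
  show ?thesis
    by (rule has_field_derivative_transform_within_open[OF d, of "{0<..<1}"])
       (use assms EllK_has_integral in \<open>auto simp: integral_unique\<close>)
qed

text \<open>K diverges logarithmically at modulus 1 while 2 E stays at most pi. For q^2 = 1 - e^2
  the integrand of K is at least 1 / (pi/2 - x + e), so K is at least -ln e. The choice e = exp (-4)
  makes this 4, which exceeds pi.\<close>

lemma EllK_exceeds_twice_EllE: "\<exists>q. 0 < q \<and> q < 1 \<and> 2 * EllE q - EllK q < 0"
proof -
  define e :: real where "e = exp (- 4)"
  have e: "0 < e" "e < 1" by (auto simp: e_def)
  then have e2: "e\<^sup>2 < 1" by (simp add: abs_square_less_1)
  define q where "q = sqrt (1 - e\<^sup>2)"
  have q: "0 < q" "q < 1" "q\<^sup>2 = 1 - e\<^sup>2" using e e2 by (auto simp: q_def)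
  have "((\<lambda>x. - ln (pi/2 - x + e)) has_real_derivative 1 / (pi/2 - x + e)) (at x within {0..pi/2})" if "x \<in> {0..pi/2}" for x
    using that e by (auto intro!: derivative_eq_intros simp: field_simps)
  then have i: "((\<lambda>x. 1 / (pi/2 - x + e)) has_integral - ln (pi/2 - pi/2 + e) - - ln (pi/2 - 0 + e)) {0..pi/2}"
    by (intro fundamental_theorem_of_calculus) (auto simp: has_real_derivative_iff_has_vector_derivative[symmetric])
  have "- ln (pi/2 - pi/2 + e) - - ln (pi/2 - 0 + e) \<le> EllK q"
  proof (rule has_integral_le[OF i EllK_has_integral])
    show "\<bar>q\<bar> < 1" using q by simp
    fix x assume x: "x \<in> {0..pi/2}"
    define u where "u = pi/2 - x"
    have u: "u \<ge> 0" "sin x = cos u" using x by (auto simp: u_def cos_sin_eq)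
    have "1 - q\<^sup>2 * (sin x)\<^sup>2 = (sin u)\<^sup>2 + e\<^sup>2 * (cos u)\<^sup>2"
      unfolding q u sin_squared_eq by (simp add: algebra_simps)
    also have "\<dots> \<le> u\<^sup>2 + e\<^sup>2"
    proof (rule add_mono)
      show "(sin u)\<^sup>2 \<le> u\<^sup>2" using abs_sin_x_le_abs_x[of u] by (simp add: abs_le_square_iff)
      show "e\<^sup>2 * (cos u)\<^sup>2 \<le> e\<^sup>2" by (simp add: mult_left_le abs_square_le_1)
    qed
    also have "\<dots> \<le> (u + e)\<^sup>2" using u e by (simp add: power2_sum)
    finally have "sqrt (1 - q\<^sup>2 * (sin x)\<^sup>2) \<le> u + e"
      using u e by (intro real_le_lsqrt) auto
    then show "1 / (pi/2 - x + e) \<le> 1 / sqrt (1 - q\<^sup>2 * (sin x)\<^sup>2)"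
      using modulus_bound(2)[of q x] q u e unfolding u_def[symmetric] by (simp add: frac_le)
  qed
  moreover have "ln e = - 4" by (simp add: e_def)
  moreover have "0 \<le> ln (pi/2 + e)" using pi_gt3 e by (intro ln_ge_zero) auto
  ultimately have "4 \<le> EllK q" by simp
  moreover have "2 * EllE q \<le> pi" using EllE_le[of q] q by auto
  ultimately show ?thesis using q pi_less_4 by (intro exI[of _ q]) auto
qed

text \<open>Geometrically, an arc of modulus \<open>q\<close> and scale \<open>\<alpha>\<close> has
  its end points at signed distance 2 \<open>EllU q\<close> / \<open>\<alpha>\<close>. Beyond the
  zero \<open>qstar\<close> the chord would point backwards.\<close>

definition EllU :: "real \<Rightarrow> real" where "EllU q = 2 * EllE q - EllK q"

lemma EllU_deriv:
  assumes "0 < q" "q < 1"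
  shows "(EllU has_real_derivative ((1 - 2 * q\<^sup>2) * EllE q - (1 - q\<^sup>2) * EllK q) / (q * (1 - q\<^sup>2))) (at q)"
proof -
  have m: "1 - q\<^sup>2 > 0" using assms by (simp add: abs_square_less_1)
  have "(EllU has_real_derivative 2 * ((EllE q - EllK q) / q) - (EllE q - (1 - q\<^sup>2) * EllK q) / (q * (1 - q\<^sup>2))) (at q)"
    unfolding EllU_def[abs_def] by (auto intro!: derivative_eq_intros EllE_deriv EllK_deriv assms)
  moreover have "2 * ((EllE q - EllK q) / q) - (EllE q - (1 - q\<^sup>2) * EllK q) / (q * (1 - q\<^sup>2))
     = (2 * (1 - q\<^sup>2) * (EllE q - EllK q) - (EllE q - (1 - q\<^sup>2) * EllK q)) / (q * (1 - q\<^sup>2))"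
  proof -
    have "2 * (1 - q\<^sup>2) * (EllE q - EllK q) / (q * (1 - q\<^sup>2)) = 2 * ((EllE q - EllK q) / q)"
      using m assms by (simp add: field_simps)
    then show ?thesis by (simp only: diff_divide_distrib)
  qed
  moreover have "2 * (1 - q\<^sup>2) * (EllE q - EllK q) - (EllE q - (1 - q\<^sup>2) * EllK q) = (1 - 2 * q\<^sup>2) * EllE q - (1 - q\<^sup>2) * EllK q"
    by (simp add: algebra_simps)
  ultimately show ?thesis by (simp only:)
qed

lemma EllU_deriv_neg:
  assumes "0 < q" "q < 1"
  shows "((1 - 2 * q\<^sup>2) * EllE q - (1 - q\<^sup>2) * EllK q) / (q * (1 - q\<^sup>2)) < 0"
proof -
  have m: "1 - q\<^sup>2 > 0" using assms by (simp add: abs_square_less_1)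
  have "(1 - q\<^sup>2) * EllE q \<le> (1 - q\<^sup>2) * EllK q" using m EllE_le_EllK[of q] assms by (intro mult_left_mono) auto
  moreover have "0 < q\<^sup>2 * EllE q" using assms EllE_pos[of q] by simp
  moreover have "(1 - 2 * q\<^sup>2) * EllE q = (1 - q\<^sup>2) * EllE q - q\<^sup>2 * EllE q" by (simp add: algebra_simps)
  ultimately have "(1 - 2 * q\<^sup>2) * EllE q - (1 - q\<^sup>2) * EllK q < 0" by linarith
  then show ?thesis using m assms by (simp add: divide_neg_pos)
qed

lemma EllU_strict_antimono: assumes "0 < a" "a < b" "b < 1" shows "EllU b < EllU a"
  by (rule DERIV_neg_imp_decreasing[OF assms(2)])
     (use assms EllU_deriv EllU_deriv_neg in \<open>meson le_less_trans less_le_trans\<close>)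

lemma EllU_continuous: "0 < a \<Longrightarrow> b < 1 \<Longrightarrow> continuous_on {a..b} EllU"
  by (intro DERIV_continuous_on[where D="\<lambda>q. ((1 - 2 * q\<^sup>2) * EllE q - (1 - q\<^sup>2) * EllK q) / (q * (1 - q\<^sup>2))"]
      has_field_derivative_at_within[OF EllU_deriv]) auto

lemma inv_sqrt2: "0 < 1 / sqrt 2" "1 / sqrt 2 < 1" "(1 / sqrt 2)\<^sup>2 = 1/2"
  by (auto simp: power_divide)

text \<open>At q^2 = 1/2 the inequality \<open>EllE_gt\<close> reads K < 2 E.\<close>

lemma EllU_inv_sqrt2: "EllU (1 / sqrt 2) > 0"
  using EllE_gt[of "1 / sqrt 2"] inv_sqrt2 unfolding EllU_def by auto

lemma qstar: "1 / sqrt 2 < qstar" "qstar < 1" "EllU qstar = 0"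
  and EllU_pos: "0 < q \<Longrightarrow> q < qstar \<Longrightarrow> EllU q > 0"
  and EllU_neg: "qstar < q \<Longrightarrow> q < 1 \<Longrightarrow> EllU q < 0"
proof -
  obtain q1 where q1: "0 < q1" "q1 < 1" "EllU q1 < 0" using EllK_exceeds_twice_EllE unfolding EllU_def by auto
  have lt: "1 / sqrt 2 < q1"
  proof (rule ccontr)
    assume "\<not> ?thesis"
    then have "EllU (1 / sqrt 2) \<le> EllU q1"
      using EllU_strict_antimono[of q1 "1 / sqrt 2"] q1 inv_sqrt2 by (cases "q1 = 1 / sqrt 2") auto
    then show False using q1 EllU_inv_sqrt2 by auto
  qed
  obtain z where z: "1 / sqrt 2 \<le> z" "z \<le> q1" "EllU z = 0"
    using IVT2'[of EllU q1 0 "1 / sqrt 2"] q1 lt EllU_inv_sqrt2 EllU_continuous[of "1 / sqrt 2" q1] inv_sqrt2 by auto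
  have z': "1 / sqrt 2 < z" using z EllU_inv_sqrt2 by (cases "z = 1 / sqrt 2") auto
  then have z': "1 / sqrt 2 < z" "z < 1" "0 < z" using z q1 inv_sqrt2(1) by linarith+
  have uni: "y = z" if "0 < y" "y < 1" "EllU y = 0" for y
    using EllU_strict_antimono[of y z] EllU_strict_antimono[of z y] that z' z by (cases y z rule: linorder_cases) auto
  have "qstar = z" unfolding qstar_def EllU_def[symmetric]
  proof (rule the_equality)
    show "0 < z \<and> z < 1 \<and> EllU z = 0" using z z' by simp
  qed (rule uni; simp)
  then show "1 / sqrt 2 < qstar" "qstar < 1" "EllU qstar = 0" using z z' by auto
  show "0 < q \<Longrightarrow> q < qstar \<Longrightarrow> EllU q > 0" using EllU_strict_antimono[of q z] z z' \<open>qstar = z\<close> by auto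
  show "qstar < q \<Longrightarrow> q < 1 \<Longrightarrow> EllU q < 0" using EllU_strict_antimono[of z q] z z' \<open>qstar = z\<close> by auto
qed

section \<open>Monotonicity of \<open>fcrit\<close> and \<open>gcrit\<close>, and the critical
  modulus\<close>

lemma fcrit_deriv:
  assumes "0 < q" "q < 1"
  shows "(fcrit has_real_derivative q * ((20 * q\<^sup>2 - 13) * EllK q - 20 * (2 * q\<^sup>2 - 1) * EllE q)) (at q)"
proof -
  define K E where "K = EllK q" and "E = EllE q"
  have m: "1 - q\<^sup>2 > 0" using assms by (simp add: abs_square_less_1)
  have dK: "(EllK has_real_derivative (E - (1 - q\<^sup>2) * K) / (q * (1 - q\<^sup>2))) (at q)"
    and dE: "(EllE has_real_derivative (E - K) / q) (at q)"
    unfolding K_def E_def using EllK_deriv EllE_deriv assms by auto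
  have d: "(fcrit has_real_derivative (16 * q^3 - 10 * q) * K + (4 * q^4 - 5 * q\<^sup>2 + 1) * ((E - (1 - q\<^sup>2) * K) / (q * (1 - q\<^sup>2)))
     + ((- 32 * q^3 + 16 * q) * E + (- 8 * q^4 + 8 * q\<^sup>2 - 1) * ((E - K) / q))) (at q)"
    unfolding fcrit_def[abs_def] K_def E_def
    by (rule derivative_eq_intros dK[unfolded K_def E_def] dE[unfolded K_def E_def] refl | simp add: mult.commute)+
  \<comment> \<open>The coefficient of K contains the factor 1 - q^2, which cancels the pole of the
    derivative of K.\<close>
  have e1: "(4 * q^4 - 5 * q\<^sup>2 + 1) * ((E - (1 - q\<^sup>2) * K) / (q * (1 - q\<^sup>2))) = (1 - 4 * q\<^sup>2) * (E - (1 - q\<^sup>2) * K) / q"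
  proof -
    have "4 * q^4 - 5 * q\<^sup>2 + 1 = (1 - 4 * q\<^sup>2) * (1 - q\<^sup>2)" by (simp add: algebra_simps power2_eq_square power4_eq_xxxx)
    then show ?thesis using m by simp
  qed
  have e2: "(16 * q^3 - 10 * q) * K + (1 - 4 * q\<^sup>2) * (E - (1 - q\<^sup>2) * K) / q
     + ((- 32 * q^3 + 16 * q) * E + (- 8 * q^4 + 8 * q\<^sup>2 - 1) * ((E - K) / q)) = q * ((20 * q\<^sup>2 - 13) * K - 20 * (2 * q\<^sup>2 - 1) * E)"
    using assms by (simp add: field_simps power2_eq_square power3_eq_cube power4_eq_xxxx)
  show ?thesis using d unfolding e1 e2 unfolding K_def E_def .
qed

text \<open>This is the origin of \<open>fcrit\<close>: up to a positive factor,
  \<open>gcrit\<close> has derivative \<open>EllU q * fcrit q\<close>. Since \<open>EllU\<close> is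
  positive left of \<open>qstar\<close>, the sign of \<open>fcrit\<close> decides there whether
  \<open>gcrit\<close> increases.\<close>

lemma gcrit_deriv:
  assumes "0 < q" "q < 1"
  shows "(gcrit has_real_derivative 16 * EllU q * fcrit q / (q * (1 - q\<^sup>2))) (at q)"
proof -
  define K E V where "K = EllK q" and "E = EllE q" and "V = ((1 - 2 * q\<^sup>2) * E - (1 - q\<^sup>2) * K) / (q * (1 - q\<^sup>2))"
  have m: "1 - q\<^sup>2 > 0" using assms by (simp add: abs_square_less_1)
  have g: "gcrit = (\<lambda>q. 8 * (EllU q)\<^sup>2 * (2 * q\<^sup>2 - 1))" by (simp add: gcrit_def EllU_def fun_eq_iff)
  have dU: "(EllU has_real_derivative V) (at q)"
    using EllU_deriv[OF assms] unfolding V_def K_def E_def .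
  have "(gcrit has_real_derivative 16 * EllU q * (V * (2 * q\<^sup>2 - 1) + 2 * q * EllU q)) (at q)"
    unfolding g by (auto intro!: derivative_eq_intros dU simp: algebra_simps power2_eq_square)
  moreover have "V * (2 * q\<^sup>2 - 1) + 2 * q * EllU q = fcrit q / (q * (1 - q\<^sup>2))"
  proof -
    have "V * (2 * q\<^sup>2 - 1) + 2 * q * EllU q = (((1 - 2 * q\<^sup>2) * E - (1 - q\<^sup>2) * K) * (2 * q\<^sup>2 - 1) + 2 * q * EllU q * (q * (1 - q\<^sup>2))) / (q * (1 - q\<^sup>2))"
      unfolding V_def using m assms by (simp add: add_divide_distrib)
    also have "((1 - 2 * q\<^sup>2) * E - (1 - q\<^sup>2) * K) * (2 * q\<^sup>2 - 1) + 2 * q * EllU q * (q * (1 - q\<^sup>2)) = fcrit q"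
      unfolding EllU_def fcrit_def K_def[symmetric] E_def[symmetric]
      by (simp add: algebra_simps power2_eq_square power4_eq_xxxx)
    finally show ?thesis .
  qed
  ultimately show ?thesis by simp
qed

lemma sq_ge_half: assumes "1 / sqrt 2 \<le> q" shows "q > 0" "1/2 \<le> q\<^sup>2"
proof -
  show "q > 0" using assms inv_sqrt2(1) by linarith
  show "1/2 \<le> q\<^sup>2" using power_mono[OF assms, of 2] inv_sqrt2 by auto
qed

lemma sq_gt_half: assumes "1 / sqrt 2 < q" shows "1/2 < q\<^sup>2"
  using power_strict_mono[OF assms, of 2] inv_sqrt2 by auto

text \<open>Left of \<open>qstar\<close> one has K < 2 E. If the coefficient 20 q^2 - 13 of K is
  nonnegative, replacing K by 2 E leaves -6 E; otherwise both terms of the derivative are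
  negative.\<close>

lemma fcrit_strict_antimono:
  assumes "1 / sqrt 2 \<le> a" "a < b" "b \<le> qstar" shows "fcrit b < fcrit a"
proof (rule DERIV_neg_imp_decreasing_open[OF assms(2)])
  fix q assume q: "a < q" "q < b"
  have q': "0 < q" "q < 1" "1/2 < q\<^sup>2" "q < qstar" using q assms qstar sq_ge_half[of q] sq_gt_half[of q] by auto
  have K: "EllK q < 2 * EllE q" "EllK q > 0" "EllE q > 0"
    using EllU_pos[of q] q' EllK_pos[of q] EllE_pos[of q] by (auto simp: EllU_def)
  have "(20 * q\<^sup>2 - 13) * EllK q - 20 * (2 * q\<^sup>2 - 1) * EllE q < 0"
  proof (cases "20 * q\<^sup>2 - 13 \<ge> 0")
    case True
    have "(20 * q\<^sup>2 - 13) * EllK q \<le> (20 * q\<^sup>2 - 13) * (2 * EllE q)" using K True by (intro mult_left_mono) auto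
    then show ?thesis using K by (simp add: algebra_simps)
  next
    case False
    have "(20 * q\<^sup>2 - 13) * EllK q < 0" using K False by (simp add: mult_neg_pos)
    moreover have "0 < (2 * q\<^sup>2 - 1) * EllE q" using K q' by simp
    ultimately show ?thesis by linarith
  qed
  then show "\<exists>y. (fcrit has_real_derivative y) (at q) \<and> y < 0"
    using fcrit_deriv[of q] q' by (intro exI[of _ "q * ((20 * q\<^sup>2 - 13) * EllK q - 20 * (2 * q\<^sup>2 - 1) * EllE q)"]) (auto simp: mult_pos_neg)
next
  show "continuous_on {a..b} fcrit"
    using assms qstar sq_ge_half
    by (intro DERIV_continuous_on[where D="\<lambda>q. q * ((20 * q\<^sup>2 - 13) * EllK q - 20 * (2 * q\<^sup>2 - 1) * EllE q)"]
      has_field_derivative_at_within[OF fcrit_deriv]) fastforce+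
qed

text \<open>From \<open>qstar\<close> on, 2 E is at most K. The coefficient of K is negative, so
  replacing K by 2 E gives the upper bound (1 - 2 q^2) E, which is negative.\<close>

lemma fcrit_neg: assumes "qstar \<le> q" "q < 1" shows "fcrit q < 0"
proof -
  have q: "0 < q" "1/2 < q\<^sup>2" using assms qstar sq_ge_half[of q] sq_gt_half[of q] by auto
  have m: "1 - q\<^sup>2 > 0" using assms q by (simp add: abs_square_less_1)
  have K: "2 * EllE q \<le> EllK q" "EllE q > 0"
    using EllU_neg[of q] qstar assms EllE_pos[of q] q by (cases "q = qstar"; auto simp: EllU_def)+
  have "(4 * q^4 - 5 * q\<^sup>2 + 1) = (1 - q\<^sup>2) * (1 - 4 * q\<^sup>2)" by (simp add: algebra_simps power2_eq_square power4_eq_xxxx)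
  also have "\<dots> < 0" using m q by (simp add: mult_pos_neg)
  finally have "(4 * q^4 - 5 * q\<^sup>2 + 1) * EllK q \<le> (4 * q^4 - 5 * q\<^sup>2 + 1) * (2 * EllE q)" using K by (intro mult_left_mono_neg) auto
  then have "fcrit q \<le> (1 - 2 * q\<^sup>2) * EllE q" unfolding fcrit_def by (simp add: algebra_simps)
  also have "\<dots> < 0" using q K by (simp add: mult_neg_pos)
  finally show ?thesis .
qed

lemma fcrit_inv_sqrt2: "fcrit (1 / sqrt 2) > 0"
proof -
  have p4: "(1 / sqrt 2) ^ 4 = (1/4 :: real)" using inv_sqrt2(3) power_mult[of "1 / sqrt 2 :: real" 2 2] by (simp add: power2_eq_square)
  have "fcrit (1 / sqrt 2) = EllU (1 / sqrt 2) / 2" unfolding fcrit_def EllU_def inv_sqrt2(3) p4 by simp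
  then show ?thesis using EllU_inv_sqrt2 by simp
qed

lemma qhat: "1 / sqrt 2 < qhat" "qhat < qstar" "fcrit qhat = 0"
proof -
  have c: "continuous_on {1 / sqrt 2..qstar} fcrit"
    using qstar sq_ge_half
    by (intro DERIV_continuous_on[where D="\<lambda>q. q * ((20 * q\<^sup>2 - 13) * EllK q - 20 * (2 * q\<^sup>2 - 1) * EllE q)"]
      has_field_derivative_at_within[OF fcrit_deriv]) fastforce+
  obtain z where z: "1 / sqrt 2 \<le> z" "z \<le> qstar" "fcrit z = 0"
    using IVT2'[of fcrit qstar 0 "1 / sqrt 2"] fcrit_neg[of qstar] fcrit_inv_sqrt2 c qstar by auto
  have z': "1 / sqrt 2 < z" "z < qstar"
    using z fcrit_inv_sqrt2 fcrit_neg[of qstar] qstar by (auto simp: less_le)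
  have uni: "y = z" if y: "1 / sqrt 2 \<le> y" "y < 1" "fcrit y = 0" for y
  proof -
    have "y < qstar" using fcrit_neg[of y] y by force
    then show ?thesis using fcrit_strict_antimono[of y z] fcrit_strict_antimono[of z y] y z z'
      by (cases y z rule: linorder_cases) auto
  qed
  have "qhat = z" unfolding qhat_def
  proof (rule the_equality)
    show "1 / sqrt 2 \<le> z \<and> z < 1 \<and> fcrit z = 0" using z z' qstar by simp
  qed (rule uni; simp)
  then show "1 / sqrt 2 < qhat" "qhat < qstar" "fcrit qhat = 0" using z z' by auto
qed

lemma gcrit_continuous: "0 < a \<Longrightarrow> b < 1 \<Longrightarrow> continuous_on {a..b} gcrit"
  by (intro DERIV_continuous_on[where D="\<lambda>q. 16 * EllU q * fcrit q / (q * (1 - q\<^sup>2))"]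
      has_field_derivative_at_within[OF gcrit_deriv]) auto

lemma gcrit_strict_mono:
  assumes "1 / sqrt 2 \<le> a" "a < b" "b \<le> qhat" shows "gcrit a < gcrit b"
proof (rule DERIV_pos_imp_increasing_open[OF assms(2)])
  fix q assume q: "a < q" "q < b"
  have q': "0 < q" "q < 1" "q < qhat" "q < qstar" using q assms qhat qstar sq_ge_half[of q] by auto
  have "fcrit q > 0" using fcrit_strict_antimono[of q qhat] q assms qhat by auto
  moreover have "EllU q > 0" using EllU_pos q' by auto
  moreover have "1 - q\<^sup>2 > 0" using q' by (simp add: abs_square_less_1)
  ultimately show "\<exists>y. (gcrit has_real_derivative y) (at q) \<and> 0 < y"
    using gcrit_deriv[of q] q' by (intro exI[of _ "16 * EllU q * fcrit q / (q * (1 - q\<^sup>2))"] conjI) auto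
next
  show "continuous_on {a..b} gcrit" using assms qhat qstar sq_ge_half by (intro gcrit_continuous) auto
qed

lemma gcrit_strict_antimono:
  assumes "qhat \<le> a" "a < b" "b \<le> qstar" shows "gcrit b < gcrit a"
proof (rule DERIV_neg_imp_decreasing_open[OF assms(2)])
  fix q assume q: "a < q" "q < b"
  have q': "0 < q" "q < 1" "qhat < q" "q < qstar" using q assms qhat qstar sq_ge_half[of q] by auto
  have "fcrit q < 0" using fcrit_strict_antimono[of qhat q] q assms qhat by auto
  moreover have "EllU q > 0" using EllU_pos q' by auto
  moreover have "1 - q\<^sup>2 > 0" using q' by (simp add: abs_square_less_1)
  ultimately show "\<exists>y. (gcrit has_real_derivative y) (at q) \<and> y < 0"
    using gcrit_deriv[of q] q' by (intro exI[of _ "16 * EllU q * fcrit q / (q * (1 - q\<^sup>2))"] conjI) (auto simp: divide_neg_pos mult_pos_neg)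
next
  show "continuous_on {a..b} gcrit" using assms qhat qstar sq_ge_half[of a] by (intro gcrit_continuous) auto
qed

lemma gcrit_qstar: "gcrit qstar = 0"
  using qstar(3) by (simp add: gcrit_def EllU_def)

lemma q2_eq:
  assumes "qhat \<le> q" "q < qstar" shows "q2 (gcrit q) = q"
  unfolding q2_def
proof (rule the_equality)
  fix y assume "qhat \<le> y \<and> y < qstar \<and> gcrit y = gcrit q"
  then show "y = q" using gcrit_strict_antimono[of y q] gcrit_strict_antimono[of q y] assms
    by (cases y q rule: linorder_cases) auto
qed (use assms in auto)

lemma q2_exists:
  assumes "0 < c" "c \<le> lamhat" obtains q where "qhat \<le> q" "q < qstar" "gcrit q = c"
proof -
  obtain q where q: "qhat \<le> q" "q \<le> qstar" "gcrit q = c"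
    using IVT2'[of gcrit qstar c qhat] assms gcrit_qstar qhat qstar sq_ge_half[of qhat] gcrit_continuous[of qhat qstar]
    unfolding lamhat_def by auto
  moreover have "q \<noteq> qstar" using q gcrit_qstar assms by auto
  ultimately show ?thesis using that by auto
qed

section \<open>Tangent angles and critical curves\<close>

text \<open>Here \<open>v\<close> is the speed and \<open>\<psi>\<close> a continuous lift of the
  tangent angle. \<open>\<kappa>\<close> is the derivative of the angle in the parameter, so the
  curvature is \<open>\<kappa>\<close> / \<open>v\<close> and the bending energy the integral of
  \<open>\<kappa>\<close>^2 / \<open>v\<close>. In these coordinates a curve can be prescribed
  freely, the end point condition being two integral conditions.\<close>

definition polar :: "curve \<Rightarrow> (real \<Rightarrow> real) \<Rightarrow> (real \<Rightarrow> real) \<Rightarrow> (real \<Rightarrow> real) \<Rightarrow> (real \<Rightarrow> real) \<Rightarrow> bool" where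
  "polar g v v' \<psi> \<kappa> \<longleftrightarrow> H1 v v' \<and> (\<forall>t\<in>{0..1}. v t > 0) \<and> H1 \<psi> \<kappa> \<and>
     (\<forall>t\<in>{0..1}. (g has_vector_derivative (v t * cos (\<psi> t), v t * sin (\<psi> t))) (at t within {0..1}))"

lemma polarD:
  assumes "polar g v v' \<psi> \<kappa>"
  shows "H1 v v'" "\<And>t. t \<in> {0..1} \<Longrightarrow> v t > 0" "H1 \<psi> \<kappa>"
    "\<And>t. t \<in> {0..1} \<Longrightarrow> (g has_vector_derivative (v t * cos (\<psi> t), v t * sin (\<psi> t))) (at t within {0..1})"
  using assms unfolding polar_def by blast+

lemma norm_polar: "norm (r * cos a, r * sin a) = \<bar>r\<bar>" for r a :: real
proof -
  have "(r * cos a)\<^sup>2 + (r * sin a)\<^sup>2 = r\<^sup>2 * ((sin a)\<^sup>2 + (cos a)\<^sup>2)" by (simp only: power_mult_distrib algebra_simps)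
  then show ?thesis by (simp add: norm_Pair)
qed

lemma polar_W22:
  assumes "polar g v v' \<psi> \<kappa>"
  shows "W22 g (\<lambda>t. (v t * cos (\<psi> t), v t * sin (\<psi> t)))
    (\<lambda>t. (v' t * cos (\<psi> t) + v t * (- sin (\<psi> t) * \<kappa> t), v' t * sin (\<psi> t) + v t * (cos (\<psi> t) * \<kappa> t)))"
  by (intro W22_I H1_mult H1_sin H1_cos polarD[OF assms])

lemma polar_energy:
  assumes "polar g v v' \<psi> \<kappa>"
  shows "energy lam g = integral {0..1} (\<lambda>t. (\<kappa> t)\<^sup>2 / v t) + lam * integral {0..1} v"
proof -
  have "energy lam g = integral {0..1} (\<lambda>t. ((v t)\<^sup>2 * \<kappa> t)\<^sup>2 / \<bar>v t\<bar> ^ 5) + lam * integral {0..1} (\<lambda>t. \<bar>v t\<bar>)"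
  proof -
    have "cross (r * cos a, r * sin a) (r' * cos a + r * (- sin a * k), r' * sin a + r * (cos a * k)) = r\<^sup>2 * k * ((sin a)\<^sup>2 + (cos a)\<^sup>2)" for r r' a k
      unfolding cross_def
      by (simp add: algebra_simps power2_eq_square del: sin_cos_squared_add sin_cos_squared_add2 sin_cos_squared_add3)
    then show ?thesis unfolding energy_W22[OF polar_W22[OF assms]] norm_polar by simp
  qed
  also have "integral {0..1} (\<lambda>t. \<bar>v t\<bar>) = integral {0..1} v"
    by (rule integral_cong) (use polarD(2)[OF assms] in \<open>auto simp: less_imp_le\<close>)
  also have "integral {0..1} (\<lambda>t. ((v t)\<^sup>2 * \<kappa> t)\<^sup>2 / \<bar>v t\<bar> ^ 5) = integral {0..1} (\<lambda>t. (\<kappa> t)\<^sup>2 / v t)"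
  proof (rule integral_cong)
    fix t :: real assume "t \<in> {0..1}"
    then have "v t > 0" by (rule polarD(2)[OF assms])
    then show "((v t)\<^sup>2 * \<kappa> t)\<^sup>2 / \<bar>v t\<bar> ^ 5 = (\<kappa> t)\<^sup>2 / v t"
      by (simp add: power_mult_distrib field_simps flip: power_add power_Suc power_mult)
  qed
  finally show ?thesis .
qed

lemma polar_Aset:
  assumes "polar g v v' \<psi> \<kappa>" "g 0 = (0, 0)" "g 1 = (l, 0)"
  shows "g \<in> Aset l"
proof -
  have "(v t * cos (\<psi> t), v t * sin (\<psi> t)) \<noteq> 0" if "t \<in> {0..1}" for t
    using norm_polar[of "v t" "\<psi> t"] polarD(2)[OF assms(1) that] by auto
  then show ?thesis unfolding Aset_def using polar_W22[OF assms(1)] assms(2,3) by blast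
qed

text \<open>The lift is obtained by integrating the angular velocity, the cross product of first and
  second derivative over the squared speed. That it is the tangent angle follows because the
  components of the unit tangent in the frame turning with \<open>\<psi>\<close> have derivative
  zero. The start angle \<open>a\<close> can be prescribed, which lets nearby curves be lifted on
  the same branch.\<close>

lemma polar_exists:
  assumes W: "W22 g g1 g2" and nz: "\<And>t. t \<in> {0..1} \<Longrightarrow> g1 t \<noteq> 0"
    and a: "g1 0 = (norm (g1 0) * cos a, norm (g1 0) * sin a)"
  shows "\<exists>v' \<psi> \<kappa>. polar g (\<lambda>t. norm (g1 t)) v' \<psi> \<kappa> \<and> \<psi> 0 = a \<and>
    (\<forall>t\<in>{0..1}. g1 t = (norm (g1 t) * cos (\<psi> t), norm (g1 t) * sin (\<psi> t)))"
proof -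
  define x1 y1 x2 y2 where "x1 = (\<lambda>t. fst (g1 t))" and "y1 = (\<lambda>t. snd (g1 t))"
    and "x2 = (\<lambda>t. fst (g2 t))" and "y2 = (\<lambda>t. snd (g2 t))"
  define v where "v = (\<lambda>t. norm (g1 t))"
  have x: "H1 x1 x2" and y: "H1 y1 y2" using W22_H1[OF W] by (auto simp: x1_def x2_def y1_def y2_def)
  have v2: "v t = sqrt (x1 t * x1 t + y1 t * y1 t)" for t
    by (simp add: v_def x1_def y1_def norm_prod_def power2_eq_square)
  have vp: "v t > 0" if "t \<in> {0..1}" for t using nz[OF that] by (simp add: v_def)
  have vsq: "v t * v t = x1 t * x1 t + y1 t * y1 t" for t by (simp add: v2)
  have pos: "x1 t * x1 t + y1 t * y1 t > 0" if "t \<in> {0..1}" for t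
    using vp[OF that] vsq[of t] by (metis mult_pos_pos)
  define v' where "v' = (\<lambda>t. (x2 t * x1 t + x1 t * x2 t + (y2 t * y1 t + y1 t * y2 t)) / (2 * sqrt (x1 t * x1 t + y1 t * y1 t)))"
  have Hv: "H1 v v'"
    unfolding v2 v'_def by (intro H1_sqrt H1_add H1_mult x y pos)
  have v': "v t * v' t = x1 t * x2 t + y1 t * y2 t" if "t \<in> {0..1}" for t
    using vp[OF that] unfolding v'_def v2[symmetric] by (simp add: field_simps)
  define w where "w = (\<lambda>t. 1 / v t)"
  define w' where "w' = (\<lambda>t. - v' t / (v t)\<^sup>2)"
  have Hw: "H1 w w'" unfolding w_def w'_def using vp by (intro H1_inverse Hv) (auto simp: less_le)
  define \<kappa> where "\<kappa> = (\<lambda>t. x1 t * w t * w t * y2 t - y1 t * w t * w t * x2 t)"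
  have c: "continuous_on {0..1} x1" "continuous_on {0..1} y1" "continuous_on {0..1} w"
    using H1_continuous x y Hw by auto
  have L\<kappa>: "L2 \<kappa>" unfolding \<kappa>_def
    by (intro L2_diff L2_cont_mult continuous_intros c H1_L2[OF x] H1_L2[OF y])
  define \<psi> where "\<psi> = (\<lambda>t. a + integral {0..t} \<kappa>)"
  have H\<psi>: "H1 \<psi> \<kappa>" unfolding \<psi>_def by (rule H1_integral[OF L\<kappa>])
  have \<psi>0: "\<psi> 0 = a" by (simp add: \<psi>_def)
  have key: "x2 t = w t * v' t * x1 t - \<kappa> t * y1 t" "y2 t = w t * v' t * y1 t + \<kappa> t * x1 t" if t: "t \<in> {0..1}" for t
  proof -
    have vt: "v t > 0" by (rule vp[OF t])
    have "v t * v t * (w t * v' t) = v t * v' t" "v t * v t * (w t * w t) = 1" using vt by (simp_all add: w_def)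
    then have 1: "v t * v t * (w t * v' t) = x1 t * x2 t + y1 t * y2 t" "v t * v t * (w t * w t) = 1" using v'[OF t] by auto
    have 2: "v t * v t * \<kappa> t = x1 t * y2 t - y1 t * x2 t"
    proof -
      have "v t * v t * \<kappa> t = v t * v t * (w t * w t) * (x1 t * y2 t - y1 t * x2 t)" by (simp add: \<kappa>_def algebra_simps)
      then show ?thesis using 1(2) by simp
    qed
    have "v t * v t * (w t * v' t * x1 t - \<kappa> t * y1 t) = (v t * v t * (w t * v' t)) * x1 t - (v t * v t * \<kappa> t) * y1 t"
      by (simp add: algebra_simps)
    also have "\<dots> = v t * v t * x2 t" unfolding 1 2 by (simp add: vsq algebra_simps)
    finally show "x2 t = w t * v' t * x1 t - \<kappa> t * y1 t" using vt by simp
    have "v t * v t * (w t * v' t * y1 t + \<kappa> t * x1 t) = (v t * v t * (w t * v' t)) * y1 t + (v t * v t * \<kappa> t) * x1 t"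
      by (simp add: algebra_simps)
    also have "\<dots> = v t * v t * y2 t" unfolding 1 2 by (simp add: vsq algebra_simps)
    finally show "y2 t = w t * v' t * y1 t + \<kappa> t * x1 t" using vt by simp
  qed
  have w'v: "w' t = - w t * w t * v' t" for t by (simp add: w'_def w_def power2_eq_square)
  \<comment> \<open>The component of the unit tangent along the direction of angle
    \<open>\<psi>\<close>; it is constant and equals 1 at the start. The normal component, treated
    next, is constant and equals 0.\<close>
  have "H1 (\<lambda>t. w t * (x1 t * cos (\<psi> t) + y1 t * sin (\<psi> t)))
     (\<lambda>t. w' t * (x1 t * cos (\<psi> t) + y1 t * sin (\<psi> t)) + w t * (x2 t * cos (\<psi> t) + x1 t * (- sin (\<psi> t) * \<kappa> t) + (y2 t * sin (\<psi> t) + y1 t * (cos (\<psi> t) * \<kappa> t))))"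
    by (intro H1_mult H1_add H1_sin H1_cos Hw x y H\<psi>)
  then have A: "H1 (\<lambda>t. w t * (x1 t * cos (\<psi> t) + y1 t * sin (\<psi> t))) (\<lambda>_. 0)"
    by (rule H1_cong) (auto simp: w'v key algebra_simps)
  have "H1 (\<lambda>t. w t * (y1 t * cos (\<psi> t) - x1 t * sin (\<psi> t)))
     (\<lambda>t. w' t * (y1 t * cos (\<psi> t) - x1 t * sin (\<psi> t)) + w t * (y2 t * cos (\<psi> t) + y1 t * (- sin (\<psi> t) * \<kappa> t) - (x2 t * sin (\<psi> t) + x1 t * (cos (\<psi> t) * \<kappa> t))))"
    by (intro H1_mult H1_add H1_diff H1_sin H1_cos Hw x y H\<psi>)
  then have B: "H1 (\<lambda>t. w t * (y1 t * cos (\<psi> t) - x1 t * sin (\<psi> t))) (\<lambda>_. 0)"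
    by (rule H1_cong) (auto simp: w'v key algebra_simps)
  have x0: "x1 0 = v 0 * cos a" "y1 0 = v 0 * sin a" using a by (metis fst_conv snd_conv v_def x1_def y1_def)+
  have g1: "g1 t = (v t * cos (\<psi> t), v t * sin (\<psi> t))" if t: "t \<in> {0..1}" for t
  proof -
    define c s where "c = cos (\<psi> t)" and "s = sin (\<psi> t)"
    have cs: "c * c + s * s = 1" unfolding c_def s_def by (metis sin_cos_squared_add2 add.commute power2_eq_square)
    have "w t * (x1 t * c + y1 t * s) = w 0 * (x1 0 * cos a + y1 0 * sin a)"
      using H1_eq[OF A t] by (simp add: \<psi>0 c_def s_def)
    also have "\<dots> = w 0 * v 0 * ((sin a)\<^sup>2 + (cos a)\<^sup>2)" unfolding x0 by (simp only: power2_eq_square algebra_simps)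
    also have "\<dots> = 1" using vp[of 0] by (simp add: w_def)
    finally have 1: "x1 t * c + y1 t * s = v t" using vp[OF t] by (simp add: w_def field_simps)
    have "w t * (y1 t * c - x1 t * s) = w 0 * (y1 0 * cos a - x1 0 * sin a)"
      using H1_eq[OF B t] by (simp add: \<psi>0 c_def s_def)
    also have "\<dots> = 0" unfolding x0 by simp
    finally have 2: "y1 t * c - x1 t * s = 0" using vp[OF t] by (simp add: w_def)
    have "x1 t * (c * c + s * s) = (x1 t * c + y1 t * s) * c - (y1 t * c - x1 t * s) * s" by (simp add: algebra_simps)
    moreover have "y1 t * (c * c + s * s) = (x1 t * c + y1 t * s) * s + (y1 t * c - x1 t * s) * c" by (simp add: algebra_simps)
    ultimately have "x1 t = v t * c" "y1 t = v t * s" unfolding 1 2 cs by auto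
    then show ?thesis by (simp add: x1_def y1_def c_def s_def prod_eq_iff)
  qed
  have "polar g v v' \<psi> \<kappa>" unfolding polar_def
    using Hv vp H\<psi> g1 W22_has_vector_derivative[OF W] by auto
  then show ?thesis using \<psi>0 g1 unfolding v_def by blast
qed

section \<open>First variation and the Euler-Lagrange equations\<close>

lemma derivative_under_integral:
  fixes f f' :: "real \<Rightarrow> real \<Rightarrow> real"
  assumes e0: "e0 > 0"
    and d: "\<And>e t. \<bar>e\<bar> < e0 \<Longrightarrow> t \<in> {0..1} \<Longrightarrow> ((\<lambda>e. f e t) has_real_derivative f' e t) (at e)"
    and i: "\<And>e. \<bar>e\<bar> < e0 \<Longrightarrow> f e integrable_on {0..1}"
    and h: "h integrable_on {0..1}" "\<And>e t. \<bar>e\<bar> < e0 \<Longrightarrow> t \<in> {0..1} \<Longrightarrow> \<bar>f' e t\<bar> \<le> h t"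
  shows "f' 0 integrable_on {0..1}"
    and "((\<lambda>e. integral {0..1} (f e)) has_real_derivative integral {0..1} (f' 0)) (at 0)"
proof -
  have seq: "f' 0 integrable_on {0..1} \<and>
     (\<lambda>n. (integral {0..1} (f (X n)) - integral {0..1} (f 0)) / X n) \<longlonglongrightarrow> integral {0..1} (f' 0)"
    if X: "X \<longlonglongrightarrow> 0" "\<And>n. X n \<noteq> 0" "\<And>n. \<bar>X n\<bar> < e0" for X
  proof -
    let ?q = "\<lambda>n t. (f (X n) t - f 0 t) / X n"
    have int: "?q n integrable_on {0..1}" for n
      using Henstock_Kurzweil_Integration.integrable_diff[OF i[OF X(3)[of n]] i[of 0]] e0
      by (simp add: integrable_on_divide)
    \<comment> \<open>The mean value bound makes \<open>h\<close> a dominating function for all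
      difference quotients, so dominated convergence applies along every sequence.\<close>
    have bd: "norm (?q n t) \<le> h t" if t: "t \<in> {0..1}" for n t
    proof -
      have "norm (f (X n) t - f 0 t) \<le> h t * norm (X n - 0)"
      proof (rule field_differentiable_bound[where S="{-e0<..<e0}" and f'="\<lambda>e. f' e t"])
        fix e assume "e \<in> {-e0<..<e0}"
        then show "((\<lambda>e. f e t) has_field_derivative f' e t) (at e within {-e0<..<e0})" "norm (f' e t) \<le> h t"
          using d[of e t] h(2)[of e t] t by (auto intro: has_field_derivative_at_within)
      qed (use X(3)[of n] e0 in auto)
      then show ?thesis using X(2)[of n] by (simp add: field_simps)
    qed
    have lim: "(\<lambda>n. ?q n t) \<longlonglongrightarrow> f' 0 t" if t: "t \<in> {0..1}" for t
    proof -
      have "((\<lambda>y. (f y t - f 0 t) / (y - 0)) \<longlongrightarrow> f' 0 t) (at 0)"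
        using d[of 0 t] e0 t by (simp add: has_field_derivative_iff)
      then show ?thesis using X(1,2) by (auto simp: tendsto_at_iff_sequentially o_def)
    qed
    have "(\<lambda>n. integral {0..1} (?q n)) \<longlonglongrightarrow> integral {0..1} (f' 0)" "f' 0 integrable_on {0..1}"
      using dominated_convergence[OF int h(1) bd lim] by auto
    moreover have "integral {0..1} (?q n) = (integral {0..1} (f (X n)) - integral {0..1} (f 0)) / X n" for n
      using Henstock_Kurzweil_Integration.integral_diff[OF i[OF X(3)[of n]] i[of 0]] e0
      by (simp only: integral_divide abs_zero)
    ultimately show ?thesis by (simp only:)
  qed
  \<comment> \<open>A concrete null sequence of admissible nonzero parameters, needed to extract
    integrability of \<open>f' 0\<close>.\<close>
  have "(\<lambda>n. e0 / 2 * (1 / real (Suc n))) \<longlonglongrightarrow> e0 / 2 * 0"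
    by (intro tendsto_intros LIMSEQ_Suc[OF lim_1_over_n])
  then have "(\<lambda>n. e0 / 2 * (1 / real (Suc n))) \<longlonglongrightarrow> 0" by simp
  moreover have "e0 / 2 * (1 / real (Suc n)) \<noteq> 0" "\<bar>e0 / 2 * (1 / real (Suc n))\<bar> < e0" for n
  proof -
    have "1 / real (Suc n) \<le> 1" by simp
    then have "e0 / 2 * (1 / real (Suc n)) \<le> e0 / 2 * 1" using e0 by (intro mult_left_mono) auto
    moreover have "0 \<le> e0 / 2 * (1 / real (Suc n))" using e0 by simp
    ultimately show "\<bar>e0 / 2 * (1 / real (Suc n))\<bar> < e0" using e0 by linarith
  qed (use e0 in auto)
  ultimately show "f' 0 integrable_on {0..1}" using seq by blast
  show "((\<lambda>e. integral {0..1} (f e)) has_real_derivative integral {0..1} (f' 0)) (at 0)"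
    unfolding has_field_derivative_iff tendsto_at_iff_sequentially
  proof (intro allI impI)
    fix X :: "nat \<Rightarrow> real" assume X: "\<forall>i. X i \<in> UNIV - {0}" "X \<longlonglongrightarrow> 0"
    have "eventually (\<lambda>n. dist (X n) 0 < e0) sequentially" using X(2) e0 by (rule tendstoD)
    then obtain M where M: "\<And>n. n \<ge> M \<Longrightarrow> \<bar>X n\<bar> < e0" by (auto simp: eventually_sequentially)
    have "(\<lambda>n. (integral {0..1} (f (X (n + M))) - integral {0..1} (f 0)) / X (n + M)) \<longlonglongrightarrow> integral {0..1} (f' 0)"
      using seq[of "\<lambda>n. X (n + M)"] X M LIMSEQ_ignore_initial_segment[OF X(2), of M] by auto
    then show "((\<lambda>y. (integral {0..1} (f y) - integral {0..1} (f 0)) / (y - 0)) \<circ> X) \<longlonglongrightarrow> integral {0..1} (f' 0)"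
      unfolding o_def by (simp add: LIMSEQ_offset)
  qed
qed

lemma continuous_Icc_bound:
  fixes f :: "real \<Rightarrow> real"
  assumes "continuous_on {0..1} f" obtains M where "M > 0" "\<And>t. t \<in> {0..1} \<Longrightarrow> \<bar>f t\<bar> \<le> M"
proof -
  have "bounded (f ` {0..1})" using assms by (intro compact_imp_bounded compact_continuous_image) auto
  then obtain M where "M > 0" "\<forall>x\<in>f ` {0..1}. norm x \<le> M" unfolding bounded_pos by blast
  then show ?thesis using that by auto
qed

text \<open>The integrand is quadratic in the second derivatives and divided by powers of the speed.
  For small parameters the speed stays away from zero, so its derivative is dominated by a multiple
  of the square of an L2 function plus a constant.\<close>

lemma first_variation:
  assumes W: "W22 g g1 g2" and nz: "\<And>t. t \<in> {0..1} \<Longrightarrow> g1 t \<noteq> 0" and V: "W22 \<eta> \<eta>1 \<eta>2"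
  shows "((\<lambda>e. energy lam (\<lambda>t. g t + e *\<^sub>R \<eta> t)) has_real_derivative
    integral {0..1} (\<lambda>t. 2 * cross (g1 t) (g2 t) * (cross (\<eta>1 t) (g2 t) + cross (g1 t) (\<eta>2 t)) / norm (g1 t) ^ 5
      - 5 * (cross (g1 t) (g2 t))\<^sup>2 * (g1 t \<bullet> \<eta>1 t) / norm (g1 t) ^ 7 + lam * ((g1 t \<bullet> \<eta>1 t) / norm (g1 t)))) (at 0)"
proof -
  define x1 y1 x2 y2 where "x1 = (\<lambda>t. fst (g1 t))" and "y1 = (\<lambda>t. snd (g1 t))"
    and "x2 = (\<lambda>t. fst (g2 t))" and "y2 = (\<lambda>t. snd (g2 t))"
  define a1 b1 a2 b2 where "a1 = (\<lambda>t. fst (\<eta>1 t))" and "b1 = (\<lambda>t. snd (\<eta>1 t))"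
    and "a2 = (\<lambda>t. fst (\<eta>2 t))" and "b2 = (\<lambda>t. snd (\<eta>2 t))"
  note xy = x1_def y1_def x2_def y2_def a1_def b1_def a2_def b2_def
  have H: "H1 x1 x2" "H1 y1 y2" "H1 a1 a2" "H1 b1 b2" using W22_H1[OF W] W22_H1[OF V] by (auto simp: xy)
  have C: "continuous_on {0..1} x1" "continuous_on {0..1} y1" "continuous_on {0..1} a1" "continuous_on {0..1} b1"
    using H1_continuous H by auto
  obtain M1 where M1: "M1 > 0" "\<And>t. t \<in> {0..1} \<Longrightarrow> \<bar>x1 t\<bar> \<le> M1" using continuous_Icc_bound[OF C(1)] by blast
  obtain M2 where M2: "M2 > 0" "\<And>t. t \<in> {0..1} \<Longrightarrow> \<bar>y1 t\<bar> \<le> M2" using continuous_Icc_bound[OF C(2)] by blast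
  obtain M3 where M3: "M3 > 0" "\<And>t. t \<in> {0..1} \<Longrightarrow> \<bar>a1 t\<bar> \<le> M3" using continuous_Icc_bound[OF C(3)] by blast
  obtain M4 where M4: "M4 > 0" "\<And>t. t \<in> {0..1} \<Longrightarrow> \<bar>b1 t\<bar> \<le> M4" using continuous_Icc_bound[OF C(4)] by blast
  define M where "M = M1 + M2 + M3 + M4"
  have M: "M > 0" "\<And>t. t \<in> {0..1} \<Longrightarrow> \<bar>x1 t\<bar> \<le> M \<and> \<bar>y1 t\<bar> \<le> M \<and> \<bar>a1 t\<bar> \<le> M \<and> \<bar>b1 t\<bar> \<le> M"
    using M1 M2 M3 M4 unfolding M_def by fastforce+
  define n where "n = (\<lambda>e t. sqrt ((x1 t + e * a1 t)\<^sup>2 + (y1 t + e * b1 t)\<^sup>2))"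
  have n_norm: "norm (g1 t + e *\<^sub>R \<eta>1 t) = n e t" for e t
    by (simp add: n_def norm_prod_def xy)
  obtain m where m: "m > 0" "\<And>t. t \<in> {0..1} \<Longrightarrow> m \<le> n 0 t"
  proof -
    have "continuous_on {0..1} (n 0)" unfolding n_def by (intro continuous_intros C)
    then obtain t0 where t0: "t0 \<in> {0..1}" "\<And>t. t \<in> {0..1} \<Longrightarrow> n 0 t0 \<le> n 0 t"
      using continuous_attains_inf[of "{0..1::real}" "n 0"] by auto
    moreover have "n 0 t0 > 0" using nz[OF t0(1)] n_norm[of t0 0] by (metis add.right_neutral scale_zero_left zero_less_norm_iff)
    ultimately show ?thesis using that by blast
  qed
  \<comment> \<open>Since the norm of \<open>\<eta>1\<close> is at most 2 \<open>M\<close>, the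
    perturbation changes the speed by at most \<open>m\<close> / 2, half of its minimum.\<close>
  define e0 where "e0 = min 1 (m / (4 * M))"
  have e0: "e0 > 0" "e0 \<le> 1" using m M by (auto simp: e0_def)
  have n_low: "m / 2 \<le> n e t" if e: "\<bar>e\<bar> < e0" and t: "t \<in> {0..1}" for e t
  proof -
    have "norm (g1 t) \<le> norm (g1 t + e *\<^sub>R \<eta>1 t) + norm (e *\<^sub>R \<eta>1 t)" by (metis add_diff_cancel_right' norm_triangle_ineq4)
    moreover have "norm (\<eta>1 t) \<le> 2 * M"
      using norm_Pair_le[of "a1 t" "b1 t"] M(2)[OF t] by (simp add: xy)
    then have "norm (e *\<^sub>R \<eta>1 t) \<le> e0 * (2 * M)" using e by (auto intro: mult_mono)
    moreover have "e0 * (2 * M) \<le> m / (4 * M) * (2 * M)" using M(1) unfolding e0_def by (intro mult_right_mono) auto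
    moreover have "m / (4 * M) * (2 * M) = m / 2" using M(1) by simp
    moreover have "m \<le> norm (g1 t)" using m(2)[OF t] n_norm[of t 0] by simp
    ultimately show ?thesis using n_norm[of t e] by linarith
  qed
  have npos: "n e t > 0" if e: "\<bar>e\<bar> < e0" and t: "t \<in> {0..1}" for e t using n_low[OF that] m(1) by linarith
  define N where "N = (\<lambda>e t. (x1 t + e * a1 t) * (y2 t + e * b2 t) - (y1 t + e * b1 t) * (x2 t + e * a2 t))"
  define N' where "N' = (\<lambda>e t. a1 t * (y2 t + e * b2 t) + (x1 t + e * a1 t) * b2 t - (b1 t * (x2 t + e * a2 t) + (y1 t + e * b1 t) * a2 t))"
  define s where "s = (\<lambda>e t. (x1 t + e * a1 t) * a1 t + (y1 t + e * b1 t) * b1 t)"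
  define f where "f = (\<lambda>e t. (N e t)\<^sup>2 / n e t ^ 5 + lam * n e t)"
  define f' where "f' = (\<lambda>e t. 2 * N e t * N' e t / n e t ^ 5 - 5 * (N e t)\<^sup>2 * s e t / n e t ^ 7 + lam * (s e t / n e t))"
  have dn: "((\<lambda>e. n e t) has_real_derivative s e t / n e t) (at e)" if e: "\<bar>e\<bar> < e0" and t: "t \<in> {0..1}" for e t
  proof -
    have "((x1 t + e * a1 t)\<^sup>2 + (y1 t + e * b1 t)\<^sup>2) > 0" using npos[OF that] unfolding n_def by simp
    then have "((\<lambda>e. n e t) has_real_derivative (2 * (x1 t + e * a1 t) * a1 t + 2 * (y1 t + e * b1 t) * b1 t) * (inverse (n e t) / 2)) (at e)"
      unfolding n_def by (auto intro!: derivative_eq_intros simp: algebra_simps)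
    moreover have "(2 * (x1 t + e * a1 t) * a1 t + 2 * (y1 t + e * b1 t) * b1 t) * (inverse (n e t) / 2) = s e t / n e t"
      using npos[OF that] by (simp add: s_def field_simps)
    ultimately show ?thesis by (simp only:)
  qed
  have d: "((\<lambda>e. f e t) has_real_derivative f' e t) (at e)" if e: "\<bar>e\<bar> < e0" and t: "t \<in> {0..1}" for e t
  proof -
    have np: "n e t > 0" by (rule npos[OF that])
    have dN: "((\<lambda>e. N e t) has_real_derivative N' e t) (at e)"
      unfolding N_def N'_def by (auto intro!: derivative_eq_intros simp: algebra_simps)
    have "((\<lambda>e. f e t) has_real_derivative
       ((2 * N e t * N' e t) * n e t ^ 5 - (N e t)\<^sup>2 * (5 * n e t ^ 4 * (s e t / n e t))) / (n e t ^ 5 * n e t ^ 5) + lam * (s e t / n e t)) (at e)"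
      unfolding f_def using np by (auto intro!: derivative_eq_intros dN dn[OF that] simp: power2_eq_square mult_ac)
    also have "((2 * N e t * N' e t) * n e t ^ 5 - (N e t)\<^sup>2 * (5 * n e t ^ 4 * (s e t / n e t))) / (n e t ^ 5 * n e t ^ 5)
       = 2 * N e t * N' e t / n e t ^ 5 - 5 * (N e t)\<^sup>2 * s e t / n e t ^ 7"
      using np by (simp add: field_simps eval_nat_numeral)
    finally show ?thesis unfolding f'_def .
  qed
  have L2N: "L2 (N e)" for e unfolding N_def
    by (intro L2_diff L2_cont_mult L2_add L2_cmult continuous_intros C H1_L2[OF H(1)] H1_L2[OF H(2)] H1_L2[OF H(3)] H1_L2[OF H(4)])
  have cn: "continuous_on {0..1} (n e)" for e unfolding n_def by (intro continuous_intros C)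
  have int: "(\<lambda>t. (N e t)\<^sup>2 / n e t ^ 5) integrable_on {0..1}" "n e integrable_on {0..1}" if e: "\<bar>e\<bar> < e0" for e
  proof -
    have "L2 (\<lambda>t. 1 / n e t ^ 5 * N e t)"
      using npos[OF e] by (intro L2_cont_mult L2N continuous_intros cn) (auto simp: less_le)
    from L2_mult_absolutely_integrable[OF this L2N[of e]]
    show "(\<lambda>t. (N e t)\<^sup>2 / n e t ^ 5) integrable_on {0..1}"
      by (simp add: absolutely_integrable_on_def power2_eq_square)
    show "n e integrable_on {0..1}" by (intro integrable_continuous_interval cn)
  qed
  define P where "P = (\<lambda>t. \<bar>x2 t\<bar> + \<bar>y2 t\<bar> + \<bar>a2 t\<bar> + \<bar>b2 t\<bar>)"
  have LP: "L2 P" unfolding P_def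
    by (intro L2_add L2_abs H1_L2[OF H(1)] H1_L2[OF H(2)] H1_L2[OF H(3)] H1_L2[OF H(4)])
  \<comment> \<open>Assembled from the bounds 2 \<open>M\<close> \<open>P\<close> for
    \<open>N\<close>, 5 \<open>M\<close> \<open>P\<close> for \<open>N'\<close>, 4
    \<open>M\<close>^2 for \<open>s\<close> and the lower bound \<open>m\<close> / 2 for the
    speed.\<close>
  define h where "h = (\<lambda>t. (2 * (2 * M) * (5 * M) / (m/2)^5 + 5 * (2 * M)\<^sup>2 * (4 * M * M) / (m/2)^7) * (P t)\<^sup>2 + \<bar>lam\<bar> * (4 * M * M / (m/2)))"
  have "h integrable_on {0..1}" unfolding h_def
    by (intro integrable_add integrable_on_mult_right L2_square_integrable[OF LP]) auto
  moreover have "\<bar>f' e t\<bar> \<le> h t" if e: "\<bar>e\<bar> < e0" and t: "t \<in> {0..1}" for e t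
  proof -
    have e1: "\<bar>e\<bar> \<le> 1" using e e0 by simp
    have P0: "P t \<ge> 0" by (simp add: P_def)
    have be: "\<bar>e * z\<bar> \<le> \<bar>z\<bar>" for z using e1 by (simp add: abs_mult mult_left_le_one_le)
    have B: "\<bar>x1 t + e * a1 t\<bar> \<le> 2 * M" "\<bar>y1 t + e * b1 t\<bar> \<le> 2 * M" "\<bar>a1 t\<bar> \<le> M" "\<bar>b1 t\<bar> \<le> M"
      using M(2)[OF t] be[of "a1 t"] be[of "b1 t"] by linarith+
    have Q: "\<bar>y2 t + e * b2 t\<bar> \<le> \<bar>y2 t\<bar> + \<bar>b2 t\<bar>" "\<bar>x2 t + e * a2 t\<bar> \<le> \<bar>x2 t\<bar> + \<bar>a2 t\<bar>"
      using be[of "a2 t"] be[of "b2 t"] by linarith+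
    have "\<bar>N e t\<bar> \<le> \<bar>x1 t + e * a1 t\<bar> * \<bar>y2 t + e * b2 t\<bar> + \<bar>y1 t + e * b1 t\<bar> * \<bar>x2 t + e * a2 t\<bar>"
      unfolding N_def by (metis abs_mult abs_triangle_ineq4)
    also have "\<dots> \<le> 2 * M * (\<bar>y2 t\<bar> + \<bar>b2 t\<bar>) + 2 * M * (\<bar>x2 t\<bar> + \<bar>a2 t\<bar>)"
      using B Q M(1) by (intro add_mono mult_mono) auto
    also have "\<dots> = 2 * M * P t" by (simp add: P_def algebra_simps)
    finally have bN: "\<bar>N e t\<bar> \<le> 2 * M * P t" .
    have "\<bar>N' e t\<bar> \<le> \<bar>a1 t\<bar> * \<bar>y2 t + e * b2 t\<bar> + \<bar>x1 t + e * a1 t\<bar> * \<bar>b2 t\<bar> + (\<bar>b1 t\<bar> * \<bar>x2 t + e * a2 t\<bar> + \<bar>y1 t + e * b1 t\<bar> * \<bar>a2 t\<bar>)"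
      unfolding N'_def by (simp only: abs_mult[symmetric])
    also have "\<dots> \<le> M * (\<bar>y2 t\<bar> + \<bar>b2 t\<bar>) + 2 * M * \<bar>b2 t\<bar> + (M * (\<bar>x2 t\<bar> + \<bar>a2 t\<bar>) + 2 * M * \<bar>a2 t\<bar>)"
      using B Q M(1) by (intro add_mono mult_mono) auto
    also have "\<dots> \<le> 5 * M * P t" using M(1) by (simp add: P_def algebra_simps)
    finally have bN': "\<bar>N' e t\<bar> \<le> 5 * M * P t" .
    have "\<bar>s e t\<bar> \<le> \<bar>x1 t + e * a1 t\<bar> * \<bar>a1 t\<bar> + \<bar>y1 t + e * b1 t\<bar> * \<bar>b1 t\<bar>"
      unfolding s_def by (metis abs_mult abs_triangle_ineq)
    also have "\<dots> \<le> 2 * M * M + 2 * M * M" using B M(1) by (intro add_mono mult_mono) auto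
    finally have bs: "\<bar>s e t\<bar> \<le> 4 * M * M" by simp
    note nl = n_low[OF that]
    have np: "n e t > 0" by (rule npos[OF that])
    have pw: "(m/2) ^ k \<le> n e t ^ k" for k using nl m(1) by (intro power_mono) auto
    have t1: "\<bar>2 * N e t * N' e t / n e t ^ 5\<bar> \<le> 2 * (2 * M * P t) * (5 * M * P t) / (m/2)^5"
      unfolding abs_divide abs_mult using bN bN' pw[of 5] m(1) np P0 M(1)
      by (intro frac_le mult_mono) (auto intro!: mult_nonneg_nonneg simp: power_abs)
    have "(N e t)\<^sup>2 \<le> (2 * M * P t)\<^sup>2" using bN by (metis abs_ge_zero power2_abs power_mono)
    then have t2: "\<bar>5 * (N e t)\<^sup>2 * s e t / n e t ^ 7\<bar> \<le> 5 * (2 * M * P t)\<^sup>2 * (4 * M * M) / (m/2)^7"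
      unfolding abs_divide abs_mult using bs pw[of 7] m(1) np P0 M(1)
      by (intro frac_le mult_mono) (auto intro!: mult_nonneg_nonneg simp: power_abs)
    have t3: "\<bar>lam * (s e t / n e t)\<bar> \<le> \<bar>lam\<bar> * (4 * M * M / (m/2))"
      unfolding abs_divide abs_mult using bs nl m(1) np
      by (intro mult_left_mono frac_le) auto
    have "\<bar>f' e t\<bar> \<le> 2 * (2 * M * P t) * (5 * M * P t) / (m/2)^5 + 5 * (2 * M * P t)\<^sup>2 * (4 * M * M) / (m/2)^7 + \<bar>lam\<bar> * (4 * M * M / (m/2))"
      unfolding f'_def using t1 t2 t3 by linarith
    also have "\<dots> = h t" unfolding h_def by (simp add: power_mult_distrib algebra_simps add_divide_distrib power2_eq_square)
    finally show ?thesis .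
  qed
  moreover have "f e integrable_on {0..1}" if "\<bar>e\<bar> < e0" for e
    unfolding f_def by (intro integrable_add integrable_on_mult_right int that)
  ultimately have D: "((\<lambda>e. integral {0..1} (f e)) has_real_derivative integral {0..1} (f' 0)) (at 0)"
    by (intro derivative_under_integral(2)[OF e0(1) d])
  have "energy lam (\<lambda>t. g t + e *\<^sub>R \<eta> t) = integral {0..1} (f e)" if e: "\<bar>e\<bar> < e0" for e
  proof -
    have "cross (g1 t + e *\<^sub>R \<eta>1 t) (g2 t + e *\<^sub>R \<eta>2 t) = N e t" for t
      by (simp add: cross_def N_def xy)
    then have "energy lam (\<lambda>t. g t + e *\<^sub>R \<eta> t) = integral {0..1} (\<lambda>t. (N e t)\<^sup>2 / n e t ^ 5) + lam * integral {0..1} (n e)"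
      unfolding energy_W22[OF W22_add_scaled[OF W V, of e]] n_norm by simp
    also have "\<dots> = integral {0..1} (f e)"
      unfolding f_def using int[OF e] by (simp add: Henstock_Kurzweil_Integration.integral_add integrable_on_mult_right)
    finally show ?thesis .
  qed
  then have D2: "((\<lambda>e. energy lam (\<lambda>t. g t + e *\<^sub>R \<eta> t)) has_real_derivative integral {0..1} (f' 0)) (at 0)"
    by (intro has_field_derivative_transform_within_open[OF D, of "{-e0<..<e0}"]) (use e0 in auto)
  have "f' 0 = (\<lambda>t. 2 * cross (g1 t) (g2 t) * (cross (\<eta>1 t) (g2 t) + cross (g1 t) (\<eta>2 t)) / norm (g1 t) ^ 5
      - 5 * (cross (g1 t) (g2 t))\<^sup>2 * (g1 t \<bullet> \<eta>1 t) / norm (g1 t) ^ 7 + lam * ((g1 t \<bullet> \<eta>1 t) / norm (g1 t)))"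
  proof
    fix t
    have "n 0 t = norm (g1 t)" using n_norm[of t 0] by simp
    moreover have "N 0 t = cross (g1 t) (g2 t)" by (simp add: N_def cross_def xy)
    moreover have "N' 0 t = cross (\<eta>1 t) (g2 t) + cross (g1 t) (\<eta>2 t)" by (simp add: N'_def cross_def xy)
    moreover have "s 0 t = g1 t \<bullet> \<eta>1 t" by (simp add: s_def inner_prod_def xy)
    ultimately show "f' 0 t = 2 * cross (g1 t) (g2 t) * (cross (\<eta>1 t) (g2 t) + cross (g1 t) (\<eta>2 t)) / norm (g1 t) ^ 5
      - 5 * (cross (g1 t) (g2 t))\<^sup>2 * (g1 t \<bullet> \<eta>1 t) / norm (g1 t) ^ 7 + lam * ((g1 t \<bullet> \<eta>1 t) / norm (g1 t))"
      by (simp add: f'_def)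
  qed
  then show ?thesis using D2 by (simp only:)
qed

lemma polar_snd: "polar g v v' \<psi> \<kappa> \<Longrightarrow> H1 (\<lambda>t. snd (g t)) (\<lambda>t. v t * sin (\<psi> t))"
  and polar_fst: "polar g v v' \<psi> \<kappa> \<Longrightarrow> H1 (\<lambda>t. fst (g t)) (\<lambda>t. v t * cos (\<psi> t))"
proof -
  assume P: "polar g v v' \<psi> \<kappa>"
  note c = H1_continuous[OF polarD(1)[OF P]] H1_continuous[OF polarD(3)[OF P]]
  have "((\<lambda>t. snd (g t)) has_vector_derivative snd (v t * cos (\<psi> t), v t * sin (\<psi> t))) (at t within {0..1})"
    "((\<lambda>t. fst (g t)) has_vector_derivative fst (v t * cos (\<psi> t), v t * sin (\<psi> t))) (at t within {0..1})" if "t \<in> {0..1}" for t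
    by (intro bounded_linear.has_vector_derivative[OF bounded_linear_snd] bounded_linear.has_vector_derivative[OF bounded_linear_fst]
        polarD(4)[OF P that])+
  then show "H1 (\<lambda>t. snd (g t)) (\<lambda>t. v t * sin (\<psi> t))" "H1 (\<lambda>t. fst (g t)) (\<lambda>t. v t * cos (\<psi> t))"
    by (intro H1_C1 continuous_intros c; simp add: has_real_derivative_iff_has_vector_derivative)+
qed

text \<open>The derivative of the variation is written in the moving frame as \<open>u\<close> times
  the velocity plus \<open>w\<close> times the velocity turned by a right angle. Thus
  \<open>u\<close> is the relative change of speed and \<open>w\<close> the change of the tangent
  angle, and the first variation decouples into these two.\<close>

lemma variation_algebra:
  fixes c s v v' k u u' w w' lam :: real
  assumes cs: "s * s = 1 - c * c" and v: "v > 0"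
  defines "g1 \<equiv> (v * c, v * s)" and "g2 \<equiv> (v' * c + v * (- s * k), v' * s + v * (c * k))"
    and "\<eta>1 \<equiv> (u * (v * c) - w * (v * s), u * (v * s) + w * (v * c))"
    and "\<eta>2 \<equiv> (u' * (v * c) + u * (v' * c + v * (- s * k)) - (w' * (v * s) + w * (v' * s + v * (c * k))),
       u' * (v * s) + u * (v' * s + v * (c * k)) + (w' * (v * c) + w * (v' * c + v * (- s * k))))"
  shows "2 * cross g1 g2 * (cross \<eta>1 g2 + cross g1 \<eta>2) / norm g1 ^ 5
      - 5 * (cross g1 g2)\<^sup>2 * (g1 \<bullet> \<eta>1) / norm g1 ^ 7 + lam * ((g1 \<bullet> \<eta>1) / norm g1)
    = 2 * k * w' / v + u * (lam * v - k\<^sup>2 / v)"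
proof -
  have "(v * c)\<^sup>2 + (v * s)\<^sup>2 = v * v * (c * c + s * s)" by (simp add: power2_eq_square algebra_simps)
  then have n: "norm g1 = v" using v cs unfolding g1_def norm_Pair by (simp add: power2_eq_square[symmetric])
  have c1: "cross g1 g2 = v * v * k"
  proof -
    have "cross g1 g2 = v * v * k * (c * c + s * s)" by (simp add: g1_def g2_def cross_def algebra_simps)
    then show ?thesis using cs by simp
  qed
  have c2: "cross \<eta>1 g2 + cross g1 \<eta>2 = v * v * (2 * u * k + w')"
  proof -
    have "cross \<eta>1 g2 + cross g1 \<eta>2 = v * v * (2 * u * k + w') * (c * c + s * s)"
      by (simp add: g1_def g2_def \<eta>1_def \<eta>2_def cross_def algebra_simps)
    then show ?thesis using cs by simp
  qed
  have c3: "g1 \<bullet> \<eta>1 = u * v * v"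
  proof -
    have "g1 \<bullet> \<eta>1 = u * v * v * (c * c + s * s)"
      by (simp add: g1_def \<eta>1_def algebra_simps)
    then show ?thesis using cs by simp
  qed
  show ?thesis unfolding n c1 c2 c3 using v
    by (simp add: field_simps eval_nat_numeral)
qed

text \<open>A variation given by \<open>u\<close> and \<open>w\<close> is admissible when two
  integrals vanish. For arbitrary \<open>u\<close> and \<open>w\<close> this is enforced by
  subtracting constants, which costs a multiple of the first variation for \<open>u\<close> = 1 and
  hence produces the multiplier \<open>p\<close>. Constant \<open>w\<close> is an infinitesimal
  rotation and costs nothing, so the multiplier has only a horizontal component. Testing with the
  defect of each equation then shows that the defect is zero.\<close>

lemma euler_lagrange:
  assumes P: "polar g v v' \<psi> \<kappa>" and g0: "g 0 = (0, 0)" and g1: "g 1 = (l, 0)" and l: "l > 0"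
    and crit: "\<And>\<eta> \<eta>1 \<eta>2. W22 \<eta> \<eta>1 \<eta>2 \<Longrightarrow> \<eta> 0 = 0 \<Longrightarrow> \<eta> 1 = 0 \<Longrightarrow>
        ((\<lambda>e. energy lam (\<lambda>t. g t + e *\<^sub>R \<eta> t)) has_real_derivative 0) (at 0)"
  obtains p where "\<And>t. t \<in> {0..1} \<Longrightarrow> lam - p\<^sup>2 * (snd (g t))\<^sup>2 / 4 = p * cos (\<psi> t)"
    and "polar g v v' \<psi> (\<lambda>t. p * snd (g t) * v t / 2)"
proof -
  note Hv = polarD(1)[OF P] and vp = polarD(2)[OF P] and H\<psi> = polarD(3)[OF P]
  define y where "y = (\<lambda>t. snd (g t))"
  define c s where "c = (\<lambda>t. cos (\<psi> t))" and "s = (\<lambda>t. sin (\<psi> t))"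
  have Hc: "H1 c (\<lambda>t. - s t * \<kappa> t)" and Hs: "H1 s (\<lambda>t. c t * \<kappa> t)"
    unfolding c_def s_def by (intro H1_cos H1_sin H\<psi>)+
  have Hy: "H1 y (\<lambda>t. v t * s t)" using polar_snd[OF P] by (simp add: y_def s_def)
  have Hx: "H1 (\<lambda>t. fst (g t)) (\<lambda>t. v t * c t)" using polar_fst[OF P] by (simp add: c_def)
  note cv = H1_continuous[OF Hv] and cc = H1_continuous[OF Hc] and csn = H1_continuous[OF Hs] and cy = H1_continuous[OF Hy]
  have y01: "y 0 = 0" "y 1 = 0" using g0 g1 by (auto simp: y_def)
  have Ic: "integral {0..1} (\<lambda>t. v t * c t) = l" using H1_eq[OF Hx, of 1] g0 g1 by simp
  have Is: "integral {0..1} (\<lambda>t. v t * s t) = 0" using H1_eq[OF Hy, of 1] y01 by simp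
  have cs: "s t * s t = 1 - c t * c t" for t
    using sin_cos_squared_add[of "\<psi> t"] by (simp add: s_def c_def power2_eq_square)
  have vne: "v t \<noteq> 0" if "t \<in> {0..1}" for t using vp[OF that] by simp
  have L\<kappa>: "L2 \<kappa>" by (rule H1_L2[OF H\<psi>])
  have L\<kappa>v: "L2 (\<lambda>t. 1 / v t * \<kappa> t)" using vne by (intro L2_cont_mult L\<kappa> continuous_intros cv) auto
  have ai: "(\<lambda>t. (\<kappa> t)\<^sup>2 / v t) absolutely_integrable_on {0..1}"
    using L2_mult_absolutely_integrable[OF L\<kappa> L\<kappa>v] by (simp add: power2_eq_square)
  have fv: "integral {0..1} (\<lambda>t. 2 * \<kappa> t * w' t / v t + u t * (lam * v t - (\<kappa> t)\<^sup>2 / v t)) = 0"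
    if u: "H1 u u'" and w: "H1 w w'"
      and z1: "integral {0..1} (\<lambda>t. u t * (v t * c t) - w t * (v t * s t)) = 0"
      and z2: "integral {0..1} (\<lambda>t. u t * (v t * s t) + w t * (v t * c t)) = 0" for u u' w w'
  proof -
    define \<eta>1 where "\<eta>1 = (\<lambda>t. (u t * (v t * c t) - w t * (v t * s t), u t * (v t * s t) + w t * (v t * c t)))"
    define \<eta>2 where "\<eta>2 = (\<lambda>t. (u' t * (v t * c t) + u t * (v' t * c t + v t * (- s t * \<kappa> t)) - (w' t * (v t * s t) + w t * (v' t * s t + v t * (c t * \<kappa> t))),
       u' t * (v t * s t) + u t * (v' t * s t + v t * (c t * \<kappa> t)) + (w' t * (v t * c t) + w t * (v' t * c t + v t * (- s t * \<kappa> t)))))"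
    define \<eta> where "\<eta> = (\<lambda>t. (0 + integral {0..t} (\<lambda>t. u t * (v t * c t) - w t * (v t * s t)), 0 + integral {0..t} (\<lambda>t. u t * (v t * s t) + w t * (v t * c t))))"
    have W: "W22 \<eta> \<eta>1 \<eta>2" unfolding \<eta>_def \<eta>1_def \<eta>2_def
      by (intro W22_primitive H1_diff H1_add H1_mult u w Hv Hc Hs)
    have "\<eta> 0 = 0" "\<eta> 1 = 0" using z1 z2 by (auto simp: \<eta>_def zero_prod_def)
    from crit[OF W this] have D0: "((\<lambda>e. energy lam (\<lambda>t. g t + e *\<^sub>R \<eta> t)) has_real_derivative 0) (at 0)" .
    define h1 where "h1 = (\<lambda>t. (v t * c t, v t * s t))"
    define h2 where "h2 = (\<lambda>t. (v' t * c t + v t * (- s t * \<kappa> t), v' t * s t + v t * (c t * \<kappa> t)))"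
    have Wg: "W22 g h1 h2" using polar_W22[OF P] unfolding h1_def h2_def c_def s_def .
    have nz: "h1 t \<noteq> 0" if "t \<in> {0..1}" for t
      using norm_polar[of "v t" "\<psi> t"] vp[OF that] unfolding h1_def c_def s_def by auto
    have "integral {0..1} (\<lambda>t. 2 * cross (h1 t) (h2 t) * (cross (\<eta>1 t) (h2 t) + cross (h1 t) (\<eta>2 t)) / norm (h1 t) ^ 5
      - 5 * (cross (h1 t) (h2 t))\<^sup>2 * (h1 t \<bullet> \<eta>1 t) / norm (h1 t) ^ 7 + lam * ((h1 t \<bullet> \<eta>1 t) / norm (h1 t))) = 0"
      by (rule DERIV_unique[OF first_variation[OF Wg nz W] D0])
    moreover have "integral {0..1} (\<lambda>t. 2 * cross (h1 t) (h2 t) * (cross (\<eta>1 t) (h2 t) + cross (h1 t) (\<eta>2 t)) / norm (h1 t) ^ 5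
      - 5 * (cross (h1 t) (h2 t))\<^sup>2 * (h1 t \<bullet> \<eta>1 t) / norm (h1 t) ^ 7 + lam * ((h1 t \<bullet> \<eta>1 t) / norm (h1 t)))
      = integral {0..1} (\<lambda>t. 2 * \<kappa> t * w' t / v t + u t * (lam * v t - (\<kappa> t)\<^sup>2 / v t))"
      unfolding h1_def h2_def \<eta>1_def \<eta>2_def by (intro integral_cong variation_algebra cs vp)
    ultimately show ?thesis by simp
  qed
  \<comment> \<open>The first variation in the scaling direction \<open>u\<close> = 1, per unit of
    chord.\<close>
  define p where "p = integral {0..1} (\<lambda>t. lam * v t - (\<kappa> t)\<^sup>2 / v t) / l"
  have iq: "(\<lambda>t. lam * v t - (\<kappa> t)\<^sup>2 / v t) absolutely_integrable_on {0..1}"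
    by (intro set_integral_diff(1) ai absolutely_integrable_continuous_real continuous_intros cv)
  have lag: "integral {0..1} (\<lambda>t. 2 * \<kappa> t * w' t / v t + u t * (lam * v t - (\<kappa> t)\<^sup>2 / v t))
      = p * integral {0..1} (\<lambda>t. u t * (v t * c t) - w t * (v t * s t))"
    if u: "H1 u u'" and w: "H1 w w'" for u u' w w'
  proof -
    note cu = H1_continuous[OF u] and cw = H1_continuous[OF w]
    define V1 where "V1 = integral {0..1} (\<lambda>t. u t * (v t * c t) - w t * (v t * s t))"
    define V2 where "V2 = integral {0..1} (\<lambda>t. u t * (v t * s t) + w t * (v t * c t))"
    have i1: "((\<lambda>t. u t * (v t * c t) - w t * (v t * s t)) has_integral V1) {0..1}"
      unfolding V1_def by (intro integrable_integral integrable_continuous_interval continuous_intros cu cw cv cc csn)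
    have i2: "((\<lambda>t. u t * (v t * s t) + w t * (v t * c t)) has_integral V2) {0..1}"
      unfolding V2_def by (intro integrable_integral integrable_continuous_interval continuous_intros cu cw cv cc csn)
    have ic: "((\<lambda>t. v t * c t) has_integral l) {0..1}" and ist: "((\<lambda>t. v t * s t) has_integral 0) {0..1}"
      using integrable_integral[OF integrable_continuous_interval[OF continuous_on_mult[OF cv cc]]]
        integrable_integral[OF integrable_continuous_interval[OF continuous_on_mult[OF cv csn]]] Ic Is by simp_all
    have U: "H1 (\<lambda>t. u t - V1 / l) (\<lambda>t. u' t - 0)" and W: "H1 (\<lambda>t. w t - V2 / l) (\<lambda>t. w' t - 0)"
      by (intro H1_diff u w H1_const)+
    have j1: "((\<lambda>t. u t * (v t * c t) - w t * (v t * s t) - (V1 / l * (v t * c t) - V2 / l * (v t * s t))) has_integral V1 - (V1 / l * l - V2 / l * 0)) {0..1}"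
      by (intro has_integral_diff has_integral_mult_right i1 ic ist)
    have j2: "((\<lambda>t. u t * (v t * s t) + w t * (v t * c t) - (V1 / l * (v t * s t) + V2 / l * (v t * c t))) has_integral V2 - (V1 / l * 0 + V2 / l * l)) {0..1}"
      by (intro has_integral_diff has_integral_add has_integral_mult_right i2 ic ist)
    have 1: "integral {0..1} (\<lambda>t. (u t - V1 / l) * (v t * c t) - (w t - V2 / l) * (v t * s t)) = 0"
      using integral_unique[OF j1] l by (simp add: algebra_simps)
    have 2: "integral {0..1} (\<lambda>t. (u t - V1 / l) * (v t * s t) + (w t - V2 / l) * (v t * c t)) = 0"
      using integral_unique[OF j2] l by (simp add: algebra_simps)
    have k: "integral {0..1} (\<lambda>t. 2 * \<kappa> t * (w' t - 0) / v t + (u t - V1 / l) * (lam * v t - (\<kappa> t)\<^sup>2 / v t)) = 0"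
      by (rule fv[OF U W 1 2])
    have A: "(\<lambda>t. 2 * \<kappa> t * w' t / v t) integrable_on {0..1}"
    proof -
      have "(\<lambda>t. 2 * (1 / v t * \<kappa> t * w' t)) absolutely_integrable_on {0..1}"
        by (intro set_integrable_mult_right L2_mult_absolutely_integrable L\<kappa>v H1_L2[OF w])
      then show ?thesis by (simp add: absolutely_integrable_on_def mult.assoc)
    qed
    have B: "(\<lambda>t. u t * (lam * v t - (\<kappa> t)\<^sup>2 / v t)) integrable_on {0..1}"
      using absolutely_integrable_mult_bounded[OF cu iq] by (simp add: absolutely_integrable_on_def)
    have C: "(\<lambda>t. lam * v t - (\<kappa> t)\<^sup>2 / v t) integrable_on {0..1}"
      using iq by (simp add: absolutely_integrable_on_def)
    have "((\<lambda>t. 2 * \<kappa> t * w' t / v t + u t * (lam * v t - (\<kappa> t)\<^sup>2 / v t) - V1 / l * (lam * v t - (\<kappa> t)\<^sup>2 / v t)) has_integral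
       integral {0..1} (\<lambda>t. 2 * \<kappa> t * w' t / v t + u t * (lam * v t - (\<kappa> t)\<^sup>2 / v t)) - V1 / l * (p * l)) {0..1}"
      using l by (intro has_integral_diff has_integral_mult_right integrable_integral integrable_add A B) (auto simp: p_def intro: integrable_integral C)
    note I = integral_unique[OF this]
    have eqf: "2 * \<kappa> t * (w' t - 0) / v t + (u t - V1 / l) * (lam * v t - (\<kappa> t)\<^sup>2 / v t)
        = 2 * \<kappa> t * w' t / v t + u t * (lam * v t - (\<kappa> t)\<^sup>2 / v t) - V1 / l * (lam * v t - (\<kappa> t)\<^sup>2 / v t)" for t
      by (simp only: left_diff_distrib diff_zero add_diff_eq)
    have "integral {0..1} (\<lambda>t. 2 * \<kappa> t * w' t / v t + u t * (lam * v t - (\<kappa> t)\<^sup>2 / v t)) - V1 / l * (p * l) = 0"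
      using k unfolding eqf I .
    then show ?thesis unfolding V1_def[symmetric] using l by simp
  qed
  \<comment> \<open>The defect of the first equation, up to the factor \<open>v\<close> / 2. Used as
    the derivative of \<open>w\<close>, and after integration by parts with \<open>y\<close>
    vanishing at both ends, it makes the identity \<open>lag\<close> say that the integral of
    \<open>z\<close>^2 is zero.\<close>
  define z where "z = (\<lambda>t. 2 * (1 / v t * \<kappa> t) - p * y t)"
  have Lz: "L2 z" unfolding z_def by (intro L2_diff L2_cmult L\<kappa>v continuous_on_imp_L2 cy)
  define w where "w = (\<lambda>t. 0 + integral {0..t} z)"
  have Hw: "H1 w z" unfolding w_def by (rule H1_integral[OF Lz])
  have zz: "integral {0..1} (\<lambda>t. (z t)\<^sup>2) = 0"
  proof -
    have "integral {0..1} (\<lambda>t. 2 * \<kappa> t * z t / v t + 0 * (lam * v t - (\<kappa> t)\<^sup>2 / v t))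
      = p * integral {0..1} (\<lambda>t. 0 * (v t * c t) - w t * (v t * s t))"
      by (rule lag[OF H1_const Hw])
    then have e1: "integral {0..1} (\<lambda>t. 2 * \<kappa> t * z t / v t) = - p * integral {0..1} (\<lambda>t. w t * (v t * s t))" by simp
    have "integral {0..1} (\<lambda>t. z t * y t + w t * (v t * s t)) = 0"
      using H1_by_parts[OF Hw Hy] y01 by simp
    moreover have "integral {0..1} (\<lambda>t. z t * y t + w t * (v t * s t)) = integral {0..1} (\<lambda>t. z t * y t) + integral {0..1} (\<lambda>t. w t * (v t * s t))"
    proof (rule Henstock_Kurzweil_Integration.integral_add)
      show "(\<lambda>t. z t * y t) integrable_on {0..1}"
        using L2_mult_absolutely_integrable[OF Lz continuous_on_imp_L2[OF cy]] by (simp add: absolutely_integrable_on_def)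
      show "(\<lambda>t. w t * (v t * s t)) integrable_on {0..1}"
        by (intro integrable_continuous_interval continuous_intros cv csn H1_continuous[OF Hw])
    qed
    ultimately have e2: "p * integral {0..1} (\<lambda>t. z t * y t) = integral {0..1} (\<lambda>t. 2 * \<kappa> t * z t / v t)"
      unfolding e1 by (simp add: add_eq_0_iff)
    have "integral {0..1} (\<lambda>t. (z t)\<^sup>2) = integral {0..1} (\<lambda>t. 2 * (1 / v t * \<kappa> t * z t) - p * (z t * y t))"
      by (rule integral_cong) (simp add: z_def power2_eq_square algebra_simps)
    also have "\<dots> = integral {0..1} (\<lambda>t. 2 * (1 / v t * \<kappa> t * z t)) - integral {0..1} (\<lambda>t. p * (z t * y t))"
      using L2_mult_absolutely_integrable[OF Lz continuous_on_imp_L2[OF cy]] L2_mult_absolutely_integrable[OF L\<kappa>v Lz]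
      by (intro Henstock_Kurzweil_Integration.integral_diff integrable_on_mult_right) (auto simp: absolutely_integrable_on_def)
    also have "\<dots> = 0" using e2 by (simp add: mult.assoc)
    finally show ?thesis .
  qed
  obtain N where N: "negligible N" "\<forall>t\<in>{0..1} - N. z t = 0"
    using integral_zero_imp_negligible[OF Lz integral_square_zero_imp[OF Lz zz]] by blast
  \<comment> \<open>A continuous representative of the derivative of \<open>\<psi>\<close>, agreeing
    with \<open>\<kappa>\<close> almost everywhere.\<close>
  define \<kappa>' where "\<kappa>' = (\<lambda>t. p * y t * v t / 2)"
  have \<kappa>\<kappa>': "\<kappa> t = \<kappa>' t" if "t \<in> {0..1} - N" for t
  proof -
    have "2 * (1 / v t * \<kappa> t) = p * y t" using N(2) that by (simp add: z_def)
    then show ?thesis using vne[of t] that by (simp add: \<kappa>'_def field_simps)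
  qed
  have H\<psi>': "H1 \<psi> \<kappa>'" unfolding H1_def
  proof (intro conjI ballI)
    show "L2 \<kappa>'" unfolding \<kappa>'_def by (intro continuous_on_imp_L2 continuous_intros cy cv) auto
    fix t :: real assume t: "t \<in> {0..1}"
    have "integral {0..t} \<kappa> = integral {0..t} \<kappa>'" by (rule integral_cong_ae[OF N(1)]) (use \<kappa>\<kappa>' t in auto)
    then show "\<psi> t = \<psi> 0 + integral {0..t} \<kappa>'" using H1_eq[OF H\<psi> t] by simp
  qed
  \<comment> \<open>The defect of the second equation, tested with itself. Being continuous, it
    vanishes everywhere once the integral of \<open>v * u\<^sup>2\<close> does.\<close>
  define u where "u = (\<lambda>t. lam - p\<^sup>2 / 4 * (y t * y t) - p * c t)"
  have Hu: "H1 u (\<lambda>t. 0 - p\<^sup>2 / 4 * (v t * s t * y t + y t * (v t * s t)) - p * (- s t * \<kappa> t))"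
    unfolding u_def by (intro H1_diff H1_const H1_cmult H1_mult Hy Hc)
  note cu = H1_continuous[OF Hu]
  have "integral {0..1} (\<lambda>t. v t * (u t)\<^sup>2) = 0"
  proof -
    have e: "integral {0..1} (\<lambda>t. u t * (lam * v t - (\<kappa> t)\<^sup>2 / v t)) = p * integral {0..1} (\<lambda>t. u t * (v t * c t))"
      using lag[OF Hu H1_const[of 0]] by simp
    have "integral {0..1} (\<lambda>t. v t * (u t)\<^sup>2) = integral {0..1} (\<lambda>t. u t * (lam * v t - (\<kappa> t)\<^sup>2 / v t) - p * (u t * (v t * c t)))"
    proof (rule integral_cong_ae[OF N(1)])
      fix t assume t: "t \<in> {0..1} - N"
      have "(\<kappa> t)\<^sup>2 / v t = p\<^sup>2 / 4 * (y t * y t) * v t"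
        unfolding \<kappa>\<kappa>'[OF t] \<kappa>'_def using vne[of t] t by (simp add: power2_eq_square)
      then have e: "(\<kappa> t)\<^sup>2 / v t = p\<^sup>2 / 4 * (y t * y t) * v t" .
      show "v t * (u t)\<^sup>2 = u t * (lam * v t - (\<kappa> t)\<^sup>2 / v t) - p * (u t * (v t * c t))"
        unfolding e by (simp add: u_def power2_eq_square algebra_simps)
    qed
    also have "\<dots> = integral {0..1} (\<lambda>t. u t * (lam * v t - (\<kappa> t)\<^sup>2 / v t)) - integral {0..1} (\<lambda>t. p * (u t * (v t * c t)))"
    proof (rule Henstock_Kurzweil_Integration.integral_diff)
      show "(\<lambda>t. u t * (lam * v t - (\<kappa> t)\<^sup>2 / v t)) integrable_on {0..1}"
        using absolutely_integrable_mult_bounded[OF cu iq] by (simp add: absolutely_integrable_on_def)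
      show "(\<lambda>t. p * (u t * (v t * c t))) integrable_on {0..1}"
        by (intro integrable_continuous_interval continuous_intros cv cu cc)
    qed
    also have "\<dots> = 0" using e by simp
    finally show ?thesis .
  qed
  then have "\<forall>t\<in>{0..1}. v t * (u t)\<^sup>2 = 0"
    using vp by (subst (asm) integral_eq_0_iff) (auto intro!: continuous_intros cv cu mult_nonneg_nonneg simp: less_imp_le)
  then have "u t = 0" if "t \<in> {0..1}" for t using vne[OF that] that by auto
  then have "lam - p\<^sup>2 * (snd (g t))\<^sup>2 / 4 = p * cos (\<psi> t)" if "t \<in> {0..1}" for t
    using that by (simp add: u_def y_def c_def power2_eq_square)
  moreover have "polar g v v' \<psi> (\<lambda>t. p * snd (g t) * v t / 2)"
    using P H\<psi>' unfolding polar_def \<kappa>'_def y_def by blast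
  ultimately show ?thesis using that by blast
qed

section \<open>Second variation\<close>

lemma abs_cos_diff: "\<bar>cos a - cos b\<bar> \<le> \<bar>a - b\<bar>" for a b :: real
proof -
  have "norm (cos a - cos b) \<le> 1 * norm (a - b)"
    by (rule field_differentiable_bound[where S=UNIV and f'="\<lambda>x. - sin x"]) (auto intro!: derivative_eq_intros)
  then show ?thesis by simp
qed

lemma abs_sin_diff: "\<bar>sin a - sin b\<bar> \<le> \<bar>a - b\<bar>" for a b :: real
proof -
  have "norm (sin a - sin b) \<le> 1 * norm (a - b)"
    by (rule field_differentiable_bound[where S=UNIV and f'="\<lambda>x. cos x"]) (auto intro!: derivative_eq_intros)
  then show ?thesis by simp
qed

lemma mult_diff_bound:
  fixes a b c d :: real
  assumes "\<bar>a - c\<bar> \<le> x" "\<bar>b - d\<bar> \<le> y" "\<bar>b\<bar> \<le> B" "\<bar>c\<bar> \<le> C" "0 \<le> x" "0 \<le> y"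
  shows "\<bar>a * b - c * d\<bar> \<le> x * B + C * y"
proof -
  have "a * b - c * d = (a - c) * b + c * (b - d)" by (simp add: algebra_simps)
  also have "\<bar>\<dots>\<bar> \<le> \<bar>a - c\<bar> * \<bar>b\<bar> + \<bar>c\<bar> * \<bar>b - d\<bar>" by (metis abs_mult abs_triangle_ineq)
  also have "\<dots> \<le> x * B + C * y" using assms by (intro add_mono mult_mono) auto
  finally show ?thesis .
qed

text \<open>One coordinate of the first and second derivative, to be used with \<open>T\<close>,
  \<open>T'\<close> equal to cosine and minus sine or to sine and cosine. The errors of the
  derivatives are measured by a multiple of \<open>h\<close>, to be instantiated with an L2
  function, because \<open>v'\<close> and \<open>\<kappa>\<close> need not be bounded.\<close>

lemma polar_close_component:
  fixes T T' :: "real \<Rightarrow> real"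
  assumes T: "\<And>a b. \<bar>T a - T b\<bar> \<le> \<bar>a - b\<bar>" "\<And>a. \<bar>T a\<bar> \<le> 1"
    and T': "\<And>a b. \<bar>T' a - T' b\<bar> \<le> \<bar>a - b\<bar>" "\<And>a. \<bar>T' a\<bar> \<le> 1"
    and r: "0 \<le> r" "r \<le> 1" and V: "\<bar>v\<bar> \<le> V" and h: "0 \<le> h"
    and c: "\<bar>w - v\<bar> \<le> r" "\<bar>a - b\<bar> \<le> r" "\<bar>w' - v'\<bar> \<le> r * h" "\<bar>j - k\<bar> \<le> r * h"
  shows "\<bar>w * T a - v * T b\<bar> \<le> r * (1 + V)"
    and "\<bar>(w' * T a + w * (T' a * j)) - (v' * T b + v * (T' b * k))\<bar> \<le> r * (h * (2 * V + 2) + \<bar>k\<bar> * (V + 1) + \<bar>v'\<bar>)"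
proof -
  have V0: "0 \<le> V" using V by linarith
  have Ta: "\<bar>T a - T b\<bar> \<le> r" "\<bar>T' a - T' b\<bar> \<le> r" using T(1)[of a b] T'(1)[of a b] c(2) by linarith+
  have "\<bar>w * T a - v * T b\<bar> \<le> r * 1 + V * r" by (rule mult_diff_bound) (use c Ta T V r in auto)
  then show "\<bar>w * T a - v * T b\<bar> \<le> r * (1 + V)" by (simp add: algebra_simps)
  have 1: "\<bar>w' * T a - v' * T b\<bar> \<le> r * h * 1 + \<bar>v'\<bar> * r"
    by (rule mult_diff_bound) (use c Ta T r h in auto)
  have 2: "\<bar>T' a * j - T' b * k\<bar> \<le> r * (\<bar>k\<bar> + r * h) + 1 * (r * h)"
    by (rule mult_diff_bound) (use c Ta T' r h in auto)
  have r2: "r * (r * h) \<le> r * h" using r h by (simp add: mult_left_le_one_le mult_left_mono)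
  have w: "\<bar>w\<bar> \<le> V + 1" using c(1) V r by linarith
  have "\<bar>w * (T' a * j) - v * (T' b * k)\<bar> = \<bar>(T' a * j) * w - (T' b * k) * v\<bar>" by (simp add: mult.commute)
  also have "\<dots> \<le> (r * (\<bar>k\<bar> + r * h) + 1 * (r * h)) * V + (\<bar>k\<bar> + r * h) * r"
  proof -
    have "\<bar>T' a * j\<bar> \<le> \<bar>k\<bar> + r * h"
    proof -
      have "\<bar>T' a * j\<bar> \<le> \<bar>j\<bar>" using T'(2)[of a] by (simp add: abs_mult mult_left_le_one_le)
      then show ?thesis using c(4) by linarith
    qed
    have "\<bar>w * (T' a * j) - v * (T' b * k)\<bar> \<le> r * (\<bar>k\<bar> + r * h) + V * (r * (\<bar>k\<bar> + r * h) + 1 * (r * h))"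
      by (rule mult_diff_bound) (use c 2 V r h \<open>\<bar>T' a * j\<bar> \<le> \<bar>k\<bar> + r * h\<close> in auto)
    then show ?thesis by (simp add: algebra_simps)
  qed
  also have "\<dots> \<le> r * h * (2 * V + 1) + r * \<bar>k\<bar> * (V + 1)"
  proof -
    have "r * (r * h) * V \<le> r * h * V" using r2 V0 by (rule mult_right_mono)
    then show ?thesis using r2 by (simp add: algebra_simps)
  qed
  finally have 3: "\<bar>w * (T' a * j) - v * (T' b * k)\<bar> \<le> r * h * (2 * V + 1) + r * \<bar>k\<bar> * (V + 1)" .
  have "\<bar>(w' * T a + w * (T' a * j)) - (v' * T b + v * (T' b * k))\<bar> \<le> (r * h * 1 + \<bar>v'\<bar> * r) + (r * h * (2 * V + 1) + r * \<bar>k\<bar> * (V + 1))"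
    using 1 3 by linarith
  also have "\<dots> = r * (h * (2 * V + 2) + \<bar>k\<bar> * (V + 1) + \<bar>v'\<bar>)" by (simp add: algebra_simps)
  finally have 4: "\<bar>(w' * T a + w * (T' a * j)) - (v' * T b + v * (T' b * k))\<bar> \<le> r * (h * (2 * V + 2) + \<bar>k\<bar> * (V + 1) + \<bar>v'\<bar>)" .
  then show "\<bar>(w' * T a + w * (T' a * j)) - (v' * T b + v * (T' b * k))\<bar> \<le> r * (h * (2 * V + 2) + \<bar>k\<bar> * (V + 1) + \<bar>v'\<bar>)" .
qed

lemma norm_le_components: "\<bar>fst p\<bar> \<le> a \<Longrightarrow> \<bar>snd p\<bar> \<le> a \<Longrightarrow> norm p \<le> 2 * a" for p :: "real \<times> real"
  using norm_Pair_le[of "fst p" "snd p"] by simp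

lemma W22_continuous:
  assumes "W22 g g1 g2" shows "continuous_on {0..1} g"
  unfolding continuous_on_eq_continuous_within
proof
  fix t :: real assume "t \<in> {0..1}"
  then show "continuous (at t within {0..1}) g"
    by (rule has_vector_derivative_continuous[OF W22_has_vector_derivative[OF assms]])
qed

lemma W22_squares_integrable:
  assumes W: "W22 g g1 g2"
  shows "(\<lambda>t. (norm (g t))\<^sup>2 + (norm (g1 t))\<^sup>2 + (norm (g2 t))\<^sup>2) integrable_on {0..1}"
proof (intro integrable_add)
  show "(\<lambda>t. (norm (g t))\<^sup>2) integrable_on {0..1}"
    by (intro integrable_continuous_interval continuous_intros W22_continuous[OF W])
  have "(\<lambda>t. (fst (g1 t))\<^sup>2 + (snd (g1 t))\<^sup>2) integrable_on {0..1}"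
    by (intro integrable_continuous_interval continuous_intros
        H1_continuous[OF W22_H1(1)[OF W]] H1_continuous[OF W22_H1(2)[OF W]])
  then show "(\<lambda>t. (norm (g1 t))\<^sup>2) integrable_on {0..1}" by (simp add: norm_prod_def)
  show "(\<lambda>t. (norm (g2 t))\<^sup>2) integrable_on {0..1}" using W unfolding W22_def by blast
qed

text \<open>Transfers closeness of speed and angle to the W^{2,2} distance, with a constant
  depending on \<open>g\<close> and \<open>H\<close> alone. Instability proofs then only have to
  construct speeds and angles. The L2 weight \<open>H\<close> permits derivative errors proportional
  to unbounded functions such as \<open>v'\<close>.\<close>

lemma polar_dist_bound:
  assumes P: "polar g v v' \<psi> \<kappa>" and LH: "L2 H" and H0: "\<And>t. H t \<ge> 0"
  obtains C where "C > 0" "\<And>G w w' \<phi> \<mu> r. polar G w w' \<phi> \<mu> \<Longrightarrow> G 0 = g 0 \<Longrightarrow> 0 \<le> r \<Longrightarrow> r \<le> 1 \<Longrightarrow>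
     (\<And>t. t \<in> {0..1} \<Longrightarrow> \<bar>w t - v t\<bar> \<le> r \<and> \<bar>\<phi> t - \<psi> t\<bar> \<le> r \<and> \<bar>w' t - v' t\<bar> \<le> r * H t \<and> \<bar>\<mu> t - \<kappa> t\<bar> \<le> r * H t) \<Longrightarrow>
     w22_dist G g \<le> C * r"
proof -
  obtain V where V: "V > 0" "\<And>t. t \<in> {0..1} \<Longrightarrow> \<bar>v t\<bar> \<le> V"
    using continuous_Icc_bound[OF H1_continuous[OF polarD(1)[OF P]]] by blast
  define Q where "Q = (\<lambda>t. H t * (2 * V + 2) + \<bar>\<kappa> t\<bar> * (V + 1) + \<bar>v' t\<bar>)"
  have LQ: "L2 Q"
  proof -
    have "L2 (\<lambda>t. (2 * V + 2) * H t + (V + 1) * \<bar>\<kappa> t\<bar> + \<bar>v' t\<bar>)"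
      by (rule L2_add[OF L2_add[OF L2_cmult[OF LH] L2_cmult[OF L2_abs[OF H1_L2[OF polarD(3)[OF P]]]]]
          L2_abs[OF H1_L2[OF polarD(1)[OF P]]]])
    then show ?thesis by (rule L2_cong) (simp add: Q_def mult.commute)
  qed
  define D where "D = integral {0..1} (\<lambda>t. 2 * (2 * (1 + V))\<^sup>2 + 4 * (Q t)\<^sup>2)"
  have iQ: "(\<lambda>t. 2 * (2 * (1 + V))\<^sup>2 + 4 * (Q t)\<^sup>2) integrable_on {0..1}"
    by (rule integrable_add[OF integrable_const_ivl integrable_on_mult_right[OF L2_square_integrable[OF LQ]]])
  have D0: "D \<ge> 0" unfolding D_def by (intro Henstock_Kurzweil_Integration.integral_nonneg iQ) auto
  show ?thesis
  proof (rule that[of "sqrt D + 1"])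
    show "sqrt D + 1 > 0" using D0 by (simp add: add_nonneg_pos)
    fix G w w' \<phi> \<mu> r
    assume PG: "polar G w w' \<phi> \<mu>" and G0: "G 0 = g 0" and r: "0 \<le> r" "r \<le> 1"
      and c: "\<And>t. t \<in> {0..1} \<Longrightarrow> \<bar>w t - v t\<bar> \<le> r \<and> \<bar>\<phi> t - \<psi> t\<bar> \<le> r \<and> \<bar>w' t - v' t\<bar> \<le> r * H t \<and> \<bar>\<mu> t - \<kappa> t\<bar> \<le> r * H t"
    have ngs: "\<bar>- sin a - - sin b\<bar> \<le> \<bar>a - b\<bar>" for a b :: real using abs_sin_diff[of a b] by linarith
    have ngs1: "\<bar>- sin a\<bar> \<le> 1" for a :: real by simp
    note cl = polar_close_component[where r=r and V=V]
    define G1 g1 where "G1 = (\<lambda>t. (w t * cos (\<phi> t), w t * sin (\<phi> t)))" and "g1 = (\<lambda>t. (v t * cos (\<psi> t), v t * sin (\<psi> t)))"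
    define G2 where "G2 = (\<lambda>t. (w' t * cos (\<phi> t) + w t * (- sin (\<phi> t) * \<mu> t), w' t * sin (\<phi> t) + w t * (cos (\<phi> t) * \<mu> t)))"
    define g2 where "g2 = (\<lambda>t. (v' t * cos (\<psi> t) + v t * (- sin (\<psi> t) * \<kappa> t), v' t * sin (\<psi> t) + v t * (cos (\<psi> t) * \<kappa> t)))"
    have W: "W22 G G1 G2" "W22 g g1 g2" using polar_W22[OF PG] polar_W22[OF P] unfolding G1_def G2_def g1_def g2_def .
    have b1: "\<bar>fst (G1 t - g1 t)\<bar> \<le> r * (1 + V)" "\<bar>snd (G1 t - g1 t)\<bar> \<le> r * (1 + V)"
      and b2: "\<bar>fst (G2 t - g2 t)\<bar> \<le> r * Q t" "\<bar>snd (G2 t - g2 t)\<bar> \<le> r * Q t" if t: "t \<in> {0..1}" for t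
    proof -
      have c': "\<bar>w t - v t\<bar> \<le> r" "\<bar>\<phi> t - \<psi> t\<bar> \<le> r" "\<bar>w' t - v' t\<bar> \<le> r * H t" "\<bar>\<mu> t - \<kappa> t\<bar> \<le> r * H t" using c[OF t] by auto
      note X = cl[OF abs_cos_diff abs_cos_le_one ngs ngs1 r V(2)[OF t] H0 c'] cl[OF abs_sin_diff abs_sin_le_one abs_cos_diff abs_cos_le_one r V(2)[OF t] H0 c']
      show "\<bar>fst (G1 t - g1 t)\<bar> \<le> r * (1 + V)" "\<bar>snd (G1 t - g1 t)\<bar> \<le> r * (1 + V)"
        "\<bar>fst (G2 t - g2 t)\<bar> \<le> r * Q t" "\<bar>snd (G2 t - g2 t)\<bar> \<le> r * Q t"
        using X unfolding G1_def g1_def G2_def g2_def Q_def by simp_all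
    qed
    have n1: "norm (G1 t - g1 t) \<le> r * (2 * (1 + V))" if t: "t \<in> {0..1}" for t
      using norm_le_components[OF b1[OF t]] by (simp add: algebra_simps)
    have n2: "norm (G2 t - g2 t) \<le> r * (2 * Q t)" if t: "t \<in> {0..1}" for t
      using norm_le_components[OF b2[OF t]] by (simp add: algebra_simps)
    have n0: "norm (G t - g t) \<le> r * (2 * (1 + V))" if t: "t \<in> {0..1}" for t
    proof -
      have "norm ((G t - g t) - (G 0 - g 0)) \<le> (r * (2 * (1 + V))) * norm (t - 0)"
      proof (rule differentiable_bound[where S="{0..1}" and f'="\<lambda>s h. h *\<^sub>R (G1 s - g1 s)"])
        fix s :: real assume s: "s \<in> {0..1}"
        show "((\<lambda>t. G t - g t) has_derivative (\<lambda>h. h *\<^sub>R (G1 s - g1 s))) (at s within {0..1})"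
          using has_vector_derivative_diff[OF W22_has_vector_derivative[OF W(1) s] W22_has_vector_derivative[OF W(2) s]]
          by (simp add: has_vector_derivative_def)
        show "onorm (\<lambda>h. h *\<^sub>R (G1 s - g1 s)) \<le> r * (2 * (1 + V))"
          using n1[OF s] by (simp add: onorm_scaleR_left onorm_id[unfolded id_def])
      qed (use t in auto)
      also have "\<dots> \<le> r * (2 * (1 + V)) * 1" using t r V by (intro mult_left_mono) auto
      finally show ?thesis using G0 by simp
    qed
    have sq: "(r * A)\<^sup>2 + (r * A)\<^sup>2 + (r * (2 * q))\<^sup>2 = r\<^sup>2 * (2 * A\<^sup>2 + 4 * q\<^sup>2)" for A q :: real
      by (simp add: power_mult_distrib algebra_simps)
    have "integral {0..1} (\<lambda>t. (norm (G t - g t))\<^sup>2 + (norm (G1 t - g1 t))\<^sup>2 + (norm (G2 t - g2 t))\<^sup>2)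
       \<le> integral {0..1} (\<lambda>t. r\<^sup>2 * (2 * (2 * (1 + V))\<^sup>2 + 4 * (Q t)\<^sup>2))"
    proof (rule integral_le)
      show "(\<lambda>t. r\<^sup>2 * (2 * (2 * (1 + V))\<^sup>2 + 4 * (Q t)\<^sup>2)) integrable_on {0..1}"
        by (rule integrable_on_mult_right[OF iQ])
      have W': "W22 (\<lambda>t. G t + (-1) *\<^sub>R g t) (\<lambda>t. G1 t + (-1) *\<^sub>R g1 t) (\<lambda>t. G2 t + (-1) *\<^sub>R g2 t)"
        by (rule W22_add_scaled[OF W])
      from W22_squares_integrable[OF W']
      show "(\<lambda>t. (norm (G t - g t))\<^sup>2 + (norm (G1 t - g1 t))\<^sup>2 + (norm (G2 t - g2 t))\<^sup>2) integrable_on {0..1}"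
        by simp
      fix t :: real assume t: "t \<in> {0..1}"
      have "(norm (G t - g t))\<^sup>2 + (norm (G1 t - g1 t))\<^sup>2 + (norm (G2 t - g2 t))\<^sup>2
         \<le> (r * (2 * (1 + V)))\<^sup>2 + (r * (2 * (1 + V)))\<^sup>2 + (r * (2 * Q t))\<^sup>2"
        using n0[OF t] n1[OF t] n2[OF t] by (intro add_mono power_mono) auto
      then show "(norm (G t - g t))\<^sup>2 + (norm (G1 t - g1 t))\<^sup>2 + (norm (G2 t - g2 t))\<^sup>2 \<le> r\<^sup>2 * (2 * (2 * (1 + V))\<^sup>2 + 4 * (Q t)\<^sup>2)"
        unfolding sq .
    qed
    also have "\<dots> = r\<^sup>2 * D" by (simp add: D_def)
    finally have "w22_dist G g \<le> sqrt (r\<^sup>2 * D)" unfolding w22_dist_W22[OF W] by simp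
    also have "\<dots> = sqrt D * r" using r by (simp add: real_sqrt_mult)
    also have "\<dots> \<le> (sqrt D + 1) * r" using r by (simp add: distrib_right)
    finally show "w22_dist G g \<le> (sqrt D + 1) * r" .
  qed
qed

lemma not_stableI:
  assumes P: "polar g v v' \<psi> \<kappa>" and LH: "L2 H" and H0: "\<And>t. H t \<ge> 0" and g0: "g 0 = (0, 0)"
    and ex: "\<And>r. r > 0 \<Longrightarrow> \<exists>G w w' \<phi> \<mu>. polar G w w' \<phi> \<mu> \<and> G 0 = (0, 0) \<and> G 1 = (l, 0) \<and> energy lam G < energy lam g \<and>
     (\<forall>t\<in>{0..1}. \<bar>w t - v t\<bar> \<le> r \<and> \<bar>\<phi> t - \<psi> t\<bar> \<le> r \<and> \<bar>w' t - v' t\<bar> \<le> r * H t \<and> \<bar>\<mu> t - \<kappa> t\<bar> \<le> r * H t)"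
  shows "\<not> stable lam l g"
proof
  assume "stable lam l g"
  then obtain \<delta> where \<delta>: "\<delta> > 0" "\<And>G. G \<in> Aset l \<Longrightarrow> w22_dist G g < \<delta> \<Longrightarrow> energy lam g \<le> energy lam G"
    unfolding stable_def by blast
  obtain C where C: "C > 0" "\<And>G w w' \<phi> \<mu> r. polar G w w' \<phi> \<mu> \<Longrightarrow> G 0 = g 0 \<Longrightarrow> 0 \<le> r \<Longrightarrow> r \<le> 1 \<Longrightarrow>
     (\<And>t. t \<in> {0..1} \<Longrightarrow> \<bar>w t - v t\<bar> \<le> r \<and> \<bar>\<phi> t - \<psi> t\<bar> \<le> r \<and> \<bar>w' t - v' t\<bar> \<le> r * H t \<and> \<bar>\<mu> t - \<kappa> t\<bar> \<le> r * H t) \<Longrightarrow>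
     w22_dist G g \<le> C * r"
    using polar_dist_bound[OF P LH H0] by blast
  define r where "r = min 1 (\<delta> / (2 * C))"
  have r: "0 < r" "r \<le> 1" "C * r < \<delta>"
  proof -
    show "0 < r" "r \<le> 1" using \<delta> C by (auto simp: r_def)
    have "C * r \<le> C * (\<delta> / (2 * C))" using C by (intro mult_left_mono) (auto simp: r_def)
    then show "C * r < \<delta>" using C \<delta> by simp
  qed
  obtain G w w' \<phi> \<mu> where G: "polar G w w' \<phi> \<mu>" "G 0 = (0, 0)" "G 1 = (l, 0)" "energy lam G < energy lam g"
     "\<And>t. t \<in> {0..1} \<Longrightarrow> \<bar>w t - v t\<bar> \<le> r \<and> \<bar>\<phi> t - \<psi> t\<bar> \<le> r \<and> \<bar>w' t - v' t\<bar> \<le> r * H t \<and> \<bar>\<mu> t - \<kappa> t\<bar> \<le> r * H t"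
    using ex[OF r(1)] by blast
  have "w22_dist G g \<le> C * r" using r by (intro C(2)[OF G(1) _ _ _ G(5)]) (auto simp: G g0)
  then have "energy lam g \<le> energy lam G" using r by (intro \<delta>(2) polar_Aset[OF G(1-3)]) auto
  then show False using G(4) by simp
qed

lemma polar_primitive:
  assumes "H1 v v'" "\<And>t. t \<in> {0..1} \<Longrightarrow> v t > 0" "H1 \<psi> \<kappa>"
  shows "polar (\<lambda>t. (0 + integral {0..t} (\<lambda>t. v t * cos (\<psi> t)), 0 + integral {0..t} (\<lambda>t. v t * sin (\<psi> t)))) v v' \<psi> \<kappa>"
proof -
  note W = W22_primitive[OF H1_mult[OF assms(1) H1_cos[OF assms(3)]] H1_mult[OF assms(1) H1_sin[OF assms(3)]]]
  show ?thesis unfolding polar_def using assms W22_has_vector_derivative[OF W] by blast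
qed

section \<open>Expansion of the end point and of the energy to second order\<close>

lemma sin_expansion: "\<bar>sin h - h\<bar> \<le> \<bar>h\<bar> ^ 3" for h :: real
proof -
  have "\<bar>sin h - (\<Sum>m<3. sin_coeff m * h ^ m)\<bar> \<le> inverse (fact 3) * \<bar>h\<bar> ^ 3" by (rule Maclaurin_sin_bound)
  moreover have "(\<Sum>m<3. sin_coeff m * h ^ m) = h" by (simp add: eval_nat_numeral sin_coeff_def)
  moreover have "inverse (fact 3) * \<bar>h\<bar> ^ 3 \<le> \<bar>h\<bar> ^ 3" by (simp add: fact_numeral mult_left_le_one_le)
  ultimately show ?thesis by simp
qed

lemma cos_expansion: "\<bar>cos h - 1 + h\<^sup>2 / 2\<bar> \<le> h ^ 4" for h :: real
proof -
  have "cos h = 1 - 2 * (sin (h/2))\<^sup>2" using cos_double_sin[of "h/2"] by simp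
  then have "cos h - 1 + h\<^sup>2 / 2 = 2 * ((h/2 - sin (h/2)) * (h/2 + sin (h/2)))" by (simp add: power2_eq_square algebra_simps)
  then have "\<bar>cos h - 1 + h\<^sup>2 / 2\<bar> = 2 * (\<bar>sin (h/2) - h/2\<bar> * \<bar>h/2 + sin (h/2)\<bar>)" by (simp add: abs_mult abs_minus_commute)
  also have "\<dots> \<le> 2 * (\<bar>h/2\<bar> ^ 3 * (2 * \<bar>h/2\<bar>))"
  proof -
    have "\<bar>h/2 + sin (h/2)\<bar> \<le> 2 * \<bar>h/2\<bar>" using abs_sin_x_le_abs_x[of "h/2"] by linarith
    then show ?thesis by (intro mult_left_mono mult_mono sin_expansion) auto
  qed
  also have "\<dots> = \<bar>h\<bar> ^ 4 / 4" by (simp add: eval_nat_numeral)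
  also have "\<dots> \<le> h ^ 4" by (simp add: power_even_abs)
  finally show ?thesis .
qed

lemma cos_taylor: "\<bar>cos (a + h) - (cos a - h * sin a - h\<^sup>2 / 2 * cos a)\<bar> \<le> \<bar>h\<bar> ^ 3 + h ^ 4" for a h :: real
proof -
  have "cos (a + h) - (cos a - h * sin a - h\<^sup>2 / 2 * cos a) = cos a * (cos h - 1 + h\<^sup>2 / 2) - sin a * (sin h - h)"
    by (simp add: cos_add algebra_simps)
  also have "\<bar>\<dots>\<bar> \<le> \<bar>cos a\<bar> * \<bar>cos h - 1 + h\<^sup>2 / 2\<bar> + \<bar>sin a\<bar> * \<bar>sin h - h\<bar>"
    unfolding abs_mult[symmetric] by (rule abs_triangle_ineq4)
  also have "\<dots> \<le> 1 * h ^ 4 + 1 * \<bar>h\<bar> ^ 3"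
    by (intro add_mono mult_mono cos_expansion sin_expansion abs_cos_le_one abs_sin_le_one) auto
  finally show ?thesis by simp
qed

lemma integral_cos_expansion:
  fixes v \<psi> \<eta> :: "real \<Rightarrow> real"
  assumes c: "continuous_on {0..1} v" "continuous_on {0..1} \<psi>" "continuous_on {0..1} \<eta>"
  obtains C where "\<And>e. \<bar>e\<bar> \<le> 1 \<Longrightarrow> \<bar>integral {0..1} (\<lambda>t. v t * cos (\<psi> t + e * \<eta> t))
     - (integral {0..1} (\<lambda>t. v t * cos (\<psi> t)) - e * integral {0..1} (\<lambda>t. v t * \<eta> t * sin (\<psi> t))
        - e\<^sup>2 / 2 * integral {0..1} (\<lambda>t. v t * (\<eta> t)\<^sup>2 * cos (\<psi> t)))\<bar> \<le> C * \<bar>e\<bar> ^ 3"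
proof -
  obtain V where V: "V > 0" "\<And>t. t \<in> {0..1} \<Longrightarrow> \<bar>v t\<bar> \<le> V" using continuous_Icc_bound[OF c(1)] by blast
  obtain M where M: "M > 0" "\<And>t. t \<in> {0..1} \<Longrightarrow> \<bar>\<eta> t\<bar> \<le> M" using continuous_Icc_bound[OF c(3)] by blast
  show ?thesis
  proof (rule that)
    fix e :: real assume e: "\<bar>e\<bar> \<le> 1"
    let ?f = "\<lambda>t. v t * cos (\<psi> t + e * \<eta> t) - (v t * cos (\<psi> t) - e * (v t * \<eta> t * sin (\<psi> t)) - e\<^sup>2 / 2 * (v t * (\<eta> t)\<^sup>2 * cos (\<psi> t)))"
    have I: "(?f has_integral integral {0..1} (\<lambda>t. v t * cos (\<psi> t + e * \<eta> t))
     - (integral {0..1} (\<lambda>t. v t * cos (\<psi> t)) - e * integral {0..1} (\<lambda>t. v t * \<eta> t * sin (\<psi> t))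
        - e\<^sup>2 / 2 * integral {0..1} (\<lambda>t. v t * (\<eta> t)\<^sup>2 * cos (\<psi> t)))) {0..1}"
      by (intro has_integral_diff has_integral_mult_right integrable_integral integrable_continuous_interval continuous_intros c)
    have b: "norm (?f t) \<le> V * (M ^ 3 + M ^ 4) * \<bar>e\<bar> ^ 3" if t: "t \<in> {0..1}" for t
    proof -
      have "?f t = v t * (cos (\<psi> t + e * \<eta> t) - (cos (\<psi> t) - e * \<eta> t * sin (\<psi> t) - (e * \<eta> t)\<^sup>2 / 2 * cos (\<psi> t)))"
        by (simp add: algebra_simps power_mult_distrib)
      then have "norm (?f t) = \<bar>v t\<bar> * \<bar>cos (\<psi> t + e * \<eta> t) - (cos (\<psi> t) - e * \<eta> t * sin (\<psi> t) - (e * \<eta> t)\<^sup>2 / 2 * cos (\<psi> t))\<bar>"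
        by (simp add: abs_mult)
      also have "\<dots> \<le> V * (\<bar>e * \<eta> t\<bar> ^ 3 + (e * \<eta> t) ^ 4)"
        using V(2)[OF t] V(1) by (intro mult_mono cos_taylor) auto
      also have "\<dots> \<le> V * (\<bar>e\<bar> ^ 3 * M ^ 3 + \<bar>e\<bar> ^ 3 * M ^ 4)"
      proof -
        have "\<bar>e * \<eta> t\<bar> ^ 3 \<le> \<bar>e\<bar> ^ 3 * M ^ 3"
          unfolding abs_mult power_mult_distrib using M(2)[OF t] by (intro mult_left_mono power_mono) auto
        moreover have "(e * \<eta> t) ^ 4 \<le> \<bar>e\<bar> ^ 3 * M ^ 4"
        proof -
          have "(e * \<eta> t) ^ 4 = \<bar>e\<bar> ^ 4 * \<bar>\<eta> t\<bar> ^ 4" by (simp add: power_mult_distrib)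
          also have "\<dots> \<le> \<bar>e\<bar> ^ 3 * M ^ 4"
            using M(2)[OF t] e by (intro mult_mono power_mono power_decreasing) auto
          finally show ?thesis .
        qed
        ultimately show ?thesis using V(1) by (intro mult_left_mono add_mono) auto
      qed
      also have "\<dots> = V * (M ^ 3 + M ^ 4) * \<bar>e\<bar> ^ 3" by (simp add: algebra_simps)
      finally show ?thesis .
    qed
    have "norm (integral {0..1} ?f) \<le> integral {0..1::real} (\<lambda>_. V * (M ^ 3 + M ^ 4) * \<bar>e\<bar> ^ 3)"
    proof (rule integral_norm_bound_integral)
      show "?f integrable_on {0..1}" using I by (rule has_integral_integrable)
      show "norm (?f t) \<le> V * (M ^ 3 + M ^ 4) * \<bar>e\<bar> ^ 3" if "t \<in> {0..1}" for t by (rule b[OF that])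
    qed (rule integrable_const_ivl)
    then show "\<bar>integral {0..1} (\<lambda>t. v t * cos (\<psi> t + e * \<eta> t))
     - (integral {0..1} (\<lambda>t. v t * cos (\<psi> t)) - e * integral {0..1} (\<lambda>t. v t * \<eta> t * sin (\<psi> t))
        - e\<^sup>2 / 2 * integral {0..1} (\<lambda>t. v t * (\<eta> t)\<^sup>2 * cos (\<psi> t)))\<bar> \<le> V * (M ^ 3 + M ^ 4) * \<bar>e\<bar> ^ 3"
      unfolding integral_unique[OF I] by simp
  qed
qed

lemma limit_of_cubic_remainder:
  fixes f :: "real \<Rightarrow> real"
  assumes "\<And>e. \<bar>e\<bar> \<le> 1 \<Longrightarrow> \<bar>f e - (a + e * b + e\<^sup>2 * c)\<bar> \<le> C * \<bar>e\<bar> ^ 3"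
  shows "((\<lambda>e. (f e - a - e * b) / e\<^sup>2) \<longlongrightarrow> c) (at 0)"
proof -
  have "((\<lambda>e. (f e - a - e * b) / e\<^sup>2 - c) \<longlongrightarrow> 0) (at 0)"
  proof (rule Lim_null_comparison)
    show "((\<lambda>e. C * \<bar>e\<bar>) \<longlongrightarrow> 0) (at 0)" by (auto intro!: tendsto_eq_intros)
    show "\<forall>\<^sub>F e in at 0. norm ((f e - a - e * b) / e\<^sup>2 - c) \<le> C * \<bar>e\<bar>"
      unfolding eventually_at
    proof (intro exI[of _ 1] conjI ballI impI)
      fix e :: real assume e: "e \<noteq> 0 \<and> dist e 0 < 1"
      then have e2: "e\<^sup>2 > 0" by simp
      have "(f e - a - e * b) / e\<^sup>2 - c = (f e - (a + e * b + e\<^sup>2 * c)) / e\<^sup>2" using e by (simp add: field_simps)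
      then have "norm ((f e - a - e * b) / e\<^sup>2 - c) = \<bar>f e - (a + e * b + e\<^sup>2 * c)\<bar> / e\<^sup>2" by simp
      also have "\<dots> \<le> C * \<bar>e\<bar> ^ 3 / e\<^sup>2" using assms[of e] e e2 by (intro divide_right_mono) auto
      also have "\<dots> = C * \<bar>e\<bar>" using e by (simp add: eval_nat_numeral divide_simps)
      finally show "norm ((f e - a - e * b) / e\<^sup>2 - c) \<le> C * \<bar>e\<bar>" .
    qed simp
  qed
  then show ?thesis by (simp add: LIM_zero_iff)
qed

text \<open>Changing the angle by \<open>e * \<eta>\<close> moves the end point to (l + e
  \<open>X1\<close> + e^2 \<open>a e\<close>, e \<open>y e\<close>). Scaling the curve by 1 /
  \<open>\<rho> e\<close> restores the length of the chord, which multiplies the bending by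
  \<open>\<rho> e\<close> and divides the length by it. The hypotheses \<open>b0\<close> and
  \<open>b1\<close> express criticality and cancel the first order, so the limit is the coefficient
  of e^2.\<close>

lemma scaled_energy_limit:
  fixes a y :: "real \<Rightarrow> real"
  assumes l: "l > 0" and a: "(a \<longlongrightarrow> X2) (at 0)" and y: "(y \<longlongrightarrow> Y1) (at 0)"
    and b0: "B0 - lam * L = - p * l" and b1: "b1 = p * X1"
  defines "\<rho> \<equiv> \<lambda>e. sqrt ((l + e * X1 + e\<^sup>2 * a e)\<^sup>2 + (e * y e)\<^sup>2) / l"
  shows "(\<rho> \<longlongrightarrow> 1) (at 0)"
    and "((\<lambda>e. (\<rho> e * (B0 + e * b1 + e\<^sup>2 * b2) + lam * L / \<rho> e - (B0 + lam * L)) / e\<^sup>2) \<longlongrightarrow>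
        b2 - p * X2 - p * Y1\<^sup>2 / (2 * l) + p * X1\<^sup>2 / l + lam * L * X1\<^sup>2 / l\<^sup>2) (at 0)"
proof -
  have "(\<rho> \<longlongrightarrow> sqrt ((l + 0 * X1 + 0\<^sup>2 * X2)\<^sup>2 + (0 * Y1)\<^sup>2) / l) (at 0)"
    unfolding \<rho>_def using l by (intro tendsto_intros a y) auto
  then show \<rho>1: "(\<rho> \<longlongrightarrow> 1) (at 0)" using l by simp
  \<comment> \<open>The functions \<open>r1\<close> and \<open>s\<close> are the first and second
    divided differences of \<open>\<rho>\<close> at 0: \<open>\<rho>\<close> = 1 + e
    \<open>r1\<close> and \<open>r1\<close> = \<open>x\<close> + e \<open>s\<close>. They are
    defined by rationalizing the square root rather than by dividing by e, so their limits can be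
    read off.\<close>
  define x where "x = X1 / l"
  define m2 where "m2 = (\<lambda>e. 2 * (a e / l) + (x + e * (a e / l))\<^sup>2 + (y e / l)\<^sup>2)"
  define m1 where "m1 = (\<lambda>e. 2 * x + e * m2 e)"
  define r1 where "r1 = (\<lambda>e. m1 e / (\<rho> e + 1))"
  define s where "s = (\<lambda>e. (m2 e - x * r1 e) / (\<rho> e + 1))"
  have \<rho>0: "\<rho> e \<ge> 0" for e using l by (simp add: \<rho>_def)
  have \<rho>sq: "(\<rho> e)\<^sup>2 - 1 = e * m1 e" for e
  proof -
    have "(\<rho> e)\<^sup>2 = ((l + e * X1 + e\<^sup>2 * a e)\<^sup>2 + (e * y e)\<^sup>2) / l\<^sup>2"
      unfolding \<rho>_def power_divide by (subst real_sqrt_pow2) auto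
    also have "\<dots> = (1 + e * x + e\<^sup>2 * (a e / l))\<^sup>2 + (e * (y e / l))\<^sup>2"
      using l by (simp add: x_def power2_eq_square field_simps)
    finally show ?thesis by (simp add: m1_def m2_def power2_eq_square algebra_simps)
  qed
  have r1: "\<rho> e - 1 = e * r1 e" for e
  proof -
    have "(\<rho> e - 1) * (\<rho> e + 1) = e * m1 e" using \<rho>sq[of e] by (simp add: power2_eq_square algebra_simps)
    then show ?thesis using \<rho>0[of e] by (simp add: r1_def field_simps)
  qed
  have s: "r1 e - x = e * s e" for e
  proof -
    have "m1 e = 2 * x + e * m2 e" by (simp add: m1_def)
    then have "r1 e * (\<rho> e + 1) = 2 * x + e * m2 e" using \<rho>0[of e] by (simp add: r1_def)
    then have "(r1 e - x) * (\<rho> e + 1) = e * m2 e - x * (\<rho> e - 1)" by (simp add: algebra_simps)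
    also have "\<dots> = e * (m2 e - x * r1 e)" unfolding r1 by (simp add: algebra_simps)
    finally show ?thesis using \<rho>0[of e] by (simp add: s_def field_simps)
  qed
  have m2l: "(m2 \<longlongrightarrow> 2 * (X2 / l) + (x + 0 * (X2 / l))\<^sup>2 + (Y1 / l)\<^sup>2) (at 0)"
    unfolding m2_def using l by (intro tendsto_intros a y) auto
  have m1l: "(m1 \<longlongrightarrow> 2 * x + 0 * (2 * (X2 / l) + (x + 0 * (X2 / l))\<^sup>2 + (Y1 / l)\<^sup>2)) (at 0)"
    unfolding m1_def by (intro tendsto_intros m2l)
  have "(r1 \<longlongrightarrow> (2 * x + 0 * (2 * (X2 / l) + (x + 0 * (X2 / l))\<^sup>2 + (Y1 / l)\<^sup>2)) / (1 + 1)) (at 0)"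
    unfolding r1_def by (intro tendsto_intros m1l \<rho>1) auto
  then have r1l: "(r1 \<longlongrightarrow> x) (at 0)" by simp
  have "(s \<longlongrightarrow> ((2 * (X2 / l) + (x + 0 * (X2 / l))\<^sup>2 + (Y1 / l)\<^sup>2) - x * x) / (1 + 1)) (at 0)"
    unfolding s_def by (intro tendsto_intros m2l r1l \<rho>1) auto
  then have sl: "(s \<longlongrightarrow> X2 / l + (Y1 / l)\<^sup>2 / 2) (at 0)" by (simp add: power2_eq_square add_divide_distrib)
  have A: "((\<lambda>e. b2 - p * l * s e + r1 e * (p * X1 + e * b2) + lam * L * (r1 e)\<^sup>2 / \<rho> e) \<longlongrightarrow>
      b2 - p * l * (X2 / l + (Y1 / l)\<^sup>2 / 2) + x * (p * X1 + 0 * b2) + lam * L * x\<^sup>2 / 1) (at 0)"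
    by (intro tendsto_intros sl r1l \<rho>1) auto
  have B: "b2 - p * l * (X2 / l + (Y1 / l)\<^sup>2 / 2) + x * (p * X1 + 0 * b2) + lam * L * x\<^sup>2 / 1
     = b2 - p * X2 - p * Y1\<^sup>2 / (2 * l) + p * X1\<^sup>2 / l + lam * L * X1\<^sup>2 / l\<^sup>2"
    using l by (simp add: x_def field_simps power2_eq_square)
  have C: "\<forall>\<^sub>F e in at 0. b2 - p * l * s e + r1 e * (p * X1 + e * b2) + lam * L * (r1 e)\<^sup>2 / \<rho> e
      = (\<rho> e * (B0 + e * b1 + e\<^sup>2 * b2) + lam * L / \<rho> e - (B0 + lam * L)) / e\<^sup>2"
  proof -
    have "\<forall>\<^sub>F e in at 0. \<rho> e > 0" using order_tendstoD(1)[OF \<rho>1, of 0] by simp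
    moreover have "\<forall>\<^sub>F e in at (0::real). e \<noteq> 0" by (simp add: eventually_at_filter)
    ultimately show ?thesis
    proof eventually_elim
      case (elim e)
      have r: "\<rho> e = 1 + e * r1 e" using r1[of e] by simp
      have pls: "p * l * (e * s e) = p * l * r1 e - p * X1"
      proof -
        have "l * (e * s e) = l * r1 e - X1" using s[of e, symmetric] l by (simp add: x_def field_simps)
        then have "p * (l * (e * s e)) = p * (l * r1 e - X1)" by simp
        then show ?thesis by (simp add: algebra_simps)
      qed
      have inv: "lam * L / \<rho> e = lam * L - lam * L * (\<rho> e - 1) + lam * L * (\<rho> e - 1)\<^sup>2 / \<rho> e"
        using elim by (simp add: field_simps power2_eq_square)
      have B0: "B0 = lam * L - p * l" using b0 by simp
      have "\<rho> e * (B0 + e * b1 + e\<^sup>2 * b2) + lam * L / \<rho> e - (B0 + lam * L)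
        = (1 + e * r1 e) * (lam * L - p * l + e * (p * X1) + e\<^sup>2 * b2) - (lam * L - p * l) - lam * L * (e * r1 e) + lam * L * (e * r1 e)\<^sup>2 / \<rho> e"
        unfolding inv B0 b1 r1 by (simp add: r)
      also have "\<dots> = e * (e * b2) - e * (p * l * r1 e - p * X1) + e\<^sup>2 * (r1 e * (p * X1 + e * b2)) + e\<^sup>2 * (lam * L * (r1 e)\<^sup>2 / \<rho> e)"
        by (simp add: algebra_simps power2_eq_square)
      also have "\<dots> = e\<^sup>2 * (b2 - p * l * s e + r1 e * (p * X1 + e * b2) + lam * L * (r1 e)\<^sup>2 / \<rho> e)"
        unfolding pls[symmetric] by (simp add: algebra_simps power2_eq_square)
      finally show ?case using elim by simp
    qed
  qed
  show "((\<lambda>e. (\<rho> e * (B0 + e * b1 + e\<^sup>2 * b2) + lam * L / \<rho> e - (B0 + lam * L)) / e\<^sup>2) \<longlongrightarrow>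
        b2 - p * X2 - p * Y1\<^sup>2 / (2 * l) + p * X1\<^sup>2 / l + lam * L * X1\<^sup>2 / l\<^sup>2) (at 0)"
    using Lim_transform_eventually[OF A C] unfolding B .
qed

text \<open>Only the angle is varied, by \<open>e * \<eta>\<close>; the curve is then rotated by
  \<open>- \<beta> e\<close> and scaled by 1 / \<open>\<rho> e\<close>, so the whole family stays in
  \<open>Aset l\<close>. The left side of \<open>neg\<close> is the coefficient of e^2 of its
  energy. The term in \<open>Y1\<close> comes from the rotation, the remaining terms in
  \<open>p\<close> and \<open>lam\<close> from the scaling.\<close>

lemma second_variation_unstable:
  assumes P: "polar g v v' \<psi> \<kappa>" and g0: "g 0 = (0, 0)" and g1: "g 1 = (l, 0)" and l: "l > 0"
    and H\<eta>: "H1 \<eta> h"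
    and X1: "X1 = - integral {0..1} (\<lambda>t. v t * \<eta> t * sin (\<psi> t))"
    and Y1: "Y1 = integral {0..1} (\<lambda>t. v t * \<eta> t * cos (\<psi> t))"
    and b0: "integral {0..1} (\<lambda>t. (\<kappa> t)\<^sup>2 / v t) - lam * integral {0..1} v = - p * l"
    and b1: "integral {0..1} (\<lambda>t. 2 * \<kappa> t * h t / v t) = p * X1"
    and neg: "integral {0..1} (\<lambda>t. (h t)\<^sup>2 / v t) + p / 2 * integral {0..1} (\<lambda>t. v t * (\<eta> t)\<^sup>2 * cos (\<psi> t))
       - p * Y1\<^sup>2 / (2 * l) + p * X1\<^sup>2 / l + lam * integral {0..1} v * X1\<^sup>2 / l\<^sup>2 < 0"
  shows "\<not> stable lam l g"
proof -
  note Hv = polarD(1)[OF P] and vp = polarD(2)[OF P] and H\<psi> = polarD(3)[OF P]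
  note cv = H1_continuous[OF Hv] and c\<psi> = H1_continuous[OF H\<psi>] and c\<eta> = H1_continuous[OF H\<eta>]
  define L where "L = integral {0..1} v"
  define X Y where "X = (\<lambda>e. integral {0..1} (\<lambda>t. v t * cos (\<psi> t + e * \<eta> t)))"
    and "Y = (\<lambda>e. integral {0..1} (\<lambda>t. v t * sin (\<psi> t + e * \<eta> t)))"
  have Ic: "integral {0..1} (\<lambda>t. v t * cos (\<psi> t)) = l" using H1_eq[OF polar_fst[OF P], of 1] g0 g1 by simp
  have Is: "integral {0..1} (\<lambda>t. v t * sin (\<psi> t)) = 0" using H1_eq[OF polar_snd[OF P], of 1] g0 g1 by simp
  define X2 where "X2 = - (1/2) * integral {0..1} (\<lambda>t. v t * (\<eta> t)\<^sup>2 * cos (\<psi> t))"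
  define a y where "a = (\<lambda>e. (X e - l - e * X1) / e\<^sup>2)" and "y = (\<lambda>e. Y e / e)"
  have al: "(a \<longlongrightarrow> X2) (at 0)"
  proof -
    obtain C where C: "\<And>e. \<bar>e\<bar> \<le> 1 \<Longrightarrow> \<bar>integral {0..1} (\<lambda>t. v t * cos (\<psi> t + e * \<eta> t))
     - (integral {0..1} (\<lambda>t. v t * cos (\<psi> t)) - e * integral {0..1} (\<lambda>t. v t * \<eta> t * sin (\<psi> t))
        - e\<^sup>2 / 2 * integral {0..1} (\<lambda>t. v t * (\<eta> t)\<^sup>2 * cos (\<psi> t)))\<bar> \<le> C * \<bar>e\<bar> ^ 3"
      using integral_cos_expansion[OF cv c\<psi> c\<eta>] by blast
    show ?thesis unfolding a_def
    proof (rule limit_of_cubic_remainder)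
      fix e :: real assume "\<bar>e\<bar> \<le> 1"
      from C[OF this] show "\<bar>X e - (l + e * X1 + e\<^sup>2 * X2)\<bar> \<le> C * \<bar>e\<bar> ^ 3"
        unfolding X_def X2_def X1 Ic by (simp add: algebra_simps)
    qed
  qed
  have yl: "(y \<longlongrightarrow> Y1) (at 0)"
  proof -
    \<comment> \<open>The expansion for the sine is the one for the cosine with the angle shifted by
      pi/2.\<close>
    have cc: "continuous_on {0..1} (\<lambda>t. \<psi> t - pi/2)" by (intro continuous_intros c\<psi>)
    have sh: "cos (z - pi/2 + w) = sin (z + w)" "cos (z - pi/2) = sin z" "sin (z - pi/2) = - cos z" for z w :: real
    proof -
      have "z - pi/2 + w = (z + w) - pi/2" by simp
      then show "cos (z - pi/2 + w) = sin (z + w)" by (simp only: cos_diff) simp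
    qed (simp_all add: cos_diff sin_diff)
    obtain C where C: "\<And>e. \<bar>e\<bar> \<le> 1 \<Longrightarrow> \<bar>integral {0..1} (\<lambda>t. v t * cos (\<psi> t - pi/2 + e * \<eta> t))
     - (integral {0..1} (\<lambda>t. v t * cos (\<psi> t - pi/2)) - e * integral {0..1} (\<lambda>t. v t * \<eta> t * sin (\<psi> t - pi/2))
        - e\<^sup>2 / 2 * integral {0..1} (\<lambda>t. v t * (\<eta> t)\<^sup>2 * cos (\<psi> t - pi/2)))\<bar> \<le> C * \<bar>e\<bar> ^ 3"
      using integral_cos_expansion[OF cv cc c\<eta>] by blast
    define Y2 where "Y2 = - (1/2) * integral {0..1} (\<lambda>t. v t * (\<eta> t)\<^sup>2 * sin (\<psi> t))"
    have "((\<lambda>e. (Y e - 0 - e * Y1) / e\<^sup>2) \<longlongrightarrow> Y2) (at 0)"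
    proof (rule limit_of_cubic_remainder)
      fix e :: real assume "\<bar>e\<bar> \<le> 1"
      from C[OF this] show "\<bar>Y e - (0 + e * Y1 + e\<^sup>2 * Y2)\<bar> \<le> C * \<bar>e\<bar> ^ 3"
        unfolding Y_def Y2_def Y1 sh Is by (simp add: algebra_simps)
    qed
    then have "((\<lambda>e. Y1 + e * ((Y e - 0 - e * Y1) / e\<^sup>2)) \<longlongrightarrow> Y1 + 0 * Y2) (at 0)"
      by (intro tendsto_intros)
    moreover have "\<forall>\<^sub>F e in at 0. Y1 + e * ((Y e - 0 - e * Y1) / e\<^sup>2) = y e"
      unfolding eventually_at_filter by (rule always_eventually) (simp add: y_def field_simps power2_eq_square)
    ultimately show ?thesis by (auto elim: Lim_transform_eventually)
  qed
  define B0 b2 where "B0 = integral {0..1} (\<lambda>t. (\<kappa> t)\<^sup>2 / v t)" and "b2 = integral {0..1} (\<lambda>t. (h t)\<^sup>2 / v t)"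
  define \<rho> where "\<rho> = (\<lambda>e. sqrt ((l + e * X1 + e\<^sup>2 * a e)\<^sup>2 + (e * y e)\<^sup>2) / l)"
  have b0': "B0 - lam * L = - p * l" using b0 by (simp add: B0_def L_def)
  have lim1: "(\<rho> \<longlongrightarrow> 1) (at 0)" using scaled_energy_limit(1)[OF l al yl b0' refl] unfolding \<rho>_def .
  have lim2: "((\<lambda>e. (\<rho> e * (B0 + e * (p * X1) + e\<^sup>2 * b2) + lam * L / \<rho> e - (B0 + lam * L)) / e\<^sup>2) \<longlongrightarrow>
        b2 - p * X2 - p * Y1\<^sup>2 / (2 * l) + p * X1\<^sup>2 / l + lam * L * X1\<^sup>2 / l\<^sup>2) (at 0)"
    using scaled_energy_limit(2)[OF l al yl b0' refl] unfolding \<rho>_def .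
  have E2: "b2 - p * X2 - p * Y1\<^sup>2 / (2 * l) + p * X1\<^sup>2 / l + lam * L * X1\<^sup>2 / l\<^sup>2 < 0"
    using neg unfolding b2_def X2_def L_def by simp
  \<comment> \<open>The direction of the displaced end point; the arctangent suffices because
    \<open>X e\<close> tends to \<open>l\<close>, hence is positive.\<close>
  define \<beta> where "\<beta> = (\<lambda>e. arctan (Y e / X e))"
  have Xf: "\<forall>\<^sub>F e in at 0. X e = l + e * X1 + e\<^sup>2 * a e \<and> Y e = e * y e"
    unfolding eventually_at_filter by (rule always_eventually) (simp add: a_def y_def)
  have Xl: "(X \<longlongrightarrow> l) (at 0)"
  proof -
    have "((\<lambda>e. l + e * X1 + e\<^sup>2 * a e) \<longlongrightarrow> l + 0 * X1 + 0\<^sup>2 * X2) (at 0)" by (intro tendsto_intros al)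
    moreover have "\<forall>\<^sub>F e in at 0. l + e * X1 + e\<^sup>2 * a e = X e" using Xf by eventually_elim auto
    ultimately show ?thesis by (auto elim: Lim_transform_eventually)
  qed
  have Yl: "(Y \<longlongrightarrow> 0) (at 0)"
  proof -
    have "((\<lambda>e. e * y e) \<longlongrightarrow> 0 * Y1) (at 0)" by (intro tendsto_intros yl)
    moreover have "\<forall>\<^sub>F e in at 0. e * y e = Y e" using Xf by eventually_elim auto
    ultimately show ?thesis by (auto elim: Lim_transform_eventually)
  qed
  have "(\<beta> \<longlongrightarrow> arctan (0 / l)) (at 0)" unfolding \<beta>_def using l by (intro tendsto_intros Xl Yl) auto
  then have \<beta>l: "(\<beta> \<longlongrightarrow> 0) (at 0)" by simp
  obtain V where V: "V > 0" "\<And>t. t \<in> {0..1} \<Longrightarrow> \<bar>v t\<bar> \<le> V" using continuous_Icc_bound[OF cv] by blast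
  obtain M where M: "M > 0" "\<And>t. t \<in> {0..1} \<Longrightarrow> \<bar>\<eta> t\<bar> \<le> M" using continuous_Icc_bound[OF c\<eta>] by blast
  have "((\<lambda>e. \<bar>1 / \<rho> e - 1\<bar> * (V + 1)) \<longlongrightarrow> \<bar>1 / 1 - 1\<bar> * (V + 1)) (at 0)" by (intro tendsto_intros lim1) auto
  then have sm1: "((\<lambda>e. \<bar>1 / \<rho> e - 1\<bar> * (V + 1)) \<longlongrightarrow> 0) (at 0)" by simp
  have "((\<lambda>e. \<bar>e\<bar> * (M + 1) + \<bar>\<beta> e\<bar>) \<longlongrightarrow> \<bar>0\<bar> * (M + 1) + \<bar>0\<bar>) (at 0)" by (intro tendsto_intros \<beta>l)
  then have sm2: "((\<lambda>e. \<bar>e\<bar> * (M + 1) + \<bar>\<beta> e\<bar>) \<longlongrightarrow> 0) (at 0)" by simp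
  show ?thesis
  proof (rule not_stableI[OF P, where H="\<lambda>t. \<bar>v' t\<bar> + \<bar>h t\<bar>"])
    \<comment> \<open>Scaling changes \<open>v'\<close> by a multiple of itself, and the variation
      changes \<open>\<kappa>\<close> by a multiple of \<open>h\<close>; this sum controls both
      errors.\<close>
    show "L2 (\<lambda>t. \<bar>v' t\<bar> + \<bar>h t\<bar>)" by (rule L2_add[OF L2_abs[OF H1_L2[OF Hv]] L2_abs[OF H1_L2[OF H\<eta>]]])
    show "g 0 = (0, 0)" by (rule g0)
    fix r :: real assume r: "r > 0"
    have "\<forall>\<^sub>F e in at 0. (\<rho> e * (B0 + e * (p * X1) + e\<^sup>2 * b2) + lam * L / \<rho> e - (B0 + lam * L)) / e\<^sup>2 < 0"
      using order_tendstoD(2)[OF lim2 E2] .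
    moreover have "\<forall>\<^sub>F e in at 0. \<rho> e > 0" using order_tendstoD(1)[OF lim1, of 0] by simp
    moreover have "\<forall>\<^sub>F e in at 0. X e > 0" using order_tendstoD(1)[OF Xl l] .
    moreover have "\<forall>\<^sub>F e in at 0. \<bar>1 / \<rho> e - 1\<bar> * (V + 1) < r" using order_tendstoD(2)[OF sm1 r] .
    moreover have "\<forall>\<^sub>F e in at 0. \<bar>e\<bar> * (M + 1) + \<bar>\<beta> e\<bar> < r" using order_tendstoD(2)[OF sm2 r] .
    moreover have "\<forall>\<^sub>F e in at (0::real). e \<noteq> 0" by (simp add: eventually_at_filter)
    ultimately have "\<forall>\<^sub>F e in at 0. (\<rho> e * (B0 + e * (p * X1) + e\<^sup>2 * b2) + lam * L / \<rho> e - (B0 + lam * L)) / e\<^sup>2 < 0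
      \<and> \<rho> e > 0 \<and> X e > 0 \<and> \<bar>1 / \<rho> e - 1\<bar> * (V + 1) < r \<and> \<bar>e\<bar> * (M + 1) + \<bar>\<beta> e\<bar> < r \<and> e \<noteq> 0
      \<and> X e = l + e * X1 + e\<^sup>2 * a e \<and> Y e = e * y e"
      using Xf by eventually_elim auto
    then have "\<exists>e. (\<rho> e * (B0 + e * (p * X1) + e\<^sup>2 * b2) + lam * L / \<rho> e - (B0 + lam * L)) / e\<^sup>2 < 0
      \<and> \<rho> e > 0 \<and> X e > 0 \<and> \<bar>1 / \<rho> e - 1\<bar> * (V + 1) < r \<and> \<bar>e\<bar> * (M + 1) + \<bar>\<beta> e\<bar> < r \<and> e \<noteq> 0
      \<and> X e = l + e * X1 + e\<^sup>2 * a e \<and> Y e = e * y e"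
      by (intro eventually_happens') auto
    then obtain e where q: "(\<rho> e * (B0 + e * (p * X1) + e\<^sup>2 * b2) + lam * L / \<rho> e - (B0 + lam * L)) / e\<^sup>2 < 0"
      and \<rho>p: "\<rho> e > 0" and Xp: "X e > 0" and s1: "\<bar>1 / \<rho> e - 1\<bar> * (V + 1) < r" and s2: "\<bar>e\<bar> * (M + 1) + \<bar>\<beta> e\<bar> < r" and e0: "e \<noteq> 0"
      and XY: "X e = l + e * X1 + e\<^sup>2 * a e" "Y e = e * y e" by blast
    define w w' where "w = (\<lambda>t. 1 / \<rho> e * v t)" and "w' = (\<lambda>t. 1 / \<rho> e * v' t)"
    define \<phi> \<mu> where "\<phi> = (\<lambda>t. \<psi> t + e * \<eta> t - \<beta> e)" and "\<mu> = (\<lambda>t. \<kappa> t + e * h t - 0)"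
    have Hw: "H1 w w'" unfolding w_def w'_def by (rule H1_cmult[OF Hv])
    have H\<phi>: "H1 \<phi> \<mu>" unfolding \<phi>_def \<mu>_def by (intro H1_diff H1_add H\<psi> H1_cmult H\<eta> H1_const)
    define G where "G = (\<lambda>t. (0 + integral {0..t} (\<lambda>t. w t * cos (\<phi> t)), 0 + integral {0..t} (\<lambda>t. w t * sin (\<phi> t))))"
    have PG: "polar G w w' \<phi> \<mu>" unfolding G_def by (rule polar_primitive[OF Hw _ H\<phi>]) (use vp \<rho>p in \<open>auto simp: w_def\<close>)
    define R where "R = sqrt ((X e)\<^sup>2 + (Y e)\<^sup>2)"
    have R: "R > 0" "\<rho> e = R / l" using Xp by (auto simp: R_def \<rho>_def XY add_pos_nonneg)
    have R2: "R * R = X e * X e + Y e * Y e" by (simp add: R_def power2_eq_square[symmetric])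
    have sq: "sqrt (1 + (Y e / X e)\<^sup>2) = R / X e"
    proof -
      have "1 + (Y e / X e)\<^sup>2 = ((X e)\<^sup>2 + (Y e)\<^sup>2) / (X e)\<^sup>2" using Xp by (simp add: power_divide add_divide_distrib)
      then show ?thesis using Xp by (simp add: R_def real_sqrt_divide)
    qed
    have cb: "cos (\<beta> e) = X e / R" "sin (\<beta> e) = Y e / R"
      unfolding \<beta>_def cos_arctan sin_arctan sq using Xp R by auto
    have iX: "((\<lambda>t. v t * cos (\<psi> t + e * \<eta> t)) has_integral X e) {0..1}" and iY: "((\<lambda>t. v t * sin (\<psi> t + e * \<eta> t)) has_integral Y e) {0..1}"
      unfolding X_def Y_def by (intro integrable_integral integrable_continuous_interval continuous_intros cv c\<psi> c\<eta>)+
    have "((\<lambda>t. 1 / \<rho> e * (cos (\<beta> e) * (v t * cos (\<psi> t + e * \<eta> t)) + sin (\<beta> e) * (v t * sin (\<psi> t + e * \<eta> t)))) has_integral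
       1 / \<rho> e * (cos (\<beta> e) * X e + sin (\<beta> e) * Y e)) {0..1}"
      by (intro has_integral_mult_right has_integral_add iX iY)
    then have "integral {0..1} (\<lambda>t. w t * cos (\<phi> t)) = 1 / \<rho> e * (cos (\<beta> e) * X e + sin (\<beta> e) * Y e)"
      by (intro integral_unique) (simp add: w_def \<phi>_def cos_diff algebra_simps)
    also have "\<dots> = 1 / \<rho> e * ((X e * X e + Y e * Y e) / R)" unfolding cb by (simp add: add_divide_distrib)
    also have "\<dots> = l" unfolding R2[symmetric] using R l by simp
    finally have G1x: "integral {0..1} (\<lambda>t. w t * cos (\<phi> t)) = l" .
    have "((\<lambda>t. 1 / \<rho> e * (cos (\<beta> e) * (v t * sin (\<psi> t + e * \<eta> t)) - sin (\<beta> e) * (v t * cos (\<psi> t + e * \<eta> t)))) has_integral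
       1 / \<rho> e * (cos (\<beta> e) * Y e - sin (\<beta> e) * X e)) {0..1}"
      by (intro has_integral_mult_right has_integral_diff iX iY)
    then have "integral {0..1} (\<lambda>t. w t * sin (\<phi> t)) = 1 / \<rho> e * (cos (\<beta> e) * Y e - sin (\<beta> e) * X e)"
      by (intro integral_unique) (simp add: w_def \<phi>_def sin_diff algebra_simps)
    also have "\<dots> = 0" unfolding cb by simp
    finally have G1y: "integral {0..1} (\<lambda>t. w t * sin (\<phi> t)) = 0" .
    have G01: "G 0 = (0, 0)" "G 1 = (l, 0)" by (simp_all add: G_def G1x G1y)
    have cvi: "continuous_on {0..1} (\<lambda>t. 1 / v t)" using vp by (intro continuous_intros cv) (auto simp: less_le)
    have Lh: "L2 h" "L2 \<kappa>" by (rule H1_L2[OF H\<eta>], rule H1_L2[OF H\<psi>])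
    have bb: "(\<lambda>t. f t * k t / v t) integrable_on {0..1}" if "L2 f" "L2 k" for f k
      using L2_mult_absolutely_integrable[OF L2_cont_mult[OF cvi that(1)] that(2)] by (simp add: absolutely_integrable_on_def)
    have eG: "energy lam G = \<rho> e * (B0 + e * (p * X1) + e\<^sup>2 * b2) + lam * L / \<rho> e"
    proof -
      have i0: "((\<lambda>t. (\<kappa> t)\<^sup>2 / v t) has_integral B0) {0..1}" "((\<lambda>t. (h t)\<^sup>2 / v t) has_integral b2) {0..1}"
        unfolding B0_def b2_def using bb[OF Lh(2) Lh(2)] bb[OF Lh(1) Lh(1)] by (auto simp: power2_eq_square intro!: integrable_integral)
      have "(\<lambda>t. 2 * (\<kappa> t * h t / v t)) integrable_on {0..1}" by (rule integrable_on_mult_right[OF bb[OF Lh(2) Lh(1)]])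
      then have i1: "((\<lambda>t. 2 * \<kappa> t * h t / v t) has_integral p * X1) {0..1}"
        unfolding b1[symmetric] by (intro integrable_integral) (simp add: mult.assoc)
      have "((\<lambda>t. \<rho> e * ((\<kappa> t)\<^sup>2 / v t + e * (2 * \<kappa> t * h t / v t) + e\<^sup>2 * ((h t)\<^sup>2 / v t))) has_integral
        \<rho> e * (B0 + e * (p * X1) + e\<^sup>2 * b2)) {0..1}"
        by (intro has_integral_mult_right has_integral_add i0 i1)
      then have "integral {0..1} (\<lambda>t. (\<mu> t)\<^sup>2 / w t) = \<rho> e * (B0 + e * (p * X1) + e\<^sup>2 * b2)"
        by (intro integral_unique) (simp add: \<mu>_def w_def power2_sum power_mult_distrib add_divide_distrib algebra_simps)
      moreover have "integral {0..1} w = L / \<rho> e" by (simp add: w_def L_def)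
      ultimately show ?thesis unfolding polar_energy[OF PG] by simp
    qed
    have "\<rho> e * (B0 + e * (p * X1) + e\<^sup>2 * b2) + lam * L / \<rho> e - (B0 + lam * L) < 0"
      using q e0 by (simp add: divide_less_0_iff)
    then have less: "energy lam G < energy lam g" unfolding eG polar_energy[OF P] B0_def L_def by simp
    have cl: "\<bar>w t - v t\<bar> \<le> r \<and> \<bar>\<phi> t - \<psi> t\<bar> \<le> r \<and> \<bar>w' t - v' t\<bar> \<le> r * (\<bar>v' t\<bar> + \<bar>h t\<bar>) \<and> \<bar>\<mu> t - \<kappa> t\<bar> \<le> r * (\<bar>v' t\<bar> + \<bar>h t\<bar>)"
      if t: "t \<in> {0..1}" for t
    proof (intro conjI)
      have z: "\<bar>1 / \<rho> e - 1\<bar> * V \<le> r" "\<bar>1 / \<rho> e - 1\<bar> \<le> r"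
      proof -
        define A where "A = \<bar>1 / \<rho> e - 1\<bar>"
        have "0 \<le> A" "0 \<le> A * V" using V(1) by (simp_all add: A_def)
        moreover have "A * V + A < r" using s1 unfolding A_def[symmetric] by (simp add: distrib_left)
        ultimately have "A * V \<le> r" "A \<le> r" by linarith+
        then show "\<bar>1 / \<rho> e - 1\<bar> * V \<le> r" "\<bar>1 / \<rho> e - 1\<bar> \<le> r" by (simp_all add: A_def)
      qed
      have e': "\<bar>e\<bar> * M + \<bar>\<beta> e\<bar> \<le> r" "\<bar>e\<bar> \<le> r"
      proof -
        have "0 \<le> \<bar>e\<bar> * M" "0 \<le> \<bar>\<beta> e\<bar>" using M(1) by simp_all
        moreover have "\<bar>e\<bar> * M + \<bar>e\<bar> + \<bar>\<beta> e\<bar> < r" using s2 by (simp add: distrib_left)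
        moreover have "0 \<le> \<bar>e\<bar>" by simp
        ultimately show "\<bar>e\<bar> * M + \<bar>\<beta> e\<bar> \<le> r" "\<bar>e\<bar> \<le> r" by linarith+
      qed
      have "w t - v t = (1 / \<rho> e - 1) * v t" by (simp add: w_def algebra_simps)
      then have "\<bar>w t - v t\<bar> \<le> \<bar>1 / \<rho> e - 1\<bar> * V" using V(2)[OF t] by (simp add: abs_mult mult_left_mono)
      then show "\<bar>w t - v t\<bar> \<le> r" using z by linarith
      have "\<bar>e * \<eta> t\<bar> \<le> \<bar>e\<bar> * M" using M(2)[OF t] by (simp add: abs_mult mult_left_mono)
      then show "\<bar>\<phi> t - \<psi> t\<bar> \<le> r" unfolding \<phi>_def using e'(1) by linarith
      have "w' t - v' t = (1 / \<rho> e - 1) * v' t" by (simp add: w'_def algebra_simps)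
      then have "\<bar>w' t - v' t\<bar> = \<bar>1 / \<rho> e - 1\<bar> * \<bar>v' t\<bar>" by (simp add: abs_mult)
      also have "\<dots> \<le> r * (\<bar>v' t\<bar> + \<bar>h t\<bar>)" using z r by (intro mult_mono) auto
      finally show "\<bar>w' t - v' t\<bar> \<le> r * (\<bar>v' t\<bar> + \<bar>h t\<bar>)" .
      have "\<bar>\<mu> t - \<kappa> t\<bar> = \<bar>e\<bar> * \<bar>h t\<bar>" by (simp add: \<mu>_def abs_mult)
      also have "\<dots> \<le> r * (\<bar>v' t\<bar> + \<bar>h t\<bar>)" using e'(2) r by (intro mult_mono) auto
      finally show "\<bar>\<mu> t - \<kappa> t\<bar> \<le> r * (\<bar>v' t\<bar> + \<bar>h t\<bar>)" .
    qed
    show "\<exists>G w w' \<phi> \<mu>. polar G w w' \<phi> \<mu> \<and> G 0 = (0, 0) \<and> G 1 = (l, 0) \<and> energy lam G < energy lam g \<and>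
     (\<forall>t\<in>{0..1}. \<bar>w t - v t\<bar> \<le> r \<and> \<bar>\<phi> t - \<psi> t\<bar> \<le> r \<and> \<bar>w' t - v' t\<bar> \<le> r * (\<bar>v' t\<bar> + \<bar>h t\<bar>) \<and> \<bar>\<mu> t - \<kappa> t\<bar> \<le> r * (\<bar>v' t\<bar> + \<bar>h t\<bar>))"
      using PG G01 less cl by blast
  qed simp
qed

section \<open>Unstable critical curves\<close>

lemma has_integral_cut:
  fixes f :: "real \<Rightarrow> real"
  assumes "(f has_integral I) {0..b}" "0 \<le> b" "b \<le> 1"
  shows "((\<lambda>t. if t \<le> b then f t else 0) has_integral I) {0..1}"
proof -
  have "((\<lambda>t. if t \<in> {0..b} then f t else 0) has_integral I) {0..1}"
    using assms by (subst has_integral_restrict) auto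
  then show ?thesis by (rule has_integral_eq[rotated]) auto
qed

lemma H1_cut:
  assumes f: "H1 f f'" and b: "0 \<le> b" "b \<le> 1" and z: "f b = 0"
  shows "H1 (\<lambda>t. if t \<le> b then f t else 0) (\<lambda>t. if t \<le> b then f' t else 0)"
  unfolding H1_def
proof (intro conjI ballI)
  have "L2 (\<lambda>t. indicator {..b} t * f' t)"
  proof (rule L2_bounded_mult[OF _ _ H1_L2[OF f]])
    show "indicator {..b} \<in> borel_measurable (lebesgue_on {0..1})"
      by (intro measurable_restrict_space1 borel_measurable_indicator sets_completionI_sets) auto
    show "bounded (indicator {..b} ` {0..1} :: real set)"
      by (rule boundedI[of _ 1]) (auto simp: indicator_def)
  qed
  then show "L2 (\<lambda>t. if t \<le> b then f' t else 0)" by (rule L2_cong) (auto simp: indicator_def)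
  fix t :: real assume t: "t \<in> {0..1}"
  show "(if t \<le> b then f t else 0) = (if 0 \<le> b then f 0 else 0) + integral {0..t} (\<lambda>t. if t \<le> b then f' t else 0)"
  proof (cases "t \<le> b")
    case True
    have "integral {0..t} (\<lambda>t. if t \<le> b then f' t else 0) = integral {0..t} f'" using True by (intro integral_cong) auto
    then show ?thesis using H1_eq[OF f t] True b by simp
  next
    case False
    have "((\<lambda>t. if t \<in> {0..b} then f' t else 0) has_integral integral {0..b} f') {0..t}"
      using False b t by (subst has_integral_restrict) (auto intro!: integrable_integral L2_integrable_sub[OF H1_L2[OF f]])
    then have "((\<lambda>t. if t \<le> b then f' t else 0) has_integral integral {0..b} f') {0..t}"
      by (rule has_integral_eq[rotated]) auto
    then have "integral {0..t} (\<lambda>t. if t \<le> b then f' t else 0) = integral {0..b} f'" by (rule integral_unique)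
    then show ?thesis using H1_eq[OF f, of b] z False b by simp
  qed
qed

text \<open>The form in which elasticae are used from here on: the angular velocity is replaced by
  the continuous function that the Euler-Lagrange equation provides, and \<open>EL\<close> is its
  first integral. The sign of \<open>p\<close> is left open.\<close>

locale critical_curve =
  fixes g :: curve and v v' \<psi> :: "real \<Rightarrow> real" and p lam l :: real
  assumes P: "polar g v v' \<psi> (\<lambda>t. p * snd (g t) * v t / 2)"
    and g0: "g 0 = (0, 0)" and g1: "g 1 = (l, 0)" and l: "l > 0" and lam: "lam > 0"
    and EL: "\<And>t. t \<in> {0..1} \<Longrightarrow> lam - p\<^sup>2 * (snd (g t))\<^sup>2 / 4 = p * cos (\<psi> t)"
begin

abbreviation "y \<equiv> \<lambda>t. snd (g t)"
abbreviation "x \<equiv> \<lambda>t. fst (g t)"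
abbreviation "\<kappa> \<equiv> \<lambda>t. p * y t * v t / 2"

lemmas Hv = polarD(1)[OF P] and vp = polarD(2)[OF P] and H\<psi> = polarD(3)[OF P]
lemmas Hy = polar_snd[OF P] and Hx = polar_fst[OF P]
lemmas cv = H1_continuous[OF Hv] and c\<psi> = H1_continuous[OF H\<psi>] and cy = H1_continuous[OF Hy] and cx = H1_continuous[OF Hx]

lemma y01: "y 0 = 0" "y 1 = 0" using g0 g1 by auto

lemma p_nz: "p \<noteq> 0" using EL[of 0] lam by auto

lemma cos_at_zero: "t \<in> {0..1} \<Longrightarrow> y t = 0 \<Longrightarrow> cos (\<psi> t) = lam / p"
  using EL[of t] p_nz by (simp add: field_simps)

lemma integral_v_cos: "integral {0..1} (\<lambda>t. v t * cos (\<psi> t)) = l" using H1_eq[OF Hx, of 1] g0 g1 by simp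

text \<open>The stationarity under scaling, up to the work of the multiplier along the chord,
  obtained here by integrating \<open>EL\<close> against the speed.\<close>

lemma energy_balance: "integral {0..1} (\<lambda>t. (\<kappa> t)\<^sup>2 / v t) - lam * integral {0..1} v = - p * l"
proof -
  have "integral {0..1} (\<lambda>t. (\<kappa> t)\<^sup>2 / v t) = integral {0..1} (\<lambda>t. lam * v t - p * (v t * cos (\<psi> t)))"
  proof (rule integral_cong)
    fix t :: real assume t: "t \<in> {0..1}"
    have "(\<kappa> t)\<^sup>2 / v t = p\<^sup>2 * (y t)\<^sup>2 / 4 * v t"
      using vp[OF t] by (simp add: power2_eq_square)
    also have "p\<^sup>2 * (y t)\<^sup>2 / 4 = lam - p * cos (\<psi> t)" using EL[OF t] by simp
    finally show "(\<kappa> t)\<^sup>2 / v t = lam * v t - p * (v t * cos (\<psi> t))" by (simp add: algebra_simps)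
  qed
  also have "\<dots> = integral {0..1} (\<lambda>t. lam * v t) - integral {0..1} (\<lambda>t. p * (v t * cos (\<psi> t)))"
    by (intro Henstock_Kurzweil_Integration.integral_diff integrable_continuous_interval continuous_intros cv c\<psi>)
  also have "\<dots> = lam * integral {0..1} v - p * l" using integral_v_cos by simp
  finally show ?thesis by simp
qed

text \<open>Integration by parts of \<open>\<eta>\<close> against \<open>y\<close>, without boundary
  terms because \<open>y\<close> vanishes at both ends. It supplies the first-order hypothesis of
  the instability criterion.\<close>

lemma bending_variation:
  assumes "H1 \<eta> h"
  shows "integral {0..1} (\<lambda>t. 2 * \<kappa> t * h t / v t) = p * (- integral {0..1} (\<lambda>t. v t * \<eta> t * sin (\<psi> t)))"
proof -
  have "integral {0..1} (\<lambda>t. 2 * \<kappa> t * h t / v t) = integral {0..1} (\<lambda>t. p * (h t * y t))"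
    by (rule integral_cong) (use vp in \<open>force simp: field_simps\<close>)
  also have "\<dots> = p * integral {0..1} (\<lambda>t. h t * y t)" by simp
  also have "integral {0..1} (\<lambda>t. h t * y t) = - integral {0..1} (\<lambda>t. v t * \<eta> t * sin (\<psi> t))"
  proof -
    have "integral {0..1} (\<lambda>t. h t * y t + \<eta> t * (v t * sin (\<psi> t))) = 0"
      using H1_by_parts[OF assms Hy] y01 by simp
    moreover have "integral {0..1} (\<lambda>t. h t * y t + \<eta> t * (v t * sin (\<psi> t))) = integral {0..1} (\<lambda>t. h t * y t) + integral {0..1} (\<lambda>t. \<eta> t * (v t * sin (\<psi> t)))"
    proof (rule Henstock_Kurzweil_Integration.integral_add)
      show "(\<lambda>t. h t * y t) integrable_on {0..1}"
        using L2_mult_absolutely_integrable[OF H1_L2[OF assms] continuous_on_imp_L2[OF cy]] by (simp add: absolutely_integrable_on_def)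
      show "(\<lambda>t. \<eta> t * (v t * sin (\<psi> t))) integrable_on {0..1}"
        by (intro integrable_continuous_interval continuous_intros cv c\<psi> H1_continuous[OF assms])
    qed
    moreover have "integral {0..1} (\<lambda>t. \<eta> t * (v t * sin (\<psi> t))) = integral {0..1} (\<lambda>t. v t * \<eta> t * sin (\<psi> t))"
      by (rule integral_cong) (simp add: mult_ac)
    ultimately show ?thesis by linarith
  qed
  finally show ?thesis .
qed

text \<open>The variation \<open>y\<close> is the Jacobi field of translations along the elastica. It vanishes at
  the zeros of \<open>y\<close>, so cutting it off at such a zero leaves the second variation zero but
  destroys the natural boundary condition, and a small multiple of \<open>t\<close> makes it negative.\<close>

lemma test_variation:
  assumes b: "0 < b" "b \<le> 1" and yb: "y b = 0"
  obtains K Y' where "\<And>\<mu>. 2 * \<mu> * b * sin (\<psi> b) + \<mu>\<^sup>2 * K - p * (2 / p * (sin (\<psi> b) - sin (\<psi> 0)) + \<mu> * Y')\<^sup>2 / (2 * l) < 0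
    \<Longrightarrow> \<not> stable lam l g"
proof -
  define y0 y0' where "y0 = (\<lambda>t. if t \<le> b then y t else 0)" and "y0' = (\<lambda>t. if t \<le> b then v t * sin (\<psi> t) else 0)"
  have b': "0 \<le> b" using b by simp
  have Hy0: "H1 y0 y0'" unfolding y0_def y0'_def by (rule H1_cut[OF Hy b' b(2) yb])
  have Ht: "H1 (\<lambda>t. t) (\<lambda>_. 1)" by (rule H1_C1) (auto intro!: derivative_eq_intros)
  have H1_has_integral: "(f' has_integral f b - f 0) {0..b}" if "H1 f f'" for f f'
    using integrable_integral[OF L2_integrable_sub[OF H1_L2[OF that], of 0 b]] H1_diff_eq[OF that, of 0 b] b by simp
  note Hs = H1_sin[OF H\<psi>]
  define X' Y' A B where "X' = - integral {0..1} (\<lambda>t. v t * t * sin (\<psi> t))" and "Y' = integral {0..1} (\<lambda>t. v t * t * cos (\<psi> t))"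
    and "A = integral {0..1} (\<lambda>t. 1 / v t)" and "B = integral {0..1} (\<lambda>t. v t * t\<^sup>2 * cos (\<psi> t))"
  define L where "L = integral {0..1} v"
  have iX': "((\<lambda>t. v t * t * sin (\<psi> t)) has_integral - X') {0..1}" and iY': "((\<lambda>t. v t * t * cos (\<psi> t)) has_integral Y') {0..1}"
    and iB: "((\<lambda>t. v t * t\<^sup>2 * cos (\<psi> t)) has_integral B) {0..1}"
    unfolding X'_def Y'_def B_def minus_minus
    by (intro integrable_integral integrable_continuous_interval continuous_intros cv c\<psi>)+
  have iA: "((\<lambda>t. 1 / v t) has_integral A) {0..1}"
    unfolding A_def using vp by (intro integrable_integral integrable_continuous_interval continuous_intros cv) (auto simp: less_le)
  \<comment> \<open>The integrals \<open>z1\<close> to \<open>z4\<close> are exact. By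
    \<open>\<kappa>\<close> = p y v / 2 their integrands on [0, b] are the derivatives of y^2 / 2,
    of (2 / p) sin \<open>\<psi>\<close>, of y sin \<open>\<psi>\<close> and of t sin
    \<open>\<psi>\<close>. Only the last one leaves a boundary term at \<open>b\<close> that is
    linear in the added multiple of t.\<close>
  have z1: "((\<lambda>t. v t * y0 t * sin (\<psi> t)) has_integral 0) {0..1}"
  proof -
    have "((\<lambda>t. 1/2 * (v t * sin (\<psi> t) * y t + y t * (v t * sin (\<psi> t)))) has_integral 1/2 * (y b * y b - y 0 * y 0)) {0..b}"
      by (intro has_integral_mult_right H1_has_integral H1_mult Hy)
    then have "((\<lambda>t. v t * y t * sin (\<psi> t)) has_integral 0) {0..b}" using y01 yb by (simp add: algebra_simps)
    from has_integral_cut[OF this b' b(2)] show ?thesis by (rule has_integral_eq[rotated]) (auto simp: y0_def)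
  qed
  have z2: "((\<lambda>t. v t * y0 t * cos (\<psi> t)) has_integral 2 / p * (sin (\<psi> b) - sin (\<psi> 0))) {0..1}"
  proof -
    have "((\<lambda>t. 2 / p * (cos (\<psi> t) * \<kappa> t)) has_integral 2 / p * (sin (\<psi> b) - sin (\<psi> 0))) {0..b}"
      by (intro has_integral_mult_right H1_has_integral[OF Hs])
    then have "((\<lambda>t. v t * y t * cos (\<psi> t)) has_integral 2 / p * (sin (\<psi> b) - sin (\<psi> 0))) {0..b}"
      by (rule has_integral_eq[rotated]) (use p_nz in simp)
    from has_integral_cut[OF this b' b(2)] show ?thesis by (rule has_integral_eq[rotated]) (auto simp: y0_def)
  qed
  have z3: "((\<lambda>t. (y0' t)\<^sup>2 / v t + p / 2 * (v t * (y0 t)\<^sup>2 * cos (\<psi> t))) has_integral 0) {0..1}"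
  proof -
    have "((\<lambda>t. v t * sin (\<psi> t) * sin (\<psi> t) + y t * (cos (\<psi> t) * \<kappa> t)) has_integral (y b * sin (\<psi> b) - y 0 * sin (\<psi> 0))) {0..b}"
      by (intro H1_has_integral H1_mult Hy Hs)
    then have "((\<lambda>t. v t * sin (\<psi> t) * sin (\<psi> t) + y t * (cos (\<psi> t) * \<kappa> t)) has_integral 0) {0..b}" using y01 yb by simp
    from has_integral_cut[OF this b' b(2)] show ?thesis
      by (rule has_integral_eq[rotated]) (use vp in \<open>force simp: y0_def y0'_def power2_eq_square field_simps\<close>)
  qed
  have z4: "((\<lambda>t. y0' t / v t + p / 2 * (v t * y0 t * t * cos (\<psi> t))) has_integral b * sin (\<psi> b)) {0..1}"
  proof -
    have "((\<lambda>t. 1 * sin (\<psi> t) + t * (cos (\<psi> t) * \<kappa> t)) has_integral (b * sin (\<psi> b) - 0 * sin (\<psi> 0))) {0..b}"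
      by (intro H1_has_integral H1_mult Ht Hs)
    then have "((\<lambda>t. 1 * sin (\<psi> t) + t * (cos (\<psi> t) * \<kappa> t)) has_integral b * sin (\<psi> b)) {0..b}" by simp
    from has_integral_cut[OF this b' b(2)] show ?thesis
      by (rule has_integral_eq[rotated]) (use vp in \<open>force simp: y0_def y0'_def power2_eq_square field_simps\<close>)
  qed
  have res: "\<not> stable lam l g"
    if neg: "2 * \<mu> * b * sin (\<psi> b) + \<mu>\<^sup>2 * (A + p / 2 * B + p * X'\<^sup>2 / l + lam * L * X'\<^sup>2 / l\<^sup>2) - p * (2 / p * (sin (\<psi> b) - sin (\<psi> 0)) + \<mu> * Y')\<^sup>2 / (2 * l) < 0" for \<mu>
  proof -
    define \<eta> h where "\<eta> = (\<lambda>t. y0 t + \<mu> * t)" and "h = (\<lambda>t. y0' t + \<mu> * 1)"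
    have H\<eta>: "H1 \<eta> h" unfolding \<eta>_def h_def by (intro H1_add H1_cmult Hy0 Ht)
    have "((\<lambda>t. v t * y0 t * sin (\<psi> t) + \<mu> * (v t * t * sin (\<psi> t))) has_integral 0 + \<mu> * - X') {0..1}"
      by (intro has_integral_add has_integral_mult_right z1 iX')
    then have "((\<lambda>t. v t * \<eta> t * sin (\<psi> t)) has_integral 0 + \<mu> * - X') {0..1}"
      by (rule has_integral_eq[rotated]) (simp add: \<eta>_def algebra_simps)
    then have IX: "\<mu> * X' = - integral {0..1} (\<lambda>t. v t * \<eta> t * sin (\<psi> t))"
      by (simp add: integral_unique)
    have "((\<lambda>t. v t * y0 t * cos (\<psi> t) + \<mu> * (v t * t * cos (\<psi> t))) has_integral 2 / p * (sin (\<psi> b) - sin (\<psi> 0)) + \<mu> * Y') {0..1}"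
      by (intro has_integral_add has_integral_mult_right z2 iY')
    then have "((\<lambda>t. v t * \<eta> t * cos (\<psi> t)) has_integral 2 / p * (sin (\<psi> b) - sin (\<psi> 0)) + \<mu> * Y') {0..1}"
      by (rule has_integral_eq[rotated]) (simp add: \<eta>_def algebra_simps)
    then have IY: "2 / p * (sin (\<psi> b) - sin (\<psi> 0)) + \<mu> * Y' = integral {0..1} (\<lambda>t. v t * \<eta> t * cos (\<psi> t))"
      by (simp add: integral_unique)
    have ih: "(\<lambda>t. (h t)\<^sup>2 / v t) integrable_on {0..1}"
    proof -
      have "L2 (\<lambda>t. 1 / v t * h t)" using vp by (intro L2_cont_mult H1_L2[OF H\<eta>] continuous_intros cv) (auto simp: less_le)
      from L2_mult_absolutely_integrable[OF H1_L2[OF H\<eta>] this] show ?thesis by (simp add: absolutely_integrable_on_def power2_eq_square)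
    qed
    have ie: "(\<lambda>t. v t * (\<eta> t)\<^sup>2 * cos (\<psi> t)) integrable_on {0..1}"
      by (intro integrable_continuous_interval continuous_intros cv c\<psi> H1_continuous[OF H\<eta>])
    have "((\<lambda>t. ((y0' t)\<^sup>2 / v t + p / 2 * (v t * (y0 t)\<^sup>2 * cos (\<psi> t))) + (2 * \<mu>) * (y0' t / v t + p / 2 * (v t * y0 t * t * cos (\<psi> t)))
       + \<mu>\<^sup>2 * (1 / v t + p / 2 * (v t * t\<^sup>2 * cos (\<psi> t)))) has_integral 0 + (2 * \<mu>) * (b * sin (\<psi> b)) + \<mu>\<^sup>2 * (A + p / 2 * B)) {0..1}"
      by (intro has_integral_add has_integral_mult_right z3 z4 iA iB)
    then have "((\<lambda>t. (h t)\<^sup>2 / v t + p / 2 * (v t * (\<eta> t)\<^sup>2 * cos (\<psi> t))) has_integral 0 + (2 * \<mu>) * (b * sin (\<psi> b)) + \<mu>\<^sup>2 * (A + p / 2 * B)) {0..1}"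
    proof (rule has_integral_eq[rotated])
      fix t :: real
      show "((y0' t)\<^sup>2 / v t + p / 2 * (v t * (y0 t)\<^sup>2 * cos (\<psi> t))) + (2 * \<mu>) * (y0' t / v t + p / 2 * (v t * y0 t * t * cos (\<psi> t)))
       + \<mu>\<^sup>2 * (1 / v t + p / 2 * (v t * t\<^sup>2 * cos (\<psi> t))) = (h t)\<^sup>2 / v t + p / 2 * (v t * (\<eta> t)\<^sup>2 * cos (\<psi> t))"
        by (simp add: \<eta>_def h_def power2_eq_square algebra_simps add_divide_distrib)
    qed
    moreover have "((\<lambda>t. (h t)\<^sup>2 / v t + p / 2 * (v t * (\<eta> t)\<^sup>2 * cos (\<psi> t))) has_integral
       integral {0..1} (\<lambda>t. (h t)\<^sup>2 / v t) + p / 2 * integral {0..1} (\<lambda>t. v t * (\<eta> t)\<^sup>2 * cos (\<psi> t))) {0..1}"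
      by (intro has_integral_add has_integral_mult_right integrable_integral ih ie)
    ultimately have IQ: "integral {0..1} (\<lambda>t. (h t)\<^sup>2 / v t) + p / 2 * integral {0..1} (\<lambda>t. v t * (\<eta> t)\<^sup>2 * cos (\<psi> t)) = 0 + (2 * \<mu>) * (b * sin (\<psi> b)) + \<mu>\<^sup>2 * (A + p / 2 * B)"
      by (rule has_integral_unique[rotated])
    show ?thesis
    proof (rule second_variation_unstable[OF P g0 g1 l H\<eta> IX IY energy_balance bending_variation[OF H\<eta>, folded IX]])
      show "integral {0..1} (\<lambda>t. (h t)\<^sup>2 / v t) + p / 2 * integral {0..1} (\<lambda>t. v t * (\<eta> t)\<^sup>2 * cos (\<psi> t))
       - p * (2 / p * (sin (\<psi> b) - sin (\<psi> 0)) + \<mu> * Y')\<^sup>2 / (2 * l) + p * (\<mu> * X')\<^sup>2 / l + lam * integral {0..1} v * (\<mu> * X')\<^sup>2 / l\<^sup>2 < 0"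
        unfolding IQ L_def[symmetric] using neg by (simp add: algebra_simps power_mult_distrib)
    qed
  qed
  show ?thesis by (rule that[of "A + p / 2 * B + p * X'\<^sup>2 / l + lam * L * X'\<^sup>2 / l\<^sup>2" Y']) (rule res)
qed

text \<open>Equal sines at the two zeros mean that the cut field does not move the end point
  vertically to first order. The expression becomes 2 \<open>\<mu>\<close> c +
  \<open>\<mu>\<close>^2 \<open>K'\<close> with c nonzero, which is negative for suitable
  \<open>\<mu>\<close> of the sign opposite to c.\<close>

lemma unstable_full_period:
  assumes b: "0 < b" "b \<le> 1" and yb: "y b = 0" and s: "sin (\<psi> b) = sin (\<psi> 0)" "sin (\<psi> 0) \<noteq> 0"
  shows "\<not> stable lam l g"
proof -
  obtain K Y' where T: "\<And>\<mu>. 2 * \<mu> * b * sin (\<psi> b) + \<mu>\<^sup>2 * K - p * (2 / p * (sin (\<psi> b) - sin (\<psi> 0)) + \<mu> * Y')\<^sup>2 / (2 * l) < 0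
    \<Longrightarrow> \<not> stable lam l g"
    using test_variation[OF b yb] by blast
  define K' where "K' = K - p * Y'\<^sup>2 / (2 * l)"
  define c where "c = b * sin (\<psi> b)"
  have c: "c \<noteq> 0" using b s by (simp add: c_def)
  define M where "M = \<bar>K'\<bar> + 1"
  have M: "M > 0" "K' < M" by (auto simp: M_def)
  \<comment> \<open>With \<open>M\<close> above \<open>K'\<close> the quadratic term stays below c^2
    / \<open>M\<close>, half of the absolute value of the linear one.\<close>
  define \<mu> where "\<mu> = - c / M"
  have "2 * \<mu> * c + \<mu>\<^sup>2 * K' < 0"
  proof -
    have "\<mu>\<^sup>2 * K' < \<mu>\<^sup>2 * M" using M c by (intro mult_strict_left_mono) (auto simp: \<mu>_def)
    also have "\<mu>\<^sup>2 * M = - \<mu> * c" using M by (simp add: \<mu>_def power2_eq_square)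
    finally have 1: "\<mu>\<^sup>2 * K' < - \<mu> * c" .
    have "c * c / M > 0" using M c by (metis divide_pos_pos power2_eq_square zero_less_power2)
    then have "\<mu> * c < 0" by (simp add: \<mu>_def)
    then show ?thesis using 1 by linarith
  qed
  then show ?thesis using s by (intro T[of \<mu>]) (simp add: K'_def c_def power_mult_distrib algebra_simps)
qed

text \<open>Here the full field \<open>y\<close> is used, with \<open>b\<close> = 1 and
  \<open>\<mu>\<close> = 0. Only the rotation term survives, and it is negative for positive
  \<open>p\<close>.\<close>

lemma unstable_pos_multiplier:
  assumes p: "p > 0" and s: "sin (\<psi> 1) \<noteq> sin (\<psi> 0)"
  shows "\<not> stable lam l g"
proof -
  obtain K Y' where T: "\<And>\<mu>. 2 * \<mu> * 1 * sin (\<psi> 1) + \<mu>\<^sup>2 * K - p * (2 / p * (sin (\<psi> 1) - sin (\<psi> 0)) + \<mu> * Y')\<^sup>2 / (2 * l) < 0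
    \<Longrightarrow> \<not> stable lam l g"
    using test_variation[of 1] y01 by auto
  have "p * (2 / p * (sin (\<psi> 1) - sin (\<psi> 0)))\<^sup>2 / (2 * l) > 0" using p s l by simp
  then show ?thesis by (intro T[of 0]) simp
qed

end

lemma H1_has_derivative:
  assumes f: "H1 f f'" and c: "continuous_on {0..1} f'" and t: "t \<in> {0..1}"
  shows "(f has_real_derivative f' t) (at t within {0..1})"
proof (rule has_field_derivative_transform_within[where f="\<lambda>t. f 0 + integral {0..t} f'" and d=1])
  show "((\<lambda>t. f 0 + integral {0..t} f') has_real_derivative f' t) (at t within {0..1})"
    using DERIV_add[OF DERIV_const integral_has_real_derivative[OF c t]] by simp
qed (use t H1_eq[OF f, symmetric] in \<open>simp_all only: zero_less_one\<close>)

lemma H1_strict_mono: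
  assumes f: "H1 f f'" and c: "continuous_on {0..1} f'" and p: "\<And>t. t \<in> {0..1} \<Longrightarrow> f' t > 0"
  shows "strict_mono_on {0..1} f"
proof (rule strict_mono_onI)
  fix s t :: real assume st: "s \<in> {0..1}" "t \<in> {0..1}" "s < t"
  obtain r where r: "r \<in> {0..1}" "\<And>u. u \<in> {0..1} \<Longrightarrow> f' r \<le> f' u"
    using continuous_attains_inf[OF _ _ c] by auto
  have "f' r * (t - s) \<le> integral {s..t} f'"
  proof -
    have "((\<lambda>_. f' r) has_integral f' r * (t - s)) {s..t}"
      using has_integral_const_real[of "f' r" s t] st by (simp add: mult.commute)
    moreover have "(f' has_integral integral {s..t} f') {s..t}"
      using st by (intro integrable_integral L2_integrable_sub[OF H1_L2[OF f]]) auto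
    ultimately show ?thesis by (rule has_integral_le) (use st r in auto)
  qed
  moreover have "0 < f' r * (t - s)" using p[OF r(1)] st by simp
  moreover have "f t - f s = integral {s..t} f'" using st by (intro H1_diff_eq[OF f]) auto
  ultimately show "f s < f t" by linarith
qed

lemma strict_mono_on_image:
  fixes f :: "real \<Rightarrow> real"
  assumes c: "continuous_on {0..1} f" and m: "strict_mono_on {0..1} f"
  shows "f ` {0..1} = {f 0..f 1}"
proof
  have mono: "f s \<le> f t" if "s \<in> {0..1}" "t \<in> {0..1}" "s \<le> t" for s t
    using m that unfolding strict_mono_on_def by (cases "s = t") (auto simp: less_le)
  then show "f ` {0..1} \<subseteq> {f 0..f 1}" by auto
  show "{f 0..f 1} \<subseteq> f ` {0..1}"
  proof
    fix z assume "z \<in> {f 0..f 1}"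
    then obtain t where "0 \<le> t" "t \<le> 1" "f t = z" using IVT'[of f 0 z 1] c by auto
    then show "z \<in> f ` {0..1}" by auto
  qed
qed

section \<open>Shape of stable critical curves\<close>

context critical_curve begin

lemma y_deriv: "t \<in> {0..1} \<Longrightarrow> (y has_real_derivative v t * sin (\<psi> t)) (at t within {0..1})"
  by (intro H1_has_derivative Hy continuous_intros cv c\<psi>)

lemma sin_sq_at_zero: assumes "t \<in> {0..1}" "y t = 0" shows "(sin (\<psi> t))\<^sup>2 = (sin (\<psi> 0))\<^sup>2"
  using cos_at_zero[OF assms] cos_at_zero[of 0] y01 by (simp add: sin_squared_eq)

text \<open>Uniqueness by a Gronwall argument: \<open>EL\<close> with p^2 = lam^2 bounds sin^2
  \<open>\<psi>\<close> by (lam / 2) y^2, hence y^2 exp (-C t) does not increase and, starting from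
  0, vanishes identically.\<close>

lemma segment_if_horizontal_start:
  assumes s0: "sin (\<psi> 0) = 0" shows "is_segment l g"
proof -
  have "(cos (\<psi> 0))\<^sup>2 = 1" using s0 by (simp add: cos_squared_eq)
  then have p2: "p\<^sup>2 = lam\<^sup>2" using cos_at_zero[of 0] y01 p_nz by (simp add: power_divide)
  have sb: "(sin (\<psi> t))\<^sup>2 \<le> lam / 2 * (y t)\<^sup>2" if t: "t \<in> {0..1}" for t
  proof -
    have "lam\<^sup>2 * (sin (\<psi> t))\<^sup>2 = lam\<^sup>2 - (p * cos (\<psi> t))\<^sup>2"
      by (simp add: sin_squared_eq p2[symmetric] algebra_simps power_mult_distrib)
    also have "\<dots> = lam\<^sup>2 - (lam - lam\<^sup>2 * (y t)\<^sup>2 / 4)\<^sup>2" using EL[OF t] by (simp add: p2)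
    also have "\<dots> \<le> lam\<^sup>2 * (lam / 2 * (y t)\<^sup>2)"
    proof -
      have "0 \<le> (lam\<^sup>2 * (y t)\<^sup>2 / 4)\<^sup>2" by simp
      then show ?thesis by (simp add: power2_diff power2_eq_square algebra_simps)
    qed
    finally show ?thesis using lam by simp
  qed
  obtain V where V: "V > 0" "\<And>t. t \<in> {0..1} \<Longrightarrow> \<bar>v t\<bar> \<le> V" using continuous_Icc_bound[OF cv] by blast
  define C where "C = V * (1 + lam / 2)"
  define f' where "f' = (\<lambda>t. (v t * sin (\<psi> t) * y t + y t * (v t * sin (\<psi> t))) * exp (- C * t) + (y t * y t) * (exp (- C * t) * - C))"
  have He: "H1 (\<lambda>t. exp (- C * t)) (\<lambda>t. exp (- C * t) * - C)"
    by (rule H1_C1) (auto intro!: derivative_eq_intros continuous_intros)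
  have Hf: "H1 (\<lambda>t. y t * y t * exp (- C * t)) f'" unfolding f'_def by (intro H1_mult Hy He)
  have fn: "f' t \<le> 0" if t: "t \<in> {0..1}" for t
  proof -
    have "2 * (y t * sin (\<psi> t)) \<le> (y t)\<^sup>2 + (sin (\<psi> t))\<^sup>2" using sum_squares_bound[of "y t" "sin (\<psi> t)"] by simp
    also have "\<dots> \<le> (1 + lam / 2) * (y t)\<^sup>2" using sb[OF t] by (simp add: algebra_simps)
    finally have "v t * (2 * (y t * sin (\<psi> t))) \<le> v t * ((1 + lam / 2) * (y t)\<^sup>2)"
      using vp[OF t] by (intro mult_left_mono) auto
    also have "\<dots> \<le> V * ((1 + lam / 2) * (y t)\<^sup>2)" using V(2)[OF t] lam by (intro mult_right_mono) auto
    finally have "(v t * (2 * (y t * sin (\<psi> t))) - C * (y t * y t)) \<le> 0" by (simp add: C_def power2_eq_square)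
    then have "(v t * (2 * (y t * sin (\<psi> t))) - C * (y t * y t)) * exp (- C * t) \<le> 0" by (intro mult_nonpos_nonneg) auto
    then show ?thesis by (simp add: f'_def algebra_simps)
  qed
  have yz: "y t = 0" if t: "t \<in> {0..1}" for t
  proof -
    have "y t * y t * exp (- C * t) = integral {0..t} f'" using H1_eq[OF Hf t] y01 by simp
    also have "\<dots> \<le> integral {0..t} (\<lambda>_. 0)"
      using t fn by (intro integral_le L2_integrable_sub[OF H1_L2[OF Hf]]) auto
    finally have "y t * y t * exp (- C * t) \<le> 0" by simp
    then have "y t * y t \<le> 0" by (simp add: mult_le_0_iff)
    then show ?thesis using zero_le_square[of "y t"] by simp
  qed
  have cc: "cos (\<psi> t) = lam / p" if "t \<in> {0..1}" for t using cos_at_zero[OF that yz[OF that]] .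
  \<comment> \<open>The tangent has constant horizontal component lam / p; if it were not positive,
    the chord could not be positive.\<close>
  have lp: "lam / p > 0"
  proof (rule ccontr)
    assume "\<not> ?thesis"
    then have "integral {0..1} (\<lambda>t. v t * cos (\<psi> t)) \<le> integral {0..1::real} (\<lambda>_. 0)"
    proof (intro integral_le integrable_continuous_interval continuous_intros cv c\<psi>)
      fix t :: real assume t: "t \<in> {0..1}"
      show "v t * cos (\<psi> t) \<le> 0" unfolding cc[OF t]
        using vp[OF t] \<open>\<not> 0 < lam / p\<close> by (intro mult_nonneg_nonpos) auto
    qed
    then show False using integral_v_cos l by simp
  qed
  have cx': "continuous_on {0..1} (\<lambda>t. v t * cos (\<psi> t))" by (intro continuous_intros cv c\<psi>)
  have sm: "strict_mono_on {0..1} x"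
  proof (rule H1_strict_mono[OF Hx cx'])
    fix t :: real assume t: "t \<in> {0..1}"
    show "0 < v t * cos (\<psi> t)" unfolding cc[OF t] using vp[OF t] lp by (rule mult_pos_pos)
  qed
  have "g t = (x t, 0)" if "t \<in> {0..1}" for t using yz[OF that] by (simp add: prod_eq_iff)
  then show ?thesis unfolding is_segment_def reparam_def
    using strict_mono_on_image[OF cx sm] sm cx g0 g1 by (intro exI[of _ x]) simp
qed

text \<open>By \<open>sin_sq_at_zero\<close> the sine at any later zero of \<open>y\<close> is plus
  or minus the initial one, and the plus sign is excluded by instability after a full period. So
  \<open>y\<close> can cross zero only downwards. It can then never return from negative values,
  although it must end at 0; hence it is never negative, and an interior zero would make it
  so.\<close>

lemma stable_arc_structure:
  assumes st: "stable lam l g" and s0: "sin (\<psi> 0) > 0"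
  shows "p < 0" "sin (\<psi> 1) = - sin (\<psi> 0)" "\<And>t. 0 < t \<Longrightarrow> t < 1 \<Longrightarrow> y t > 0"
proof -
  have z: "sin (\<psi> t) = - sin (\<psi> 0)" if t: "0 < t" "t \<le> 1" "y t = 0" for t
  proof -
    have "sin (\<psi> t) = sin (\<psi> 0) \<or> sin (\<psi> t) = - sin (\<psi> 0)"
      using sin_sq_at_zero[of t] t by (simp add: power2_eq_iff)
    then show ?thesis using unstable_full_period[OF t] st s0 by auto
  qed
  show s1: "sin (\<psi> 1) = - sin (\<psi> 0)" using z[of 1] y01 by simp
  have "\<not> p > 0" using unstable_pos_multiplier st s1 s0 by auto
  then show "p < 0" using p_nz by linarith
  have nonneg: False if a: "0 < a" "a < 1" "y a < 0" for a
  proof -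
    \<comment> \<open>The least element of this compact set is the first zero after
      \<open>a\<close>, which \<open>y\<close> would have to reach from below.\<close>
    define Z where "Z = {t \<in> {a..1}. y t = 0}"
    have ca: "continuous_on {a..1} y" by (rule continuous_on_subset[OF cy]) (use a in auto)
    have "closed Z" unfolding Z_def by (rule continuous_closed_preimage_constant[OF ca]) auto
    moreover have "bounded Z" unfolding Z_def by (rule bounded_subset[of "{a..1}"]) auto
    moreover have "Z \<noteq> {}" using y01 a unfolding Z_def by auto
    ultimately obtain b where b: "b \<in> Z" "\<And>t. t \<in> Z \<Longrightarrow> b \<le> t"
      using compact_attains_inf[of Z] by (auto simp: compact_eq_bounded_closed)
    have ab: "a < b" "b \<le> 1" "y b = 0" using b(1) a unfolding Z_def by (auto simp: less_le)
    have neg: "y t < 0" if t: "a \<le> t" "t < b" for t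
    proof (rule ccontr)
      assume "\<not> y t < 0"
      then obtain u where "a \<le> u" "u \<le> t" "y u = 0"
        using IVT'[of y a 0 t] a t ab continuous_on_subset[OF ca, of "{a..t}"] by auto
      then have "u \<in> Z" using t ab by (auto simp: Z_def)
      then show False using b(2)[of u] \<open>u \<le> t\<close> t by auto
    qed
    have "v b * sin (\<psi> b) < 0" using vp[of b] z[of b] a ab s0 by (simp add: mult_pos_neg)
    then obtain d where d: "d > 0" "\<And>h. 0 < h \<Longrightarrow> b - h \<in> {0..1} \<Longrightarrow> h < d \<Longrightarrow> y b < y (b - h)"
      using has_real_derivative_neg_dec_left[OF y_deriv[of b]] a ab by auto
    define h where "h = min (d / 2) (b - a)"
    have h: "0 < h" "h < d" "a \<le> b - h" using d ab by (auto simp: h_def)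
    have "y b < y (b - h)" using h a ab by (intro d(2)) auto
    then show False using neg[of "b - h"] h ab by auto
  qed
  show "y t > 0" if t: "0 < t" "t < 1" for t
  proof (rule ccontr)
    assume "\<not> ?thesis"
    then have yt: "y t = 0" using nonneg[of t] t by fastforce
    have "v t * sin (\<psi> t) < 0" using vp[of t] z[of t] t yt s0 by (simp add: mult_pos_neg)
    then obtain d where d: "d > 0" "\<And>h. 0 < h \<Longrightarrow> t + h \<in> {0..1} \<Longrightarrow> h < d \<Longrightarrow> y t > y (t + h)"
      using has_real_derivative_neg_dec_right[OF y_deriv[of t]] t by auto
    define h where "h = min (d / 2) ((1 - t) / 2)"
    have h: "0 < h" "h < d" "t + h < 1" using d t by (auto simp: h_def min_def field_simps)
    have "y t > y (t + h)" using h t by (intro d(2)) auto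
    then show False using nonneg[of "t + h"] h t yt by auto
  qed
qed

text \<open>Explicit integration of the elastica equation. In terms of \<open>S\<close> and
  \<open>C\<close> the first integral \<open>EL\<close> becomes \<open>S\<close>^2 +
  \<open>C\<close>^2 = 1, so the two are sine and cosine of an amplitude \<open>a\<close> running
  from -pi/2 to pi/2, whose derivative with respect to \<open>\<alpha>\<close> times arclength is
  the square root of 1 - q^2 sin^2 \<open>a\<close>. Then F(a, q) is affine in arclength, and the
  first coordinate is an E integral. Eliminating \<open>p\<close> from lam = 2
  \<open>\<alpha>\<close>^2 (2 q^2 - 1) and \<open>\<alpha>\<close> l = 2 \<open>EllU q\<close>
  gives the equation for the modulus.\<close>

lemma arc_form:
  assumes pn: "p < 0" and s0: "sin (\<psi> 0) > 0" and s1: "sin (\<psi> 1) = - sin (\<psi> 0)"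
    and yp: "\<And>t. 0 < t \<Longrightarrow> t < 1 \<Longrightarrow> y t > 0"
  obtains q \<alpha> a where "1 / sqrt 2 < q" "q < 1" "\<alpha> > 0" "\<alpha> * l = 2 * EllU q" "gcrit q = lam * l\<^sup>2"
    "H1 a (\<lambda>t. \<alpha> * v t * sqrt (1 - q\<^sup>2 * (sin (a t))\<^sup>2))" "a 0 = - (pi / 2)" "a 1 = pi / 2"
    "\<And>t. t \<in> {0..1} \<Longrightarrow> EllF (a t) q = \<alpha> * integral {0..t} v - EllK q"
    "\<And>t. t \<in> {0..1} \<Longrightarrow> g t = ((2 * EllEx (a t) q + 2 * EllE q - \<alpha> * integral {0..t} v) / \<alpha>, 2 * q / \<alpha> * cos (a t))"
    "\<And>t. t \<in> {0..1} \<Longrightarrow> cos (\<psi> t) = 1 - 2 * q\<^sup>2 * (sin (a t))\<^sup>2"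
    "\<And>t. t \<in> {0..1} \<Longrightarrow> sin (\<psi> t) = - 2 * q * sin (a t) * sqrt (1 - q\<^sup>2 * (sin (a t))\<^sup>2)"
    "\<And>t. t \<in> {0..1} \<Longrightarrow> \<kappa> t = - 2 * q * \<alpha> * v t * cos (a t)"
proof -
  \<comment> \<open>At the ends cos \<open>\<psi>\<close> = lam / p, so \<open>q\<close> is the
    absolute value of sin (\<open>\<psi>\<close> / 2) there; negativity of \<open>p\<close> gives
    q^2 > 1/2. The scale satisfies \<open>p\<close> = -2 \<open>\<alpha>\<close>^2.\<close>
  define q \<alpha> where "q = sqrt ((1 - lam / p) / 2)" and "\<alpha> = sqrt (- p / 2)"
  have c0: "cos (\<psi> 0) = lam / p" using cos_at_zero[of 0] y01 by simp
  have lp: "lam / p < 0" using lam pn by (simp add: divide_pos_neg)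
  have "(lam / p)\<^sup>2 < 1"
    using s0 sin_squared_eq[of "\<psi> 0"] unfolding c0 by (metis diff_gt_0_iff_gt zero_less_power)
  then have lp1: "- 1 < lam / p" unfolding abs_square_less_1 by linarith
  have q2: "q\<^sup>2 = (1 - lam / p) / 2" using lp unfolding q_def by (subst real_sqrt_pow2) auto
  have q0: "0 < q" using lp by (simp add: q_def)
  have \<alpha>0: "0 < \<alpha>" using pn by (simp add: \<alpha>_def)
  have \<alpha>2: "\<alpha>\<^sup>2 = - p / 2" using pn unfolding \<alpha>_def by (subst real_sqrt_pow2) auto
  have "q\<^sup>2 < 1" using q2 lp1 by simp
  then have qlt: "q < 1" unfolding abs_square_less_1 by linarith
  have qgt: "1 / sqrt 2 < q"
    by (rule power_less_imp_less_base[of _ 2]) (use q2 lp q0 inv_sqrt2 in auto)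
  have cosy: "cos (\<psi> t) = lam / p - p * (y t)\<^sup>2 / 4" if "t \<in> {0..1}" for t
    using EL[OF that] p_nz by (simp add: field_simps power2_eq_square)
  have cosgt: "- 1 < cos (\<psi> t)" if "t \<in> {0..1}" for t
  proof -
    have "p * (y t)\<^sup>2 / 4 \<le> 0" using pn by (simp add: mult_nonpos_nonneg)
    then show ?thesis using cosy[OF that] lp1 by linarith
  qed
  have ynn: "y t \<ge> 0" if t: "t \<in> {0..1}" for t
    using yp[of t] y01 t by (cases "t = 0 \<or> t = 1") (auto simp: less_le)
  \<comment> \<open>\<open>D\<close> is the absolute value of cos (\<open>\<psi>\<close> / 2), and
    \<open>q * S\<close> is minus sin (\<open>\<psi>\<close> / 2) up to the sign of that cosine.
    Written through sin \<open>\<psi>\<close> and cos \<open>\<psi>\<close>, these do not depend on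
    the branch of the angle.\<close>
  define D S C where "D = (\<lambda>t. sqrt ((1 + cos (\<psi> t)) / 2))" and "S = (\<lambda>t. - sin (\<psi> t) / (2 * q * D t))"
    and "C = (\<lambda>t. \<alpha> * y t / (2 * q))"
  have D0: "D t > 0" and D2: "(D t)\<^sup>2 = (1 + cos (\<psi> t)) / 2" if "t \<in> {0..1}" for t
    using cosgt[OF that] unfolding D_def by auto
  have S2: "q\<^sup>2 * (S t)\<^sup>2 = (1 - cos (\<psi> t)) / 2" if t: "t \<in> {0..1}" for t
  proof -
    have "q\<^sup>2 * (S t)\<^sup>2 = (sin (\<psi> t))\<^sup>2 / (4 * (D t)\<^sup>2)" using q0 by (simp add: S_def power_divide power_mult_distrib)
    also have "\<dots> = ((1 - cos (\<psi> t)) * (1 + cos (\<psi> t))) / (2 * (1 + cos (\<psi> t)))"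
    proof -
      have "1 - (cos (\<psi> t))\<^sup>2 = (1 - cos (\<psi> t)) * (1 + cos (\<psi> t))" by (simp add: power2_eq_square algebra_simps)
      moreover have "4 * ((1 + cos (\<psi> t)) / 2) = 2 * (1 + cos (\<psi> t))" by simp
      ultimately show ?thesis unfolding D2[OF t] sin_squared_eq by (simp only:)
    qed
    also have "\<dots> = (1 - cos (\<psi> t)) / 2"
    proof -
      have "a * b / (2 * b) = a / 2" if "b \<noteq> 0" for a b :: real using that by simp
      moreover have "1 + cos (\<psi> t) \<noteq> 0" using cosgt[OF t] by linarith
      ultimately show ?thesis by blast
    qed
    finally show ?thesis .
  qed
  have C2: "q\<^sup>2 * (C t)\<^sup>2 = - p * (y t)\<^sup>2 / 8" for t
    using q0 \<alpha>2 by (simp add: C_def power_divide power_mult_distrib)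
  have SC: "(S t)\<^sup>2 + (C t)\<^sup>2 = 1" if t: "t \<in> {0..1}" for t
  proof -
    have "q\<^sup>2 * ((S t)\<^sup>2 + (C t)\<^sup>2) = (1 - (lam / p - p * (y t)\<^sup>2 / 4)) / 2 + - p * (y t)\<^sup>2 / 8"
      unfolding distrib_left S2[OF t] C2 cosy[OF t] ..
    also have "\<dots> = q\<^sup>2" unfolding q2 by (simp add: field_simps)
    finally have "q\<^sup>2 * ((S t)\<^sup>2 + (C t)\<^sup>2) = q\<^sup>2" .
    then show ?thesis using q0 by simp
  qed
  have DS: "1 - q\<^sup>2 * (S t)\<^sup>2 = (D t)\<^sup>2" if "t \<in> {0..1}" for t
    unfolding S2[OF that] D2[OF that] by (simp add: field_simps)
  have C0: "C t \<ge> 0" if "t \<in> {0..1}" for t using ynn[OF that] q0 \<alpha>0 by (simp add: C_def)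
  have S1: "\<bar>S t\<bar> \<le> 1" if "t \<in> {0..1}" for t
  proof -
    have "(S t)\<^sup>2 \<le> 1" using SC[OF that] zero_le_power2[of "C t"] by linarith
    then show ?thesis by (simp add: abs_square_le_1)
  qed
  define a where "a = (\<lambda>t. arcsin (S t))"
  have sa: "sin (a t) = S t" if "t \<in> {0..1}" for t using S1[OF that] by (simp add: a_def abs_le_iff)
  have ca: "cos (a t) = C t" if t: "t \<in> {0..1}" for t
  proof -
    have "cos (a t) = sqrt (1 - (S t)\<^sup>2)" using S1[OF t] unfolding a_def by (intro cos_arcsin) auto
    also have "1 - (S t)\<^sup>2 = (C t)\<^sup>2" using SC[OF t] by simp
    finally show ?thesis using C0[OF t] by simp
  qed
  have sqD: "sqrt (1 - q\<^sup>2 * (sin (a t))\<^sup>2) = D t" if t: "t \<in> {0..1}" for t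
    unfolding sa[OF t] DS[OF t] using D0[OF t] by simp
  have \<kappa>C: "\<kappa> t = - 2 * q * \<alpha> * v t * C t" for t
  proof -
    have "- 2 * q * \<alpha> * v t * C t = - \<alpha>\<^sup>2 * v t * y t" using q0 by (simp add: C_def power2_eq_square)
    then show ?thesis unfolding \<alpha>2 by simp
  qed
  have cD: "continuous_on {0..1} D" unfolding D_def by (intro continuous_intros c\<psi>) auto
  have cS: "continuous_on {0..1} S" unfolding S_def
    using D0 q0 by (intro continuous_intros c\<psi> cD) (auto simp: less_le)
  have cona: "continuous_on {0..1} a" unfolding a_def
    by (rule continuous_on_arcsin[OF cS]) (use S1 in \<open>force simp: abs_le_iff\<close>)
  \<comment> \<open>The arcsine has no derivative where \<open>S\<close> is plus or minus 1, that
    is, at the ends of the arc. The derivative is computed in the interior, where \<open>y\<close> >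
    0 makes \<open>C\<close> positive, and continuity carries the integrated identity to the closed
    interval.\<close>
  have da: "(a has_real_derivative \<alpha> * v t * D t) (at t)" if t: "0 < t" "t < 1" for t
  proof -
    have t': "t \<in> {0..1}" using t by simp
    have "continuous_on {0..1} \<kappa>" by (intro continuous_intros cy cv) auto
    from H1_has_derivative[OF H\<psi> this t'] have d\<psi>: "(\<psi> has_real_derivative \<kappa> t) (at t)"
      using t by (simp add: at_within_Icc_at)
    have dD: "(D has_real_derivative - (sin (\<psi> t) * \<kappa> t) / (4 * D t)) (at t)"
    proof -
      have pos: "(1 + cos (\<psi> t)) / 2 > 0" using cosgt[OF t'] by simp
      have "((\<lambda>t. (1 + cos (\<psi> t)) / 2) has_real_derivative - (sin (\<psi> t) * \<kappa> t) / 2) (at t)"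
        by (auto intro!: derivative_eq_intros d\<psi>)
      from DERIV_chain2[OF DERIV_real_sqrt[OF pos] this] show ?thesis
        unfolding D_def by (simp add: field_simps)
    qed
    have Dt: "D t > 0" by (rule D0[OF t'])
    have ne: "2 * q * D t \<noteq> 0" using Dt q0 by simp
    have "(S has_real_derivative ((- (cos (\<psi> t) * \<kappa> t)) * (2 * q * D t) - (- sin (\<psi> t)) * (2 * q * (- (sin (\<psi> t) * \<kappa> t) / (4 * D t)))) / ((2 * q * D t) * (2 * q * D t))) (at t)"
      unfolding S_def
      by (rule DERIV_divide[OF DERIV_minus[OF DERIV_chain2[OF DERIV_sin d\<psi>]] DERIV_cmult[OF dD] ne])
    moreover have "((- (cos (\<psi> t) * \<kappa> t)) * (2 * q * D t) - (- sin (\<psi> t)) * (2 * q * (- (sin (\<psi> t) * \<kappa> t) / (4 * D t)))) / ((2 * q * D t) * (2 * q * D t))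
       = \<alpha> * v t * D t * C t"
    proof -
      have "(- (cos (\<psi> t) * \<kappa> t)) * (2 * q * D t) - (- sin (\<psi> t)) * (2 * q * (- (sin (\<psi> t) * \<kappa> t) / (4 * D t)))
        = - 2 * q * \<kappa> t * (cos (\<psi> t) * D t + (sin (\<psi> t))\<^sup>2 / (4 * D t))"
        using Dt by (simp add: field_simps power2_eq_square)
      also have "(sin (\<psi> t))\<^sup>2 / (4 * D t) = (1 - cos (\<psi> t)) * D t / 2"
      proof -
        have "(sin (\<psi> t))\<^sup>2 = (1 - cos (\<psi> t)) * (2 * (D t)\<^sup>2)"
          unfolding D2[OF t'] sin_squared_eq by (simp add: power2_eq_square algebra_simps)
        then show ?thesis using Dt by (simp add: power2_eq_square)
      qed
      also have "cos (\<psi> t) * D t + (1 - cos (\<psi> t)) * D t / 2 = D t * ((1 + cos (\<psi> t)) / 2)" by (simp add: field_simps)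
      also have "(1 + cos (\<psi> t)) / 2 = D t * D t" using D2[OF t'] by (simp add: power2_eq_square)
      finally have e: "(- (cos (\<psi> t) * \<kappa> t)) * (2 * q * D t) - (- sin (\<psi> t)) * (2 * q * (- (sin (\<psi> t) * \<kappa> t) / (4 * D t)))
        = - 2 * q * \<kappa> t * (D t * (D t * D t))" .
      show ?thesis unfolding e unfolding \<kappa>C using Dt q0 by (simp add: field_simps)
    qed
    ultimately have dS: "(S has_real_derivative \<alpha> * v t * D t * C t) (at t)" by simp
    have Cp: "C t > 0" using yp[OF t] q0 \<alpha>0 by (simp add: C_def)
    have "(S t)\<^sup>2 < 1" using SC[OF t'] Cp zero_less_power[OF Cp, of 2] by linarith
    then have Sb: "- 1 < S t" "S t < 1" by (auto simp: abs_square_less_1)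
    have "sqrt (1 - (S t)\<^sup>2) = C t" using SC[OF t'] C0[OF t'] by (metis add_diff_cancel_left' real_sqrt_unique)
    then have "(a has_real_derivative inverse (C t) * (\<alpha> * v t * D t * C t)) (at t)"
      using DERIV_chain2[OF DERIV_arcsin[OF Sb] dS] unfolding a_def by simp
    moreover have "inverse (C t) * (\<alpha> * v t * D t * C t) = \<alpha> * v t * D t" using Cp by simp
    ultimately show ?thesis by (simp only:)
  qed
  have Ha: "H1 a (\<lambda>t. \<alpha> * v t * D t)" unfolding H1_def
  proof (intro conjI ballI)
    show "L2 (\<lambda>t. \<alpha> * v t * D t)" by (intro continuous_on_imp_L2 continuous_intros cv cD)
    fix t :: real assume t: "t \<in> {0..1}"
    have "((\<lambda>t. \<alpha> * v t * D t) has_integral a t - a 0) {0..t}"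
      using t by (intro fundamental_theorem_of_calculus_interior continuous_on_subset[OF cona])
        (auto simp: has_real_derivative_iff_has_vector_derivative[symmetric] intro: da)
    then show "a t = a 0 + integral {0..t} (\<lambda>t. \<alpha> * v t * D t)" by (simp add: integral_unique)
  qed
  have Sends: "S 0 = - 1" "S 1 = 1"
  proof -
    have "(S 0)\<^sup>2 = 1" "(S 1)\<^sup>2 = 1" using SC[of 0] SC[of 1] y01 by (auto simp: C_def)
    moreover have "S 0 < 0" "S 1 > 0" using s0 s1 D0[of 0] D0[of 1] q0 by (auto simp: S_def divide_neg_pos)
    ultimately show "S 0 = - 1" "S 1 = 1" by (auto simp: power2_eq_1_iff)
  qed
  have aends: "a 0 = - (pi / 2)" "a 1 = pi / 2" using Sends by (auto simp: a_def)
  have qa: "\<bar>q\<bar> < 1" using q0 qlt by simp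
  define \<sigma> where "\<sigma> = (\<lambda>t. integral {0..t} v)"
  have H\<sigma>: "H1 \<sigma> v" using H1_integral[OF continuous_on_imp_L2[OF cv], of 0] by (simp add: \<sigma>_def)
  have F: "EllF (a t) q = \<alpha> * \<sigma> t - EllK q" if t: "t \<in> {0..1}" for t
  proof -
    have "H1 (\<lambda>t. EllF (a t) q) (\<lambda>t. 1 / sqrt (1 - q\<^sup>2 * (sin (a t))\<^sup>2) * (\<alpha> * v t * D t))"
      by (rule H1_chain[OF Ha, where h="\<lambda>x. EllF x q"]) (rule EllF_deriv[OF qa], rule EllF_integrand_continuous[OF qa])
    from H1_diff[OF this H1_cmult[OF H\<sigma>, of \<alpha>]]
    have "H1 (\<lambda>t. EllF (a t) q - \<alpha> * \<sigma> t) (\<lambda>_. 0)"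
      by (rule H1_cong) (use D0 sqD in \<open>auto simp: less_le\<close>)
    from H1_eq[OF this t] show ?thesis
      using EllF_minus[OF qa, of "pi / 2"] by (simp add: aends \<sigma>_def EllK_def)
  qed
  have X: "x t = (2 * EllEx (a t) q + 2 * EllE q - \<alpha> * \<sigma> t) / \<alpha>" if t: "t \<in> {0..1}" for t
  proof -
    have "H1 (\<lambda>t. EllEx (a t) q) (\<lambda>t. sqrt (1 - q\<^sup>2 * (sin (a t))\<^sup>2) * (\<alpha> * v t * D t))"
      by (rule H1_chain[OF Ha, where h="\<lambda>x. EllEx x q"]) (rule EllEx_deriv[OF qa], rule EllE_integrand_continuous[OF qa])
    from H1_diff[OF H1_cmult[OF Hx, of \<alpha>] H1_diff[OF H1_cmult[OF this, of 2] H1_cmult[OF H\<sigma>, of \<alpha>]]]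
    have "H1 (\<lambda>t. \<alpha> * x t - (2 * EllEx (a t) q - \<alpha> * \<sigma> t)) (\<lambda>_. 0)"
    proof (rule H1_cong)
      fix t :: real assume t: "t \<in> {0..1}"
      have e: "cos (\<psi> t) = 2 * (D t * D t) - 1" using D2[OF t] by (simp add: power2_eq_square)
      show "\<alpha> * (v t * cos (\<psi> t)) - (2 * (sqrt (1 - q\<^sup>2 * (sin (a t))\<^sup>2) * (\<alpha> * v t * D t)) - \<alpha> * v t) = 0"
        unfolding sqD[OF t] e by (simp add: algebra_simps)
    qed simp
    from H1_eq[OF this t] have "\<alpha> * x t - (2 * EllEx (a t) q - \<alpha> * \<sigma> t) = 2 * EllE q"
      using EllEx_minus[OF qa, of "pi / 2"] g0 by (simp add: aends \<sigma>_def EllE_def)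
    then show ?thesis using \<alpha>0 by (simp add: field_simps)
  qed
  have G: "g t = ((2 * EllEx (a t) q + 2 * EllE q - \<alpha> * \<sigma> t) / \<alpha>, 2 * q / \<alpha> * cos (a t))" if t: "t \<in> {0..1}" for t
    using X[OF t] ca[OF t] q0 \<alpha>0 by (simp add: prod_eq_iff C_def)
  have L: "\<alpha> * \<sigma> 1 = 2 * EllK q" using F[of 1] by (simp add: aends EllK_def)
  have lU: "\<alpha> * l = 2 * EllU q"
  proof -
    have "l = (2 * EllE q + 2 * EllE q - 2 * EllK q) / \<alpha>" using X[of 1] g1 L by (simp add: aends EllE_def[symmetric])
    then show ?thesis using \<alpha>0 by (simp add: EllU_def field_simps)
  qed
  have gc: "gcrit q = lam * l\<^sup>2"
  proof -
    have "gcrit q = 2 * (2 * EllU q)\<^sup>2 * (2 * q\<^sup>2 - 1)"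
      unfolding gcrit_def EllU_def[symmetric] by (simp add: power_mult_distrib)
    also have "\<dots> = 2 * \<alpha>\<^sup>2 * l\<^sup>2 * (2 * q\<^sup>2 - 1)" unfolding lU[symmetric] by (simp add: power_mult_distrib)
    also have "\<dots> = lam * l\<^sup>2" unfolding \<alpha>2 q2 using p_nz by (simp add: field_simps)
    finally show ?thesis .
  qed
  have cpsi: "cos (\<psi> t) = 1 - 2 * q\<^sup>2 * (sin (a t))\<^sup>2" if t: "t \<in> {0..1}" for t
    using S2[OF t] sa[OF t] by simp
  have spsi: "sin (\<psi> t) = - 2 * q * sin (a t) * sqrt (1 - q\<^sup>2 * (sin (a t))\<^sup>2)" if t: "t \<in> {0..1}" for t
    unfolding sqD[OF t] unfolding sa[OF t] S_def using D0[OF t] q0 by simp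
  have Ha': "H1 a (\<lambda>t. \<alpha> * v t * sqrt (1 - q\<^sup>2 * (sin (a t))\<^sup>2))"
    by (rule H1_cong[OF Ha]) (auto simp: sqD)
  have kap: "\<kappa> t = - 2 * q * \<alpha> * v t * cos (a t)" if t: "t \<in> {0..1}" for t
    unfolding ca[OF t] by (rule \<kappa>C)
  show ?thesis
    by (rule that[OF qgt qlt \<alpha>0 lU gc Ha' aends F[unfolded \<sigma>_def] G[unfolded \<sigma>_def] cpsi spsi kap])
qed

end

section \<open>Arcs of small modulus\<close>

text \<open>The energy of the larc with modulus \<open>r\<close>, scaled so that its ends are at distance \<open>l\<close>. Up to
  scaling, this larc is an elastica for the multiplier \<open>gcrit r / l\<^sup>2\<close>, so its energy has at \<open>r\<close> the derivative
  \<open>lam - gcrit r / l\<^sup>2\<close> times that of its length.\<close>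

definition arc_energy :: "real \<Rightarrow> real \<Rightarrow> real \<Rightarrow> real" where
  "arc_energy lam l r = 16 / l * (EllU r * (EllE r - (1 - r\<^sup>2) * EllK r)) + lam * l * (EllK r / EllU r)"

lemma EllB_deriv:
  assumes "0 < r" "r < 1"
  shows "((\<lambda>r. EllE r - (1 - r\<^sup>2) * EllK r) has_real_derivative r * EllK r) (at r)"
proof -
  have m: "1 - r\<^sup>2 > 0" using assms by (simp add: abs_square_less_1)
  have "((\<lambda>r. EllE r - (1 - r\<^sup>2) * EllK r) has_real_derivative (EllE r - EllK r) / r - ((- (2 * r)) * EllK r + (1 - r\<^sup>2) * ((EllE r - (1 - r\<^sup>2) * EllK r) / (r * (1 - r\<^sup>2))))) (at r)"
    by (rule derivative_eq_intros EllE_deriv EllK_deriv assms refl | simp)+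
  moreover have "(EllE r - EllK r) / r - ((- (2 * r)) * EllK r + (1 - r\<^sup>2) * ((EllE r - (1 - r\<^sup>2) * EllK r) / (r * (1 - r\<^sup>2)))) = r * EllK r"
    using assms m by (simp add: field_simps power2_eq_square)
  ultimately show ?thesis by (simp only:)
qed

text \<open>Both parts of the derivative are multiples of the derivative \<open>W\<close> of K / U.
  Its numerator is a positive multiple of (E - m K)^2 + m (1 - m) K^2, hence \<open>W\<close> > 0;
  the identity \<open>B\<close> expresses the bending part through the same quantity.\<close>

lemma arc_energy_deriv:
  assumes r: "0 < r" "r < 1" and U: "EllU r \<noteq> 0" and l: "l > 0"
  obtains L' where "L' > 0" "(arc_energy lam l has_real_derivative (lam - gcrit r / l\<^sup>2) * L') (at r)"
proof -
  define E K U m where "E = EllE r" and "K = EllK r" and "U = EllU r" and "m = 1 - r\<^sup>2"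
  define U' K' where "U' = ((1 - 2 * r\<^sup>2) * E - m * K) / (r * m)" and "K' = (E - m * K) / (r * m)"
  have m: "m > 0" "m < 1" using r by (auto simp: m_def abs_square_less_1)
  have Ue: "U = 2 * E - K" by (simp add: U_def E_def K_def EllU_def)
  have U0: "U \<noteq> 0" using U by (simp add: U_def)
  define W where "W = (K' * U - K * U') / U\<^sup>2"
  have r2: "r\<^sup>2 = 1 - m" by (simp add: m_def)
  have KU: "K' * U - K * U' = 2 * ((E - m * K)\<^sup>2 + m * (1 - m) * K\<^sup>2) / (r * m)"
  proof -
    have "K' * U - K * U' = ((E - m * K) * U - K * ((1 - 2 * r\<^sup>2) * E - m * K)) / (r * m)"
    proof -
      have "b / z * U - K * (c / z) = (b * U - K * c) / z" for b c z :: real by (simp add: diff_divide_distrib)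
      then show ?thesis unfolding K'_def U'_def .
    qed
    also have "(E - m * K) * U - K * ((1 - 2 * r\<^sup>2) * E - m * K) = 2 * ((E - m * K)\<^sup>2 + m * (1 - m) * K\<^sup>2)"
      unfolding Ue r2 by (simp add: power2_eq_square algebra_simps)
    finally show ?thesis .
  qed
  have W: "W > 0"
  proof -
    have "K > 0" using r EllK_pos[of r] by (simp add: K_def)
    then have "m * (1 - m) * K\<^sup>2 > 0" using m by simp
    then have "2 * ((E - m * K)\<^sup>2 + m * (1 - m) * K\<^sup>2) / (r * m) > 0" using r m by (simp add: add_nonneg_pos)
    then show ?thesis unfolding W_def KU by (rule divide_pos_pos) (use U0 in simp)
  qed
  have B: "U' * (E - m * K) + U * (r * K) = - (1/2) * (2 * r\<^sup>2 - 1) * (K' * U - K * U')"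
  proof -
    have "U' * (E - m * K) + U * (r * K) = (((1 - 2 * r\<^sup>2) * E - m * K) * (E - m * K) + U * (r\<^sup>2 * m * K)) / (r * m)"
      unfolding U'_def using r m by (simp add: add_divide_distrib power2_eq_square)
    also have "((1 - 2 * r\<^sup>2) * E - m * K) * (E - m * K) + U * (r\<^sup>2 * m * K) = - (1/2) * (2 * r\<^sup>2 - 1) * (2 * ((E - m * K)\<^sup>2 + m * (1 - m) * K\<^sup>2))"
      unfolding Ue r2 by (simp add: power2_eq_square algebra_simps)
    finally show ?thesis unfolding KU by simp
  qed
  have dU: "(EllU has_real_derivative U') (at r)" using EllU_deriv[OF r] by (simp add: U'_def E_def K_def m_def)
  have dK: "(EllK has_real_derivative K') (at r)" using EllK_deriv[OF r] by (simp add: K'_def E_def K_def m_def)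
  have "(arc_energy lam l has_real_derivative 16 / l * (U' * (E - m * K) + r * K * U) + lam * l * ((K' * U - K * U') / (U * U))) (at r)"
    unfolding arc_energy_def[abs_def] U_def E_def K_def m_def
    by (intro DERIV_add DERIV_cmult DERIV_mult DERIV_divide dU dK EllB_deriv[OF r] U)
  also have "16 / l * (U' * (E - m * K) + r * K * U) + lam * l * ((K' * U - K * U') / (U * U)) = (lam - gcrit r / l\<^sup>2) * (l * W)"
  proof -
    have g: "gcrit r = 8 * U\<^sup>2 * (2 * r\<^sup>2 - 1)" by (simp add: gcrit_def U_def EllU_def)
    have KW: "K' * U - K * U' = W * U\<^sup>2" using U0 by (simp add: W_def)
    have B': "U' * (E - m * K) + r * K * U = - (1/2) * (2 * r\<^sup>2 - 1) * (W * U\<^sup>2)" using B unfolding KW by (simp add: mult_ac)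
    show ?thesis unfolding B' g KW using l U0 by (simp add: field_simps power2_eq_square)
  qed
  finally show ?thesis using that[of "l * W"] W l by simp
qed

text \<open>In the interior \<open>gcrit\<close> lies strictly below its value at \<open>b\<close>,
  so the derivative is positive there. At \<open>b\<close> itself it may vanish, as it does when
  \<open>b\<close> is the modulus of the larc, and this does not affect strictness.\<close>

lemma arc_energy_strict_mono:
  assumes "1 / sqrt 2 \<le> a" "a < b" "b \<le> qhat" and l: "l > 0" and lam: "gcrit b \<le> lam * l\<^sup>2"
  shows "arc_energy lam l a < arc_energy lam l b"
proof -
  have r: "0 < r" "r < 1" "EllU r > 0" if "a \<le> r" "r \<le> b" for r
    using that assms qhat qstar sq_ge_half[of r] EllU_pos[of r] by auto
  show ?thesis
  proof (rule DERIV_pos_imp_increasing_open[OF assms(2)])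
    fix r assume ab: "a < r" "r < b"
    have rr: "0 < r" "r < 1" "EllU r > 0" using r[of r] ab by auto
    have "EllU r \<noteq> 0" using rr by simp
    from arc_energy_deriv[OF rr(1,2) this l, of lam]
    obtain L' where L': "L' > 0" "(arc_energy lam l has_real_derivative (lam - gcrit r / l\<^sup>2) * L') (at r)" by blast
    have "gcrit r < lam * l\<^sup>2" using gcrit_strict_mono[of r b] ab assms by auto
    then have "gcrit r / l\<^sup>2 < lam" using l by (simp add: pos_divide_less_eq)
    then show "\<exists>y. (arc_energy lam l has_real_derivative y) (at r) \<and> 0 < y" using L'
      by (intro exI[of _ "(lam - gcrit r / l\<^sup>2) * L'"] conjI) auto
  next
    show "continuous_on {a..b} (arc_energy lam l)" unfolding continuous_on_eq_continuous_within
    proof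
      fix r assume "r \<in> {a..b}"
      then have rr: "0 < r" "r < 1" "EllU r > 0" using r[of r] by auto
      have "EllU r \<noteq> 0" using rr by simp
      from arc_energy_deriv[OF rr(1,2) this l, of lam]
      show "continuous (at r within {a..b}) (arc_energy lam l)"
        by (metis DERIV_isCont continuous_at_imp_continuous_at_within)
    qed
  qed
qed

lemma uniformly_small_near:
  fixes F :: "real \<Rightarrow> real \<Rightarrow> real"
  assumes c: "continuous_on ({a..b} \<times> {0..1}) (\<lambda>z. F (fst z) (snd z))" and ab: "a \<le> b"
    and z: "\<And>t. t \<in> {0..1} \<Longrightarrow> F b t = 0" and e: "e > 0"
  obtains d where "d > 0" "\<And>r t. r \<in> {a..b} \<Longrightarrow> b - r < d \<Longrightarrow> t \<in> {0..1} \<Longrightarrow> \<bar>F r t\<bar> \<le> e"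
proof -
  have "uniformly_continuous_on ({a..b} \<times> {0..1}) (\<lambda>z. F (fst z) (snd z))"
    by (intro compact_uniformly_continuous c compact_Times) auto
  then obtain d where d: "d > 0" "\<And>z z'. z \<in> {a..b} \<times> {0..1} \<Longrightarrow> z' \<in> {a..b} \<times> {0..1} \<Longrightarrow> dist z' z < d \<Longrightarrow>
     dist (F (fst z') (snd z')) (F (fst z) (snd z)) < e"
    using e unfolding uniformly_continuous_on_def by metis
  show ?thesis
  proof (rule that[OF d(1)])
    fix r t assume r: "r \<in> {a..b}" "b - r < d" and t: "t \<in> {0..(1::real)}"
    have "dist (r, t) (b, t) < d" using r by (simp add: dist_Pair_Pair dist_real_def)
    then have "dist (F r t) (F b t) < e" using d(2)[of "(b, t)" "(r, t)"] r t ab by auto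
    then show "\<bar>F r t\<bar> \<le> e" using z[OF t] by (simp add: dist_real_def)
  qed
qed

section \<open>The family of arcs of neighbouring modulus through a given arc\<close>

context critical_curve begin

context
  fixes q \<alpha> :: real and a :: "real \<Rightarrow> real"
  assumes q: "1 / sqrt 2 < q" "q < 1" and \<alpha>: "\<alpha> > 0" and al: "\<alpha> * l = 2 * EllU q"
    and Ha: "H1 a (\<lambda>t. \<alpha> * v t * sqrt (1 - q\<^sup>2 * (sin (a t))\<^sup>2))"
    and aends: "a 0 = - (pi / 2)" "a 1 = pi / 2"
    and cpsi: "\<And>t. t \<in> {0..1} \<Longrightarrow> cos (\<psi> t) = 1 - 2 * q\<^sup>2 * (sin (a t))\<^sup>2"
    and spsi: "\<And>t. t \<in> {0..1} \<Longrightarrow> sin (\<psi> t) = - 2 * q * sin (a t) * sqrt (1 - q\<^sup>2 * (sin (a t))\<^sup>2)"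
    and kap: "\<And>t. t \<in> {0..1} \<Longrightarrow> \<kappa> t = - 2 * q * \<alpha> * v t * cos (a t)"
begin

definition "S t = sin (a t)"
definition "D r t = sqrt (1 - r\<^sup>2 * (S t)\<^sup>2)"
definition "S' t = cos (a t) * (\<alpha> * v t * D q t)"
definition "\<alpha>r r = 2 * EllU r / l"
text \<open>The arc of modulus \<open>r\<close> is run through with the same amplitude function
  \<open>a\<close>. Its speed must then be a' / (\<open>\<alpha>r r\<close> \<open>D r\<close>),
  where \<open>\<alpha>r r\<close> normalizes the chord to \<open>l\<close>; the factor
  \<open>\<omega>\<close> is the ratio of this speed to \<open>v\<close>, and equals 1 at
  \<open>r\<close> = \<open>q\<close>.\<close>

definition "\<omega> r t = \<alpha> / \<alpha>r r * (D q t * (1 / D r t))"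
definition "D' r t = - (r\<^sup>2 * S t * S' t) / D r t"
definition "\<omega>' r t = \<alpha> / \<alpha>r r * (D' q t * (1 / D r t) + D q t * (- D' r t / (D r t)\<^sup>2))"
definition "w r t = v t * \<omega> r t"
definition "w' r t = v' t * \<omega> r t + v t * \<omega>' r t"
text \<open>The angle is given as a correction of \<open>\<psi>\<close>, not directly as -2 arcsin
  (r sin a), because the hypotheses determine \<open>\<psi>\<close> only modulo 2 pi. This way it
  stays close to \<open>\<psi>\<close> for \<open>r\<close> near \<open>q\<close>.\<close>

definition "\<phi> r t = \<psi> t + (2 * arcsin (q * S t) - 2 * arcsin (r * S t))"
definition "\<mu> r t = \<kappa> t + (2 * (q * S' t / D q t) - 2 * (r * S' t / D r t))"

lemma Ha': "H1 a (\<lambda>t. \<alpha> * v t * D q t)" using Ha by (simp add: D_def S_def)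
lemma ca: "continuous_on {0..1} a" by (rule H1_continuous[OF Ha])
lemma cS: "continuous_on {0..1} S" unfolding S_def[abs_def] by (intro continuous_intros ca)

lemma HS: "H1 S S'"
  using H1_sin[OF Ha'] by (simp add: S_def[abs_def] S'_def[abs_def])

lemma rS: assumes "0 < r" "r < 1" shows "1 - r\<^sup>2 * (S t)\<^sup>2 > 0" "- 1 < r * S t" "r * S t < 1"
proof -
  show *: "1 - r\<^sup>2 * (S t)\<^sup>2 > 0" unfolding S_def using assms by (intro modulus_bound(2)) auto
  then have "(r * S t)\<^sup>2 < 1" by (simp add: power_mult_distrib)
  then show "- 1 < r * S t" "r * S t < 1" unfolding abs_square_less_1 by linarith+
qed

lemma D_pos: "0 < r \<Longrightarrow> r < 1 \<Longrightarrow> D r t > 0" using rS(1) by (simp add: D_def)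
lemma D_sq: "0 < r \<Longrightarrow> r < 1 \<Longrightarrow> D r t * D r t = 1 - r\<^sup>2 * (S t)\<^sup>2"
  using rS(1)[of r t] by (simp add: D_def power2_eq_square[symmetric])

lemma q0: "0 < q" using q(1) inv_sqrt2(1) by linarith

lemma HD: assumes r: "0 < r" "r < 1" shows "H1 (D r) (D' r)"
proof -
  have "H1 (\<lambda>t. sqrt (1 - r\<^sup>2 * (S t * S t))) (\<lambda>t. (0 - r\<^sup>2 * (S' t * S t + S t * S' t)) / (2 * sqrt (1 - r\<^sup>2 * (S t * S t))))"
    using rS(1)[OF r] by (intro H1_sqrt H1_diff H1_const H1_cmult H1_mult HS) (simp add: power2_eq_square)
  then show ?thesis
    by (rule H1_cong) (auto simp: D_def D'_def power2_eq_square)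
qed

lemma Hw: assumes r: "0 < r" "r < 1" shows "H1 (w r) (w' r)"
proof -
  have "H1 (\<lambda>t. v t * (\<alpha> / \<alpha>r r * (D q t * (1 / D r t)))) (\<lambda>t. v' t * (\<alpha> / \<alpha>r r * (D q t * (1 / D r t))) + v t * (\<alpha> / \<alpha>r r * (D' q t * (1 / D r t) + D q t * (- D' r t / (D r t)\<^sup>2))))"
    using D_pos[OF r] by (intro H1_mult H1_cmult H1_inverse Hv HD r q q0) (auto simp: less_le)
  then show ?thesis by (simp add: w_def[abs_def] w'_def[abs_def] \<omega>_def \<omega>'_def)
qed

lemma H\<phi>: assumes r: "0 < r" "r < 1" shows "H1 (\<phi> r) (\<mu> r)"
proof -
  have as: "H1 (\<lambda>t. arcsin (r * S t)) (\<lambda>t. r * S' t / D r t)" if r: "0 < r" "r < 1" for r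
  proof -
    have "H1 (\<lambda>t. arcsin (r * S t)) (\<lambda>t. inverse (sqrt (1 - (r * S t)\<^sup>2)) * (r * S' t))"
    proof (rule H1_chain[OF H1_cmult[OF HS], where h=arcsin and h'="\<lambda>x. inverse (sqrt (1 - x\<^sup>2))"])
      fix x assume "x \<in> (\<lambda>t. r * S t) ` {0..1}"
      then show "(arcsin has_real_derivative inverse (sqrt (1 - x\<^sup>2))) (at x)" using rS[OF r] by (auto intro!: DERIV_arcsin)
    next
      show "continuous_on ((\<lambda>t. r * S t) ` {0..1}) (\<lambda>x. inverse (sqrt (1 - x\<^sup>2)))"
        using rS(1)[OF r] by (intro continuous_intros) (auto simp: power_mult_distrib less_le)
    qed
    then show ?thesis by (rule H1_cong) (auto simp: D_def power_mult_distrib field_simps)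
  qed
  have "H1 (\<lambda>t. \<psi> t + (2 * arcsin (q * S t) - 2 * arcsin (r * S t))) (\<lambda>t. \<kappa> t + (2 * (q * S' t / D q t) - 2 * (r * S' t / D r t)))"
    by (intro H1_add H1_diff H1_cmult H\<psi> as r q q0)
  then show ?thesis by (simp add: \<phi>_def[abs_def] \<mu>_def[abs_def])
qed

lemma trig_\<phi>:
  assumes r: "0 < r" "r < 1" and t: "t \<in> {0..1}"
  shows "cos (\<phi> r t) = 1 - 2 * r\<^sup>2 * (S t)\<^sup>2" "sin (\<phi> r t) = - 2 * r * S t * D r t"
proof -
  have tr: "cos (2 * arcsin (r * S t)) = 1 - 2 * r\<^sup>2 * (S t)\<^sup>2" "sin (2 * arcsin (r * S t)) = 2 * r * S t * D r t" if r: "0 < r" "r < 1" for r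
  proof -
    have 1: "sin (arcsin (r * S t)) = r * S t" "cos (arcsin (r * S t)) = D r t"
      using rS[OF r, of t] by (auto simp: cos_arcsin D_def power_mult_distrib)
    show "cos (2 * arcsin (r * S t)) = 1 - 2 * r\<^sup>2 * (S t)\<^sup>2" unfolding cos_double_sin 1 by (simp add: power_mult_distrib)
    show "sin (2 * arcsin (r * S t)) = 2 * r * S t * D r t" unfolding sin_double 1 by simp
  qed
  define A where "A = 2 * arcsin (q * S t)"
  define B where "B = 2 * arcsin (r * S t)"
  have \<psi>A: "cos (\<psi> t) = cos A" "sin (\<psi> t) = - sin A"
    unfolding A_def tr[OF q0 q(2)] cpsi[OF t] spsi[OF t] by (simp_all add: S_def D_def)
  \<comment> \<open>So \<open>\<psi> t + A\<close> is a multiple of 2 pi, which need not be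
    identified.\<close>
  have "cos (\<psi> t + A) = 1" "sin (\<psi> t + A) = 0"
    unfolding cos_add sin_add \<psi>A by (simp_all add: algebra_simps)
  then have "cos ((\<psi> t + A) - B) = cos B" "sin ((\<psi> t + A) - B) = - sin B"
    unfolding cos_diff sin_diff by simp_all
  moreover have "\<phi> r t = (\<psi> t + A) - B" by (simp add: \<phi>_def A_def B_def)
  ultimately show "cos (\<phi> r t) = 1 - 2 * r\<^sup>2 * (S t)\<^sup>2" "sin (\<phi> r t) = - 2 * r * S t * D r t"
    using tr[OF r] by (simp_all add: B_def)
qed

lemma H1_has_integral: "H1 f f' \<Longrightarrow> (f' has_integral f 1 - f 0) {0..1}"
  using integrable_integral[OF L2_integrable[OF H1_L2]] H1_eq[of f f' 1] by fastforce

text \<open>The amplitude serves as integration variable on [-pi/2, pi/2]. Everything reduces to the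
  integrals \<open>IF\<close>, \<open>IE\<close> and \<open>IS\<close>, that is, to complete
  integrals of modulus \<open>r\<close> and to a sine integral that vanishes by symmetry.\<close>

lemma family_integrals:
  assumes r: "0 < r" "r < 1" "EllU r > 0"
  shows "integral {0..1} (\<lambda>t. (\<mu> r t)\<^sup>2 / w r t) + lam * integral {0..1} (w r) = arc_energy lam l r"
    and "integral {0..1} (\<lambda>t. w r t * cos (\<phi> r t)) = l"
    and "integral {0..1} (\<lambda>t. w r t * sin (\<phi> r t)) = 0"
proof -
  have ar: "\<alpha>r r > 0" using r(3) l by (simp add: \<alpha>r_def)
  have ra: "\<bar>r\<bar> < 1" using r by simp
  define a' where "a' = (\<lambda>t. \<alpha> * v t * D q t)"
  have Da: "sqrt (1 - r\<^sup>2 * (sin (a t))\<^sup>2) = D r t" for t by (simp add: D_def S_def)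
  have "H1 (\<lambda>t. EllF (a t) r) (\<lambda>t. 1 / sqrt (1 - r\<^sup>2 * (sin (a t))\<^sup>2) * (\<alpha> * v t * D q t))"
    by (rule H1_chain[OF Ha', where h="\<lambda>x. EllF x r"]) (rule EllF_deriv[OF ra], rule EllF_integrand_continuous[OF ra])
  from H1_has_integral[OF this] have IF: "((\<lambda>t. 1 / D r t * a' t) has_integral 2 * EllK r) {0..1}"
    using EllF_minus[OF ra, of "pi / 2"] by (simp add: aends EllK_def Da a'_def)
  have "H1 (\<lambda>t. EllEx (a t) r) (\<lambda>t. sqrt (1 - r\<^sup>2 * (sin (a t))\<^sup>2) * (\<alpha> * v t * D q t))"
    by (rule H1_chain[OF Ha', where h="\<lambda>x. EllEx x r"]) (rule EllEx_deriv[OF ra], rule EllE_integrand_continuous[OF ra])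
  from H1_has_integral[OF this] have IE: "((\<lambda>t. D r t * a' t) has_integral 2 * EllE r) {0..1}"
    using EllEx_minus[OF ra, of "pi / 2"] by (simp add: aends EllE_def Da a'_def)
  from H1_has_integral[OF H1_cos[OF Ha']] have IS: "((\<lambda>t. - S t * a' t) has_integral 0) {0..1}"
    by (simp add: aends S_def a'_def)
  have Dr: "D r t > 0" "D q t > 0" for t using D_pos r q q0 by auto
  have wa: "w r t = 1 / \<alpha>r r * (1 / D r t * a' t)" if "t \<in> {0..1}" for t
    by (simp add: w_def \<omega>_def a'_def)
  have "((\<lambda>t. 1 / \<alpha>r r * (1 / D r t * a' t)) has_integral 1 / \<alpha>r r * (2 * EllK r)) {0..1}"
    by (intro has_integral_mult_right IF)
  then have IW: "integral {0..1} (w r) = 1 / \<alpha>r r * (2 * EllK r)"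
    by (intro integral_unique) (rule has_integral_eq[rotated], auto simp: wa)
  have mu: "(\<mu> r t)\<^sup>2 / w r t = 4 * \<alpha>r r * (D r t * a' t - (1 - r\<^sup>2) * (1 / D r t * a' t))" if t: "t \<in> {0..1}" for t
  proof -
    have S': "S' t = cos (a t) * a' t" by (simp add: S'_def a'_def)
    have "\<kappa> t + 2 * (q * S' t / D q t) = 0"
      unfolding kap[OF t] S' a'_def using Dr(2)[of t] by simp
    then have m: "\<mu> r t = - 2 * r * cos (a t) * a' t / D r t" unfolding \<mu>_def S' by (simp add: algebra_simps)
    have a0: "a' t > 0" using vp[OF t] \<alpha> Dr(2)[of t] by (simp add: a'_def)
    have "(\<mu> r t)\<^sup>2 / w r t = 4 * \<alpha>r r * (r\<^sup>2 * (cos (a t))\<^sup>2 / D r t * a' t)"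
      unfolding m wa[OF t] using Dr(1)[of t] a0 ar by (simp add: power2_eq_square field_simps)
    also have "r\<^sup>2 * (cos (a t))\<^sup>2 = D r t * D r t - (1 - r\<^sup>2)"
      unfolding D_sq[OF r(1,2)] by (simp add: S_def cos_squared_eq algebra_simps)
    also have "(D r t * D r t - (1 - r\<^sup>2)) / D r t * a' t = D r t * a' t - (1 - r\<^sup>2) * (1 / D r t * a' t)"
      using Dr(1)[of t] by (simp add: field_simps)
    finally show ?thesis .
  qed
  have "((\<lambda>t. 4 * \<alpha>r r * (D r t * a' t - (1 - r\<^sup>2) * (1 / D r t * a' t))) has_integral 4 * \<alpha>r r * (2 * EllE r - (1 - r\<^sup>2) * (2 * EllK r))) {0..1}"
    by (intro has_integral_mult_right has_integral_diff IE IF)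
  then have IM: "integral {0..1} (\<lambda>t. (\<mu> r t)\<^sup>2 / w r t) = 4 * \<alpha>r r * (2 * EllE r - (1 - r\<^sup>2) * (2 * EllK r))"
    by (intro integral_unique) (rule has_integral_eq[rotated], auto simp: mu)
  show "integral {0..1} (\<lambda>t. (\<mu> r t)\<^sup>2 / w r t) + lam * integral {0..1} (w r) = arc_energy lam l r"
    unfolding IM IW arc_energy_def \<alpha>r_def using l r(3) by (simp add: field_simps)
  have I1: "((\<lambda>t. 1 / \<alpha>r r * (2 * (D r t * a' t) - 1 / D r t * a' t)) has_integral 1 / \<alpha>r r * (2 * (2 * EllE r) - 2 * EllK r)) {0..1}"
    by (intro has_integral_mult_right has_integral_diff IE IF)
  have e1: "1 / \<alpha>r r * (2 * (D r t * a' t) - 1 / D r t * a' t) = w r t * cos (\<phi> r t)" if t: "t \<in> {0..1}" for t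
  proof -
    have e: "cos (\<phi> r t) = 2 * (D r t * D r t) - 1" unfolding trig_\<phi>(1)[OF r(1,2) t] D_sq[OF r(1,2)] by simp
    show ?thesis unfolding wa[OF t] e using Dr(1)[of t] by (simp add: field_simps)
  qed
  have "integral {0..1} (\<lambda>t. w r t * cos (\<phi> r t)) = 1 / \<alpha>r r * (2 * (2 * EllE r) - 2 * EllK r)"
    by (rule integral_unique[OF has_integral_eq[OF e1 I1]])
  also have "\<dots> = l" using l r(3) by (simp add: \<alpha>r_def EllU_def)
  finally show "integral {0..1} (\<lambda>t. w r t * cos (\<phi> r t)) = l" .
  have I2: "((\<lambda>t. 2 * r / \<alpha>r r * (- S t * a' t)) has_integral 2 * r / \<alpha>r r * 0) {0..1}"
    by (intro has_integral_mult_right IS)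
  have e2: "2 * r / \<alpha>r r * (- S t * a' t) = w r t * sin (\<phi> r t)" if t: "t \<in> {0..1}" for t
    unfolding wa[OF t] trig_\<phi>(2)[OF r(1,2) t] using Dr(1)[of t] by simp
  have "integral {0..1} (\<lambda>t. w r t * sin (\<phi> r t)) = 2 * r / \<alpha>r r * 0"
    by (rule integral_unique[OF has_integral_eq[OF e2 I2]])
  then show "integral {0..1} (\<lambda>t. w r t * sin (\<phi> r t)) = 0" by simp
qed

lemma EllU_q: "EllU q > 0" using al \<alpha> l by (metis mult_pos_pos zero_less_mult_pos zero_less_numeral)

lemma arc_energy_eq: "energy lam g = arc_energy lam l q"
proof -
  have a1: "\<alpha>r q = \<alpha>" using al l by (simp add: \<alpha>r_def field_simps)
  have w1: "w q t = v t" for t using D_pos[OF q0 q(2), of t] \<alpha> by (simp add: w_def \<omega>_def a1)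
  have m1: "\<mu> q t = \<kappa> t" for t by (simp add: \<mu>_def)
  show ?thesis using family_integrals(1)[OF q0 q(2) EllU_q] unfolding polar_energy[OF P]
    by (simp add: w1[abs_def] m1 w1)
qed

text \<open>Moduli slightly below \<open>q\<close> give curves with the same ends and less energy by
  \<open>arc_energy_strict_mono\<close>. Compactness makes the four differences in speed, angle and
  their derivatives small uniformly in \<open>t\<close>. Since the comparison goes to the left,
  \<open>q = qhat\<close> is covered.\<close>

lemma short_arc_unstable:
  assumes qh: "q \<le> qhat" and gc: "gcrit q = lam * l\<^sup>2" shows "\<not> stable lam l g"
proof -
  obtain V where V: "V > 0" "\<And>t. t \<in> {0..1} \<Longrightarrow> \<bar>v t\<bar> \<le> V" using continuous_Icc_bound[OF cv] by blast
  \<comment> \<open>A lower end for a compact interval of moduli on which \<open>EllU\<close> is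
    positive and \<open>gcrit\<close> increases.\<close>
  define q1 where "q1 = 1 / sqrt 2"
  have q1: "0 < q1" "q1 < q" using q inv_sqrt2 by (auto simp: q1_def)
  have rng: "0 < r" "r < 1" "EllU r > 0" if "r \<in> {q1..q}" for r
    using that q1 q qh qhat qstar EllU_pos[of r] by auto
  let ?Q = "{q1..q} \<times> {0..1::real}"
  have cf: "continuous_on ?Q fst" and cs: "continuous_on ?Q snd" by (intro continuous_intros)+
  have jS: "continuous_on ?Q (\<lambda>z. S (snd z))" by (rule continuous_on_compose2[OF cS cs]) auto
  have ja: "continuous_on ?Q (\<lambda>z. a (snd z))" by (rule continuous_on_compose2[OF ca cs]) auto
  have jv: "continuous_on ?Q (\<lambda>z. v (snd z))" by (rule continuous_on_compose2[OF cv cs]) auto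
  have jU: "continuous_on ?Q (\<lambda>z. EllU (fst z))"
    by (rule continuous_on_compose2[OF EllU_continuous[of q1 q] cf]) (use q1 q in auto)
  have j\<alpha>: "continuous_on ?Q (\<lambda>z. \<alpha>r (fst z))" unfolding \<alpha>r_def using l by (intro continuous_intros jU) auto
  have jDq: "continuous_on ?Q (\<lambda>z. D q (snd z))" unfolding D_def by (intro continuous_intros jS)
  have jD: "continuous_on ?Q (\<lambda>z. D (fst z) (snd z))" unfolding D_def by (intro continuous_intros jS cf)
  have jS': "continuous_on ?Q (\<lambda>z. S' (snd z))" unfolding S'_def by (intro continuous_intros ja jv jDq)
  have nz: "D r t \<noteq> 0" "\<alpha>r r \<noteq> 0" "D q t \<noteq> 0" if "r \<in> {q1..q}" for r t
    using D_pos[of r t] D_pos[OF q0 q(2), of t] rng[OF that] l by (auto simp: \<alpha>r_def)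
  have jD': "continuous_on ?Q (\<lambda>z. D' (fst z) (snd z))" unfolding D'_def
    using nz by (intro continuous_intros jS jS' jD cf) auto
  have jD'q: "continuous_on ?Q (\<lambda>z. D' q (snd z))" unfolding D'_def
    using nz by (intro continuous_intros jS jS' jDq) auto
  have c1: "continuous_on ?Q (\<lambda>z. \<omega> (fst z) (snd z) - 1)" unfolding \<omega>_def
    using nz by (intro continuous_intros j\<alpha> jDq jD) auto
  have c2: "continuous_on ?Q (\<lambda>z. 2 * arcsin (q * S (snd z)) - 2 * arcsin (fst z * S (snd z)))"
    using rS(2,3)[OF q0 q(2)] rS(2,3)[OF rng(1,2)] by (intro continuous_intros jS cf) (auto simp: less_imp_le)
  have c3: "continuous_on ?Q (\<lambda>z. \<omega>' (fst z) (snd z))" unfolding \<omega>'_def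
    using nz by (intro continuous_intros j\<alpha> jDq jD jD' jD'q) auto
  have c4: "continuous_on ?Q (\<lambda>z. 2 * (q * S' (snd z) / D q (snd z)) - 2 * (fst z * S' (snd z) / D (fst z) (snd z)))"
    using nz by (intro continuous_intros jS' jDq jD cf) auto
  have a1: "\<alpha>r q = \<alpha>" using al l by (simp add: \<alpha>r_def field_simps)
  have qq: "q1 \<le> q" using q1 by simp
  show ?thesis
  proof (rule not_stableI[OF P, where H="\<lambda>t. \<bar>v' t\<bar> + (V + 1)"])
    \<comment> \<open>The derivative of the speed changes by (\<open>\<omega>\<close> - 1) v' +
      \<open>\<omega>'\<close> v, so its error is controlled by \<bar>\<open>v'\<close>\<bar> plus a
      bounded term.\<close>
    show "L2 (\<lambda>t. \<bar>v' t\<bar> + (V + 1))" by (intro L2_add L2_abs H1_L2[OF Hv] continuous_on_imp_L2) auto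
    show "\<And>t. 0 \<le> \<bar>v' t\<bar> + (V + 1)" using V(1) by simp
    show "g 0 = (0, 0)" by (rule g0)
    fix e :: real assume e: "e > 0"
    define e1 where "e1 = e / (V + 1)"
    have e1: "e1 > 0" "e1 * (V + 1) = e" using e V(1) by (auto simp: e1_def)
    obtain d1 where d1: "d1 > 0" "\<And>r t. r \<in> {q1..q} \<Longrightarrow> q - r < d1 \<Longrightarrow> t \<in> {0..1} \<Longrightarrow> \<bar>\<omega> r t - 1\<bar> \<le> e1"
    proof (rule uniformly_small_near[OF c1 qq _ e1(1)])
      show "\<omega> q t - 1 = 0" for t using D_pos[OF q0 q(2), of t] \<alpha> by (simp add: \<omega>_def a1)
    qed blast
    obtain d2 where d2: "d2 > 0" "\<And>r t. r \<in> {q1..q} \<Longrightarrow> q - r < d2 \<Longrightarrow> t \<in> {0..1} \<Longrightarrow> \<bar>2 * arcsin (q * S t) - 2 * arcsin (r * S t)\<bar> \<le> e1"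
      by (rule uniformly_small_near[OF c2 qq _ e1(1)]) auto
    obtain d3 where d3: "d3 > 0" "\<And>r t. r \<in> {q1..q} \<Longrightarrow> q - r < d3 \<Longrightarrow> t \<in> {0..1} \<Longrightarrow> \<bar>\<omega>' r t\<bar> \<le> e1"
    proof (rule uniformly_small_near[OF c3 qq _ e1(1)])
      show "\<omega>' q t = 0" for t using D_pos[OF q0 q(2), of t] by (simp add: \<omega>'_def power2_eq_square)
    qed blast
    obtain d4 where d4: "d4 > 0" "\<And>r t. r \<in> {q1..q} \<Longrightarrow> q - r < d4 \<Longrightarrow> t \<in> {0..1} \<Longrightarrow> \<bar>2 * (q * S' t / D q t) - 2 * (r * S' t / D r t)\<bar> \<le> e1"
      by (rule uniformly_small_near[OF c4 qq _ e1(1)]) auto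
    define d where "d = min (min d1 d2) (min d3 (min d4 (q - q1)))"
    define r where "r = q - d / 2"
    have dd: "d > 0" "d \<le> d1" "d \<le> d2" "d \<le> d3" "d \<le> d4" "d \<le> q - q1" using d1(1) d2(1) d3(1) d4(1) q1 by (auto simp: d_def)
    have r: "r \<in> {q1..q}" "r < q" "q - r < d1" "q - r < d2" "q - r < d3" "q - r < d4"
      using dd by (auto simp: r_def)
    note rr = rng[OF r(1)]
    define G where "G = (\<lambda>t. (0 + integral {0..t} (\<lambda>t. w r t * cos (\<phi> r t)), 0 + integral {0..t} (\<lambda>t. w r t * sin (\<phi> r t))))"
    have wp: "w r t > 0" if "t \<in> {0..1}" for t
      using vp[OF that] \<alpha> D_pos[OF rr(1,2), of t] D_pos[OF q0 q(2), of t] rr(3) l by (simp add: w_def \<omega>_def \<alpha>r_def)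
    have PG: "polar G (w r) (w' r) (\<phi> r) (\<mu> r)"
      unfolding G_def by (rule polar_primitive[OF Hw[OF rr(1,2)] wp H\<phi>[OF rr(1,2)]])
    have "energy lam G = arc_energy lam l r" unfolding polar_energy[OF PG] by (rule family_integrals(1)[OF rr])
    also have "\<dots> < arc_energy lam l q"
      using r q1 qh gc l by (intro arc_energy_strict_mono) (auto simp: q1_def)
    finally have en: "energy lam G < energy lam g" by (simp add: arc_energy_eq)
    have G01: "G 0 = (0, 0)" "G 1 = (l, 0)" using family_integrals(2,3)[OF rr] by (auto simp: G_def)
    have cl: "\<bar>w r t - v t\<bar> \<le> e \<and> \<bar>\<phi> r t - \<psi> t\<bar> \<le> e \<and> \<bar>w' r t - v' t\<bar> \<le> e * (\<bar>v' t\<bar> + (V + 1)) \<and> \<bar>\<mu> r t - \<kappa> t\<bar> \<le> e * (\<bar>v' t\<bar> + (V + 1))"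
      if t: "t \<in> {0..1}" for t
    proof (intro conjI)
      have e1e: "e1 \<le> e" using e1 V(1) mult_left_mono[of 1 "V + 1" e1] by simp
      have e1V: "e1 * V \<le> e" using e1 by (simp add: algebra_simps)
      note s1 = d1(2)[OF r(1,3) t] and s2 = d2(2)[OF r(1,4) t] and s3 = d3(2)[OF r(1,5) t] and s4 = d4(2)[OF r(1,6) t]
      have "w r t - v t = (\<omega> r t - 1) * v t" by (simp add: w_def algebra_simps)
      then have "\<bar>w r t - v t\<bar> \<le> e1 * V" unfolding abs_mult using s1 V e1(1) t
        by (metis abs_ge_zero abs_mult less_imp_le mult_mono)
      then show "\<bar>w r t - v t\<bar> \<le> e" using e1V by linarith
      show "\<bar>\<phi> r t - \<psi> t\<bar> \<le> e" using s2 e1e by (simp add: \<phi>_def)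
      have "w' r t - v' t = (\<omega> r t - 1) * v' t + \<omega>' r t * v t" by (simp add: w'_def algebra_simps)
      then have "\<bar>w' r t - v' t\<bar> \<le> \<bar>\<omega> r t - 1\<bar> * \<bar>v' t\<bar> + \<bar>\<omega>' r t\<bar> * \<bar>v t\<bar>" by (metis abs_mult abs_triangle_ineq)
      also have "\<dots> \<le> e * \<bar>v' t\<bar> + e * (V + 1)"
        using s1 s3 e1e V t e by (intro add_mono mult_mono) (auto intro: order_trans[OF V(2)])
      finally show "\<bar>w' r t - v' t\<bar> \<le> e * (\<bar>v' t\<bar> + (V + 1))" by (simp add: algebra_simps)
      have "\<bar>\<mu> r t - \<kappa> t\<bar> \<le> e * 1" using s4 e1e by (simp add: \<mu>_def)
      also have "\<dots> \<le> e * (\<bar>v' t\<bar> + (V + 1))" using e V(1) by (intro mult_left_mono) auto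
      finally show "\<bar>\<mu> r t - \<kappa> t\<bar> \<le> e * (\<bar>v' t\<bar> + (V + 1))" .
    qed
    show "\<exists>G w w' \<phi> \<mu>. polar G w w' \<phi> \<mu> \<and> G 0 = (0, 0) \<and> G 1 = (l, 0) \<and> energy lam G < energy lam g \<and>
     (\<forall>t\<in>{0..1}. \<bar>w t - v t\<bar> \<le> e \<and> \<bar>\<phi> t - \<psi> t\<bar> \<le> e \<and> \<bar>w' t - v' t\<bar> \<le> e * (\<bar>v' t\<bar> + (V + 1)) \<and> \<bar>\<mu> t - \<kappa> t\<bar> \<le> e * (\<bar>v' t\<bar> + (V + 1)))"
      using PG G01 en cl by blast
  qed
qed

end

end

section \<open>A calibration bound\<close>

text \<open>Chosen so that lam + 2 \<open>\<beta>\<close>^2 cos \<open>\<theta>\<close> vanishes at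
  the angles plus and minus A with r = sin (A / 2), where the cosine is 1 - 2 r^2. For the larc,
  \<open>low_beta\<close> at its modulus is its scale \<open>\<alpha>\<close>.\<close>

definition low_beta :: "real \<Rightarrow> real \<Rightarrow> real" where
  "low_beta lam r = sqrt (lam / (2 * (2 * r\<^sup>2 - 1)))"

text \<open>Twice the integral of the calibration weight over [-A, A], minus 2
  \<open>\<beta>\<close>^2 l, the greatest work that a multiplier of length 2
  \<open>\<beta>\<close>^2 can do along a chord of length \<open>l\<close>.\<close>

definition low_energy :: "real \<Rightarrow> real \<Rightarrow> real \<Rightarrow> real" where
  "low_energy lam l r = 16 * (low_beta lam r * (EllE r - (1 - r\<^sup>2) * EllK r)) - 2 * l * (low_beta lam r)\<^sup>2"

lemma low_beta:
  assumes "lam > 0" "1/2 < r\<^sup>2"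
  shows "low_beta lam r > 0" "(low_beta lam r)\<^sup>2 * (2 * (2 * r\<^sup>2 - 1)) = lam"
  using assms by (auto simp: low_beta_def)

lemma low_beta_deriv:
  assumes "lam > 0" "1/2 < r\<^sup>2"
  shows "(low_beta lam has_real_derivative - (2 * r * low_beta lam r / (2 * r\<^sup>2 - 1))) (at r)"
proof -
  have p: "2 * r\<^sup>2 - 1 > 0" using assms by simp
  define z where "z = lam / (2 * (2 * r\<^sup>2 - 1))"
  have z: "z > 0" using p assms by (simp add: z_def)
  have "((\<lambda>r. lam / (2 * (2 * r\<^sup>2 - 1))) has_real_derivative - (lam * (2 * (2 * (2 * r)))) / ((2 * (2 * r\<^sup>2 - 1)) * (2 * (2 * r\<^sup>2 - 1)))) (at r)"
    using p by (auto intro!: derivative_eq_intros)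
  from DERIV_chain2[OF DERIV_real_sqrt[OF z[unfolded z_def]] this]
  have "(low_beta lam has_real_derivative inverse (sqrt z) / 2 * (- (lam * (2 * (2 * (2 * r)))) / ((2 * (2 * r\<^sup>2 - 1)) * (2 * (2 * r\<^sup>2 - 1))))) (at r)"
    unfolding low_beta_def[abs_def] z_def .
  moreover have "inverse (sqrt z) / 2 * (- (lam * (2 * (2 * (2 * r)))) / ((2 * (2 * r\<^sup>2 - 1)) * (2 * (2 * r\<^sup>2 - 1)))) = - (2 * r * sqrt z / (2 * r\<^sup>2 - 1))"
  proof -
    have "inverse (sqrt z) / 2 * (- (lam * (2 * (2 * (2 * r)))) / ((2 * (2 * r\<^sup>2 - 1)) * (2 * (2 * r\<^sup>2 - 1)))) = - (2 * r * (z / sqrt z) / (2 * r\<^sup>2 - 1))"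
    proof -
      have "inverse s / 2 * (- (lam * (2 * (2 * (2 * r)))) / ((2 * m) * (2 * m))) = - (2 * r * (lam / (2 * m) / s) / m)"
        if "s \<noteq> 0" "m \<noteq> 0" for s m :: real using that by (simp add: field_simps)
      from this[of "sqrt z" "2 * r\<^sup>2 - 1"] show ?thesis using p z assms(1) by (simp add: z_def)
    qed
    also have "z / sqrt z = sqrt z" using z by (simp add: real_div_sqrt)
    finally show ?thesis .
  qed
  ultimately show ?thesis unfolding low_beta_def z_def by simp
qed

text \<open>The contributions of E and K combine to \<open>EllU\<close>. The bound is thus
  stationary in \<open>r\<close> precisely when the arc of modulus \<open>r\<close> and scale
  \<open>low_beta lam r\<close> has chord \<open>l\<close>.\<close>

lemma low_energy_deriv:
  assumes "lam > 0" "1/2 < r\<^sup>2" "0 < r" "r < 1"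
  shows "(low_energy lam l has_real_derivative 8 * r * low_beta lam r * (low_beta lam r * l - 2 * EllU r) / (2 * r\<^sup>2 - 1)) (at r)"
proof -
  define b E K where "b = low_beta lam r" and "E = EllE r" and "K = EllK r"
  have p: "2 * r\<^sup>2 - 1 > 0" using assms by simp
  have db: "(low_beta lam has_real_derivative - (2 * r * b / (2 * r\<^sup>2 - 1))) (at r)"
    unfolding b_def by (rule low_beta_deriv[OF assms(1,2)])
  have fe: "low_energy lam l = (\<lambda>r. 16 * (low_beta lam r * (EllE r - (1 - r\<^sup>2) * EllK r)) - 2 * l * (low_beta lam r * low_beta lam r))"
    by (simp add: low_energy_def fun_eq_iff power2_eq_square)
  have "(low_energy lam l has_real_derivative 16 * (- (2 * r * b / (2 * r\<^sup>2 - 1)) * (E - (1 - r\<^sup>2) * K) + r * K * b)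
      - 2 * l * (- (2 * r * b / (2 * r\<^sup>2 - 1)) * b + - (2 * r * b / (2 * r\<^sup>2 - 1)) * b)) (at r)"
    unfolding fe using DERIV_diff[OF DERIV_cmult[OF DERIV_mult[OF db EllB_deriv[OF assms(3,4)]]] DERIV_cmult[OF DERIV_mult[OF db db]]]
    unfolding b_def E_def K_def .
  moreover have "16 * (- (2 * r * b / (2 * r\<^sup>2 - 1)) * (E - (1 - r\<^sup>2) * K) + r * K * b)
      - 2 * l * (- (2 * r * b / (2 * r\<^sup>2 - 1)) * b + - (2 * r * b / (2 * r\<^sup>2 - 1)) * b)
     = 8 * r * b * (b * l - 2 * EllU r) / (2 * r\<^sup>2 - 1)"
  proof -
    define m where "m = 2 * r\<^sup>2 - 1"
    have m: "m > 0" "1 - r\<^sup>2 = (1 - m) / 2" using p by (auto simp: m_def field_simps)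
    show ?thesis unfolding m_def[symmetric] m(2) EllU_def E_def[symmetric] K_def[symmetric] using m(1) by (simp add: field_simps)
  qed
  ultimately show ?thesis unfolding b_def by (simp only:)
qed

text \<open>Both \<open>gcrit r\<close> and \<open>lam * l\<^sup>2\<close> are the factor 2 (2 r^2 -
  1) times a square, of 2 \<open>EllU r\<close> and of \<open>low_beta lam r * l\<close>
  respectively.\<close>

lemma low_beta_vs_EllU:
  assumes "lam > 0" "l > 0" "1/2 < r\<^sup>2" "EllU r > 0"
  shows "gcrit r < lam * l\<^sup>2 \<longleftrightarrow> 2 * EllU r < low_beta lam r * l" "gcrit r = lam * l\<^sup>2 \<longleftrightarrow> 2 * EllU r = low_beta lam r * l"
proof -
  have p: "2 * (2 * r\<^sup>2 - 1) > 0" using assms by simp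
  note b = low_beta[OF assms(1,3)]
  have g: "gcrit r = (2 * EllU r)\<^sup>2 * (2 * (2 * r\<^sup>2 - 1))" unfolding gcrit_def EllU_def[symmetric] by (simp add: power_mult_distrib)
  have l: "lam * l\<^sup>2 = (low_beta lam r * l)\<^sup>2 * (2 * (2 * r\<^sup>2 - 1))"
  proof -
    have "(low_beta lam r * l)\<^sup>2 * (2 * (2 * r\<^sup>2 - 1)) = ((low_beta lam r)\<^sup>2 * (2 * (2 * r\<^sup>2 - 1))) * l\<^sup>2"
      by (simp add: power_mult_distrib)
    then show ?thesis unfolding b(2) by simp
  qed
  have nn: "0 \<le> 2 * EllU r" "0 \<le> low_beta lam r * l" using assms b by auto
  show "gcrit r < lam * l\<^sup>2 \<longleftrightarrow> 2 * EllU r < low_beta lam r * l"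
    unfolding g l using p nn by (metis mult_less_cancel_right_pos power_less_imp_less_base power_strict_mono zero_less_numeral)
  show "gcrit r = lam * l\<^sup>2 \<longleftrightarrow> 2 * EllU r = low_beta lam r * l"
  proof -
    have "X\<^sup>2 * c = Y\<^sup>2 * c \<longleftrightarrow> X = Y" if "c > 0" "0 \<le> X" "0 \<le> Y" for X Y c :: real using that by simp
    from this[OF p nn] show ?thesis unfolding g l .
  qed
qed

text \<open>Between \<open>qhat\<close> and \<open>qstar\<close> the function \<open>gcrit\<close>
  decreases, so by the previous comparison the derivative of \<open>low_energy\<close> is negative
  left of \<open>q\<close> and positive right of it.\<close>

lemma low_energy_min:
  assumes lam: "lam > 0" and l: "l > 0" and q: "qhat \<le> q" "q < qstar" "gcrit q = lam * l\<^sup>2"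
    and r: "qhat \<le> r" "r \<le> qstar"
  shows "low_energy lam l q \<le> low_energy lam l r"
proof -
  have rr: "0 < r" "r < 1" "1/2 < r\<^sup>2" if "qhat \<le> r" "r \<le> qstar" for r
    using that qhat qstar sq_ge_half[of r] sq_gt_half[of r] by auto
  have c: "continuous_on {a..b} (low_energy lam l)" if "qhat \<le> a" "b \<le> qstar" for a b
    unfolding continuous_on_eq_continuous_within
  proof
    fix r assume "r \<in> {a..b}"
    then have "0 < r" "r < 1" "1/2 < r\<^sup>2" using rr[of r] that by auto
    from low_energy_deriv[OF lam this(3,1,2), of l]
    show "continuous (at r within {a..b}) (low_energy lam l)"
      by (metis DERIV_isCont continuous_at_imp_continuous_at_within)
  qed
  consider "r = q" | "q < r" | "r < q" by linarith
  then show ?thesis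
  proof cases
    case 2
    have "low_energy lam l q < low_energy lam l r"
    proof (rule DERIV_pos_imp_increasing_open[OF 2])
      fix s assume s: "q < s" "s < r"
      have s': "0 < s" "s < 1" "1/2 < s\<^sup>2" "EllU s > 0" using rr[of s] s q r EllU_pos[of s] by auto
      have "gcrit s < lam * l\<^sup>2" using gcrit_strict_antimono[of q s] s q r by auto
      then have "low_beta lam s * l - 2 * EllU s > 0" using low_beta_vs_EllU(1)[OF lam l s'(3,4)] by simp
      then have "8 * s * low_beta lam s * (low_beta lam s * l - 2 * EllU s) / (2 * s\<^sup>2 - 1) > 0"
        using s' low_beta[OF lam s'(3)] by (intro divide_pos_pos mult_pos_pos) auto
      then show "\<exists>y. (low_energy lam l has_real_derivative y) (at s) \<and> 0 < y"
        using low_energy_deriv[OF lam s'(3,1,2), of l] by blast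
    qed (use c q r in auto)
    then show ?thesis by simp
  next
    case 3
    have "low_energy lam l q < low_energy lam l r"
    proof (rule DERIV_neg_imp_decreasing_open[OF 3])
      fix s assume s: "r < s" "s < q"
      have s': "0 < s" "s < 1" "1/2 < s\<^sup>2" "EllU s > 0" using rr[of s] s q r EllU_pos[of s] by auto
      have "gcrit s > lam * l\<^sup>2" using gcrit_strict_antimono[of s q] s q r by auto
      then have "low_beta lam s * l - 2 * EllU s < 0" using low_beta_vs_EllU[OF lam l s'(3,4)] by linarith
      then have "8 * s * low_beta lam s * (low_beta lam s * l - 2 * EllU s) / (2 * s\<^sup>2 - 1) < 0"
        using s' low_beta[OF lam s'(3)] by (intro divide_neg_pos mult_pos_neg mult_pos_pos) auto
      then show "\<exists>y. (low_energy lam l has_real_derivative y) (at s) \<and> y < 0"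
        using low_energy_deriv[OF lam s'(3,1,2), of l] by blast
    qed (use c q r in auto)
    then show ?thesis by simp
  qed simp
qed

text \<open>The calibration bound is sharp at the larc. With 2 \<open>EllU q\<close> =
  \<open>low_beta lam q\<close> l, eliminating \<open>lam\<close> and E turns one formula into the
  other.\<close>

lemma low_energy_eq_arc_energy:
  assumes lam: "lam > 0" and l: "l > 0" and q: "qhat \<le> q" "q < qstar" "gcrit q = lam * l\<^sup>2"
  shows "low_energy lam l q = arc_energy lam l q"
proof -
  have r: "0 < q" "q < 1" "1/2 < q\<^sup>2" "EllU q > 0" using q qhat qstar sq_ge_half[of q] sq_gt_half[of q] EllU_pos[of q] by auto
  define b E K where "b = low_beta lam q" and "E = EllE q" and "K = EllK q"
  have b: "b > 0" "lam = b * b * (2 * (2 * q\<^sup>2 - 1))" using low_beta[OF lam r(3)] by (auto simp: b_def power2_eq_square)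
  have U: "EllU q = b * l / 2" using low_beta_vs_EllU(2)[OF lam l r(3,4)] q(3) by (simp add: b_def)
  have "2 * E - K = b * l / 2" using U by (simp add: EllU_def E_def K_def)
  then have E: "E = (b * l / 2 + K) / 2" by simp
  show ?thesis unfolding low_energy_def arc_energy_def U b_def[symmetric] E_def[symmetric] K_def[symmetric]
    unfolding b(2) E using b(1) l by (simp add: field_simps power2_eq_square)
qed

text \<open>Integral of \<open>sqrt (lam + 2 \<beta>\<^sup>2 cos \<theta>)\<close> between its zeros, by the substitution \<open>sin (\<theta>/2) = r sin a\<close>.\<close>

lemma weight_integral:
  assumes A: "0 < A" "A < pi" and r: "r = sin (A / 2)" and b: "b > 0"
  shows "((\<lambda>\<theta>. 2 * b * sqrt (r\<^sup>2 - (sin (\<theta> / 2))\<^sup>2)) has_integral 8 * b * (EllE r - (1 - r\<^sup>2) * EllK r)) {-A..A}"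
proof -
  have r0: "0 < r" unfolding r using A by (intro sin_gt_zero) auto
  have r1: "r < 1" unfolding r using sin_monotone_2pi[of "A/2" "pi/2"] A by simp
  have ra: "\<bar>r\<bar> < 1" using r0 r1 by simp
  have sb: "- r < sin (\<theta> / 2)" "sin (\<theta> / 2) < r" if "- A < \<theta>" "\<theta> < A" for \<theta>
  proof -
    have "sin (- (A / 2)) < sin (\<theta> / 2)" using that A by (intro sin_monotone_2pi) auto
    then show "- r < sin (\<theta> / 2)" by (simp add: r)
    have "sin (\<theta> / 2) < sin (A / 2)" using that A by (intro sin_monotone_2pi) auto
    then show "sin (\<theta> / 2) < r" by (simp add: r)
  qed
  have sble: "- r \<le> sin (\<theta> / 2)" "sin (\<theta> / 2) \<le> r" if "- A \<le> \<theta>" "\<theta> \<le> A" for \<theta>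
  proof -
    show "- r \<le> sin (\<theta> / 2)"
      using sb[of \<theta>] that r0 r by (cases "\<theta> = A \<or> \<theta> = - A") (auto simp: less_le)
    show "sin (\<theta> / 2) \<le> r"
      using sb[of \<theta>] that r0 r by (cases "\<theta> = A \<or> \<theta> = - A") (auto simp: less_le)
  qed
  define a where "a = (\<lambda>\<theta>. arcsin (sin (\<theta> / 2) / r))"
  define h where "h = (\<lambda>x. 4 * b * (EllEx x r - (1 - r\<^sup>2) * EllF x r))"
  have ca: "continuous_on {-A..A} a" unfolding a_def
    using sble r0 by (intro continuous_intros) (auto simp: pos_le_divide_eq pos_divide_le_eq)
  have dh: "(h has_real_derivative 4 * b * (sqrt (1 - r\<^sup>2 * (sin x)\<^sup>2) - (1 - r\<^sup>2) * (1 / sqrt (1 - r\<^sup>2 * (sin x)\<^sup>2)))) (at x)" for x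
    unfolding h_def by (intro DERIV_cmult DERIV_diff EllEx_deriv EllF_deriv ra)
  have "continuous_on UNIV h" using DERIV_isCont[OF dh] by (simp add: continuous_at_imp_continuous_on)
  then have ch: "continuous_on {-A..A} (\<lambda>\<theta>. h (a \<theta>))" by (rule continuous_on_compose2[OF _ ca]) auto
  have "((\<lambda>\<theta>. 2 * b * sqrt (r\<^sup>2 - (sin (\<theta> / 2))\<^sup>2)) has_integral h (a A) - h (a (- A))) {-A..A}"
  \<comment> \<open>Only interior derivatives are available: at plus and minus \<open>A\<close> the
    argument of the arcsine is plus or minus 1.\<close>
  proof (rule fundamental_theorem_of_calculus_interior[OF _ ch])
    show "- A \<le> A" using A by simp
    fix \<theta> assume "\<theta> \<in> {-A<..<A}"
    then have th: "- A < \<theta>" "\<theta> < A" by auto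
    define z where "z = sin (\<theta> / 2) / r"
    have z: "- 1 < z" "z < 1" using sb[OF th] r0 by (auto simp: z_def pos_less_divide_eq pos_divide_less_eq)
    define c where "c = sqrt (1 - z\<^sup>2)"
    have "z\<^sup>2 < 1" using z by (simp add: abs_square_less_1 abs_less_iff)
    then have c: "c > 0" "c\<^sup>2 = 1 - z\<^sup>2" by (auto simp: c_def)
    define D where "D = cos (\<theta> / 2)"
    have D: "D > 0" unfolding D_def using th A by (intro cos_gt_zero_pi) auto
    have sa: "sin (a \<theta>) = z" using z by (simp add: a_def z_def)
    have rz: "r * z = sin (\<theta> / 2)" using r0 by (simp add: z_def)
    have "1 - r\<^sup>2 * (sin (a \<theta>))\<^sup>2 = D\<^sup>2"
      unfolding sa power_mult_distrib[symmetric] rz D_def by (simp add: cos_squared_eq)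
    then have sD: "sqrt (1 - r\<^sup>2 * (sin (a \<theta>))\<^sup>2) = D" using D by simp
    have "((\<lambda>\<theta>. sin (\<theta> / 2) / r) has_real_derivative cos (\<theta> / 2) * (1/2) / r) (at \<theta>)"
      using r0 by (auto intro!: derivative_eq_intros)
    from DERIV_chain2[OF DERIV_arcsin[OF z, unfolded z_def] this]
    have da: "(a has_real_derivative inverse c * (D * (1/2) / r)) (at \<theta>)"
      unfolding a_def c_def D_def z_def .
    have "((\<lambda>\<theta>. h (a \<theta>)) has_real_derivative 4 * b * (D - (1 - r\<^sup>2) * (1 / D)) * (inverse c * (D * (1/2) / r))) (at \<theta>)"
      using DERIV_chain2[OF dh da] unfolding sD .
    also have "4 * b * (D - (1 - r\<^sup>2) * (1 / D)) * (inverse c * (D * (1/2) / r)) = 2 * b * (D\<^sup>2 - (1 - r\<^sup>2)) / (r * c)"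
      using D c(1) r0 by (simp add: field_simps power2_eq_square)
    also have "D\<^sup>2 - (1 - r\<^sup>2) = (r * c)\<^sup>2"
    proof -
      have "(r * c)\<^sup>2 = r\<^sup>2 - (r * z)\<^sup>2" by (simp add: power_mult_distrib c(2) algebra_simps)
      then show ?thesis unfolding rz D_def by (simp add: cos_squared_eq)
    qed
    also have "2 * b * (r * c)\<^sup>2 / (r * c) = 2 * b * (r * c)" using r0 c by (simp add: power2_eq_square)
    also have "r * c = sqrt (r\<^sup>2 - (sin (\<theta> / 2))\<^sup>2)"
    proof -
      have "(r * c)\<^sup>2 = r\<^sup>2 - (sin (\<theta> / 2))\<^sup>2" unfolding rz[symmetric] by (simp add: power_mult_distrib c(2) algebra_simps)
      then show ?thesis using r0 c by (metis less_imp_le mult_pos_pos real_sqrt_unique)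
    qed
    finally show "((\<lambda>\<theta>. h (a \<theta>)) has_vector_derivative 2 * b * sqrt (r\<^sup>2 - (sin (\<theta> / 2))\<^sup>2)) (at \<theta>)"
      by (simp add: has_real_derivative_iff_has_vector_derivative)
  qed
  moreover have "a A = pi / 2" "a (- A) = - (pi / 2)" using r0 by (auto simp: a_def r[symmetric])
  ultimately show ?thesis
    by (simp add: h_def EllEx_minus[OF ra] EllF_minus[OF ra] EllE_def EllK_def algebra_simps)
qed

text \<open>The calibration bound: with the multiplier vector of length \<open>2 \<beta>\<^sup>2\<close> pointing in the middle direction \<open>m\<close> of the
  range of the tangent angle, the completed square bounds the augmented energy below by the variation of a
  primitive of the weight, and turning the multiplier to the direction of the chord only costs \<open>cos m \<le> 1\<close>.\<close>

lemma energy_lower_bound: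
  assumes P: "polar g v v' \<psi> \<kappa>" and g0: "g 0 = (0, 0)" and g1: "g 1 = (l, 0)" and l: "l > 0" and lam: "lam > 0"
    and A: "pi / 2 < A" "A < pi" and r: "r = sin (A / 2)"
    and rng: "\<And>t. t \<in> {0..1} \<Longrightarrow> \<bar>\<psi> t - m\<bar> \<le> A"
    and t1: "t1 \<in> {0..1}" "\<psi> t1 = m + A" and t2: "t2 \<in> {0..1}" "\<psi> t2 = m - A"
  shows "low_energy lam l r \<le> energy lam g"
proof -
  note Hv = polarD(1)[OF P] and vp = polarD(2)[OF P] and H\<psi> = polarD(3)[OF P]
  note cv = H1_continuous[OF Hv] and c\<psi> = H1_continuous[OF H\<psi>]
  have L\<kappa>: "L2 \<kappa>" by (rule H1_L2[OF H\<psi>])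
  have rs: "sin (pi / 4) < r" unfolding r using A by (intro sin_monotone_2pi) auto
  have r2: "1/2 < r\<^sup>2" using power_strict_mono[OF rs, of 2] by (simp add: sin_45 power_divide)
  define b where "b = low_beta lam r"
  have b: "b > 0" "b\<^sup>2 * (2 * (2 * r\<^sup>2 - 1)) = lam" using low_beta[OF lam r2] by (auto simp: b_def)
  \<comment> \<open>The maximum with 0 extends the weight continuously to all angles; the angles
    that occur lie in [-A, A], where it has no effect.\<close>
  define W where "W = (\<lambda>\<theta>. 2 * b * sqrt (max 0 (r\<^sup>2 - (sin (\<theta> / 2))\<^sup>2)))"
  have cW: "continuous_on UNIV W" unfolding W_def by (intro continuous_intros) auto
  have W0: "W \<theta> \<ge> 0" for \<theta> using b by (simp add: W_def)
  have nn: "r\<^sup>2 - (sin (\<theta> / 2))\<^sup>2 \<ge> 0" if "\<bar>\<theta>\<bar> \<le> A" for \<theta>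
  proof -
    have "sin (- (A / 2)) \<le> sin (\<theta> / 2)" "sin (\<theta> / 2) \<le> sin (A / 2)"
      using that A by (intro sin_monotone_2pi_le; simp)+
    then have "\<bar>sin (\<theta> / 2)\<bar> \<le> \<bar>r\<bar>" by (simp add: r)
    then show ?thesis by (simp add: abs_le_square_iff)
  qed
  have Wsq: "(W \<theta>)\<^sup>2 = lam + 2 * b\<^sup>2 * cos \<theta>" if "\<bar>\<theta>\<bar> \<le> A" for \<theta>
  proof -
    have c: "cos \<theta> = 1 - 2 * (sin (\<theta> / 2))\<^sup>2" using cos_double_sin[of "\<theta> / 2"] by simp
    have "(W \<theta>)\<^sup>2 = 4 * b\<^sup>2 * (r\<^sup>2 - (sin (\<theta> / 2))\<^sup>2)" using nn[OF that] by (simp add: W_def power_mult_distrib max_absorb2)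
    then show ?thesis unfolding b(2)[symmetric] c by (simp add: algebra_simps)
  qed
  have dH: "(sint0 W has_real_derivative W x) (at x)" for x by (rule sint0_deriv[OF cW])
  have Ho: "sint0 W (- x) = - sint0 W x" for x by (rule sint0_odd[OF cW]) (simp add: W_def)
  have HA: "2 * sint0 W A = 8 * b * (EllE r - (1 - r\<^sup>2) * EllK r)"
  proof -
    have A0: "0 < A" using A pi_gt_zero by linarith
    have "(W has_integral sint0 W A - sint0 W (- A)) {-A..A}"
      using A0 by (intro fundamental_theorem_of_calculus)
        (auto simp: has_real_derivative_iff_has_vector_derivative[symmetric] intro: has_field_derivative_at_within dH)
    moreover have "(W has_integral 8 * b * (EllE r - (1 - r\<^sup>2) * EllK r)) {-A..A}"
      by (rule has_integral_eq[OF _ weight_integral[OF A0 A(2) r b(1)]]) (use nn in \<open>auto simp: W_def max_absorb2 abs_le_iff\<close>)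
    ultimately have "sint0 W A - sint0 W (- A) = 8 * b * (EllE r - (1 - r\<^sup>2) * EllK r)" by (rule has_integral_unique)
    then show ?thesis using Ho[of A] by simp
  qed
  define h where "h = (\<lambda>t. sint0 W (\<psi> t - m))"
  have Hh: "H1 h (\<lambda>t. W (\<psi> t - m) * (\<kappa> t - 0))" unfolding h_def
    by (rule H1_chain[OF H1_diff[OF H\<psi> H1_const], where h="sint0 W"]) (rule dH, rule continuous_on_subset[OF cW], simp)
  define u where "u = (\<lambda>t. W (\<psi> t - m) * \<kappa> t)"
  have Lu: "L2 u" using H1_L2[OF Hh] by (simp add: u_def)
  have var: "\<bar>h s - h t\<bar> \<le> integral {0..1} (\<lambda>t. \<bar>u t\<bar>)" if st: "0 \<le> s" "s \<le> t" "t \<le> 1" for s t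
  proof -
    have "h t - h s = integral {s..t} u" using H1_diff_eq[OF Hh st] by (simp add: u_def)
    then have "\<bar>h s - h t\<bar> = norm (integral {s..t} u)" by simp
    also have "\<dots> \<le> integral {s..t} (\<lambda>t. \<bar>u t\<bar>)"
      using st by (intro integral_norm_bound_integral L2_integrable_sub[OF Lu] L2_integrable_sub[OF L2_abs[OF Lu]]) auto
    also have "\<dots> \<le> integral {0..1} (\<lambda>t. \<bar>u t\<bar>)"
      using st by (intro integral_subset_le L2_integrable_sub[OF L2_abs[OF Lu]]) auto
    finally show ?thesis .
  qed
  \<comment> \<open>Between the times of the two extreme angles, in whichever order they come, the
    primitive changes by its full increment over [-A, A].\<close>
  have "2 * sint0 W A = h t1 - h t2" using t1 t2 Ho[of A] by (simp add: h_def)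
  also have "\<dots> \<le> integral {0..1} (\<lambda>t. \<bar>u t\<bar>)"
    using var[of t1 t2] var[of t2 t1] t1(1) t2(1) by (cases "t1 \<le> t2") auto
  finally have V: "8 * b * (EllE r - (1 - r\<^sup>2) * EllK r) \<le> integral {0..1} (\<lambda>t. \<bar>u t\<bar>)" unfolding HA .
  have cvi: "continuous_on {0..1} (\<lambda>t. 1 / v t)" using vp by (intro continuous_intros cv) (auto simp: less_le)
  have ik: "((\<lambda>t. (\<kappa> t)\<^sup>2 / v t) has_integral integral {0..1} (\<lambda>t. (\<kappa> t)\<^sup>2 / v t)) {0..1}"
    using L2_mult_absolutely_integrable[OF L2_cont_mult[OF cvi L\<kappa>] L\<kappa>]
    by (intro integrable_integral) (simp add: absolutely_integrable_on_def power2_eq_square)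
  have iv: "(v has_integral integral {0..1} v) {0..1}" by (intro integrable_integral integrable_continuous_interval cv)
  have ic: "((\<lambda>t. v t * cos (\<psi> t)) has_integral l) {0..1}"
    using integrable_integral[OF L2_integrable[OF H1_L2[OF polar_fst[OF P]]]] H1_eq[OF polar_fst[OF P], of 1] g0 g1 by simp
  have isn: "((\<lambda>t. v t * sin (\<psi> t)) has_integral 0) {0..1}"
    using integrable_integral[OF L2_integrable[OF H1_L2[OF polar_snd[OF P]]]] H1_eq[OF polar_snd[OF P], of 1] g0 g1 by simp
  have i1: "((\<lambda>t. (\<kappa> t)\<^sup>2 / v t + lam * v t + 2 * b\<^sup>2 * (cos m * (v t * cos (\<psi> t)) + sin m * (v t * sin (\<psi> t)))) has_integral
     integral {0..1} (\<lambda>t. (\<kappa> t)\<^sup>2 / v t) + lam * integral {0..1} v + 2 * b\<^sup>2 * (cos m * l + sin m * 0)) {0..1}"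
    by (intro has_integral_add has_integral_mult_right ik iv ic isn)
  have i2: "((\<lambda>t. 2 * \<bar>u t\<bar>) has_integral 2 * integral {0..1} (\<lambda>t. \<bar>u t\<bar>)) {0..1}"
    by (intro has_integral_mult_right integrable_integral L2_integrable L2_abs Lu)
  have i3: "2 * \<bar>u t\<bar> \<le> (\<kappa> t)\<^sup>2 / v t + lam * v t + 2 * b\<^sup>2 * (cos m * (v t * cos (\<psi> t)) + sin m * (v t * sin (\<psi> t)))"
    if t: "t \<in> {0..1}" for t
  proof -
    define z where "z = W (\<psi> t - m)"
    have vt: "v t > 0" by (rule vp[OF t])
    have "(\<kappa> t)\<^sup>2 / v t + lam * v t + 2 * b\<^sup>2 * (cos m * (v t * cos (\<psi> t)) + sin m * (v t * sin (\<psi> t))) = (\<kappa> t)\<^sup>2 / v t + v t * (lam + 2 * b\<^sup>2 * cos (\<psi> t - m))"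
      by (simp add: cos_diff algebra_simps)
    also have "\<dots> = (\<kappa> t)\<^sup>2 / v t + v t * z\<^sup>2" unfolding z_def Wsq[OF rng[OF t]] ..
    finally have e: "(\<kappa> t)\<^sup>2 / v t + lam * v t + 2 * b\<^sup>2 * (cos m * (v t * cos (\<psi> t)) + sin m * (v t * sin (\<psi> t))) = (\<kappa> t)\<^sup>2 / v t + v t * z\<^sup>2" .
    have "0 \<le> (\<bar>\<kappa> t\<bar> - v t * z)\<^sup>2 / v t" using vt by simp
    also have "\<dots> = (\<kappa> t)\<^sup>2 / v t + v t * z\<^sup>2 - 2 * (z * \<bar>\<kappa> t\<bar>)"
      using vt by (simp add: power2_diff power_mult_distrib add_divide_distrib diff_divide_distrib) (simp add: power2_eq_square)
    finally show ?thesis unfolding e using W0[of "\<psi> t - m"] by (simp add: u_def z_def abs_mult)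
  qed
  have "2 * integral {0..1} (\<lambda>t. \<bar>u t\<bar>) \<le> integral {0..1} (\<lambda>t. (\<kappa> t)\<^sup>2 / v t) + lam * integral {0..1} v + 2 * b\<^sup>2 * (cos m * l + sin m * 0)"
    by (rule has_integral_le[OF i2 i1 i3])
  moreover have "2 * b\<^sup>2 * (cos m * l) \<le> 2 * b\<^sup>2 * l" using l by (intro mult_left_mono) auto
  ultimately have "2 * integral {0..1} (\<lambda>t. \<bar>u t\<bar>) \<le> energy lam g + 2 * b\<^sup>2 * l" unfolding polar_energy[OF P] by simp
  then show ?thesis using V unfolding low_energy_def b_def[symmetric] by (simp add: algebra_simps)
qed

section \<open>Neighbourhoods of a curve, segments and reflections\<close>

lemma Aset_W22:
  assumes "g \<in> Aset l" obtains g1 g2 where "W22 g g1 g2" "\<And>t. t \<in> {0..1} \<Longrightarrow> g1 t \<noteq> 0" "g 0 = (0, 0)" "g 1 = (l, 0)"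
  using assms unfolding Aset_def by blast

lemma polar_angle_exists: "\<exists>a. p = (norm p * cos a, norm p * sin a)" for p :: "real \<times> real"
proof (cases "p = 0")
  case True then show ?thesis by (auto simp: zero_prod_def)
next
  case False
  have n: "(norm p)\<^sup>2 = (fst p)\<^sup>2 + (snd p)\<^sup>2" by (simp add: norm_prod_def)
  have n0: "norm p \<noteq> 0" using False by simp
  have "(fst p / norm p)\<^sup>2 + (snd p / norm p)\<^sup>2 = ((fst p)\<^sup>2 + (snd p)\<^sup>2) / (norm p)\<^sup>2"
    by (simp add: power_divide add_divide_distrib)
  also have "\<dots> = 1" unfolding n[symmetric] using n0 by simp
  finally obtain a where a: "fst p / norm p = cos a" "snd p / norm p = sin a" using sincos_total_2pi by metis
  have "fst p = norm p * (fst p / norm p)" "snd p = norm p * (snd p / norm p)" using n0 by simp_all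
  then have "fst p = norm p * cos a" "snd p = norm p * sin a" unfolding a .
  then have "p = (norm p * cos a, norm p * sin a)" using prod.collapse[of p] by (simp only:)
  then show ?thesis ..
qed

lemma Aset_polar:
  assumes "g \<in> Aset l" obtains v v' \<psi> \<kappa> where "polar g v v' \<psi> \<kappa>" "g 0 = (0, 0)" "g 1 = (l, 0)"
proof -
  obtain g1 g2 where g: "W22 g g1 g2" "\<And>t. t \<in> {0..1} \<Longrightarrow> g1 t \<noteq> 0" "g 0 = (0, 0)" "g 1 = (l, 0)" using Aset_W22[OF assms] by blast
  obtain a where "g1 0 = (norm (g1 0) * cos a, norm (g1 0) * sin a)" using polar_angle_exists by blast
  from polar_exists[OF g(1,2) this] show ?thesis using that g(3,4) by blast
qed

text \<open>The one-dimensional Sobolev embedding. For each component, averaging \<bar>f t\<bar>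
  \<le> \<bar>f s\<bar> + (integral of \<bar>f'\<bar>) over s and applying Cauchy-Schwarz twice
  gives twice the distance; the two components give the factor 4.\<close>

lemma C1_norm_le_w22_dist:
  assumes G: "W22 G G1 G2" and g: "W22 g g1 g2" and t: "t \<in> {0..1}"
  shows "norm (G1 t - g1 t) \<le> 4 * w22_dist G g"
proof -
  have W: "W22 (\<lambda>t. G t + (-1) *\<^sub>R g t) (\<lambda>t. G1 t + (-1) *\<^sub>R g1 t) (\<lambda>t. G2 t + (-1) *\<^sub>R g2 t)"
    by (rule W22_add_scaled[OF G g])
  define T where "T = (\<lambda>t. (norm (G t - g t))\<^sup>2 + (norm (G1 t - g1 t))\<^sup>2 + (norm (G2 t - g2 t))\<^sup>2)"
  have iT: "T integrable_on {0..1}" using W22_squares_integrable[OF W] by (simp add: T_def)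
  have d: "w22_dist G g = sqrt (integral {0..1} T)" unfolding w22_dist_W22[OF G g] T_def ..
  have comp: "\<bar>P (G1 t - g1 t)\<bar> \<le> 2 * w22_dist G g"
    if P: "H1 (\<lambda>t. P (G1 t - g1 t)) (\<lambda>t. P (G2 t - g2 t))" "\<And>x. (P x)\<^sup>2 \<le> (norm x)\<^sup>2" for P :: "real \<times> real \<Rightarrow> real"
  proof -
    define f f2 where "f = (\<lambda>t. P (G1 t - g1 t))" and "f2 = (\<lambda>t. P (G2 t - g2 t))"
    have H: "H1 f f2" using P(1) by (simp add: f_def f2_def)
    have Lf: "L2 f" by (rule continuous_on_imp_L2[OF H1_continuous[OF H]])
    have Lf2: "L2 f2" by (rule H1_L2[OF H])
    have le: "integral {0..1} (\<lambda>t. \<bar>k t\<bar>) \<le> w22_dist G g" if k: "L2 k" "\<And>t. (k t)\<^sup>2 \<le> T t" for k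
    proof -
      have "(integral {0..1} (\<lambda>t. \<bar>k t\<bar>))\<^sup>2 \<le> integral {0..1} (\<lambda>t. (k t)\<^sup>2)" by (rule L2_Cauchy_Schwarz[OF k(1)])
      also have "\<dots> \<le> integral {0..1} T" by (rule integral_le[OF L2_square_integrable[OF k(1)] iT k(2)])
      finally show ?thesis unfolding d by (rule real_le_rsqrt)
    qed
    have fT: "(f t)\<^sup>2 \<le> T t" "(f2 t)\<^sup>2 \<le> T t" for t
      using P(2)[of "G1 t - g1 t"] P(2)[of "G2 t - g2 t"] by (simp_all add: f_def f2_def T_def add_increasing add_increasing2)
    have ineq: "\<bar>f t\<bar> \<le> \<bar>f s\<bar> + integral {0..1} (\<lambda>t. \<bar>f2 t\<bar>)" if s: "s \<in> {0..1}" for s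
    proof -
      have *: "\<bar>f b - f a\<bar> \<le> integral {0..1} (\<lambda>t. \<bar>f2 t\<bar>)" if "0 \<le> a" "a \<le> b" "b \<le> 1" for a b
      proof -
        have "\<bar>f b - f a\<bar> = norm (integral {a..b} f2)" using H1_diff_eq[OF H that] by simp
        also have "\<dots> \<le> integral {a..b} (\<lambda>t. \<bar>f2 t\<bar>)"
          using that by (intro integral_norm_bound_integral L2_integrable_sub[OF Lf2] L2_integrable_sub[OF L2_abs[OF Lf2]]) auto
        also have "\<dots> \<le> integral {0..1} (\<lambda>t. \<bar>f2 t\<bar>)"
          using that by (intro integral_subset_le L2_integrable_sub[OF L2_abs[OF Lf2]]) auto
        finally show ?thesis .
      qed
      have "\<bar>f t - f s\<bar> \<le> integral {0..1} (\<lambda>t. \<bar>f2 t\<bar>)"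
        using *[of s t] *[of t s] s t by (cases "s \<le> t") (auto simp: abs_minus_commute)
      then show ?thesis by linarith
    qed
    have "((\<lambda>_. \<bar>f t\<bar>) has_integral \<bar>f t\<bar>) {0..1::real}" using has_integral_const_real[of "\<bar>f t\<bar>" 0 1] by simp
    moreover have "((\<lambda>s. \<bar>f s\<bar> + integral {0..1} (\<lambda>t. \<bar>f2 t\<bar>)) has_integral integral {0..1} (\<lambda>s. \<bar>f s\<bar>) + integral {0..1} (\<lambda>t. \<bar>f2 t\<bar>)) {0..1}"
      using has_integral_const_real[of "integral {0..1} (\<lambda>t. \<bar>f2 t\<bar>)" 0 1]
      by (intro has_integral_add integrable_integral L2_integrable[OF L2_abs[OF Lf]]) simp
    ultimately have "\<bar>f t\<bar> \<le> integral {0..1} (\<lambda>s. \<bar>f s\<bar>) + integral {0..1} (\<lambda>t. \<bar>f2 t\<bar>)"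
      by (rule has_integral_le) (rule ineq)
    also have "\<dots> \<le> 2 * w22_dist G g" using le[OF Lf fT(1)] le[OF Lf2 fT(2)] by simp
    finally show ?thesis by (simp add: f_def)
  qed
  have "\<bar>fst (G1 t - g1 t)\<bar> \<le> 2 * w22_dist G g" "\<bar>snd (G1 t - g1 t)\<bar> \<le> 2 * w22_dist G g"
    using W22_H1[OF W] by (intro comp; simp add: norm_prod_def)+
  from norm_le_components[OF this] show ?thesis by simp
qed

text \<open>The law of cosines, with the sum of the squared norms bounded below by twice their
  product. The number \<open>k\<close> plays the role of the cosine of the largest angle allowed
  between the two vectors.\<close>

lemma inner_gt_of_close:
  fixes X Y :: "real \<times> real"
  assumes c: "norm (X - Y) \<le> e" and m: "0 < m" "m \<le> norm Y" and e: "e \<le> m / 2" "e\<^sup>2 < m\<^sup>2 * (1 - k)" and k: "k < 1"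
  shows "k * (norm X * norm Y) < X \<bullet> Y"
proof -
  have "norm Y \<le> norm X + norm (X - Y)" by (metis norm_triangle_sub norm_minus_commute add.commute)
  then have X: "m / 2 \<le> norm X" using c m e by linarith
  have mm: "m\<^sup>2 \<le> 2 * (norm X * norm Y)"
    using mult_mono[OF X m(2)] m by (simp add: power2_eq_square)
  have "2 * (X \<bullet> Y) = (norm X)\<^sup>2 + (norm Y)\<^sup>2 - (norm (X - Y))\<^sup>2"
    by (simp add: power2_norm_eq_inner inner_diff_left inner_diff_right inner_commute)
  moreover have "(norm (X - Y))\<^sup>2 \<le> e\<^sup>2" using c by (intro power_mono) auto
  moreover have "2 * (norm X * norm Y) \<le> (norm X)\<^sup>2 + (norm Y)\<^sup>2" using sum_squares_bound[of "norm X" "norm Y"] by simp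
  moreover have "m\<^sup>2 * (1 - k) \<le> 2 * (norm X * norm Y) * (1 - k)" using mm k by (intro mult_right_mono) auto
  ultimately show ?thesis using e(2) by (simp add: algebra_simps)
qed

text \<open>Closeness of the tangent vectors determines the angle only modulo 2 pi. The lift of
  \<open>G\<close> is therefore started within \<open>e\<close> of \<open>\<psi> 0\<close>;
  afterwards cos (\<open>\<phi>\<close> - \<open>\<psi>\<close>) stays above cos \<open>e\<close>,
  so by continuity the difference never attains the value \<open>e\<close> that it would have to
  cross.\<close>

lemma lift_close:
  assumes P: "polar g v v' \<psi> \<kappa>" and e: "0 < e" "e \<le> pi"
  obtains \<delta> where "\<delta> > 0" "\<And>G. G \<in> Aset l \<Longrightarrow> w22_dist G g < \<delta> \<Longrightarrow>
     \<exists>w w' \<phi> \<mu>. polar G w w' \<phi> \<mu> \<and> (\<forall>t\<in>{0..1}. \<bar>\<phi> t - \<psi> t\<bar> \<le> e)"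
proof -
  note cv = H1_continuous[OF polarD(1)[OF P]] and c\<psi> = H1_continuous[OF polarD(3)[OF P]]
  obtain t0 where t0: "t0 \<in> {0..1}" "\<And>t. t \<in> {0..1} \<Longrightarrow> v t0 \<le> v t"
    using continuous_attains_inf[OF _ _ cv] by auto
  define m where "m = v t0"
  have m: "m > 0" "\<And>t. t \<in> {0..1} \<Longrightarrow> m \<le> v t" using polarD(2)[OF P t0(1)] t0(2) by (auto simp: m_def)
  define k where "k = cos e"
  have k: "k < 1" unfolding k_def using cos_monotone_0_pi[of 0 e] e by simp
  define h where "h = min (m / 2) (m * sqrt (1 - k) / 2)"
  have h: "h > 0" "h \<le> m / 2" "h\<^sup>2 < m\<^sup>2 * (1 - k)"
  proof -
    show "h > 0" "h \<le> m / 2" using m k by (auto simp: h_def)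
    then have "h\<^sup>2 \<le> (m * sqrt (1 - k) / 2)\<^sup>2" by (intro power_mono) (auto simp: h_def)
    also have "\<dots> = m\<^sup>2 * (1 - k) / 4" using k by (simp add: power_divide power_mult_distrib)
    also have "\<dots> < m\<^sup>2 * (1 - k)" using m k by simp
    finally show "h\<^sup>2 < m\<^sup>2 * (1 - k)" .
  qed
  define g1 where "g1 = (\<lambda>t. (v t * cos (\<psi> t), v t * sin (\<psi> t)))"
  have Wg: "W22 g g1 (\<lambda>t. (v' t * cos (\<psi> t) + v t * (- sin (\<psi> t) * \<kappa> t), v' t * sin (\<psi> t) + v t * (cos (\<psi> t) * \<kappa> t)))"
    using polar_W22[OF P] by (simp add: g1_def)
  have ng1: "norm (g1 t) = v t" if "t \<in> {0..1}" for t
    using norm_polar[of "v t" "\<psi> t"] polarD(2)[OF P that] by (simp add: g1_def)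
  show ?thesis
  proof (rule that[of "h / 4"])
    show "h / 4 > 0" using h by simp
    fix G assume G: "G \<in> Aset l" and dG: "w22_dist G g < h / 4"
    obtain G1 G2 where W: "W22 G G1 G2" "\<And>t. t \<in> {0..1} \<Longrightarrow> G1 t \<noteq> 0" using Aset_W22[OF G] by blast
    have close: "k * (norm (G1 t) * norm (g1 t)) < G1 t \<bullet> g1 t" if t: "t \<in> {0..1}" for t
    proof (rule inner_gt_of_close[OF _ m(1) _ h(2,3) k])
      show "norm (G1 t - g1 t) \<le> h" using C1_norm_le_w22_dist[OF W(1) Wg t] dG by simp
      show "m \<le> norm (g1 t)" using ng1[OF t] m(2)[OF t] by simp
    qed
    define n c s x y where "n = norm (G1 0)" and "c = cos (\<psi> 0)" and "s = sin (\<psi> 0)" and "x = fst (G1 0)" and "y = snd (G1 0)"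
    have n0: "n > 0" using W(2)[of 0] by (simp add: n_def)
    have n2: "n * n = x * x + y * y" by (simp add: n_def x_def y_def norm_prod_def power2_eq_square[symmetric])
    have cs: "c * c + s * s = 1" by (simp add: c_def s_def)
    \<comment> \<open>Cosine and sine of the angle by which the initial tangent of \<open>G\<close>
      is turned from that of \<open>g\<close>.\<close>
    define c0 s0 where "c0 = (x * c + y * s) / n" and "s0 = (y * c - x * s) / n"
    have u: "c0\<^sup>2 + s0\<^sup>2 = 1"
    proof -
      have "c0\<^sup>2 + s0\<^sup>2 = ((x * c + y * s)\<^sup>2 + (y * c - x * s)\<^sup>2) / n\<^sup>2"
        unfolding c0_def s0_def power_divide by (rule add_divide_distrib[symmetric])
      also have "(x * c + y * s)\<^sup>2 + (y * c - x * s)\<^sup>2 = (x * x + y * y) * (c * c + s * s)"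
        by (simp add: power2_eq_square algebra_simps)
      finally show ?thesis using n0 by (simp add: cs n2[symmetric] power2_eq_square)
    qed
    have c0k: "k < c0"
    proof -
      have v0: "v 0 > 0" using polarD(2)[OF P, of 0] by simp
      have "G1 0 \<bullet> g1 0 = v 0 * (x * c + y * s)" by (simp add: g1_def inner_prod_def x_def y_def c_def s_def algebra_simps)
      then have "k * (n * v 0) < v 0 * (x * c + y * s)" using close[of 0] ng1[of 0] by (simp add: n_def)
      then have "v 0 * (k * n) < v 0 * (x * c + y * s)" by (simp add: mult_ac)
      then have "k * n < x * c + y * s" using v0 by simp
      then show ?thesis using n0 by (simp add: c0_def pos_less_divide_eq)
    qed
    have c01: "- 1 \<le> c0" "c0 \<le> 1"
    proof -
      have "c0\<^sup>2 \<le> 1" using u zero_le_power2[of s0] by linarith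
      then show "- 1 \<le> c0" "c0 \<le> 1" by (auto simp: abs_square_le_1 abs_le_iff)
    qed
    define b where "b = (if s0 \<ge> 0 then arccos c0 else - arccos c0)"
    have b: "cos b = c0" "sin b = s0" "\<bar>b\<bar> \<le> e"
    proof -
      have "1 - c0\<^sup>2 = s0\<^sup>2" using u by simp
      then show "cos b = c0" "sin b = s0" using c01 by (auto simp: b_def sin_arccos)
      have "arccos c0 \<le> arccos k" using c0k c01 by (intro arccos_le_arccos) (auto simp: k_def)
      also have "\<dots> = e" unfolding k_def using e by (intro arccos_cos) auto
      finally show "\<bar>b\<bar> \<le> e" using arccos_lbound[OF c01] by (simp add: b_def)
    qed
    have st: "G1 0 = (norm (G1 0) * cos (\<psi> 0 + b), norm (G1 0) * sin (\<psi> 0 + b))"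
    proof -
      have nc: "n * c0 = x * c + y * s" "n * s0 = y * c - x * s" using n0 by (simp_all add: c0_def s0_def)
      have "n * (c * c0 - s * s0) = c * (n * c0) - s * (n * s0)" by (simp add: algebra_simps)
      also have "\<dots> = x * (c * c + s * s)" unfolding nc by (simp add: algebra_simps)
      finally have "n * (c * c0 - s * s0) = x * (c * c + s * s)" .
      moreover have "n * (s * c0 + c * s0) = y * (c * c + s * s)"
      proof -
        have "n * (s * c0 + c * s0) = s * (n * c0) + c * (n * s0)" by (simp add: algebra_simps)
        also have "\<dots> = y * (c * c + s * s)" unfolding nc by (simp add: algebra_simps)
        finally show ?thesis .
      qed
      ultimately show ?thesis unfolding cos_add sin_add b c_def[symmetric] s_def[symmetric] n_def[symmetric]
        by (simp add: cs prod_eq_iff x_def y_def)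
    qed
    obtain w' \<phi> \<mu> where PG: "polar G (\<lambda>t. norm (G1 t)) w' \<phi> \<mu>" "\<phi> 0 = \<psi> 0 + b"
      "\<And>t. t \<in> {0..1} \<Longrightarrow> G1 t = (norm (G1 t) * cos (\<phi> t), norm (G1 t) * sin (\<phi> t))"
      using polar_exists[OF W st] by blast
    have cosd: "cos (\<phi> t - \<psi> t) > k" if t: "t \<in> {0..1}" for t
    proof -
      have pos: "norm (G1 t) * v t > 0" using W(2)[OF t] polarD(2)[OF P t] by simp
      have "G1 t \<bullet> g1 t = norm (G1 t) * v t * cos (\<phi> t - \<psi> t)"
        by (subst PG(3)[OF t]) (simp add: g1_def cos_diff algebra_simps)
      then have "norm (G1 t) * v t * k < norm (G1 t) * v t * cos (\<phi> t - \<psi> t)"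
        using close[OF t] ng1[OF t] by (simp add: mult_ac)
      then show ?thesis using pos by (simp only: mult_less_cancel_left_pos)
    qed
    have cd: "continuous_on {0..1} (\<lambda>t. \<bar>\<phi> t - \<psi> t\<bar>)" by (intro continuous_intros c\<psi> H1_continuous[OF polarD(3)[OF PG(1)]])
    have "\<bar>\<phi> t - \<psi> t\<bar> \<le> e" if t: "t \<in> {0..1}" for t
    proof (rule ccontr)
      assume "\<not> ?thesis"
      moreover have "\<bar>\<phi> 0 - \<psi> 0\<bar> \<le> e" using b(3) by (simp add: PG(2))
      ultimately obtain u where u: "0 \<le> u" "u \<le> t" "\<bar>\<phi> u - \<psi> u\<bar> = e"
        using IVT'[of "\<lambda>t. \<bar>\<phi> t - \<psi> t\<bar>" 0 e t] t continuous_on_subset[OF cd, of "{0..t}"] by auto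
      have "cos (\<phi> u - \<psi> u) = cos \<bar>\<phi> u - \<psi> u\<bar>" by (simp add: abs_if cos_diff)
      then show False using cosd[of u] u t by (simp add: k_def)
    qed
    then show "\<exists>w w' \<phi> \<mu>. polar G w w' \<phi> \<mu> \<and> (\<forall>t\<in>{0..1}. \<bar>\<phi> t - \<psi> t\<bar> \<le> e)" using PG(1) by blast
  qed
qed

section \<open>Stability of the segment\<close>

lemma energy_ge_chord:
  assumes "G \<in> Aset l" "lam > 0" shows "lam * l \<le> energy lam G"
proof -
  obtain v v' \<psi> \<kappa> where P: "polar G v v' \<psi> \<kappa>" and G: "G 0 = (0, 0)" "G 1 = (l, 0)" using Aset_polar[OF assms(1)] .
  note cv = H1_continuous[OF polarD(1)[OF P]] and c\<psi> = H1_continuous[OF polarD(3)[OF P]]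
  have "l = integral {0..1} (\<lambda>t. v t * cos (\<psi> t))" using H1_eq[OF polar_fst[OF P], of 1] G by simp
  also have "\<dots> \<le> integral {0..1} v"
  proof (intro integral_le integrable_continuous_interval continuous_intros cv c\<psi>)
    fix t :: real assume "t \<in> {0..1}"
    then show "v t * cos (\<psi> t) \<le> v t" using polarD(2)[OF P, of t] mult_left_mono[of "cos (\<psi> t)" 1 "v t"] by simp
  qed
  finally have "lam * l \<le> lam * integral {0..1} v" using assms(2) by simp
  moreover have "0 \<le> integral {0..1} (\<lambda>t. (\<kappa> t)\<^sup>2 / v t)"
  proof (rule Henstock_Kurzweil_Integration.integral_nonneg)
    have "continuous_on {0..1} (\<lambda>t. 1 / v t)" using polarD(2)[OF P] by (intro continuous_intros cv) (auto simp: less_le)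
    from L2_mult_absolutely_integrable[OF L2_cont_mult[OF this H1_L2[OF polarD(3)[OF P]]] H1_L2[OF polarD(3)[OF P]]]
    show "(\<lambda>t. (\<kappa> t)\<^sup>2 / v t) integrable_on {0..1}" by (simp add: absolutely_integrable_on_def power2_eq_square)
    show "\<And>t. t \<in> {0..1} \<Longrightarrow> 0 \<le> (\<kappa> t)\<^sup>2 / v t" using polarD(2)[OF P] by (simp add: less_imp_le)
  qed
  ultimately show ?thesis unfolding polar_energy[OF P] by simp
qed

text \<open>A segment is given only up to a continuous increasing parameter, so its tangent has to
  be recovered: the second coordinate is constant, hence the sine vanishes, and monotonicity of the
  first excludes a backward tangent. Then the angle is constant and the energy equals lam l, a lower
  bound on all of \<open>Aset l\<close>.\<close>

lemma segment_stable:
  assumes g: "g \<in> Aset l" and s: "is_segment l g" and lam: "lam > 0" shows "stable lam l g"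
proof -
  obtain v v' \<psi> \<kappa> where P: "polar g v v' \<psi> \<kappa>" and G: "g 0 = (0, 0)" "g 1 = (l, 0)" using Aset_polar[OF g] .
  note c\<psi> = H1_continuous[OF polarD(3)[OF P]] and cv = H1_continuous[OF polarD(1)[OF P]]
  obtain f where f: "strict_mono_on {0..1} f" "\<And>t. t \<in> {0..1} \<Longrightarrow> g t = (f t, 0)"
    using s unfolding is_segment_def reparam_def by auto
  have dx: "((\<lambda>t. fst (g t)) has_real_derivative v t * cos (\<psi> t)) (at t within {0..1})"
    and dy: "((\<lambda>t. snd (g t)) has_real_derivative v t * sin (\<psi> t)) (at t within {0..1})" if "t \<in> {0..1}" for t
    by (intro H1_has_derivative[OF polar_fst[OF P]] H1_has_derivative[OF polar_snd[OF P]] continuous_intros cv c\<psi> that)+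
  have sin0: "sin (\<psi> t) = 0" if t: "t \<in> {0..1}" for t
  proof -
    have "((\<lambda>t. snd (g t)) has_real_derivative 0) (at t within {0..1})"
      by (rule has_field_derivative_transform_within[OF DERIV_const[of 0] zero_less_one t]) (simp add: f(2))
    then have "0 = v t * sin (\<psi> t)"
      using vector_derivative_unique_within_closed_interval[of 0 1 t "\<lambda>t. snd (g t)" 0 "v t * sin (\<psi> t)"] dy[OF t] t
      by (simp add: has_real_derivative_iff_has_vector_derivative cbox_interval)
    then show ?thesis using polarD(2)[OF P t] by simp
  qed
  have cosn: "cos (\<psi> t) = 1" if t: "t \<in> {0..1}" for t
  proof -
    have "\<not> v t * cos (\<psi> t) < 0"
    proof
      assume neg: "v t * cos (\<psi> t) < 0"
      have mono: "fst (g a) < fst (g b)" if "a \<in> {0..1}" "b \<in> {0..1}" "a < b" for a b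
        using strict_mono_onD[OF f(1) that] f(2) that by simp
      show False
      proof (cases "t < 1")
        case True
        obtain d where d: "d > 0" "\<And>h. 0 < h \<Longrightarrow> t + h \<in> {0..1} \<Longrightarrow> h < d \<Longrightarrow> fst (g t) > fst (g (t + h))"
          using has_real_derivative_neg_dec_right[OF dx[OF t] neg] by auto
        define h where "h = min (d / 2) (1 - t)"
        have "0 < h" "h < d" "t + h \<le> 1" using d True by (auto simp: h_def)
        then show False using d(2)[of h] mono[of t "t + h"] t by auto
      next
        case False
        then have t1: "t = 1" using t by simp
        obtain d where d: "d > 0" "\<And>h. 0 < h \<Longrightarrow> t - h \<in> {0..1} \<Longrightarrow> h < d \<Longrightarrow> fst (g t) < fst (g (t - h))"
          using has_real_derivative_neg_dec_left[OF dx[OF t] neg] by auto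
        define h where "h = min (d / 2) 1"
        have "0 < h" "h < d" "h \<le> 1" using d by (auto simp: h_def)
        then show False using d(2)[of h] mono[of "t - h" t] t t1 by auto
      qed
    qed
    then have "cos (\<psi> t) \<ge> 0" using polarD(2)[OF P t] by (simp add: mult_less_0_iff not_less)
    moreover have "(cos (\<psi> t))\<^sup>2 = 1" using sin0[OF t] by (simp add: cos_squared_eq)
    ultimately show ?thesis by (auto simp: power2_eq_1_iff)
  qed
  have "H1 \<psi> (\<lambda>_. 0)"
  proof -
    have "integral {0..t} \<kappa> = 0" if t: "t \<in> {0..1}" for t
    proof -
      have "integral {0..t} (\<lambda>t. cos (\<psi> t) * \<kappa> t) = 0"
        using H1_eq[OF H1_sin[OF polarD(3)[OF P]] t] sin0[OF t] sin0[of 0] by simp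
      moreover have "integral {0..t} (\<lambda>t. cos (\<psi> t) * \<kappa> t) = integral {0..t} \<kappa>"
        by (rule integral_cong) (use cosn t in auto)
      ultimately show ?thesis by simp
    qed
    then have c: "\<psi> 0 = \<psi> t" if "t \<in> {0..1}" for t using H1_eq[OF polarD(3)[OF P] that] that by simp
    show ?thesis by (rule H1_cong[OF H1_const[of "\<psi> 0"] c refl])
  qed
  then have P0: "polar g v v' \<psi> (\<lambda>_. 0)" using P unfolding polar_def by blast
  have "integral {0..1} v = integral {0..1} (\<lambda>t. v t * cos (\<psi> t))" by (rule integral_cong) (simp add: cosn)
  also have "\<dots> = l" using H1_eq[OF polar_fst[OF P], of 1] G by simp
  finally have "energy lam g = lam * l" unfolding polar_energy[OF P0] by simp
  then show ?thesis unfolding stable_def using energy_ge_chord lam g by (auto intro!: exI[of _ 1])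
qed

section \<open>Reflection in the axis, and criticality of stable curves\<close>

lemma W22_reflx: assumes "W22 g g1 g2" shows "W22 (reflx \<circ> g) (reflx \<circ> g1) (reflx \<circ> g2)"
proof -
  have "W22 (reflx \<circ> g) (\<lambda>t. (fst (g1 t), -1 * snd (g1 t))) (\<lambda>t. (fst (g2 t), -1 * snd (g2 t)))"
  proof (intro W22_I H1_cmult W22_H1[OF assms])
    fix t :: real assume "t \<in> {0..1}"
    note d = W22_has_vector_derivative[OF assms this]
    have "((\<lambda>t. (fst (g t), - snd (g t))) has_vector_derivative (fst (g1 t), - snd (g1 t))) (at t within {0..1})"
      by (intro has_vector_derivative_Pair has_vector_derivative_minus
          bounded_linear.has_vector_derivative[OF bounded_linear_fst d] bounded_linear.has_vector_derivative[OF bounded_linear_snd d])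
    then show "(reflx \<circ> g has_vector_derivative (fst (g1 t), -1 * snd (g1 t))) (at t within {0..1})"
      by (simp add: o_def reflx_def)
  qed
  then show ?thesis by (simp add: o_def reflx_def)
qed

lemma reflx_reflx: "reflx \<circ> (reflx \<circ> g) = g" by (simp add: fun_eq_iff reflx_def)

lemma norm_reflx: "norm (reflx p - reflx q) = norm (p - q)" "norm (reflx p) = norm p"
  by (simp_all add: reflx_def norm_prod_def power2_commute[of "snd q"])

lemma reflx_Aset: assumes "g \<in> Aset l" shows "reflx \<circ> g \<in> Aset l"
proof -
  obtain g1 g2 where g: "W22 g g1 g2" "\<And>t. t \<in> {0..1} \<Longrightarrow> g1 t \<noteq> 0" "g 0 = (0, 0)" "g 1 = (l, 0)" using Aset_W22[OF assms] by blast
  have "(reflx \<circ> g1) t \<noteq> 0" if "t \<in> {0..1}" for t using g(2)[OF that] by (auto simp: reflx_def zero_prod_def prod_eq_iff)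
  then show ?thesis unfolding Aset_def using W22_reflx[OF g(1)] g(3,4) by (auto simp: reflx_def)
qed

lemma energy_reflx: assumes "g \<in> Aset l" shows "energy lam (reflx \<circ> g) = energy lam g"
proof -
  obtain g1 g2 where g: "W22 g g1 g2" using Aset_W22[OF assms] by blast
  have "(cross (reflx a) (reflx b))\<^sup>2 = (cross a b)\<^sup>2" for a b
    by (simp add: cross_def reflx_def power2_eq_square algebra_simps)
  then show ?thesis unfolding energy_W22[OF g] energy_W22[OF W22_reflx[OF g]] by (simp add: norm_reflx)
qed

lemma w22_dist_reflx: assumes "g \<in> Aset l" "h \<in> Aset l" shows "w22_dist (reflx \<circ> g) (reflx \<circ> h) = w22_dist g h"
proof -
  obtain g1 g2 where g: "W22 g g1 g2" using Aset_W22[OF assms(1)] by blast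
  obtain h1 h2 where h: "W22 h h1 h2" using Aset_W22[OF assms(2)] by blast
  show ?thesis unfolding w22_dist_W22[OF g h] w22_dist_W22[OF W22_reflx[OF g] W22_reflx[OF h]] by (simp add: norm_reflx)
qed

lemma stable_reflx: assumes "stable lam l g" shows "stable lam l (reflx \<circ> g)"
proof -
  obtain \<delta> where d: "g \<in> Aset l" "\<delta> > 0" "\<And>G. G \<in> Aset l \<Longrightarrow> w22_dist G g < \<delta> \<Longrightarrow> energy lam g \<le> energy lam G"
    using assms unfolding stable_def by blast
  have "energy lam (reflx \<circ> g) \<le> energy lam G" if G: "G \<in> Aset l" "w22_dist G (reflx \<circ> g) < \<delta>" for G
  proof -
    have "w22_dist (reflx \<circ> G) g = w22_dist G (reflx \<circ> g)"
      using w22_dist_reflx[OF G(1) reflx_Aset[OF d(1)]] by (simp add: reflx_reflx)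
    then show ?thesis using d(3)[OF reflx_Aset[OF G(1)]] G(2) energy_reflx[OF G(1)] energy_reflx[OF d(1)] by simp
  qed
  then show ?thesis unfolding stable_def using d(2) reflx_Aset[OF d(1)] by blast
qed

text \<open>The energy along a line through \<open>g\<close> has a derivative by
  \<open>first_variation\<close>, and small perturbations keep a nonzero tangent and stay near
  \<open>g\<close>. This allows the classification of all local minimizers, which the counting
  statements need.\<close>

lemma stable_imp_pinned: assumes st: "stable lam l g" shows "pinned_elastica lam l g"
proof -
  obtain \<delta> where d: "g \<in> Aset l" "\<delta> > 0" "\<And>G. G \<in> Aset l \<Longrightarrow> w22_dist G g < \<delta> \<Longrightarrow> energy lam g \<le> energy lam G"
    using st unfolding stable_def by blast
  obtain g1 g2 where g: "W22 g g1 g2" "\<And>t. t \<in> {0..1} \<Longrightarrow> g1 t \<noteq> 0" "g 0 = (0, 0)" "g 1 = (l, 0)" using Aset_W22[OF d(1)] by blast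
  have "((\<lambda>e. energy lam (\<lambda>t. g t + e *\<^sub>R \<eta> t)) has_real_derivative 0) (at 0)"
    if W: "W22 \<eta> \<eta>1 \<eta>2" and \<eta>: "\<eta> 0 = 0" "\<eta> 1 = 0" for \<eta> \<eta>1 \<eta>2
  proof -
    obtain D where D: "((\<lambda>e. energy lam (\<lambda>t. g t + e *\<^sub>R \<eta> t)) has_real_derivative D) (at 0)"
      using first_variation[OF g(1,2) W] by blast
    have cn: "continuous_on {0..1} (\<lambda>t. norm (g1 t))" "continuous_on {0..1} (\<lambda>t. norm (\<eta>1 t))"
      unfolding norm_prod_def
      by (intro continuous_intros H1_continuous[OF W22_H1(1)[OF g(1)]] H1_continuous[OF W22_H1(2)[OF g(1)]]
          H1_continuous[OF W22_H1(1)[OF W]] H1_continuous[OF W22_H1(2)[OF W]])+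
    obtain t0 where t0: "t0 \<in> {0..1}" "\<And>t. t \<in> {0..1} \<Longrightarrow> norm (g1 t0) \<le> norm (g1 t)"
      using continuous_attains_inf[OF _ _ cn(1)] by auto
    define m where "m = norm (g1 t0)"
    have m: "m > 0" using g(2)[OF t0(1)] by (simp add: m_def)
    obtain M where M: "M > 0" "\<And>t. t \<in> {0..1} \<Longrightarrow> \<bar>norm (\<eta>1 t)\<bar> \<le> M" using continuous_Icc_bound[OF cn(2)] by blast
    define J where "J = sqrt (integral {0..1} (\<lambda>t. (norm (\<eta> t))\<^sup>2 + (norm (\<eta>1 t))\<^sup>2 + (norm (\<eta>2 t))\<^sup>2))"
    define e0 where "e0 = min (m / (2 * M)) (\<delta> / (\<bar>J\<bar> + 1))"
    have e0: "e0 > 0" using m M d(2) by (auto simp: e0_def)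
    have "energy lam g \<le> energy lam (\<lambda>t. g t + e *\<^sub>R \<eta> t)" if e: "\<bar>e\<bar> < e0" for e
    proof (rule d(3))
      have W': "W22 (\<lambda>t. g t + e *\<^sub>R \<eta> t) (\<lambda>t. g1 t + e *\<^sub>R \<eta>1 t) (\<lambda>t. g2 t + e *\<^sub>R \<eta>2 t)" by (rule W22_add_scaled[OF g(1) W])
      have "g1 t + e *\<^sub>R \<eta>1 t \<noteq> 0" if t: "t \<in> {0..1}" for t
      proof
        assume "g1 t + e *\<^sub>R \<eta>1 t = 0"
        then have "norm (g1 t) = \<bar>e\<bar> * norm (\<eta>1 t)" by (metis add_eq_0_iff norm_minus_cancel norm_scaleR)
        also have "\<dots> \<le> \<bar>e\<bar> * M" using M(2)[OF t] by (intro mult_left_mono) auto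
        also have "\<dots> < m / (2 * M) * M" using e M(1) by (intro mult_strict_right_mono) (auto simp: e0_def)
        also have "\<dots> = m / 2" using M(1) by simp
        finally show False using t0(2)[OF t] m unfolding m_def by linarith
      qed
      then show "(\<lambda>t. g t + e *\<^sub>R \<eta> t) \<in> Aset l" unfolding Aset_def using W' g(3,4) \<eta> by auto
      have "w22_dist (\<lambda>t. g t + e *\<^sub>R \<eta> t) g = sqrt (integral {0..1} (\<lambda>t. e\<^sup>2 * ((norm (\<eta> t))\<^sup>2 + (norm (\<eta>1 t))\<^sup>2 + (norm (\<eta>2 t))\<^sup>2)))"
        unfolding w22_dist_W22[OF W' g(1)] by (simp add: power_mult_distrib distrib_left)
      also have "\<dots> = \<bar>e\<bar> * J" by (simp add: J_def real_sqrt_mult)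
      also have "\<dots> \<le> \<bar>e\<bar> * (\<bar>J\<bar> + 1)" by (intro mult_left_mono) auto
      also have "\<dots> < \<delta> / (\<bar>J\<bar> + 1) * (\<bar>J\<bar> + 1)" using e by (intro mult_strict_right_mono) (auto simp: e0_def)
      also have "\<dots> = \<delta>" by (simp add: add_nonneg_eq_0_iff)
      finally show "w22_dist (\<lambda>t. g t + e *\<^sub>R \<eta> t) g < \<delta>" .
    qed
    then have "D = 0" by (intro DERIV_local_min[OF D e0]) auto
    then show ?thesis using D by simp
  qed
  then show ?thesis unfolding pinned_elastica_def using d(1) by blast
qed

lemma pinned_critical:
  assumes "pinned_elastica lam l g" "lam > 0" "l > 0"
  obtains v v' \<psi> p where "critical_curve g v v' \<psi> p lam l"
proof -
  have gA: "g \<in> Aset l" using assms(1) unfolding pinned_elastica_def by blast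
  have crit: "((\<lambda>e. energy lam (\<lambda>t. g t + e *\<^sub>R \<eta> t)) has_real_derivative 0) (at 0)"
    if "W22 \<eta> \<eta>1 \<eta>2" "\<eta> 0 = 0" "\<eta> 1 = 0" for \<eta> \<eta>1 \<eta>2
    using assms(1) that unfolding pinned_elastica_def by blast
  obtain v v' \<psi> \<kappa> where P: "polar g v v' \<psi> \<kappa>" and G: "g 0 = (0, 0)" "g 1 = (l, 0)" using Aset_polar[OF gA] .
  show ?thesis
  proof (rule euler_lagrange[OF P G assms(3)])
    show "((\<lambda>e. energy lam (\<lambda>t. g t + e *\<^sub>R \<eta> t)) has_real_derivative 0) (at 0)"
      if "W22 \<eta> \<eta>1 \<eta>2" "\<eta> 0 = 0" "\<eta> 1 = 0" for \<eta> \<eta>1 \<eta>2 by (rule crit[OF that])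
    fix p assume "\<And>t. t \<in> {0..1} \<Longrightarrow> lam - p\<^sup>2 * (snd (g t))\<^sup>2 / 4 = p * cos (\<psi> t)"
      and "polar g v v' \<psi> (\<lambda>t. p * snd (g t) * v t / 2)"
    then have "critical_curve g v v' \<psi> p lam l" unfolding critical_curve_def using G assms(2,3) by blast
    then show thesis by (rule that)
  qed
qed

text \<open>The angle changes sign while the multiplier is kept, so a curve that starts downwards is
  reduced to one that starts upwards.\<close>

lemma critical_reflx:
  assumes "critical_curve g v v' \<psi> p lam l"
  shows "critical_curve (reflx \<circ> g) v v' (\<lambda>t. - \<psi> t) p lam l"
proof -
  interpret critical_curve g v v' \<psi> p lam l by fact
  have H: "H1 (\<lambda>t. - \<psi> t) (\<lambda>t. p * snd ((reflx \<circ> g) t) * v t / 2)"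
    by (rule H1_cong[OF H1_cmult[OF H\<psi>, of "-1"]]) (auto simp: reflx_def)
  have "(reflx \<circ> g has_vector_derivative (v t * cos (- \<psi> t), v t * sin (- \<psi> t))) (at t within {0..1})" if t: "t \<in> {0..1}" for t
    using W22_has_vector_derivative[OF W22_reflx[OF polar_W22[OF P]] t] by (simp add: reflx_def)
  then have "polar (reflx \<circ> g) v v' (\<lambda>t. - \<psi> t) (\<lambda>t. p * snd ((reflx \<circ> g) t) * v t / 2)"
    unfolding polar_def using Hv vp H by blast
  then show ?thesis unfolding critical_curve_def using g0 g1 l lam EL by (simp add: reflx_def)
qed

section \<open>Larcs and the classification\<close>

lemma reparam_iff:
  assumes "a \<le> c"
  shows "reparam g b a c \<longleftrightarrow> (\<exists>\<phi>. continuous_on {0..1} \<phi> \<and> strict_mono_on {0..1} \<phi> \<and> \<phi> 0 = a \<and> \<phi> 1 = c \<and> (\<forall>t\<in>{0..1}. g t = b (\<phi> t)))"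
proof
  assume "reparam g b a c"
  then obtain \<phi> where f: "\<phi> ` {0..1} = {a..c}" "strict_mono_on {0..1} \<phi>" "continuous_on {0..1} \<phi>" "\<forall>t\<in>{0..1}. g t = b (\<phi> t)"
    unfolding reparam_def by blast
  have "{\<phi> 0..\<phi> 1} = {a..c}" by (rule trans[OF strict_mono_on_image[OF f(3,2), symmetric] f(1)])
  then have "\<phi> 0 = a" "\<phi> 1 = c" using assms by (auto simp: Icc_eq_Icc)
  then show "\<exists>\<phi>. continuous_on {0..1} \<phi> \<and> strict_mono_on {0..1} \<phi> \<and> \<phi> 0 = a \<and> \<phi> 1 = c \<and> (\<forall>t\<in>{0..1}. g t = b (\<phi> t))"
    using f by blast
next
  assume "\<exists>\<phi>. continuous_on {0..1} \<phi> \<and> strict_mono_on {0..1} \<phi> \<and> \<phi> 0 = a \<and> \<phi> 1 = c \<and> (\<forall>t\<in>{0..1}. g t = b (\<phi> t))"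
  then show "reparam g b a c" unfolding reparam_def using strict_mono_on_image by metis
qed

lemma reparam_change:
  assumes r: "reparam g b a c" and ac: "a \<le> c" "a' \<le> c'"
    and s: "continuous_on {a..c} \<sigma>" "strict_mono_on {a..c} \<sigma>" "\<sigma> a = a'" "\<sigma> c = c'"
    and b: "\<And>u. u \<in> {a..c} \<Longrightarrow> b u = b' (\<sigma> u)"
  shows "reparam g b' a' c'"
proof -
  obtain \<phi> where f: "\<phi> ` {0..1} = {a..c}" "strict_mono_on {0..1} \<phi>" "continuous_on {0..1} \<phi>" "\<forall>t\<in>{0..1}. g t = b (\<phi> t)"
    using r unfolding reparam_def by blast
  have e: "\<phi> 0 = a" "\<phi> 1 = c" using strict_mono_on_image[OF f(3,2)] f(1) ac(1) by (auto simp: Icc_eq_Icc)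
  have "continuous_on {0..1} (\<lambda>t. \<sigma> (\<phi> t))" using continuous_on_compose[OF f(3)] s(1) f(1) by (simp add: o_def)
  moreover have "strict_mono_on {0..1} (\<lambda>t. \<sigma> (\<phi> t))"
  proof (rule strict_mono_onI)
    fix s t :: real assume st: "s \<in> {0..1}" "t \<in> {0..1}" "s < t"
    then show "\<sigma> (\<phi> s) < \<sigma> (\<phi> t)" using strict_mono_onD[OF s(2)] strict_mono_onD[OF f(2) st] f(1) by blast
  qed
  moreover have "g t = b' (\<sigma> (\<phi> t))" if t: "t \<in> {0..1}" for t
  proof -
    have "\<phi> t \<in> {a..c}" using f(1) t by blast
    then show ?thesis using f(4) b t by simp
  qed
  ultimately show ?thesis unfolding reparam_iff[OF ac(2)] using e s(3,4) by (intro exI[of _ "\<lambda>t. \<sigma> (\<phi> t)"]) simp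
qed

text \<open>The larc with the amplitude as parameter, arclength s being given by
  \<open>\<alpha>\<close> s = F + K. Its derivatives are elementary, whereas the arclength form
  involves the inverse function \<open>am\<close>.\<close>

definition arc_curve :: "real \<Rightarrow> real \<Rightarrow> curve" where
  "arc_curve \<alpha> q \<theta> = ((2 * EllEx \<theta> q + 2 * EllE q - (EllF \<theta> q + EllK q)) / \<alpha>, 2 * q / \<alpha> * cos \<theta>)"

lemma EllF_continuous: "\<bar>q\<bar> < 1 \<Longrightarrow> continuous_on S (\<lambda>x. EllF x q)"
  by (rule DERIV_continuous_on) (rule has_field_derivative_at_within[OF EllF_deriv])

lemma EllF_ends:
  assumes "\<bar>q\<bar> < 1" shows "EllF (- (pi / 2)) q = - EllK q" "EllF (pi / 2) q = EllK q"
  by (simp_all add: EllF_minus[OF assms] EllK_def)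

lemma EllEx_ends:
  assumes "\<bar>q\<bar> < 1" shows "EllEx (- (pi / 2)) q = - EllE q" "EllEx (pi / 2) q = EllE q"
  by (simp_all add: EllEx_minus[OF assms] EllE_def)

lemma am_inverse:
  assumes q: "\<bar>q\<bar> < 1" and u: "u \<in> {- EllK q..EllK q}"
  shows "EllF (am u q) q = u"
proof -
  obtain x where "EllF x q = u" using IVT'[of "\<lambda>x. EllF x q" "- (pi / 2)" u "pi / 2"] u EllF_ends[OF q] EllF_continuous[OF q] by auto
  then show ?thesis using am_EllF[OF q] by metis
qed

lemma am_continuous:
  assumes q: "\<bar>q\<bar> < 1" shows "continuous_on {- EllK q..EllK q} (\<lambda>u. am u q)"
proof (rule continuous_on_subset)
  show "continuous_on ((\<lambda>x. EllF x q) ` {- (pi / 2)..pi / 2}) (\<lambda>u. am u q)"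
    by (rule continuous_on_inv[OF EllF_continuous[OF q] compact_Icc]) (simp add: am_EllF[OF q])
  show "{- EllK q..EllK q} \<subseteq> (\<lambda>x. EllF x q) ` {- (pi / 2)..pi / 2}"
  proof
    fix u assume u: "u \<in> {- EllK q..EllK q}"
    obtain x where "- (pi / 2) \<le> x" "x \<le> pi / 2" "EllF x q = u"
      using IVT'[of "\<lambda>x. EllF x q" "- (pi / 2)" u "pi / 2"] u EllF_ends[OF q] EllF_continuous[OF q] by auto
    then show "u \<in> (\<lambda>x. EllF x q) ` {- (pi / 2)..pi / 2}" by auto
  qed
qed

lemma EllF_mono_iff: "\<bar>q\<bar> < 1 \<Longrightarrow> EllF x q < EllF y q \<longleftrightarrow> x < y"
  using EllF_strict_mono[of q x y] EllF_strict_mono[of q y x] by (cases x y rule: linorder_cases) auto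

text \<open>The maps (F + K) / \<open>\<alpha>\<close> and \<open>am\<close> of
  \<open>\<alpha>\<close> s - K are increasing, continuous and inverse to each other between the
  amplitude interval and the arclength interval.\<close>

lemma reparam_larc_iff:
  assumes lam: "lam > 0" and l: "l > 0" and q: "qhat \<le> q" "q < qstar" "gcrit q = lam * l\<^sup>2" and \<alpha>: "\<alpha> * l = 2 * EllU q"
  shows "reparam g (larc lam l) 0 (larc_end lam l) \<longleftrightarrow> reparam g (arc_curve \<alpha> q) (- (pi / 2)) (pi / 2)"
proof -
  have q': "0 < q" "\<bar>q\<bar> < 1" using q(1,2) qhat(1) qstar(2) inv_sqrt2(1) by linarith+
  have lq: "larc_q lam l = q" using q2_eq[OF q(1,2)] q(3) by (simp add: larc_q_def)
  have \<alpha>e: "\<alpha> = 2 * EllU q / l" using \<alpha> l by (simp add: field_simps)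
  have la: "larc_alpha lam l = \<alpha>" unfolding larc_alpha_def lq \<alpha>e by (simp add: EllU_def)
  have \<alpha>0: "\<alpha> > 0" unfolding \<alpha>e using EllU_pos[OF q'(1) q(2)] l by simp
  define c where "c = larc_end lam l"
  have c: "\<alpha> * c = 2 * EllK q" using \<alpha>0 by (simp add: c_def larc_end_def lq la)
  have c0: "0 < c" using EllK_pos[OF q'(2)] \<alpha>0 by (simp add: c_def larc_end_def lq la)
  have larc: "larc lam l u = arc_curve \<alpha> q (am (\<alpha> * u - EllK q) q)" if u: "u \<in> {0..c}" for u
  proof -
    have "\<alpha> * u - EllK q \<in> {- EllK q..EllK q}" using u \<alpha>0 c mult_left_mono[of u c \<alpha>] by auto
    from am_inverse[OF q'(2) this] show ?thesis
      by (simp add: larc_def lq la arc_curve_def Let_def cn_def)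
  qed
  show ?thesis unfolding c_def[symmetric]
  proof
    assume r: "reparam g (larc lam l) 0 c"
    define \<sigma> where "\<sigma> = (\<lambda>u. am (\<alpha> * u - EllK q) q)"
    have rng: "\<alpha> * u - EllK q \<in> {- EllK q..EllK q}" if "u \<in> {0..c}" for u
      using that \<alpha>0 c mult_left_mono[of u c \<alpha>] by auto
    show "reparam g (arc_curve \<alpha> q) (- (pi / 2)) (pi / 2)"
    proof (rule reparam_change[OF r])
      show "continuous_on {0..c} \<sigma>" unfolding \<sigma>_def
        using rng by (intro continuous_on_compose2[OF am_continuous[OF q'(2)]] continuous_intros) auto
      show "strict_mono_on {0..c} \<sigma>"
      proof (rule strict_mono_onI)
        fix s t assume st: "s \<in> {0..c}" "t \<in> {0..c}" "s < t"
        have "EllF (\<sigma> s) q < EllF (\<sigma> t) q"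
          unfolding \<sigma>_def am_inverse[OF q'(2) rng[OF st(1)]] am_inverse[OF q'(2) rng[OF st(2)]] using st(3) \<alpha>0 by simp
        then show "\<sigma> s < \<sigma> t" using EllF_mono_iff[OF q'(2)] by simp
      qed
      show "\<sigma> 0 = - (pi / 2)" using am_EllF[OF q'(2), of "- (pi / 2)"] EllF_ends[OF q'(2)] by (simp add: \<sigma>_def)
      show "\<sigma> c = pi / 2" using am_EllF[OF q'(2), of "pi / 2"] EllF_ends[OF q'(2)] by (simp add: \<sigma>_def c)
      show "\<And>u. u \<in> {0..c} \<Longrightarrow> larc lam l u = arc_curve \<alpha> q (\<sigma> u)" unfolding \<sigma>_def by (rule larc)
    qed (use c0 in auto)
  next
    assume r: "reparam g (arc_curve \<alpha> q) (- (pi / 2)) (pi / 2)"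
    define \<sigma> where "\<sigma> = (\<lambda>\<theta>. (EllF \<theta> q + EllK q) / \<alpha>)"
    show "reparam g (larc lam l) 0 c"
    proof (rule reparam_change[OF r])
      show "continuous_on {- (pi / 2)..pi / 2} \<sigma>" unfolding \<sigma>_def
        using \<alpha>0 by (intro continuous_intros EllF_continuous[OF q'(2)]) auto
      show sm: "strict_mono_on {- (pi / 2)..pi / 2} \<sigma>"
        unfolding \<sigma>_def using \<alpha>0 EllF_strict_mono[OF q'(2)] by (intro strict_mono_onI divide_strict_right_mono) auto
      show e: "\<sigma> (- (pi / 2)) = 0" "\<sigma> (pi / 2) = c" using c \<alpha>0 by (simp_all add: \<sigma>_def EllF_ends[OF q'(2)] field_simps)
      fix \<theta> assume \<theta>: "\<theta> \<in> {- (pi / 2)..pi / 2}"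
      have "EllF (- (pi / 2)) q \<le> EllF \<theta> q" "EllF \<theta> q \<le> EllF (pi / 2) q"
        using EllF_mono_iff[OF q'(2)] \<theta> by (metis not_less atLeastAtMost_iff)+
      then have "\<sigma> \<theta> \<in> {0..c}" unfolding e[symmetric] \<sigma>_def using \<alpha>0 by (auto intro!: divide_right_mono)
      moreover have "am (\<alpha> * \<sigma> \<theta> - EllK q) q = \<theta>" using \<alpha>0 am_EllF[OF q'(2)] by (simp add: \<sigma>_def)
      ultimately show "arc_curve \<alpha> q \<theta> = larc lam l (\<sigma> \<theta>)" using larc by simp
    qed (use c0 in auto)
  qed
qed

text \<open>The chain rule read backwards, by Caratheodory's form of the derivative. It shows that a
  reparametrization known only to be continuous is differentiable once its composition with a
  regular function is.\<close>

lemma DERIV_chain_cancel: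
  fixes f a :: "real \<Rightarrow> real"
  assumes fa: "((\<lambda>t. f (a t)) has_real_derivative d) (at t within S)" and f: "(f has_real_derivative c) (at (a t))" and c: "c \<noteq> 0"
    and a: "continuous (at t within S) a"
  shows "(a has_real_derivative d / c) (at t within S)"
proof -
  obtain h where h: "\<And>z. f z - f (a t) = h z * (z - a t)" "isCont h (a t)" "h (a t) = c"
    using f unfolding CARAT_DERIV by blast
  have ha: "((\<lambda>s. h (a s)) \<longlongrightarrow> c) (at t within S)"
    using isCont_tendsto_compose[OF h(2)] a unfolding continuous_within h(3) by blast
  have q: "((\<lambda>s. (f (a s) - f (a t)) / (s - t)) \<longlongrightarrow> d) (at t within S)"
    using fa unfolding has_field_derivative_iff .
  have "((\<lambda>s. (f (a s) - f (a t)) / (s - t) / h (a s)) \<longlongrightarrow> d / c) (at t within S)"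
    by (rule tendsto_divide[OF q ha c])
  moreover have "\<forall>\<^sub>F s in at t within S. (f (a s) - f (a t)) / (s - t) / h (a s) = (a s - a t) / (s - t)"
    using tendsto_imp_eventually_ne[OF ha c] by eventually_elim (simp add: h(1))
  ultimately show ?thesis unfolding has_field_derivative_iff by (rule Lim_transform_eventually)
qed

section \<open>Larcs as critical curves, and their stability\<close>

lemma arc_curve_deriv:
  fixes \<theta> :: real
  assumes q: "\<bar>q\<bar> < 1" and \<alpha>: "\<alpha> > 0"
  defines "D \<equiv> sqrt (1 - q\<^sup>2 * (sin \<theta>)\<^sup>2)"
  shows "((\<lambda>\<theta>. fst (arc_curve \<alpha> q \<theta>)) has_real_derivative (1 - 2 * q\<^sup>2 * (sin \<theta>)\<^sup>2) / (\<alpha> * D)) (at \<theta>)"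
    and "((\<lambda>\<theta>. snd (arc_curve \<alpha> q \<theta>)) has_real_derivative (- 2 * q * sin \<theta> * D) / (\<alpha> * D)) (at \<theta>)"
proof -
  have D: "D > 0" "D * D = 1 - q\<^sup>2 * (sin \<theta>)\<^sup>2" using modulus_bound(2)[OF q, of \<theta>] by (auto simp: D_def)
  have "((\<lambda>\<theta>. fst (arc_curve \<alpha> q \<theta>)) has_real_derivative (2 * D - 1 / D) / \<alpha>) (at \<theta>)"
    unfolding arc_curve_def fst_conv D_def
    using DERIV_cdivide[OF DERIV_diff[OF DERIV_add[OF DERIV_cmult[OF EllEx_deriv[OF q]] DERIV_const] DERIV_add[OF EllF_deriv[OF q] DERIV_const]]]
    by simp
  moreover have "(2 * D - 1 / D) / \<alpha> = (2 * (D * D) - 1) / (\<alpha> * D)" using D(1) \<alpha> by (simp add: field_simps)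
  ultimately show "((\<lambda>\<theta>. fst (arc_curve \<alpha> q \<theta>)) has_real_derivative (1 - 2 * q\<^sup>2 * (sin \<theta>)\<^sup>2) / (\<alpha> * D)) (at \<theta>)"
    unfolding D(2) by (simp add: mult.assoc)
  have "((\<lambda>\<theta>. snd (arc_curve \<alpha> q \<theta>)) has_real_derivative 2 * q / \<alpha> * - sin \<theta>) (at \<theta>)"
    unfolding arc_curve_def snd_conv by (rule DERIV_cmult[OF DERIV_cos])
  then show "((\<lambda>\<theta>. snd (arc_curve \<alpha> q \<theta>)) has_real_derivative (- 2 * q * sin \<theta> * D) / (\<alpha> * D)) (at \<theta>)"
    using D(1) \<alpha> by simp
qed

lemma arc_curve_ends:
  assumes "\<bar>q\<bar> < 1" "\<alpha> \<noteq> 0" "\<alpha> * l = 2 * EllU q"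
  shows "arc_curve \<alpha> q (- (pi / 2)) = (0, 0)" "arc_curve \<alpha> q (pi / 2) = (l, 0)"
  using assms by (auto simp: arc_curve_def EllF_ends EllEx_ends EllU_def field_simps)

text \<open>The function -2 arcsin (q sin \<open>\<theta>\<close>) is the tangent angle of
  \<open>arc_curve\<close> at amplitude \<open>\<theta>\<close>, on the branch that stays in the
  interval of half-width 2 arcsin q around 0.\<close>

lemma arc_angle:
  assumes q: "0 < q" "q < 1"
  shows "cos (- 2 * arcsin (q * sin \<theta>)) = 1 - 2 * q\<^sup>2 * (sin \<theta>)\<^sup>2"
    "sin (- 2 * arcsin (q * sin \<theta>)) = - 2 * q * sin \<theta> * sqrt (1 - q\<^sup>2 * (sin \<theta>)\<^sup>2)"
    "\<bar>- 2 * arcsin (q * sin \<theta>)\<bar> \<le> 2 * arcsin q"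
    "((\<lambda>\<theta>. - 2 * arcsin (q * sin \<theta>)) has_real_derivative - 2 * (q * cos \<theta> / sqrt (1 - q\<^sup>2 * (sin \<theta>)\<^sup>2))) (at \<theta>)"
proof -
  have b: "\<bar>q * sin \<theta>\<bar> \<le> q" using q abs_sin_le_one[of \<theta>] by (simp add: abs_mult mult_left_le)
  then have b': "- 1 \<le> q * sin \<theta>" "q * sin \<theta> \<le> 1" "- 1 < q * sin \<theta>" "q * sin \<theta> < 1" "- q \<le> q * sin \<theta>" "q * sin \<theta> \<le> q"
    using q by linarith+
  have "cos (- 2 * arcsin (q * sin \<theta>)) = cos (2 * arcsin (q * sin \<theta>))" by simp
  then show "cos (- 2 * arcsin (q * sin \<theta>)) = 1 - 2 * q\<^sup>2 * (sin \<theta>)\<^sup>2"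
    using b' by (simp add: cos_double_sin power_mult_distrib)
  have "sin (- 2 * arcsin (q * sin \<theta>)) = - sin (2 * arcsin (q * sin \<theta>))" by simp
  then show "sin (- 2 * arcsin (q * sin \<theta>)) = - 2 * q * sin \<theta> * sqrt (1 - q\<^sup>2 * (sin \<theta>)\<^sup>2)"
    using b' by (simp add: sin_double cos_arcsin power_mult_distrib)
  have "arcsin (q * sin \<theta>) \<le> arcsin q" "arcsin (- q) \<le> arcsin (q * sin \<theta>)" using b' q by (intro arcsin_le_arcsin; linarith)+
  then show "\<bar>- 2 * arcsin (q * sin \<theta>)\<bar> \<le> 2 * arcsin q" using q by (simp add: arcsin_minus abs_le_iff)
  show "((\<lambda>\<theta>. - 2 * arcsin (q * sin \<theta>)) has_real_derivative - 2 * (q * cos \<theta> / sqrt (1 - q\<^sup>2 * (sin \<theta>)\<^sup>2))) (at \<theta>)"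
    using DERIV_cmult[OF DERIV_chain2[OF DERIV_arcsin[OF b'(3,4)] DERIV_cmult[OF DERIV_sin]], of "- 2"]
    by (simp add: power_mult_distrib divide_inverse mult_ac)
qed

lemma H1_arc_angle:
  assumes q: "0 < q" "q < 1" and a: "H1 a a'"
  shows "H1 (\<lambda>t. - 2 * arcsin (q * sin (a t))) (\<lambda>t. - 2 * (q * cos (a t) / sqrt (1 - q\<^sup>2 * (sin (a t))\<^sup>2)) * a' t)"
proof (rule H1_chain[OF a, where h="\<lambda>\<theta>. - 2 * arcsin (q * sin \<theta>)" and h'="\<lambda>\<theta>. - 2 * (q * cos \<theta> / sqrt (1 - q\<^sup>2 * (sin \<theta>)\<^sup>2))"])
  show "continuous_on (a ` {0..1}) (\<lambda>\<theta>. - 2 * (q * cos \<theta> / sqrt (1 - q\<^sup>2 * (sin \<theta>)\<^sup>2)))"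
    using modulus_bound(2)[of q] q by (intro continuous_intros) (auto simp: less_le)
qed (rule arc_angle(4)[OF q])

text \<open>A converse to \<open>arc_form\<close>. The amplitude is at first only continuous and
  increasing, but membership of the curve in \<open>Aset l\<close> forces it to be differentiable
  with the expected derivative, and the Euler-Lagrange equations can be verified directly.\<close>

lemma larc_data:
  assumes g: "g \<in> Aset l" and r: "reparam g (arc_curve \<alpha> q) (- (pi / 2)) (pi / 2)"
    and lam: "lam > 0" and l: "l > 0" and q: "1 / sqrt 2 < q" "q < 1" "gcrit q = lam * l\<^sup>2" and \<alpha>: "\<alpha> > 0" "\<alpha> * l = 2 * EllU q"
  obtains v v' a p where "critical_curve g v v' (\<lambda>t. - 2 * arcsin (q * sin (a t))) p lam l"
    "H1 a (\<lambda>t. \<alpha> * v t * sqrt (1 - q\<^sup>2 * (sin (a t))\<^sup>2))" "a 0 = - (pi / 2)" "a 1 = pi / 2"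
    "\<And>t. t \<in> {0..1} \<Longrightarrow> p * snd (g t) * v t / 2 = - 2 * q * \<alpha> * v t * cos (a t)"
proof -
  have q0: "0 < q" "\<bar>q\<bar> < 1" using q(1,2) inv_sqrt2(1) by linarith+
  obtain v v' \<psi> \<kappa> where P: "polar g v v' \<psi> \<kappa>" and G: "g 0 = (0, 0)" "g 1 = (l, 0)" using Aset_polar[OF g] .
  note Hv = polarD(1)[OF P] and vp = polarD(2)[OF P]
  note cv = H1_continuous[OF Hv] and c\<psi> = H1_continuous[OF polarD(3)[OF P]]
  obtain a where ca: "continuous_on {0..1} a" and sm: "strict_mono_on {0..1} a" and ae: "a 0 = - (pi / 2)" "a 1 = pi / 2"
    and ga: "\<And>t. t \<in> {0..1} \<Longrightarrow> g t = arc_curve \<alpha> q (a t)"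
    using iffD1[OF reparam_iff r] by auto
  define D where "D = (\<lambda>t. sqrt (1 - q\<^sup>2 * (sin (a t))\<^sup>2))"
  have D: "D t > 0" for t using modulus_bound(2)[OF q0(2), of "a t"] by (simp add: D_def)
  define C1 C2 where "C1 = (\<lambda>t. 1 - 2 * q\<^sup>2 * (sin (a t))\<^sup>2)" and "C2 = (\<lambda>t. - 2 * q * sin (a t) * D t)"
  have ang: "cos (- 2 * arcsin (q * sin (a t))) = C1 t" "sin (- 2 * arcsin (q * sin (a t))) = C2 t" for t
    unfolding C1_def C2_def D_def by (rule arc_angle[OF q0(1) q(2)])+
  have C12: "C1 t * C1 t + C2 t * C2 t = 1" for t
    unfolding ang[symmetric] by (metis sin_cos_squared_add2 power2_eq_square)
  have dx: "((\<lambda>t. fst (g t)) has_real_derivative v t * cos (\<psi> t)) (at t within {0..1})"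
    and dy: "((\<lambda>t. snd (g t)) has_real_derivative v t * sin (\<psi> t)) (at t within {0..1})" if "t \<in> {0..1}" for t
    by (intro H1_has_derivative[OF polar_fst[OF P]] H1_has_derivative[OF polar_snd[OF P]] continuous_intros cv c\<psi> that)+
  have main: "cos (\<psi> t) = C1 t \<and> sin (\<psi> t) = C2 t \<and> (a has_real_derivative \<alpha> * v t * D t) (at t within {0..1})" if t: "t \<in> {0..1}" for t
  proof -
    \<comment> \<open>The arc projected on its tangent direction at \<open>a t\<close>. The
      derivative of a single coordinate may vanish there, but this projection has derivative 1 /
      (\<open>\<alpha>\<close> \<open>D t\<close>), so the chain rule can be inverted.\<close>
    define X where "X = (\<lambda>\<theta>. C1 t * fst (arc_curve \<alpha> q \<theta>) + C2 t * snd (arc_curve \<alpha> q \<theta>))"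
    have dX: "(X has_real_derivative C1 t * (C1 t / (\<alpha> * D t)) + C2 t * (C2 t / (\<alpha> * D t))) (at (a t))"
      using DERIV_add[OF DERIV_cmult[OF arc_curve_deriv(1)[OF q0(2) \<alpha>(1), of "a t"], of "C1 t"] DERIV_cmult[OF arc_curve_deriv(2)[OF q0(2) \<alpha>(1), of "a t"], of "C2 t"]]
      unfolding X_def C1_def C2_def D_def .
    have cc: "C1 t * (C1 t / (\<alpha> * D t)) + C2 t * (C2 t / (\<alpha> * D t)) = 1 / (\<alpha> * D t)"
      unfolding C12[of t, symmetric] by (simp add: add_divide_distrib)
    have "((\<lambda>s. X (a s)) has_real_derivative C1 t * (v t * cos (\<psi> t)) + C2 t * (v t * sin (\<psi> t))) (at t within {0..1})"
      by (rule has_field_derivative_transform_within[OF DERIV_add[OF DERIV_cmult[OF dx[OF t]] DERIV_cmult[OF dy[OF t]]] zero_less_one t])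
        (simp add: X_def ga)
    from DERIV_chain_cancel[OF this dX[unfolded cc]] ca t \<alpha>(1) D[of t]
    obtain a' where da: "(a has_real_derivative a') (at t within {0..1})"
      by (auto simp: continuous_on_eq_continuous_within)
    have "((\<lambda>s. fst (arc_curve \<alpha> q (a s))) has_real_derivative C1 t / (\<alpha> * D t) * a') (at t within {0..1})"
      using DERIV_chain2[OF arc_curve_deriv(1)[OF q0(2) \<alpha>(1), of "a t"] da] unfolding C1_def D_def .
    then have "((\<lambda>s. fst (g s)) has_real_derivative C1 t / (\<alpha> * D t) * a') (at t within {0..1})"
      by (rule has_field_derivative_transform_within[OF _ zero_less_one t]) (simp add: ga)
    then have e1: "v t * cos (\<psi> t) = C1 t / (\<alpha> * D t) * a'"
      using vector_derivative_unique_within_closed_interval[of 0 1 t "\<lambda>s. fst (g s)" "v t * cos (\<psi> t)"] dx[OF t] t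
      by (simp add: has_real_derivative_iff_has_vector_derivative cbox_interval)
    have "((\<lambda>s. snd (arc_curve \<alpha> q (a s))) has_real_derivative C2 t / (\<alpha> * D t) * a') (at t within {0..1})"
      using DERIV_chain2[OF arc_curve_deriv(2)[OF q0(2) \<alpha>(1), of "a t"] da] unfolding C2_def D_def .
    then have "((\<lambda>s. snd (g s)) has_real_derivative C2 t / (\<alpha> * D t) * a') (at t within {0..1})"
      by (rule has_field_derivative_transform_within[OF _ zero_less_one t]) (simp add: ga)
    then have e2: "v t * sin (\<psi> t) = C2 t / (\<alpha> * D t) * a'"
      using vector_derivative_unique_within_closed_interval[of 0 1 t "\<lambda>s. snd (g s)" "v t * sin (\<psi> t)"] dy[OF t] t
      by (simp add: has_real_derivative_iff_has_vector_derivative cbox_interval)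
    have a'0: "0 \<le> a'"
    proof (rule ccontr)
      assume "\<not> 0 \<le> a'"
      then have neg: "a' < 0" by simp
      show False
      proof (cases "t < 1")
        case True
        obtain d where d: "d > 0" "\<And>h. 0 < h \<Longrightarrow> t + h \<in> {0..1} \<Longrightarrow> h < d \<Longrightarrow> a t > a (t + h)"
          using has_real_derivative_neg_dec_right[OF da neg] by auto
        define h where "h = min (d / 2) (1 - t)"
        have "0 < h" "h < d" "t + h \<le> 1" using d True by (auto simp: h_def)
        then show False using d(2)[of h] strict_mono_onD[OF sm, of t "t + h"] t by auto
      next
        case False
        then have t1: "t = 1" using t by simp
        obtain d where d: "d > 0" "\<And>h. 0 < h \<Longrightarrow> t - h \<in> {0..1} \<Longrightarrow> h < d \<Longrightarrow> a t < a (t - h)"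
          using has_real_derivative_neg_dec_left[OF da neg] by auto
        define h where "h = min (d / 2) 1"
        have "0 < h" "h < d" "h \<le> 1" using d by (auto simp: h_def)
        then show False using d(2)[of h] strict_mono_onD[OF sm, of "t - h" t] t t1 by auto
      qed
    qed
    define w where "w = a' / (\<alpha> * D t)"
    have w: "w \<ge> 0" using a'0 \<alpha>(1) D[of t] by (simp add: w_def)
    have e: "v t * cos (\<psi> t) = w * C1 t" "v t * sin (\<psi> t) = w * C2 t" using e1 e2 by (simp_all add: w_def)
    have "(v t)\<^sup>2 * ((sin (\<psi> t))\<^sup>2 + (cos (\<psi> t))\<^sup>2) = w\<^sup>2 * (C1 t * C1 t + C2 t * C2 t)"
      using arg_cong[OF e(1), of "\<lambda>x. x * x"] arg_cong[OF e(2), of "\<lambda>x. x * x"]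
      by (simp add: power2_eq_square algebra_simps del: sin_cos_squared_add sin_cos_squared_add2 sin_cos_squared_add3)
    then have "(v t)\<^sup>2 = w\<^sup>2" by (simp add: C12)
    then have wv: "w = v t" using w vp[OF t] by (simp add: power2_eq_iff_nonneg)
    then have "a' = \<alpha> * v t * D t" using \<alpha>(1) D[of t] by (simp add: w_def field_simps)
    then show ?thesis using da e vp[OF t] by (simp add: wv)
  qed
  have cD: "continuous_on {0..1} D" unfolding D_def by (intro continuous_intros ca)
  have Ha: "H1 a (\<lambda>t. \<alpha> * v t * D t)"
    by (rule H1_C1) (use main in \<open>auto intro!: continuous_intros cv cD\<close>)
  \<comment> \<open>The multiplier of the arc, as in \<open>arc_form\<close>: there
    \<open>\<alpha>\<close>^2 was -p / 2.\<close>
  define p where "p = - 2 * \<alpha>\<^sup>2"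
  have yt: "snd (g t) = 2 * q / \<alpha> * cos (a t)" if "t \<in> {0..1}" for t using ga[OF that] by (simp add: arc_curve_def)
  have kap: "p * snd (g t) * v t / 2 = - 2 * q * \<alpha> * v t * cos (a t)" if "t \<in> {0..1}" for t
    unfolding yt[OF that] using \<alpha>(1) by (simp add: p_def power2_eq_square)
  have H\<psi>: "H1 (\<lambda>t. - 2 * arcsin (q * sin (a t))) (\<lambda>t. p * snd (g t) * v t / 2)"
  proof (rule H1_cong[OF H1_arc_angle[OF q0(1) q(2) Ha] refl])
    fix t :: real assume t: "t \<in> {0..1}"
    have "sqrt (1 - q\<^sup>2 * (sin (a t))\<^sup>2) = D t" by (simp add: D_def)
    then show "- 2 * (q * cos (a t) / sqrt (1 - q\<^sup>2 * (sin (a t))\<^sup>2)) * (\<alpha> * v t * D t) = p * snd (g t) * v t / 2"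
      unfolding kap[OF t] using D[of t] by simp
  qed
  have P': "polar g v v' (\<lambda>t. - 2 * arcsin (q * sin (a t))) (\<lambda>t. p * snd (g t) * v t / 2)"
    unfolding polar_def ang using Hv vp H\<psi> polarD(4)[OF P] main by simp
  have lamq: "lam = 2 * \<alpha>\<^sup>2 * (2 * q\<^sup>2 - 1)"
  proof -
    have "lam * l\<^sup>2 = 8 * (EllU q)\<^sup>2 * (2 * q\<^sup>2 - 1)" using q(3) by (simp add: gcrit_def EllU_def)
    also have "\<dots> = 2 * (\<alpha> * l)\<^sup>2 * (2 * q\<^sup>2 - 1)" unfolding \<alpha>(2) by (simp add: power_mult_distrib)
    also have "\<dots> = 2 * \<alpha>\<^sup>2 * (2 * q\<^sup>2 - 1) * l\<^sup>2" by (simp add: power_mult_distrib)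
    finally show ?thesis using l by simp
  qed
  have EL: "lam - p\<^sup>2 * (snd (g t))\<^sup>2 / 4 = p * cos (- 2 * arcsin (q * sin (a t)))" if t: "t \<in> {0..1}" for t
  proof -
    have "p\<^sup>2 * (snd (g t))\<^sup>2 / 4 = 4 * \<alpha>\<^sup>2 * q\<^sup>2 * (1 - (sin (a t))\<^sup>2)"
      unfolding yt[OF t] cos_squared_eq[symmetric] using \<alpha>(1) by (simp add: p_def power_mult_distrib power_divide power2_eq_square)
    then show ?thesis unfolding ang C1_def lamq p_def by (simp add: algebra_simps)
  qed
  have "critical_curve g v v' (\<lambda>t. - 2 * arcsin (q * sin (a t))) p lam l"
    unfolding critical_curve_def using P' G l lam EL by blast
  from that[OF this Ha[unfolded D_def] ae kap] show ?thesis .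
qed

text \<open>The angle of the larc ranges over the interval of half-width 2 arcsin \<open>q\<close>.
  Because \<open>q\<close> lies strictly between \<open>qhat\<close> and \<open>qstar\<close>,
  nearby curves have a half-oscillation between 2 arcsin \<open>qhat\<close> and 2 arcsin
  \<open>qstar\<close>. The calibration bound for that oscillation is at least its value at
  \<open>q\<close>, which is the energy of the larc.\<close>

lemma larc_stable:
  assumes g: "g \<in> Aset l" and r: "reparam g (arc_curve \<alpha> q) (- (pi / 2)) (pi / 2)"
    and lam: "lam > 0" and l: "l > 0" and q: "qhat < q" "q < qstar" "gcrit q = lam * l\<^sup>2" and \<alpha>: "\<alpha> > 0" "\<alpha> * l = 2 * EllU q"
  shows "stable lam l g"
proof -
  have q': "1 / sqrt 2 < q" "q < 1" "0 < q" using q(1,2) qhat(1) qstar(2) inv_sqrt2(1) by linarith+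
  obtain v v' a p where cc: "critical_curve g v v' (\<lambda>t. - 2 * arcsin (q * sin (a t))) p lam l"
    and Ha: "H1 a (\<lambda>t. \<alpha> * v t * sqrt (1 - q\<^sup>2 * (sin (a t))\<^sup>2))" and ae: "a 0 = - (pi / 2)" "a 1 = pi / 2"
    and kap: "\<And>t. t \<in> {0..1} \<Longrightarrow> p * snd (g t) * v t / 2 = - 2 * q * \<alpha> * v t * cos (a t)"
    using larc_data[OF g r lam l q'(1,2) q(3) \<alpha>] by blast
  define \<psi> where "\<psi> = (\<lambda>t. - 2 * arcsin (q * sin (a t)))"
  note ang = arc_angle[OF q'(3,2)]
  have "energy lam g = arc_energy lam l q"
    by (rule critical_curve.arc_energy_eq[OF cc q'(1,2) \<alpha> Ha ae ang(1,2) kap])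
  also have "\<dots> = low_energy lam l q" using low_energy_eq_arc_energy[OF lam l _ q(2,3)] q(1) by simp
  finally have en: "energy lam g = low_energy lam l q" .
  have P: "polar g v v' \<psi> (\<lambda>t. p * snd (g t) * v t / 2)" unfolding \<psi>_def using cc by (simp add: critical_curve_def)
  define A0 A1 A2 where "A0 = 2 * arcsin q" and "A1 = 2 * arcsin qhat" and "A2 = 2 * arcsin qstar"
  have \<psi>: "\<And>t. \<bar>\<psi> t\<bar> \<le> A0" "\<psi> 0 = A0" "\<psi> 1 = - A0"
  proof -
    show "\<bar>\<psi> t\<bar> \<le> A0" for t unfolding \<psi>_def A0_def by (rule ang(3))
    show "\<psi> 0 = A0" "\<psi> 1 = - A0" unfolding \<psi>_def A0_def ae using q' by (simp_all add: arcsin_minus)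
  qed
  have hat: "0 < qhat" "qhat < 1" using qhat qstar inv_sqrt2 by linarith+
  have A: "pi / 2 < A1" "A1 < A0" "A0 < A2" "A2 < pi"
  proof -
    have "arcsin (1 / sqrt 2) < arcsin qhat" using qhat(1) hat inv_sqrt2 by (intro arcsin_less_arcsin) linarith+
    moreover have "arcsin (1 / sqrt 2) = pi / 4"
    proof -
      have "1 / sqrt 2 = sin (pi / 4)" unfolding sin_45 by (simp add: field_simps)
      then show ?thesis using arcsin_sin[of "pi / 4"] by simp
    qed
    ultimately show "pi / 2 < A1" by (simp add: A1_def)
    show "A1 < A0" "A0 < A2" unfolding A0_def A1_def A2_def using q(1,2) hat q' qstar(2) arcsin_less_arcsin[of qhat q] arcsin_less_arcsin[of q qstar] by simp_all
    have "arcsin qstar < arcsin 1" using q(2) q' qstar(2) by (intro arcsin_less_arcsin) linarith+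
    then show "A2 < pi" by (simp add: A2_def)
  qed
  \<comment> \<open>Angles within \<open>e\<close> of those of the larc change the half-oscillation
    by at most \<open>e\<close>, so it stays between \<open>A1\<close> and
    \<open>A2\<close>.\<close>
  define e where "e = min (A0 - A1) (A2 - A0)"
  have e: "0 < e" "e \<le> pi" "e \<le> A0 - A1" "e \<le> A2 - A0" using A by (auto simp: e_def)
  obtain \<delta> where d: "\<delta> > 0" "\<And>G. G \<in> Aset l \<Longrightarrow> w22_dist G g < \<delta> \<Longrightarrow>
     \<exists>w w' \<phi> \<mu>. polar G w w' \<phi> \<mu> \<and> (\<forall>t\<in>{0..1}. \<bar>\<phi> t - \<psi> t\<bar> \<le> e)"
    using lift_close[OF P e(1,2)] by blast
  have "energy lam g \<le> energy lam G" if G: "G \<in> Aset l" "w22_dist G g < \<delta>" for G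
  proof -
    obtain w w' \<phi> \<mu> where PG: "polar G w w' \<phi> \<mu>" and cl: "\<And>t. t \<in> {0..1} \<Longrightarrow> \<bar>\<phi> t - \<psi> t\<bar> \<le> e"
      using d(2)[OF G] by blast
    have G01: "G 0 = (0, 0)" "G 1 = (l, 0)" using G(1) unfolding Aset_def by blast+
    note c\<phi> = H1_continuous[OF polarD(3)[OF PG]]
    obtain t1 where t1: "t1 \<in> {0..1}" "\<And>t. t \<in> {0..1} \<Longrightarrow> \<phi> t \<le> \<phi> t1"
      using continuous_attains_sup[OF _ _ c\<phi>] by auto
    obtain t2 where t2: "t2 \<in> {0..1}" "\<And>t. t \<in> {0..1} \<Longrightarrow> \<phi> t2 \<le> \<phi> t"
      using continuous_attains_inf[OF _ _ c\<phi>] by auto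
    \<comment> \<open>Half-oscillation and middle direction of the competitor; the middle direction
      need not be that of the chord.\<close>
    define B m where "B = (\<phi> t1 - \<phi> t2) / 2" and "m = (\<phi> t1 + \<phi> t2) / 2"
    have m: "\<phi> t1 = m + B" "\<phi> t2 = m - B" by (simp_all add: B_def m_def field_simps)
    have "\<phi> 0 \<le> \<phi> t1" "\<phi> t2 \<le> \<phi> 1" using t1(2) t2(2) by simp_all
    moreover have "\<bar>\<phi> 0 - \<psi> 0\<bar> \<le> e" "\<bar>\<phi> 1 - \<psi> 1\<bar> \<le> e" using cl by simp_all
    moreover have "\<bar>\<phi> t1 - \<psi> t1\<bar> \<le> e" "\<bar>\<phi> t2 - \<psi> t2\<bar> \<le> e" using cl t1(1) t2(1) by simp_all
    moreover have "\<bar>\<psi> t1\<bar> \<le> A0" "\<bar>\<psi> t2\<bar> \<le> A0" by (rule \<psi>(1))+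
    ultimately have B: "A1 \<le> B" "B \<le> A2" using e(3,4) \<psi>(2,3) m by linarith+
    have "sin (A1 / 2) \<le> sin (B / 2)" "sin (B / 2) \<le> sin (A2 / 2)"
      using B A by (intro sin_monotone_2pi_le; linarith)+
    then have r: "qhat \<le> sin (B / 2)" "sin (B / 2) \<le> qstar" using hat q' q(2) qstar(2) by (simp_all add: A1_def A2_def)
    have "low_energy lam l q \<le> low_energy lam l (sin (B / 2))"
      using low_energy_min[OF lam l _ q(2,3) r] q(1) by simp
    also have "\<dots> \<le> energy lam G"
    proof (rule energy_lower_bound[OF PG G01 l lam _ _ refl _ t1(1) m(1) t2(1) m(2)])
      show "pi / 2 < B" "B < pi" using A B by linarith+
      show "\<bar>\<phi> t - m\<bar> \<le> B" if "t \<in> {0..1}" for t using t1(2)[OF that] t2(2)[OF that] m by linarith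
    qed
    finally show ?thesis unfolding en .
  qed
  then show ?thesis unfolding stable_def using g d(1) by blast
qed

section \<open>Classification of the stable curves and their number\<close>

lemma larc_modulus:
  assumes lam: "lam > 0" and l: "l > 0" and small: "lam * l\<^sup>2 < lamhat"
  obtains q \<alpha> where "qhat < q" "q < qstar" "gcrit q = lam * l\<^sup>2" "\<alpha> > 0" "\<alpha> * l = 2 * EllU q"
proof -
  obtain q where q: "qhat \<le> q" "q < qstar" "gcrit q = lam * l\<^sup>2"
    using q2_exists[of "lam * l\<^sup>2"] assms by auto
  have "qhat \<noteq> q" using q(3) small unfolding lamhat_def by auto
  moreover have "EllU q > 0" using q qhat inv_sqrt2 by (intro EllU_pos) linarith+
  ultimately show ?thesis using that[of q "2 * EllU q / l"] q l by simp
qed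

text \<open>The inequality on \<open>lam * l\<^sup>2\<close> appears as a conclusion: instability
  forces the modulus above \<open>qhat\<close>, where \<open>gcrit\<close> is strictly below
  \<open>lamhat\<close>. Hence no stable arc survives when \<open>lam * l\<^sup>2\<close> reaches
  \<open>lamhat\<close>.\<close>

lemma critical_stable_larc:
  assumes cc: "critical_curve g v v' \<psi> p lam l" and st: "stable lam l g" and s0: "sin (\<psi> 0) > 0"
  shows "lam * l\<^sup>2 < lamhat \<and> reparam g (larc lam l) 0 (larc_end lam l)"
proof -
  interpret critical_curve g v v' \<psi> p lam l by (rule cc)
  note s = stable_arc_structure[OF st s0]
  show ?thesis
  proof (rule arc_form[OF s(1) s0 s(2,3)], assumption)
    fix q \<alpha> a assume q: "1 / sqrt 2 < q" "q < 1" and \<alpha>: "\<alpha> > 0" "\<alpha> * l = 2 * EllU q" and gc: "gcrit q = lam * l\<^sup>2"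
      and Ha: "H1 a (\<lambda>t. \<alpha> * v t * sqrt (1 - q\<^sup>2 * (sin (a t))\<^sup>2))" and ae: "a 0 = - (pi / 2)" "a 1 = pi / 2"
      and F: "\<And>t. t \<in> {0..1} \<Longrightarrow> EllF (a t) q = \<alpha> * integral {0..t} v - EllK q"
      and gt: "\<And>t. t \<in> {0..1} \<Longrightarrow> g t = ((2 * EllEx (a t) q + 2 * EllE q - \<alpha> * integral {0..t} v) / \<alpha>, 2 * q / \<alpha> * cos (a t))"
      and cpsi: "\<And>t. t \<in> {0..1} \<Longrightarrow> cos (\<psi> t) = 1 - 2 * q\<^sup>2 * (sin (a t))\<^sup>2"
      and spsi: "\<And>t. t \<in> {0..1} \<Longrightarrow> sin (\<psi> t) = - 2 * q * sin (a t) * sqrt (1 - q\<^sup>2 * (sin (a t))\<^sup>2)"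
      and kap: "\<And>t. t \<in> {0..1} \<Longrightarrow> p * snd (g t) * v t / 2 = - 2 * q * \<alpha> * v t * cos (a t)"
    have qh: "qhat < q"
    proof (rule ccontr)
      assume "\<not> qhat < q"
      then show False using short_arc_unstable[OF q \<alpha> Ha ae cpsi spsi kap _ gc] st by simp
    qed
    \<comment> \<open>A positive chord forces \<open>EllU q\<close> to be positive.\<close>
    have "\<not> qstar \<le> q" using EllU_neg[of q] qstar(3) q(2) \<alpha> l mult_pos_pos[OF \<alpha>(1) l] by (cases "q = qstar") auto
    then have qs: "q < qstar" by simp
    have sml: "lam * l\<^sup>2 < lamhat" using gcrit_strict_antimono[of qhat q] qh qs gc unfolding lamhat_def by simp
    have cD: "continuous_on {0..1} (\<lambda>t. \<alpha> * v t * sqrt (1 - q\<^sup>2 * (sin (a t))\<^sup>2))" by (intro continuous_intros cv H1_continuous[OF Ha])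
    have sm: "strict_mono_on {0..1} a"
    proof (rule H1_strict_mono[OF Ha cD])
      fix t :: real assume t: "t \<in> {0..1}"
      have "\<bar>q\<bar> < 1" using q inv_sqrt2(1) by linarith
      from modulus_bound(2)[OF this, of "a t"] show "0 < \<alpha> * v t * sqrt (1 - q\<^sup>2 * (sin (a t))\<^sup>2)" using \<alpha>(1) vp[OF t] by simp
    qed
    have "g t = arc_curve \<alpha> q (a t)" if "t \<in> {0..1}" for t using gt[OF that] F[OF that] by (simp add: arc_curve_def)
    then have "reparam g (arc_curve \<alpha> q) (- (pi / 2)) (pi / 2)"
      using reparam_iff[of "- (pi / 2)" "pi / 2"] H1_continuous[OF Ha] sm ae by auto
    then show "lam * l\<^sup>2 < lamhat \<and> reparam g (larc lam l) 0 (larc_end lam l)"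
      using reparam_larc_iff[OF lam l _ qs gc \<alpha>(2)] qh sml by simp
  qed
qed

lemma stable_classify:
  assumes st: "stable lam l g" and lam: "lam > 0" and l: "l > 0"
  shows "is_segment l g \<or> (lam * l\<^sup>2 < lamhat \<and> is_larc lam l g)"
proof -
  obtain v v' \<psi> p where cc: "critical_curve g v v' \<psi> p lam l"
    using pinned_critical[OF stable_imp_pinned[OF st] lam l] by blast
  consider "sin (\<psi> 0) = 0" | "sin (\<psi> 0) > 0" | "sin (- \<psi> 0) > 0" by (cases "sin (\<psi> 0)" "0::real" rule: linorder_cases) auto
  then show ?thesis
  proof cases
    case 1 then show ?thesis using critical_curve.segment_if_horizontal_start[OF cc] by blast
  next
    case 2 then show ?thesis using critical_stable_larc[OF cc st] by (simp add: is_larc_def)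
  next
    case 3 then show ?thesis using critical_stable_larc[OF critical_reflx[OF cc] stable_reflx[OF st]] by (simp add: is_larc_def)
  qed
qed

lemma is_larc_stable:
  assumes g: "g \<in> Aset l" and L: "is_larc lam l g" and lam: "lam > 0" and l: "l > 0" and small: "lam * l\<^sup>2 < lamhat"
  shows "stable lam l g"
proof -
  obtain q \<alpha> where q: "qhat < q" "q < qstar" "gcrit q = lam * l\<^sup>2" and \<alpha>: "\<alpha> > 0" "\<alpha> * l = 2 * EllU q"
    by (rule larc_modulus[OF lam l small])
  have *: "stable lam l h" if "h \<in> Aset l" "reparam h (larc lam l) 0 (larc_end lam l)" for h
    using larc_stable[OF that(1) _ lam l q \<alpha>] that(2) reparam_larc_iff[OF lam l _ q(2,3) \<alpha>(2)] q(1) by simp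
  show ?thesis using L unfolding is_larc_def
  proof
    assume "reparam (reflx \<circ> g) (larc lam l) 0 (larc_end lam l)"
    from stable_reflx[OF *[OF reflx_Aset[OF g] this]] show ?thesis by (simp add: reflx_reflx)
  qed (rule *[OF g])
qed

definition segment_curve :: "real \<Rightarrow> curve" where "segment_curve l t = (l * t, 0)"

lemma segment_curve_Aset: assumes "l > 0" shows "segment_curve l \<in> Aset l"
proof (rule polar_Aset)
  have "(segment_curve l has_vector_derivative (l * cos 0, l * sin 0)) (at t within {0..1})" for t
  proof -
    have "((\<lambda>t. (l * t, 0)) has_vector_derivative (l, 0)) (at t within {0..1})"
      by (rule has_vector_derivative_Pair) (auto intro!: derivative_eq_intros simp: has_real_derivative_iff_has_vector_derivative[symmetric])
    then show ?thesis by (simp add: segment_curve_def[abs_def])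
  qed
  then show "polar (segment_curve l) (\<lambda>_. l) (\<lambda>_. 0) (\<lambda>_. 0) (\<lambda>_. 0)"
    unfolding polar_def using assms H1_const by blast
qed (simp_all add: segment_curve_def)

lemma segment_curve_is_segment: "l > 0 \<Longrightarrow> is_segment l (segment_curve l)"
  unfolding is_segment_def
  by (subst reparam_iff) (auto simp: segment_curve_def strict_mono_on_def intro!: exI[of _ "\<lambda>t. l * t"] continuous_intros)

lemma is_segment_reparam: assumes "l > 0" "is_segment l g" shows "reparam g (segment_curve l) 0 1"
  using assms by (intro reparam_change[OF assms(2)[unfolded is_segment_def], where \<sigma>="\<lambda>s. s / l"])
    (auto simp: segment_curve_def strict_mono_on_def divide_strict_right_mono intro!: continuous_intros)

text \<open>Letting the amplitude grow linearly gives a concrete larc with a smooth parameter, the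
  witness for the second local minimizer.\<close>

lemma arc_curve_Aset:
  assumes q: "0 < q" "q < 1" and \<alpha>: "\<alpha> > 0" "\<alpha> * l = 2 * EllU q"
  shows "(\<lambda>t. arc_curve \<alpha> q (- (pi / 2) + pi * t)) \<in> Aset l"
proof -
  have q': "\<bar>q\<bar> < 1" using q by simp
  define a where "a = (\<lambda>t::real. - (pi / 2) + pi * t)"
  have da: "(a has_real_derivative pi) (at t within {0..1})" for t unfolding a_def by (auto intro!: derivative_eq_intros)
  have Ha: "H1 a (\<lambda>_. pi)" by (rule H1_C1[OF da]) simp
  define N where "N = (\<lambda>t. 1 - q\<^sup>2 * (sin (a t) * sin (a t)))"
  have N: "N t > 0" "N t = 1 - q\<^sup>2 * (sin (a t))\<^sup>2" for t
    using modulus_bound(2)[OF q', of "a t"] by (simp_all add: N_def power2_eq_square)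
  have "H1 N (\<lambda>t. 0 - q\<^sup>2 * (cos (a t) * pi * sin (a t) + sin (a t) * (cos (a t) * pi)))"
    unfolding N_def by (intro H1_diff H1_const H1_cmult H1_mult H1_sin Ha)
  from H1_cmult[OF H1_inverse[OF H1_sqrt[OF this N(1)]], of "pi / \<alpha>"] N(1)
  obtain v' where Hv: "H1 (\<lambda>t. pi / \<alpha> * (1 / sqrt (N t))) v'" by (auto simp: less_imp_neq[symmetric])
  obtain \<mu> where H\<psi>: "H1 (\<lambda>t. - 2 * arcsin (q * sin (a t))) \<mu>" using H1_arc_angle[OF q Ha] by blast
  have "polar (\<lambda>t. arc_curve \<alpha> q (a t)) (\<lambda>t. pi / \<alpha> * (1 / sqrt (N t))) v' (\<lambda>t. - 2 * arcsin (q * sin (a t))) \<mu>"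
    unfolding polar_def
  proof (intro conjI ballI Hv H\<psi>)
    fix t :: real
    show "0 < pi / \<alpha> * (1 / sqrt (N t))" using N(1) \<alpha>(1) by simp
    have d1: "((\<lambda>t. fst (arc_curve \<alpha> q (a t))) has_real_derivative (1 - 2 * q\<^sup>2 * (sin (a t))\<^sup>2) / (\<alpha> * sqrt (1 - q\<^sup>2 * (sin (a t))\<^sup>2)) * pi) (at t within {0..1})"
      by (rule DERIV_chain2[OF arc_curve_deriv(1)[OF q' \<alpha>(1)] da])
    have d2: "((\<lambda>t. snd (arc_curve \<alpha> q (a t))) has_real_derivative (- 2 * q * sin (a t) * sqrt (1 - q\<^sup>2 * (sin (a t))\<^sup>2)) / (\<alpha> * sqrt (1 - q\<^sup>2 * (sin (a t))\<^sup>2)) * pi) (at t within {0..1})"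
      by (rule DERIV_chain2[OF arc_curve_deriv(2)[OF q' \<alpha>(1)] da])
    have e: "pi / \<alpha> * (1 / z) * C = C / (\<alpha> * z) * pi" for z C by (simp add: divide_inverse mult_ac)
    from has_vector_derivative_Pair[OF d1[unfolded has_real_derivative_iff_has_vector_derivative] d2[unfolded has_real_derivative_iff_has_vector_derivative]]
    show "((\<lambda>t. arc_curve \<alpha> q (a t)) has_vector_derivative (pi / \<alpha> * (1 / sqrt (N t)) * cos (- 2 * arcsin (q * sin (a t))), pi / \<alpha> * (1 / sqrt (N t)) * sin (- 2 * arcsin (q * sin (a t))))) (at t within {0..1})"
      unfolding arc_angle(1,2)[OF q] N(2) e prod.collapse .
  qed
  then have "(\<lambda>t. arc_curve \<alpha> q (a t)) \<in> Aset l"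
    by (rule polar_Aset) (use arc_curve_ends[OF q' _ \<alpha>(2)] \<alpha>(1) in \<open>simp_all add: a_def\<close>)
  then show ?thesis by (simp add: a_def)
qed

theorem theorem1p2:
  fixes lam l :: real
  assumes "lam > 0" and "l > 0"
  shows "(\<forall>g. pinned_elastica lam l g \<longrightarrow>
            (lam * l\<^sup>2 < lamhat \<longrightarrow>
               (stable lam l g \<longleftrightarrow> is_segment l g \<or> is_larc lam l g)) \<and>
            (lam * l\<^sup>2 \<ge> lamhat \<longrightarrow>
               (stable lam l g \<longleftrightarrow> is_segment l g))) \<and>
         (lam * l\<^sup>2 < lamhat \<longrightarrow>
            (\<exists>g1 g2. stable lam l g1 \<and> stable lam l g2 \<and> \<not> equiv_rr g2 g1 \<and>
               (\<forall>g. stable lam l g \<longrightarrow> equiv_rr g g1 \<or> equiv_rr g g2))) \<and>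
         (lam * l\<^sup>2 \<ge> lamhat \<longrightarrow>
            (\<exists>g1. stable lam l g1 \<and> (\<forall>g. stable lam l g \<longrightarrow> reparam g g1 0 1)))"
proof (intro conjI allI impI)
  fix g assume "pinned_elastica lam l g"
  then have g: "g \<in> Aset l" by (simp add: pinned_elastica_def)
  show "stable lam l g \<longleftrightarrow> is_segment l g \<or> is_larc lam l g" if "lam * l\<^sup>2 < lamhat"
    using stable_classify[OF _ assms] segment_stable[OF g _ assms(1)] is_larc_stable[OF g _ assms that] by blast
  show "stable lam l g \<longleftrightarrow> is_segment l g" if "lam * l\<^sup>2 \<ge> lamhat"
    using stable_classify[OF _ assms, of g] segment_stable[OF g _ assms(1)] that by auto
next
  have S: "stable lam l (segment_curve l)"
    by (rule segment_stable[OF segment_curve_Aset[OF assms(2)] segment_curve_is_segment[OF assms(2)] assms(1)])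
  show "\<exists>g1. stable lam l g1 \<and> (\<forall>g. stable lam l g \<longrightarrow> reparam g g1 0 1)" if "lam * l\<^sup>2 \<ge> lamhat"
    using S stable_classify[OF _ assms] is_segment_reparam[OF assms(2)] that by (intro exI[of _ "segment_curve l"]) force
  show "\<exists>g1 g2. stable lam l g1 \<and> stable lam l g2 \<and> \<not> equiv_rr g2 g1 \<and>
     (\<forall>g. stable lam l g \<longrightarrow> equiv_rr g g1 \<or> equiv_rr g g2)" if small: "lam * l\<^sup>2 < lamhat"
  proof -
    obtain q \<alpha> where q: "qhat < q" "q < qstar" "gcrit q = lam * l\<^sup>2" and \<alpha>: "\<alpha> > 0" "\<alpha> * l = 2 * EllU q"
      by (rule larc_modulus[OF assms small])
    have q': "0 < q" "q < 1" using q(1,2) qhat(1) qstar(2) inv_sqrt2(1) by linarith+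
    define g2 where "g2 = (\<lambda>t. arc_curve \<alpha> q (- (pi / 2) + pi * t))"
    have g2A: "g2 \<in> Aset l" unfolding g2_def by (rule arc_curve_Aset[OF q' \<alpha>])
    have g2r: "reparam g2 (arc_curve \<alpha> q) (- (pi / 2)) (pi / 2)"
      by (subst reparam_iff) (auto simp: g2_def strict_mono_on_def intro!: exI[of _ "\<lambda>t. - (pi / 2) + pi * t"] continuous_intros)
    have st2: "stable lam l g2" by (rule larc_stable[OF g2A g2r assms q \<alpha>])
    have to_g2: "reparam h g2 0 1" if "reparam h (larc lam l) 0 (larc_end lam l)" for h
    proof (rule reparam_change)
      show "reparam h (arc_curve \<alpha> q) (- (pi / 2)) (pi / 2)"
        using that reparam_larc_iff[OF assms _ q(2,3) \<alpha>(2)] q(1) by simp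
      show "strict_mono_on {- (pi / 2)..pi / 2} (\<lambda>\<theta>. (\<theta> + pi / 2) / pi)"
        by (intro strict_mono_onI divide_strict_right_mono) auto
    qed (auto simp: g2_def intro!: continuous_intros)
    \<comment> \<open>At parameter 1/2 the larc has height 2 q / \<open>\<alpha>\<close>, which is
      not 0, while every point of the segment has height 0.\<close>
    have ne: "\<not> equiv_rr g2 (segment_curve l)"
    proof
      assume "equiv_rr g2 (segment_curve l)"
      then obtain \<phi> where "g2 (1/2) = segment_curve l \<phi> \<or> reflx (g2 (1/2)) = segment_curve l \<phi>"
        unfolding equiv_rr_def reparam_def by fastforce
      then have "snd (g2 (1/2)) = 0" by (auto simp: reflx_def segment_curve_def prod_eq_iff)
      then show False using q' \<alpha>(1) by (simp add: g2_def arc_curve_def)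
    qed
    have "equiv_rr g (segment_curve l) \<or> equiv_rr g g2" if "stable lam l g" for g
      using stable_classify[OF that assms] is_segment_reparam[OF assms(2)] to_g2 unfolding equiv_rr_def is_larc_def by blast
    then show ?thesis using S st2 ne by blast
  qed
qed

end
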